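(* Let $m,Q\ge1$ be integers, $U\subset\mathbb R^m$ open with $B(0,3)\subset U$, and let $f\in W^1_2(U,\mathcal Q_Q(\ell_2))$ be squeeze and squash stationary. Then there exist $C>0$ (depending on $\|f\|_{L^\infty(B(0,1))}$) and $\alpha\in(0,1)$ such that for every $a\in B(0,\tfrac12)$ and every $r\in(0,\tfrac12]$, $$\frac1{\mathcal L^m(B(a,r))}\int_{B(a,r)}\mathcal G^2(f,\overline f_{a,r})\le C\Big(\frac1{|\ln r|}\Big)^\alpha,$$ where $\overline f_{a,r}$ is a mean of $f$ in $B(a,r)$. In fact, $$\frac1{r^{m-2}}\int_{B(a,r)}|Df|^2\le C\Big(\frac1{|\ln r|}\Big)^\alpha .$$
   Context: $\ell_2$ is the separable infinite-dimensional Hilbert space. $\mathcal Q_Q(\ell_2)$ is the space of unordered $Q$-tuples $u=\oplus_{i=1}^Q[[u_i]]$ of elements of $\ell_2$, with metric $\mathcal G(u,v)=\min_{\sigma\in S_Q}\big(\sum_i\|u_i-v_{\sigma(i)}\|^2\big)^{1/2}$, and $|u|=\mathcal G(u,Q[[0]])$; $\|f\|_{L^\infty(A)}$ is the essential supremum of $|f|$ on $A$. $W^1_2(U,\mathcal Q_Q(\ell_2))$ is the set of measurable $f:U\to\mathcal Q_Q(\ell_2)$ with $\int_U|f|^2<\infty$ for which there is $g\in L^2(U)$ such that for every $T$ the function $\mathcal G(f(\cdot),T)$ is weakly differentiable with $|\nabla\mathcal G(f,T)|\le g$ a.e. Such $f$ is approximately differentiable a.e.: for a.e. $a$, writing $f(a)=\oplus_i[[f_i(a)]]$,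 there are linear maps $Df_i(a):\mathbb R^m\to\ell_2$, with $Df_i(a)=Df_j(a)$ if $f_i(a)=f_j(a)$, such that the approximate limit as $x\to a$ of $\mathcal G\big(f(x),\oplus_i[[f_i(a)+Df_i(a)(x-a)]]\big)/\|x-a\|$ is $0$. Put $Df=\oplus_i[[Df_i]]$ and $|Df|=\big(\sum_i\|Df_i\|_{HS}^2\big)^{1/2}$ (Hilbert–Schmidt norms). $f$ is squeeze stationary in $U$ if for every $X\in C^\infty_c(U,\mathbb R^m)$, with $\Phi_t(x)=x+tX(x)$ (a diffeomorphism of $U$ for small $|t|$), one has $\frac{d}{dt}\big|_{t=0}\int_U|D(f\circ\Phi_t)|^2=0$. $f$ is squash stationary in $U$ if for every $C^1$ map $Y:U\times\ell_2\to\ell_2$ such that $\{x\in U:Y(x,\cdot)\ne0\}$ is relatively compact in $U$, one has $\frac{d}{dt}\big|_{t=0}\int_U|D(Y\Box f)_t|^2=0$, where $(Y\Box f)_t(x)=\oplus_{i=1}^Q[[f_i(x)+tY(x,f_i(x))]]$. A mean of $f$ in a ball $B(a,r)$ is a point $P\in\mathcal Q_Q(\ell_2)$ for which the Poincaré inequality $\int_{B(a,r)}\mathcal G(f,P)^2\le C_P\,r^2\int_{B(a,r)}|Df|^2$ holds, where $C_P=C_P(m,Q)$ is a fixed constant for which such points always exist.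
   Formalization: The constant C is allowed to depend on the Dirichlet energy of f in B(0,1) as well as on the sup norm of f on B(0,1) (and on m, Q, C_P); dependence on the sup norm alone fails, e.g. for f(z)=z^n with m=2, Q=1, r=1/2, a near (1/2,0). *)

theory Defs
  imports "HOL-Probability.Essential_Supremum" "HOL-Combinatorics.List_Permutation"
begin

section \<open>Unordered tuples\<close>

text \<open>An unordered \<open>Q\<close>-tuple of points of \<open>'h\<close> is a multiset of size \<open>Q\<close>.\<close>

definition QQ :: "nat \<Rightarrow> 'h multiset set"
  where "QQ Q = {u. size u = Q}"

text \<open>The minimum is taken over all enumerations of both tuples. This agrees with fixing the
  enumerations and minimising over permutations, see \<open>Gdist_eq_Min_permutes\<close> below. Only tuples
  of equal size matter; the \<open>min\<close> merely makes the function symmetric on all multisets.\<close>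

definition Gdist :: "'h::real_normed_vector multiset \<Rightarrow> 'h multiset \<Rightarrow> real"
  where "Gdist u v = Min {sqrt (\<Sum>i<min (length xs) (length ys). (norm (xs ! i - ys ! i))\<^sup>2) |
                            xs ys. mset xs = u \<and> mset ys = v}"

definition QQ_norm :: "'h::real_normed_vector multiset \<Rightarrow> real"
  where "QQ_norm u = Gdist u (replicate_mset (size u) 0)"

definition QQ_borel :: "nat \<Rightarrow> 'h::real_normed_vector multiset measure"
  where "QQ_borel Q = sigma (QQ Q) {W. openin (Metric_space.mtopology (QQ Q) Gdist) W}"

abbreviation Gcost :: "'h::real_normed_vector list \<Rightarrow> 'h list \<Rightarrow> real"
  where "Gcost xs ys \<equiv> sqrt (\<Sum>i<min (length xs) (length ys). (norm (xs ! i - ys ! i))\<^sup>2)"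

lemma finite_Gcosts: "finite {Gcost xs ys | xs ys. mset xs = u \<and> mset ys = v}"
proof -
  have fin: "finite {xs. mset xs = w}" for w :: "'a multiset"
  proof -
    obtain zs where "mset zs = w"
      using ex_mset by blast
    then show ?thesis
      using mset_eq_finite[of zs] by simp
  qed
  have "{Gcost xs ys | xs ys. mset xs = u \<and> mset ys = v}
      = (\<lambda>(xs, ys). Gcost xs ys) ` ({xs. mset xs = u} \<times> {ys. mset ys = v})"
    by auto
  then show ?thesis
    using finite_imageI[OF finite_cartesian_product[OF fin fin]] by (rule ssubst)
qed

lemma Gdist_le: "Gdist (mset xs) (mset ys) \<le> Gcost xs ys"
  unfolding Gdist_def by (rule Min_le[OF finite_Gcosts]) auto

lemma Gdist_attained:
  obtains xs ys where "mset xs = u" "mset ys = v" "Gdist u v = Gcost xs ys"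
proof -
  have "{Gcost xs ys | xs ys. mset xs = u \<and> mset ys = v} \<noteq> {}"
    using ex_mset[of u] ex_mset[of v] by blast
  from Min_in[OF finite_Gcosts this] show ?thesis
    using that unfolding Gdist_def by blast
qed

lemma Gdist_attained_left:
  assumes "length xs = size v"
  obtains ys where "mset ys = v" "Gdist (mset xs) v = Gcost xs ys"
proof -
  obtain xs' ys' where *: "mset xs' = mset xs" "mset ys' = v" "Gdist (mset xs) v = Gcost xs' ys'"
    by (rule Gdist_attained)
  obtain p where p: "p permutes {..<length xs'}" "permute_list p xs' = xs"
    using mset_eq_permutation[OF *(1)[symmetric]] by metis
  have len: "length xs' = length xs" "length ys' = length xs"
    using mset_eq_length[OF *(1)] arg_cong[OF *(2), of size] assms by simp_all
  have p': "p permutes {..<length xs}" "p permutes {..<length ys'}"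
    using p(1) by (simp_all only: len)
  have "(\<Sum>i<length xs. (norm (xs' ! i - ys' ! i))\<^sup>2)
      = (\<Sum>i<length xs. (norm (xs' ! p i - ys' ! p i))\<^sup>2)"
    by (subst sum.permute[OF p'(1)]) (simp only: o_def)
  also have "\<dots> = (\<Sum>i<length xs. (norm (xs ! i - permute_list p ys' ! i))\<^sup>2)"
  proof (rule sum.cong)
    fix i assume "i \<in> {..<length xs}"
    then have "xs ! i = xs' ! p i" "permute_list p ys' ! i = ys' ! p i"
      using permute_list_nth[OF p(1), of i] permute_list_nth[OF p'(2), of i] len p(2) by auto
    then show "(norm (xs' ! p i - ys' ! p i))\<^sup>2 = (norm (xs ! i - permute_list p ys' ! i))\<^sup>2"
      by (simp only:)
  qed (rule refl)
  finally have "Gcost xs' ys' = Gcost xs (permute_list p ys')"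
    by (simp only: len length_permute_list min.idem)
  moreover have "mset (permute_list p ys') = v"
    using mset_permute_list[OF p'(2)] *(2) by (rule trans)
  ultimately show ?thesis
    by (intro that) (auto simp only: *(3))
qed

lemma Gdist_eq_Min_permutes:
  assumes "length xs = Q" "length ys = Q"
  shows "Gdist (mset xs) (mset ys)
    = Min ((\<lambda>\<sigma>. sqrt (\<Sum>i<Q. (norm (xs ! i - ys ! \<sigma> i))\<^sup>2)) ` {\<sigma>. \<sigma> permutes {..<Q}})"
proof (rule sym, rule Min_eqI)
  show "finite ((\<lambda>\<sigma>. sqrt (\<Sum>i<Q. (norm (xs ! i - ys ! \<sigma> i))\<^sup>2)) ` {\<sigma>. \<sigma> permutes {..<Q}})"
    by (simp add: finite_permutations)
  have cost: "Gcost xs (permute_list \<sigma> ys) = sqrt (\<Sum>i<Q. (norm (xs ! i - ys ! \<sigma> i))\<^sup>2)"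
    if "\<sigma> permutes {..<Q}" for \<sigma>
    using that assms by (auto simp: permute_list_nth intro!: sum.cong)
  show "Gdist (mset xs) (mset ys) \<le> c"
    if "c \<in> (\<lambda>\<sigma>. sqrt (\<Sum>i<Q. (norm (xs ! i - ys ! \<sigma> i))\<^sup>2)) ` {\<sigma>. \<sigma> permutes {..<Q}}" for c
  proof -
    from that obtain \<sigma> where s: "\<sigma> permutes {..<Q}"
        "c = sqrt (\<Sum>i<Q. (norm (xs ! i - ys ! \<sigma> i))\<^sup>2)"
      by auto
    then have "c = Gcost xs (permute_list \<sigma> ys)"
      using cost by simp
    then show ?thesis
      using Gdist_le[of xs "permute_list \<sigma> ys"] s assms by simp
  qed
  obtain zs where zs: "mset zs = mset ys" "Gdist (mset xs) (mset ys) = Gcost xs zs"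
    using Gdist_attained_left[of xs "mset ys"] assms by auto
  obtain \<sigma> where "\<sigma> permutes {..<length ys}" "permute_list \<sigma> ys = zs"
    using zs(1) by (rule mset_eq_permutation)
  then show "Gdist (mset xs) (mset ys)
      \<in> (\<lambda>\<sigma>. sqrt (\<Sum>i<Q. (norm (xs ! i - ys ! \<sigma> i))\<^sup>2)) ` {\<sigma>. \<sigma> permutes {..<Q}}"
    using cost zs assms by (intro image_eqI[of _ _ \<sigma>]) auto
qed

lemma Metric_space_QQ: "Metric_space (QQ Q) Gdist"
proof
  fix u v w :: "'a multiset"
  show "0 \<le> Gdist u v"
    by (rule Gdist_attained[of u v]) (simp add: sum_nonneg)
  have "Gdist u v \<le> Gdist v u" for u v :: "'a multiset"
  proof -
    obtain ys xs where *: "mset ys = v" "mset xs = u" "Gdist v u = Gcost ys xs"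
      by (rule Gdist_attained)
    have "Gcost ys xs = Gcost xs ys"
      by (subst min.commute) (subst norm_minus_commute, rule refl)
    then show ?thesis
      using Gdist_le[of xs ys] * by simp
  qed
  then show "Gdist u v = Gdist v u"
    by (intro order_antisym)
  show "Gdist u v = 0 \<longleftrightarrow> u = v" if uv: "u \<in> QQ Q" "v \<in> QQ Q"
  proof
    assume 0: "Gdist u v = 0"
    obtain xs ys where *: "mset xs = u" "mset ys = v" "Gdist u v = Gcost xs ys"
      by (rule Gdist_attained)
    have len: "length xs = Q" "length ys = Q"
      using uv * by (auto simp: QQ_def)
    have "(\<Sum>i<Q. (norm (xs ! i - ys ! i))\<^sup>2) = 0"
      using 0 * len by simp
    then have "xs = ys"
      using len by (intro nth_equalityI) (auto simp: sum_nonneg_eq_0_iff)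
    then show "u = v" using * by simp
  next
    assume "u = v"
    obtain xs where "mset xs = u" using ex_mset by blast
    then show "Gdist u v = 0"
      using Gdist_le[of xs xs] \<open>0 \<le> Gdist u v\<close> \<open>u = v\<close> by simp
  qed
  show "Gdist u w \<le> Gdist u v + Gdist v w" if "u \<in> QQ Q" "v \<in> QQ Q" "w \<in> QQ Q"
  proof -
    obtain xs ys where 1: "mset xs = u" "mset ys = v" "Gdist u v = Gcost xs ys"
      by (rule Gdist_attained)
    have "length ys = size w"
      using 1 that by (auto simp: QQ_def)
    then obtain zs where 2: "mset zs = w" "Gdist v w = Gcost ys zs"
      using Gdist_attained_left[of ys w] 1(2) by blast
    have len: "length xs = Q" "length ys = Q" "length zs = Q"
      using 1 2 that by (auto simp: QQ_def)
    have "Gdist u w \<le> L2_set (\<lambda>i. norm (xs ! i - zs ! i)) {..<Q}"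
      using Gdist_le[of xs zs] 1 2 len by (simp add: L2_set_def)
    also have "\<dots> \<le> L2_set (\<lambda>i. norm (xs ! i - ys ! i) + norm (ys ! i - zs ! i)) {..<Q}"
    proof (rule L2_set_mono)
      show "norm (xs ! i - zs ! i) \<le> norm (xs ! i - ys ! i) + norm (ys ! i - zs ! i)" for i
        using norm_triangle_ineq[of "xs ! i - ys ! i" "ys ! i - zs ! i"] by simp
    qed simp
    also have "\<dots> \<le> L2_set (\<lambda>i. norm (xs ! i - ys ! i)) {..<Q}
                   + L2_set (\<lambda>i. norm (ys ! i - zs ! i)) {..<Q}"
      by (rule L2_set_triangle_ineq)
    also have "\<dots> = Gdist u v + Gdist v w"
      using 1 2 len by (simp add: L2_set_def)
    finally show ?thesis .
  qed
qed


section \<open>Sobolev maps\<close>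

definition compactly_inside :: "'a::topological_space set \<Rightarrow> 'a set \<Rightarrow> bool"
  where "compactly_inside S U \<longleftrightarrow> compact (closure S) \<and> closure S \<subseteq> U"

primrec Ck :: "nat \<Rightarrow> ('a::euclidean_space \<Rightarrow> 'b::real_normed_vector) \<Rightarrow> bool"
  where
    "Ck 0 f \<longleftrightarrow> continuous_on UNIV f"
  | "Ck (Suc k) f \<longleftrightarrow>
       (\<forall>x. f differentiable (at x)) \<and> (\<forall>v. Ck k (\<lambda>x. frechet_derivative f (at x) v))"

text \<open>Elements of \<open>C\<^sub>c\<^sup>\<infinity>(U)\<close> are represented by their extension by \<open>0\<close>.\<close>

definition Cc_infinity :: "'a::euclidean_space set \<Rightarrow> ('a \<Rightarrow> 'b::real_normed_vector) set"
  where "Cc_infinity U = {\<phi>. (\<forall>k. Ck k \<phi>) \<and> compactly_inside {x. \<phi> x \<noteq> 0} U}"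

definition weak_gradient_on ::
    "(real^'m) set \<Rightarrow> (real^'m \<Rightarrow> real) \<Rightarrow> (real^'m \<Rightarrow> real^'m) \<Rightarrow> bool"
  where "weak_gradient_on U h v \<longleftrightarrow>
    (\<forall>K. compact K \<and> K \<subseteq> U \<longrightarrow> h absolutely_integrable_on K \<and> v absolutely_integrable_on K) \<and>
    (\<forall>\<phi>\<in>Cc_infinity U. \<forall>j.
       (LINT x:U|lebesgue. h x * frechet_derivative \<phi> (at x) (axis j 1))
     = - (LINT x:U|lebesgue. v x $ j * \<phi> x))"

definition W12 :: "(real^'m) set \<Rightarrow> nat \<Rightarrow> (real^'m \<Rightarrow> 'h::real_normed_vector multiset) set"
  where "W12 U Q = {f.
    f \<in> lebesgue_on U \<rightarrow>\<^sub>M QQ_borel Q \<and>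
    set_integrable lebesgue U (\<lambda>x. (QQ_norm (f x))\<^sup>2) \<and>
    (\<exists>g. g \<in> borel_measurable (lebesgue_on U) \<and> set_integrable lebesgue U (\<lambda>x. (g x)\<^sup>2) \<and>
      (\<forall>T\<in>QQ Q. \<exists>v. weak_gradient_on U (\<lambda>x. Gdist (f x) T) v \<and>
                     (AE x in lebesgue_on U. norm (v x) \<le> g x)))}"


section \<open>Approximate differential and Dirichlet energy\<close>

definition density_zero :: "'a::euclidean_space set \<Rightarrow> 'a \<Rightarrow> bool"
  where "density_zero E a \<longleftrightarrow>
    ((\<lambda>r. outer_measure_of lebesgue (E \<inter> ball a r) / emeasure lebesgue (ball a r))
       \<longlongrightarrow> 0) (at_right 0)"

definition approx_tendsto ::
    "('a::euclidean_space \<Rightarrow> 'b::metric_space) \<Rightarrow> 'b \<Rightarrow> 'a \<Rightarrow> bool"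
  where "approx_tendsto h l a \<longleftrightarrow> (\<forall>e>0. density_zero {x. e \<le> dist (h x) l} a)"

text \<open>The multiset \<open>w\<close> consists of the pairs \<open>(f\<^sub>i(a), Df\<^sub>i(a))\<close>. Linear maps on
  \<open>real^'m\<close> are automatically bounded. The notion is local at \<open>a\<close>, so the values of \<open>f\<close>
  outside an open domain containing \<open>a\<close> play no role.\<close>

definition has_approx_differential ::
    "(real^'m \<Rightarrow> 'h::real_normed_vector multiset) \<Rightarrow> real^'m \<Rightarrow>
     ('h \<times> ((real^'m) \<Rightarrow>\<^sub>L 'h)) multiset \<Rightarrow> bool"
  where "has_approx_differential f a w \<longleftrightarrow>
    image_mset fst w = f a \<and>
    (\<forall>p\<in>#w. \<forall>q\<in>#w. fst p = fst q \<longrightarrow> snd p = snd q) \<and>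
    approx_tendsto
      (\<lambda>x. Gdist (f x) {# y + blinfun_apply L (x - a). (y, L) \<in># w #} / norm (x - a)) 0 a"

text \<open>Such a multiset \<open>w\<close> is unique if it exists. Where it does not exist, \<open>Df\<close> is arbitrary.\<close>

definition Df :: "(real^'m \<Rightarrow> 'h::real_normed_vector multiset) \<Rightarrow> real^'m \<Rightarrow>
    ((real^'m) \<Rightarrow>\<^sub>L 'h) multiset"
  where "Df f a = image_mset snd (SOME w. has_approx_differential f a w)"

definition hs_norm :: "('a::euclidean_space \<Rightarrow>\<^sub>L 'h::real_normed_vector) \<Rightarrow> real"
  where "hs_norm L = sqrt (\<Sum>b\<in>Basis. (norm (blinfun_apply L b))\<^sup>2)"

definition Df_norm :: "(real^'m \<Rightarrow> 'h::real_normed_vector multiset) \<Rightarrow> real^'m \<Rightarrow> real"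
  where "Df_norm f a = sqrt (\<Sum>L\<in>#Df f a. (hs_norm L)\<^sup>2)"

definition dirichlet ::
    "(real^'m) set \<Rightarrow> (real^'m \<Rightarrow> 'h::real_normed_vector multiset) \<Rightarrow> real"
  where "dirichlet A f = (LINT x:A|lebesgue. (Df_norm f x)\<^sup>2)"


section \<open>Stationarity\<close>

text \<open>Since the Bochner integral of a non-integrable function is \<open>0\<close>, finiteness of the energies
  near \<open>t = 0\<close>, which is implicit in the existence of the derivative, is spelled out.\<close>

definition energy_critical ::
    "(real^'m) set \<Rightarrow> (real \<Rightarrow> real^'m \<Rightarrow> 'h::real_normed_vector multiset) \<Rightarrow> bool"
  where "energy_critical U F \<longleftrightarrow>
    (\<forall>\<^sub>F t in nhds 0. set_integrable lebesgue U (\<lambda>x. (Df_norm (F t) x)\<^sup>2)) \<and>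
    ((\<lambda>t. dirichlet U (F t)) has_real_derivative 0) (at 0)"

definition squeeze_stationary ::
    "(real^'m) set \<Rightarrow> (real^'m \<Rightarrow> 'h::real_normed_vector multiset) \<Rightarrow> bool"
  where "squeeze_stationary U f \<longleftrightarrow>
    (\<forall>X\<in>Cc_infinity U. energy_critical U (\<lambda>t x. f (x + t *\<^sub>R X x)))"

definition C1_map_on ::
    "'a::real_normed_vector set \<Rightarrow> ('a \<Rightarrow> 'b::real_normed_vector) \<Rightarrow> bool"
  where "C1_map_on S Y \<longleftrightarrow>
    (\<exists>Y'. (\<forall>p\<in>S. (Y has_derivative blinfun_apply (Y' p)) (at p)) \<and> continuous_on S Y')"

definition squash_stationary ::
    "(real^'m) set \<Rightarrow> (real^'m \<Rightarrow> 'h::real_normed_vector multiset) \<Rightarrow> bool"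
  where "squash_stationary U f \<longleftrightarrow>
    (\<forall>Y :: (real^'m) \<times> 'h \<Rightarrow> 'h.
       C1_map_on (U \<times> UNIV) Y \<and> compactly_inside {x\<in>U. \<exists>y. Y (x, y) \<noteq> 0} U \<longrightarrow>
       energy_critical U (\<lambda>t x. {# y + t *\<^sub>R Y (x, y). y \<in># f x #}))"


section \<open>Means\<close>

definition is_mean ::
    "real \<Rightarrow> nat \<Rightarrow> (real^'m \<Rightarrow> 'h::real_normed_vector multiset) \<Rightarrow> real^'m \<Rightarrow> real \<Rightarrow>
     'h multiset \<Rightarrow> bool"
  where "is_mean CP Q f a r P \<longleftrightarrow> P \<in> QQ Q \<and>
    (LINT x:ball a r|lebesgue. (Gdist (f x) P)\<^sup>2) \<le> CP * r\<^sup>2 * dirichlet (ball a r) f"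

end

theory Submission
  imports Defs
begin

text \<open>Let \<open>D(r)\<close> be the energy in balls around \<open>a\<close>, with the indicator of the ball replaced by a smooth
  radial bump function. Squeezing along a radial field shows that \<open>F(r) = r\<^sup>2\<^sup>-\<^sup>m D(r)\<close> is nondecreasing and
  expresses \<open>F'\<close> through the radial part of the energy. Squashing along \<open>Y(x, y) = \<phi>(x) y\<close> expresses
  \<open>D(r)\<close> as a pairing of \<open>f\<close> with its radial derivative, so by Cauchy-Schwarz and the bound on
  \<open>f\<close> one gets \<open>c F\<^sup>2 \<le> r F'\<close>, and hence \<open>F(r) \<le> C / \<bar>ln r\<bar>\<close>.

  That \<open>f\<close> is essentially bounded on the unit ball has to be proved as well. Squashing along
  \<open>Y(x, y) = \<phi>(x) H(\<bar>y\<bar>\<^sup>2) y\<close> with \<open>H\<close> of arbitrarily fast growth shows that \<open>Df\<^sub>i = 0\<close> wherever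
  \<open>\<bar>f\<^sub>i\<bar>\<close> exceeds some \<open>R\<close>. The function \<open>\<Sum>\<^sub>i max(0, \<bar>f\<^sub>i\<bar> - R)\<close> then has vanishing approximate
  derivative, and the Poincare inequality forces it to be constant.\<close>

section \<open>Unordered tuples\<close>

text \<open>\<open>Df\<close> takes one arbitrary fixed value wherever \<open>f\<close> has no
  approximate differential, and the size of that set is never estimated. The energy density is
  therefore split into \<open>good_energy\<close> and \<open>bad_energy\<close>. Both variations
  preserve non-differentiability: squashing leaves \<open>bad_energy\<close> alone, squeezing only
  transports it. Its integral over a ball is O(r^m), so a term \<open>K * s\<^sup>2\<close> added to
  the monotone quantity absorbs it.

  Neither part is visibly measurable. Stationarity provides this: the integrands of the first
  variations are limits of integrable difference quotients, and \<open>good_energy\<close> and the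
  directional terms are recovered from them algebraically.

  In the proof of boundedness, a vanishing approximate derivative alone would not force constancy,
  as the Cantor function shows. The Poincare inequality bounds averages of squared difference
  quotients, so no mass can concentrate on small sets, and the quotients tend to \<open>0\<close> in
  mean.

  The decay obtained has order 1/|ln r|; it is weakened to the exponent 1/2 because
  \<open>\<alpha>\<close> has to lie below \<open>1\<close>.\<close>

lemma sum_mset_mset: "(\<Sum>x\<in>#mset xs. f x) = (\<Sum>x\<leftarrow>xs. f x)"
  by (induction xs) auto

lemma sum_mset_nonneg':
  fixes f :: "'a \<Rightarrow> real"
  shows "(\<And>x. x \<in># A \<Longrightarrow> 0 \<le> f x) \<Longrightarrow> 0 \<le> (\<Sum>x\<in>#A. f x)"
  by (induction A) auto

lemma sum_mset_subtractf:
  fixes f g :: "'a \<Rightarrow> real"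
  shows "(\<Sum>x\<in>#A. f x - g x) = (\<Sum>x\<in>#A. f x) - (\<Sum>x\<in>#A. g x)"
  by (induction A) auto

lemma abs_sum_mset_le:
  fixes f :: "'a \<Rightarrow> real" and e :: real
  shows "(\<And>x. x \<in># A \<Longrightarrow> \<bar>f x\<bar> \<le> e) \<Longrightarrow> \<bar>\<Sum>x\<in>#A. f x\<bar> \<le> size A * e"
proof (induction A)
  case (add x A)
  then have "\<bar>f x\<bar> \<le> e" "\<bar>\<Sum>x\<in>#A. f x\<bar> \<le> size A * e" by auto
  then show ?case by (simp add: algebra_simps)
qed simp

lemma Gdist_nonneg: "0 \<le> Gdist u v"
  by (rule Gdist_attained[of u v]) (simp add: sum_nonneg)

lemma Gdist_commute: "Gdist u v = Gdist v u"
  by (rule Metric_space.commute[OF Metric_space_QQ])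

lemma Gdist_triangle:
  assumes "size u = Q" "size v = Q" "size w = Q"
  shows "Gdist u w \<le> Gdist u v + Gdist v w"
  using Metric_space.triangle[OF Metric_space_QQ[of Q], of u v w] assms by (simp add: QQ_def)

text \<open>An optimal enumeration, zipped, becomes a multiset of pairs that keeps the label
  \<open>snd p\<close> beside each point. Tuples \<open>image_mset \<phi> w\<close> can then be
  compared entry by entry while the base point and linear map stored in the label stay
  accessible.\<close>

lemma Gdist_coupling:
  fixes \<phi> :: "'a \<Rightarrow> 'h::real_normed_vector"
  assumes "size u = size w"
  obtains c where "image_mset fst c = u" "image_mset snd c = w"
    "(Gdist u (image_mset \<phi> w))\<^sup>2 = (\<Sum>p\<in>#c. (norm (fst p - \<phi> (snd p)))\<^sup>2)"
proof -
  obtain ws where ws: "mset ws = w" using ex_mset by blast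
  have "length (map \<phi> ws) = size u" using assms ws by (metis length_map size_mset)
  then obtain ys where ys: "mset ys = u" "Gdist (mset (map \<phi> ws)) u = Gcost (map \<phi> ws) ys"
    using Gdist_attained_left by blast
  have len: "length ys = length ws" using ws ys assms by (metis size_mset)
  let ?c = "mset (zip ys ws)"
  have "(Gdist u (image_mset \<phi> w))\<^sup>2 = (\<Sum>i<length ws. (norm (\<phi> (ws ! i) - ys ! i))\<^sup>2)"
    using ys ws len by (subst Gdist_commute) (auto simp: sum_nonneg intro!: sum.cong)
  also have "\<dots> = (\<Sum>p\<leftarrow>zip ys ws. (norm (fst p - \<phi> (snd p)))\<^sup>2)"
    using len by (simp add: sum_list_sum_nth atLeast0LessThan norm_minus_commute)
  also have "\<dots> = (\<Sum>p\<in>#?c. (norm (fst p - \<phi> (snd p)))\<^sup>2)"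
    by (simp only: sum_mset_mset)
  finally have "(Gdist u (image_mset \<phi> w))\<^sup>2 = (\<Sum>p\<in>#?c. (norm (fst p - \<phi> (snd p)))\<^sup>2)" .
  moreover have "image_mset fst ?c = u" "image_mset snd ?c = w"
    using len ws ys(1) by (simp_all flip: mset_map)
  ultimately show ?thesis
    by (intro that)
qed

text \<open>A single summand is at most the whole sum, so an optimal coupling is also uniformly
  close.\<close>

lemma Gdist_coupling_le:
  fixes \<phi> :: "'a \<Rightarrow> 'h::real_normed_vector"
  assumes "size u = size w"
  obtains c where "image_mset fst c = u" "image_mset snd c = w"
    "\<forall>p\<in>#c. norm (fst p - \<phi> (snd p)) \<le> Gdist u (image_mset \<phi> w)"
proof -
  obtain c where c: "image_mset fst c = u" "image_mset snd c = w"
    "(Gdist u (image_mset \<phi> w))\<^sup>2 = (\<Sum>p\<in>#c. (norm (fst p - \<phi> (snd p)))\<^sup>2)"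
    by (rule Gdist_coupling[OF assms])
  show ?thesis
  proof (rule that[OF c(1,2)], rule ballI)
    fix p assume "p \<in># c"
    then obtain d where "c = add_mset p d" by (metis multi_member_split)
    then have "(norm (fst p - \<phi> (snd p)))\<^sup>2 \<le> (Gdist u (image_mset \<phi> w))\<^sup>2"
      unfolding c(3) by (simp add: sum_mset_nonneg')
    then show "norm (fst p - \<phi> (snd p)) \<le> Gdist u (image_mset \<phi> w)"
      by (rule power2_le_imp_le) (rule Gdist_nonneg)
  qed
qed

lemma Gdist_image_sq_le:
  fixes F H :: "'a \<Rightarrow> 'h::real_normed_vector"
  shows "(Gdist (image_mset F c) (image_mset H c))\<^sup>2 \<le> (\<Sum>p\<in>#c. (norm (F p - H p))\<^sup>2)"
proof -
  obtain cs where cs: "mset cs = c" using ex_mset by blast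
  have "Gdist (image_mset F c) (image_mset H c) \<le> Gcost (map F cs) (map H cs)"
    using Gdist_le[of "map F cs" "map H cs"] cs by simp
  then have "(Gdist (image_mset F c) (image_mset H c))\<^sup>2 \<le> (Gcost (map F cs) (map H cs))\<^sup>2"
    by (rule power_mono) (rule Gdist_nonneg)
  also have "\<dots> = (\<Sum>p\<leftarrow>cs. (norm (F p - H p))\<^sup>2)"
    by (simp add: sum_nonneg sum_list_sum_nth atLeast0LessThan)
  also have "\<dots> = (\<Sum>p\<in>#c. (norm (F p - H p))\<^sup>2)"
    unfolding cs[symmetric] by (simp only: sum_mset_mset)
  finally show ?thesis .
qed

lemma Gdist_image_le:
  fixes F H :: "'a \<Rightarrow> 'h::real_normed_vector" and e :: real
  assumes "\<And>p. p \<in># c \<Longrightarrow> norm (F p - H p) \<le> e" "0 \<le> e"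
  shows "Gdist (image_mset F c) (image_mset H c) \<le> size c * e"
proof -
  have "(\<Sum>p\<in>#c. (norm (F p - H p))\<^sup>2) \<le> (\<Sum>p\<in>#c. e\<^sup>2)"
    using assms by (intro sum_mset_mono power_mono) auto
  also have "\<dots> = size c * e\<^sup>2"
    by simp
  \<comment> \<open>Crude: the natural factor is \<open>sqrt (size c)\<close>, and
    \<open>n \<le> n\<^sup>2\<close> trades it for \<open>size c\<close>.\<close>
  also have "\<dots> \<le> (real (size c))\<^sup>2 * e\<^sup>2"
  proof (rule mult_right_mono)
    have "real (size c) \<le> real ((size c)\<^sup>2)"
      by (rule of_nat_mono) (simp add: power2_eq_square)
    then show "real (size c) \<le> (real (size c))\<^sup>2" by simp
  qed simp
  also have "\<dots> = (size c * e)\<^sup>2"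
    by (simp add: power_mult_distrib)
  finally have "(Gdist (image_mset F c) (image_mset H c))\<^sup>2 \<le> (size c * e)\<^sup>2"
    using Gdist_image_sq_le[of F c H] by linarith
  then show ?thesis
    by (rule power2_le_imp_le) (simp add: assms(2))
qed

lemma sum_mset_replicate_image: "image_mset snd c = replicate_mset n x \<Longrightarrow> p \<in># c \<Longrightarrow> snd p = x"
  by (metis image_eqI in_replicate_mset set_image_mset)

lemma QQ_norm_sq: "(QQ_norm u)\<^sup>2 = (\<Sum>y\<in>#u. (norm y)\<^sup>2)"
proof -
  obtain c where c: "image_mset fst c = u" "image_mset snd c = replicate_mset (size u) 0"
    "(Gdist u (image_mset id (replicate_mset (size u) 0)))\<^sup>2 = (\<Sum>p\<in>#c. (norm (fst p - id (snd p)))\<^sup>2)"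
    by (rule Gdist_coupling[of u "replicate_mset (size u) 0" id]) auto
  have "(QQ_norm u)\<^sup>2 = (\<Sum>p\<in>#c. (norm (fst p - snd p))\<^sup>2)"
    using c(3) by (simp add: QQ_norm_def)
  also have "\<dots> = (\<Sum>p\<in>#c. (norm (fst p))\<^sup>2)"
    using sum_mset_replicate_image[OF c(2)] by (intro arg_cong[of _ _ sum_mset] image_mset_cong) auto
  also have "\<dots> = (\<Sum>y\<in>#u. (norm y)\<^sup>2)"
    unfolding c(1)[symmetric] by (simp add: image_mset.compositionality o_def)
  finally show ?thesis .
qed

lemma QQ_norm_nonneg: "0 \<le> QQ_norm u"
  unfolding QQ_norm_def by (rule Gdist_nonneg)

lemma Gdist_scale_le:
  fixes u v :: "'h::real_normed_vector multiset"
  assumes "size u = size v" "0 \<le> N"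
  shows "Gdist (image_mset ((*\<^sub>R) N) u) (image_mset ((*\<^sub>R) N) v) \<le> N * Gdist u v"
proof -
  obtain c where c: "image_mset fst c = u" "image_mset snd c = v"
    "(Gdist u (image_mset id v))\<^sup>2 = (\<Sum>p\<in>#c. (norm (fst p - id (snd p)))\<^sup>2)"
    using assms(1) by (rule Gdist_coupling[where \<phi>=id])
  have "(Gdist (image_mset ((*\<^sub>R) N) u) (image_mset ((*\<^sub>R) N) v))\<^sup>2
      \<le> (\<Sum>p\<in>#c. (norm (N *\<^sub>R fst p - N *\<^sub>R snd p))\<^sup>2)"
    using Gdist_image_sq_le[of "\<lambda>p. N *\<^sub>R fst p" c "\<lambda>p. N *\<^sub>R snd p"]
    unfolding c(1,2)[symmetric] by (simp add: image_mset.compositionality o_def)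
  also have "\<dots> = (\<Sum>p\<in>#c. N\<^sup>2 * (norm (fst p - snd p))\<^sup>2)"
    by (simp flip: scaleR_diff_right add: power_mult_distrib)
  also have "\<dots> = (N * Gdist u v)\<^sup>2"
    using c(3) by (simp add: sum_mset_distrib_left power_mult_distrib)
  finally show ?thesis
    by (rule power2_le_imp_le) (simp add: assms Gdist_nonneg)
qed

text \<open>Scaling by \<open>N\<close> and by \<open>1 / N\<close> are mutually inverse, so the
  one-sided bound applied to both gives equality.\<close>

lemma Gdist_scale:
  fixes u v :: "'h::real_normed_vector multiset"
  assumes "size u = size v" "0 < N"
  shows "Gdist (image_mset ((*\<^sub>R) N) u) (image_mset ((*\<^sub>R) N) v) = N * Gdist u v"
proof (rule antisym)
  have "image_mset ((*\<^sub>R) (1 / N)) (image_mset ((*\<^sub>R) N) w) = w" for w :: "'h multiset"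
    using assms(2) by (simp add: image_mset.compositionality o_def)
  then have "Gdist u v \<le> (1 / N) * Gdist (image_mset ((*\<^sub>R) N) u) (image_mset ((*\<^sub>R) N) v)"
    using Gdist_scale_le[of "image_mset ((*\<^sub>R) N) u" "image_mset ((*\<^sub>R) N) v" "1 / N"] assms by auto
  then show "N * Gdist u v \<le> Gdist (image_mset ((*\<^sub>R) N) u) (image_mset ((*\<^sub>R) N) v)"
    using assms(2) by (simp add: field_simps)
qed (use assms in \<open>simp add: Gdist_scale_le\<close>)

lemma sum_mset_lipschitz:
  fixes u v :: "'h::real_normed_vector multiset" and \<theta> :: "'h \<Rightarrow> real"
  assumes "size u = size v" and lip: "\<And>y z. \<bar>\<theta> y - \<theta> z\<bar> \<le> norm (y - z)"
  shows "\<bar>(\<Sum>y\<in>#u. \<theta> y) - (\<Sum>y\<in>#v. \<theta> y)\<bar> \<le> size u * Gdist u v"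
proof -
  obtain c where c: "image_mset fst c = u" "image_mset snd c = v"
    "\<forall>p\<in>#c. norm (fst p - id (snd p)) \<le> Gdist u (image_mset id v)"
    using assms(1) by (rule Gdist_coupling_le[where \<phi>=id])
  have "(\<Sum>y\<in>#u. \<theta> y) = (\<Sum>p\<in>#c. \<theta> (fst p))" "(\<Sum>y\<in>#v. \<theta> y) = (\<Sum>p\<in>#c. \<theta> (snd p))"
    using c(1,2) by (auto simp: image_mset.compositionality o_def)
  then have "(\<Sum>y\<in>#u. \<theta> y) - (\<Sum>y\<in>#v. \<theta> y) = (\<Sum>p\<in>#c. \<theta> (fst p) - \<theta> (snd p))"
    by (simp only: sum_mset_subtractf)
  moreover have "\<bar>\<Sum>p\<in>#c. \<theta> (fst p) - \<theta> (snd p)\<bar> \<le> size c * Gdist u v"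
  proof (rule abs_sum_mset_le)
    fix p assume "p \<in># c"
    then show "\<bar>\<theta> (fst p) - \<theta> (snd p)\<bar> \<le> Gdist u v"
      using bspec[OF c(3)] lip[of "fst p" "snd p"] by fastforce
  qed
  moreover have "size c = size u" using c(1) by (metis size_image_mset)
  ultimately show ?thesis by metis
qed

section \<open>Density and approximate differentials\<close>

lemma emeasure_lebesgue_ball:
  fixes a :: "'a::euclidean_space"
  assumes "0 \<le> r"
  shows "emeasure lebesgue (ball a r) = ennreal (unit_ball_vol (DIM('a)) * r ^ DIM('a))"
  using emeasure_ball[OF assms, of a] by simp

lemma outer_measure_of_Un_le:
  assumes "A \<subseteq> space M" "B \<subseteq> space M"
  shows "outer_measure_of M (A \<union> B) \<le> outer_measure_of M A + outer_measure_of M B"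
proof -
  obtain A' B' where *: "A' \<in> sets M" "A \<subseteq> A'" "outer_measure_of M A = emeasure M A'"
    "B' \<in> sets M" "B \<subseteq> B'" "outer_measure_of M B = emeasure M B'"
    using outer_measure_of_attain[OF assms(1)] outer_measure_of_attain[OF assms(2)] by auto
  have "outer_measure_of M (A \<union> B) \<le> outer_measure_of M (A' \<union> B')"
    using * by (intro outer_measure_of_mono) auto
  also have "\<dots> \<le> emeasure M A' + emeasure M B'"
    using * by (simp add: emeasure_subadditive)
  finally show ?thesis using * by simp
qed

text \<open>Multiplying out turns a limit of quotients in \<open>ennreal\<close> into inequalities
  between measures; this is legitimate because a ball of positive radius has measure neither
  \<open>0\<close> nor \<open>top\<close>. Outer measure appears since the exceptional sets are not
  known to be measurable.\<close>

lemma density_zero_iff: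
  fixes a :: "'a::euclidean_space"
  shows "density_zero E a \<longleftrightarrow> (\<forall>\<theta>::real>0. \<exists>\<delta>>0. \<forall>r. 0 < r \<and> r < \<delta> \<longrightarrow>
    outer_measure_of lebesgue (E \<inter> ball a r) \<le> ennreal \<theta> * emeasure lebesgue (ball a r))"
    (is "_ \<longleftrightarrow> ?R")
proof
  have V: "emeasure lebesgue (ball a r) \<noteq> 0" "emeasure lebesgue (ball a r) \<noteq> top" if "0 < r" for r
    using that by (simp_all add: emeasure_ball order.strict_implies_not_eq[OF unit_ball_vol_pos] less_imp_neq[OF unit_ball_vol_pos, symmetric])
  {
    assume "density_zero E a"
    show ?R
    proof (intro allI impI)
      fix \<theta> :: real assume "0 < \<theta>"
      then have "\<forall>\<^sub>F r in at_right 0. outer_measure_of lebesgue (E \<inter> ball a r) / emeasure lebesgue (ball a r) < ennreal \<theta>"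
        using order_tendstoD(2)[OF \<open>density_zero E a\<close>[unfolded density_zero_def], of "ennreal \<theta>"] by simp
      then obtain \<delta> where \<delta>: "\<delta> > 0" "\<And>r. 0 < r \<Longrightarrow> r < \<delta> \<Longrightarrow>
         outer_measure_of lebesgue (E \<inter> ball a r) / emeasure lebesgue (ball a r) < ennreal \<theta>"
        unfolding eventually_at_right_field by auto
      show "\<exists>\<delta>>0. \<forall>r. 0 < r \<and> r < \<delta> \<longrightarrow>
        outer_measure_of lebesgue (E \<inter> ball a r) \<le> ennreal \<theta> * emeasure lebesgue (ball a r)"
      proof (intro exI[of _ \<delta>] conjI allI impI)
        fix r assume r: "0 < r \<and> r < \<delta>"
        then have "outer_measure_of lebesgue (E \<inter> ball a r) < ennreal \<theta> * emeasure lebesgue (ball a r)"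
          using \<delta>(2)[of r] V[of r] by (intro iffD1[OF divide_less_ennreal]) (auto simp: top.not_eq_extremum)
        then show "outer_measure_of lebesgue (E \<inter> ball a r) \<le> ennreal \<theta> * emeasure lebesgue (ball a r)"
          by (rule less_imp_le)
      qed (use \<delta> in auto)
    qed
  next
    assume R: ?R
    show "density_zero E a"
      unfolding density_zero_def
    proof (rule order_tendstoI)
      fix c :: ennreal assume "0 < c"
      then obtain \<theta> where \<theta>: "0 < \<theta>" "ennreal \<theta> < c"
      proof (cases c)
        case (real r)
        then show thesis
          using that[of "r / 2"] \<open>0 < c\<close> by (auto simp: ennreal_less_iff)
      next
        case top
        then show thesis using that[of 1] by simp
      qed
      obtain \<delta> where \<delta>: "\<delta> > 0" "\<And>r. 0 < r \<Longrightarrow> r < \<delta> \<Longrightarrow>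
         outer_measure_of lebesgue (E \<inter> ball a r) \<le> ennreal \<theta> * emeasure lebesgue (ball a r)"
        using R \<theta> by metis
      show "\<forall>\<^sub>F r in at_right 0. outer_measure_of lebesgue (E \<inter> ball a r) / emeasure lebesgue (ball a r) < c"
        unfolding eventually_at_right_field
      proof (intro exI[of _ \<delta>] conjI allI impI)
        fix r assume r: "0 < r" "r < \<delta>"
        have "outer_measure_of lebesgue (E \<inter> ball a r) / emeasure lebesgue (ball a r)
          \<le> (ennreal \<theta> * emeasure lebesgue (ball a r)) / emeasure lebesgue (ball a r)"
          by (rule divide_right_mono_ennreal) (rule \<delta>(2)[OF r])
        also have "\<dots> = ennreal \<theta>"
          using V[OF r(1)] by (rule mult_divide_eq_ennreal)
        finally show "outer_measure_of lebesgue (E \<inter> ball a r) / emeasure lebesgue (ball a r) < c"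
          using \<theta> by simp
      qed (rule \<delta>)
    qed simp
  }
qed

lemma density_zero_mono_local:
  fixes a :: "'a::euclidean_space"
  assumes "density_zero E' a" "0 < \<delta>" "E \<inter> ball a \<delta> \<subseteq> E'"
  shows "density_zero E a"
  unfolding density_zero_iff
proof (intro allI impI)
  fix \<theta> :: real assume "0 < \<theta>"
  then obtain d where d: "0 < d" "\<And>r. 0 < r \<Longrightarrow> r < d \<Longrightarrow>
    outer_measure_of lebesgue (E' \<inter> ball a r) \<le> ennreal \<theta> * emeasure lebesgue (ball a r)"
    using assms(1) unfolding density_zero_iff by metis
  show "\<exists>d>0. \<forall>r. 0 < r \<and> r < d \<longrightarrow>
    outer_measure_of lebesgue (E \<inter> ball a r) \<le> ennreal \<theta> * emeasure lebesgue (ball a r)"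
  proof (intro exI[of _ "min d \<delta>"] conjI allI impI)
    fix r assume r: "0 < r \<and> r < min d \<delta>"
    then have "E \<inter> ball a r \<subseteq> E' \<inter> ball a r" using assms(3) by auto
    then show "outer_measure_of lebesgue (E \<inter> ball a r) \<le> ennreal \<theta> * emeasure lebesgue (ball a r)"
      using d(2)[of r] r outer_measure_of_mono[of "E \<inter> ball a r" "E' \<inter> ball a r" lebesgue] by (auto intro: order_trans)
  qed (use d assms in auto)
qed

lemma density_zero_Un:
  fixes a :: "'a::euclidean_space"
  assumes "density_zero E a" "density_zero E' a"
  shows "density_zero (E \<union> E') a"
  unfolding density_zero_iff
proof (intro allI impI)
  fix \<theta> :: real assume \<theta>: "0 < \<theta>"
  obtain d where d: "0 < d" "\<And>r. 0 < r \<Longrightarrow> r < d \<Longrightarrow>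
    outer_measure_of lebesgue (E \<inter> ball a r) \<le> ennreal (\<theta>/2) * emeasure lebesgue (ball a r)"
    using assms(1) \<theta> unfolding density_zero_iff by (metis half_gt_zero)
  obtain d' where d': "0 < d'" "\<And>r. 0 < r \<Longrightarrow> r < d' \<Longrightarrow>
    outer_measure_of lebesgue (E' \<inter> ball a r) \<le> ennreal (\<theta>/2) * emeasure lebesgue (ball a r)"
    using assms(2) \<theta> unfolding density_zero_iff by (metis half_gt_zero)
  show "\<exists>d>0. \<forall>r. 0 < r \<and> r < d \<longrightarrow>
    outer_measure_of lebesgue ((E \<union> E') \<inter> ball a r) \<le> ennreal \<theta> * emeasure lebesgue (ball a r)"
  proof (intro exI[of _ "min d d'"] conjI allI impI)
    fix r assume r: "0 < r \<and> r < min d d'"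
    have "outer_measure_of lebesgue ((E \<union> E') \<inter> ball a r)
        \<le> outer_measure_of lebesgue (E \<inter> ball a r) + outer_measure_of lebesgue (E' \<inter> ball a r)"
      unfolding Int_Un_distrib2 by (rule outer_measure_of_Un_le) auto
    also have "\<dots> \<le> ennreal (\<theta>/2) * emeasure lebesgue (ball a r) + ennreal (\<theta>/2) * emeasure lebesgue (ball a r)"
      using r by (intro add_mono d d') auto
    also have "\<dots> = (ennreal (\<theta>/2) + ennreal (\<theta>/2)) * emeasure lebesgue (ball a r)"
      by (simp only: distrib_right)
    also have "ennreal (\<theta>/2) + ennreal (\<theta>/2) = ennreal \<theta>"
      using \<theta> by (simp flip: ennreal_plus)
    finally show "outer_measure_of lebesgue ((E \<union> E') \<inter> ball a r) \<le> ennreal \<theta> * emeasure lebesgue (ball a r)" .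
  qed (use d d' in auto)
qed

text \<open>Otherwise \<open>E\<close> would contain the whole ball of radius
  \<open>\<eta> * s\<close> about \<open>a + s *\<^sub>R h\<close>, a fixed fraction of the ball of
  radius \<open>s * R\<close> about \<open>a\<close>. The lemma allows an approximate limit to be
  tested along any prescribed direction.\<close>

lemma density_zero_avoid:
  fixes a h :: "'a::euclidean_space"
  assumes "density_zero E a" "0 < \<eta>" "0 < \<delta>"
  obtains x s where "x \<notin> E" "0 < s" "s < \<delta>" "norm (x - a - s *\<^sub>R h) \<le> \<eta> * s"
proof -
  define R where "R = norm h + \<eta>"
  have R: "0 < R" using assms by (simp add: R_def add_nonneg_pos)
  \<comment> \<open>Half the volume fraction of the small ball in the large one, so that the two
    measure bounds contradict each other.\<close>
  define \<theta> where "\<theta> = (\<eta> / R) ^ DIM('a) / 2"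
  have \<theta>: "0 < \<theta>" using assms R by (simp add: \<theta>_def)
  then obtain d where d: "0 < d" "\<And>r. 0 < r \<Longrightarrow> r < d \<Longrightarrow>
    outer_measure_of lebesgue (E \<inter> ball a r) \<le> ennreal \<theta> * emeasure lebesgue (ball a r)"
    using assms(1) unfolding density_zero_iff by metis
  define s where "s = min (d / R) \<delta> / 2"
  have s: "0 < s" "s < \<delta>" "s * R < d"
    using d assms R by (auto simp: s_def min_def field_simps)
  have "\<not> ball (a + s *\<^sub>R h) (\<eta> * s) \<subseteq> E"
  proof
    assume sub: "ball (a + s *\<^sub>R h) (\<eta> * s) \<subseteq> E"
    have sub2: "ball (a + s *\<^sub>R h) (\<eta> * s) \<subseteq> ball a (s * R)"
    proof
      fix x assume "x \<in> ball (a + s *\<^sub>R h) (\<eta> * s)"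
      then have "dist a x < s * norm h + \<eta> * s"
        using dist_triangle[of a x "a + s *\<^sub>R h"] s by (simp add: dist_norm)
      then show "x \<in> ball a (s * R)" by (simp add: R_def algebra_simps)
    qed
    have "emeasure lebesgue (ball (a + s *\<^sub>R h) (\<eta> * s)) \<le> outer_measure_of lebesgue (E \<inter> ball a (s * R))"
      using outer_measure_of_mono[of "ball (a + s *\<^sub>R h) (\<eta> * s)" "E \<inter> ball a (s * R)" lebesgue] sub sub2
      by simp
    also have "\<dots> \<le> ennreal \<theta> * emeasure lebesgue (ball a (s * R))"
      using s R by (intro d) auto
    finally have "ennreal (unit_ball_vol DIM('a) * (\<eta> * s) ^ DIM('a))
        \<le> ennreal \<theta> * ennreal (unit_ball_vol DIM('a) * (s * R) ^ DIM('a))"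
      unfolding emeasure_lebesgue_ball[OF mult_nonneg_nonneg[OF less_imp_le[OF assms(2)] less_imp_le[OF s(1)]]]
        emeasure_lebesgue_ball[OF mult_nonneg_nonneg[OF less_imp_le[OF s(1)] less_imp_le[OF R]]] .
    then have "unit_ball_vol DIM('a) * (\<eta> * s) ^ DIM('a) \<le> \<theta> * (unit_ball_vol DIM('a) * (s * R) ^ DIM('a))"
      using s R \<theta> by (simp flip: ennreal_mult)
    moreover have "\<theta> * (s * R) ^ DIM('a) = (\<eta> * s) ^ DIM('a) / 2"
      using R by (simp add: \<theta>_def power_divide power_mult_distrib)
    ultimately have "unit_ball_vol DIM('a) * (\<eta> * s) ^ DIM('a) \<le> unit_ball_vol DIM('a) * ((\<eta> * s) ^ DIM('a) / 2)"
      by (simp only: mult.left_commute[of \<theta>])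
    moreover have "0 < unit_ball_vol DIM('a) * (\<eta> * s) ^ DIM('a)"
      using mult_pos_pos[OF assms(2) s(1)] by (intro mult_pos_pos zero_less_power) (simp_all add: assms s)
    ultimately show False by linarith
  qed
  then obtain x where "x \<in> ball (a + s *\<^sub>R h) (\<eta> * s)" "x \<notin> E" unfolding subset_eq by blast
  then show ?thesis
    using s by (intro that[of x s]) (auto simp: dist_norm algebra_simps norm_minus_commute)
qed

text \<open>At \<open>x = a\<close> the quotient is \<open>0\<close> by the convention for division
  by zero, so that point never violates the bound; elsewhere the denominator is multiplied
  out.\<close>

lemma approx_tendsto_ratio_iff:
  fixes F :: "'a::euclidean_space \<Rightarrow> real"
  assumes "\<And>x. 0 \<le> F x"
  shows "approx_tendsto (\<lambda>x. F x / norm (x - a)) 0 a \<longleftrightarrow>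
    (\<forall>e>0. density_zero {x. x \<noteq> a \<and> e * norm (x - a) \<le> F x} a)"
proof -
  have "{x. e \<le> dist (F x / norm (x - a)) 0} = {x. x \<noteq> a \<and> e * norm (x - a) \<le> F x}" if "0 < e" for e
  proof (intro Collect_cong)
    fix x show "e \<le> dist (F x / norm (x - a)) 0 \<longleftrightarrow> x \<noteq> a \<and> e * norm (x - a) \<le> F x"
      using that assms[of x] by (cases "x = a") (simp_all add: pos_le_divide_eq)
  qed
  then show ?thesis by (simp add: approx_tendsto_def)
qed

definition affine_tuple :: "('h::real_normed_vector \<times> ('a::real_normed_vector \<Rightarrow>\<^sub>L 'h)) multiset \<Rightarrow> 'a \<Rightarrow> 'a \<Rightarrow> 'h multiset"
  where "affine_tuple w a x = image_mset (\<lambda>p. fst p + blinfun_apply (snd p) (x - a)) w"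

lemma has_approx_differential_iff:
  "has_approx_differential f a w \<longleftrightarrow> image_mset fst w = f a \<and>
    (\<forall>p\<in>#w. \<forall>q\<in>#w. fst p = fst q \<longrightarrow> snd p = snd q) \<and>
    (\<forall>e>0. density_zero {x. x \<noteq> a \<and> e * norm (x - a) \<le> Gdist (f x) (affine_tuple w a x)} a)"
  unfolding has_approx_differential_def affine_tuple_def case_prod_beta
  by (subst approx_tendsto_ratio_iff) (auto simp: Gdist_nonneg)

lemma has_approx_differentialD:
  assumes "has_approx_differential f a w"
  shows "image_mset fst w = f a"
    "\<And>p q. p \<in># w \<Longrightarrow> q \<in># w \<Longrightarrow> fst p = fst q \<Longrightarrow> snd p = snd q"
    "\<And>e. 0 < e \<Longrightarrow> density_zero {x. x \<noteq> a \<and> e * norm (x - a) \<le> Gdist (f x) (affine_tuple w a x)} a"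
    "size w = size (f a)"
proof -
  show *: "image_mset fst w = f a"
    "\<And>p q. p \<in># w \<Longrightarrow> q \<in># w \<Longrightarrow> fst p = fst q \<Longrightarrow> snd p = snd q"
    "\<And>e. 0 < e \<Longrightarrow> density_zero {x. x \<noteq> a \<and> e * norm (x - a) \<le> Gdist (f x) (affine_tuple w a x)} a"
    using assms unfolding has_approx_differential_iff by blast+
  show "size w = size (f a)" using *(1) by (metis size_image_mset)
qed

lemma finite_norm_bound:
  fixes n :: "'a \<Rightarrow> real"
  assumes "finite A" "\<And>x. x \<in> A \<Longrightarrow> 0 \<le> n x"
  obtains K where "0 < K" "\<And>x. x \<in> A \<Longrightarrow> n x \<le> K"
proof (rule that)
  have "0 \<le> sum n A" using assms(2) by (rule sum_nonneg)
  then show "0 < 1 + sum n A" by simp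
  fix x assume "x \<in> A"
  then have "n x \<le> sum n A" using assms by (intro member_le_sum) auto
  then show "n x \<le> 1 + sum n A" by simp
qed

text \<open>Compatibility makes both multisets graphs of one function \<open>l\<close> over their
  first components, and a graph is determined by its multiset of base points.\<close>

lemma multiset_eq_graph:
  assumes "image_mset fst w = image_mset fst w'"
    and "\<And>p q. p \<in># w \<Longrightarrow> q \<in># w \<Longrightarrow> fst p = fst q \<Longrightarrow> snd p = snd q"
    and "\<And>p q. p \<in># w \<Longrightarrow> q \<in># w' \<Longrightarrow> fst p = fst q \<Longrightarrow> snd p = snd q"
  shows "w = w'"
proof -
  define l where "l y = (SOME L. (y, L) \<in># w)" for y
  have l: "snd p = l (fst p)" if "p \<in># w" for p
  proof -
    have "(fst p, l (fst p)) \<in># w" unfolding l_def by (rule someI[of _ "snd p"]) (use that in simp)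
    then show ?thesis using assms(2)[OF that] by force
  qed
  have l': "snd q = l (fst q)" if "q \<in># w'" for q
  proof -
    have "fst q \<in># image_mset fst w" using that assms(1) by simp
    then obtain p where "p \<in># w" "fst p = fst q" by auto
    then show ?thesis using l[of p] assms(3)[OF _ that, of p] by simp
  qed
  have "image_mset id w = image_mset (\<lambda>p. (fst p, l (fst p))) w"
    using l by (intro image_mset_cong) (auto simp: prod_eq_iff)
  also have "\<dots> = image_mset (\<lambda>y. (y, l y)) (image_mset fst w)" by (simp add: image_mset.compositionality o_def)
  also have "\<dots> = image_mset (\<lambda>p. (fst p, l (fst p))) w'"
    unfolding assms(1) by (simp add: image_mset.compositionality o_def)
  also have "\<dots> = image_mset id w'"
    using l' by (intro image_mset_cong) (auto simp: prod_eq_iff)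
  finally show ?thesis by simp
qed

lemma finite_separation:
  fixes A :: "'a::metric_space set"
  assumes "finite A"
  obtains d where "0 < d" "\<And>x y. x \<in> A \<Longrightarrow> y \<in> A \<Longrightarrow> dist x y < d \<Longrightarrow> x = y"
proof -
  have "finite (insert 1 {dist x y | x y. x \<in> A \<and> y \<in> A \<and> x \<noteq> y})" (is "finite (insert 1 ?D)")
  proof -
    have "?D \<subseteq> (\<lambda>(x, y). dist x y) ` (A \<times> A)" by auto
    from finite_subset[OF this] show ?thesis using assms by simp
  qed
  note fin = this
  show ?thesis
  proof (rule that[of "Min (insert 1 ?D)"])
    show "0 < Min (insert 1 ?D)" using fin by (subst Min_gr_iff) auto
    fix x y assume "x \<in> A" "y \<in> A" "dist x y < Min (insert 1 ?D)"
    then show "x = y" using fin by (cases "x = y") (auto dest!: Min_le[OF fin, of "dist x y", rotated])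
  qed
qed

text \<open>Two admissible first-order tuples are close at points avoiding both exceptional sets.
  Such points exist near any direction \<open>h\<close>. There the branch \<open>p\<close> is
  coupled with a branch over the same base point, because displacements shrink with \<open>s\<close>
  while distinct base points stay \<open>d\<close> apart. Hence the two linear maps agree along
  \<open>h\<close>.\<close>

lemma has_approx_differential_unique:
  fixes f :: "real^'m \<Rightarrow> 'h::real_normed_vector multiset"
  assumes U: "open U" "a \<in> U" "\<And>x. x \<in> U \<Longrightarrow> size (f x) = Q"
    and w: "has_approx_differential f a w" and w': "has_approx_differential f a w'"
  shows "w = w'"
proof (rule multiset_eq_graph)
  note W = has_approx_differentialD[OF w] and W' = has_approx_differentialD[OF w']
  show "image_mset fst w = image_mset fst w'" using W(1) W'(1) by simp
  show "\<And>p q. p \<in># w \<Longrightarrow> q \<in># w \<Longrightarrow> fst p = fst q \<Longrightarrow> snd p = snd q" by (rule W(2))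
  fix p q assume p: "p \<in># w" and q: "q \<in># w'" and pq: "fst p = fst q"
  show "snd p = snd q"
  proof (rule blinfun_eqI, rule ccontr)
    fix h assume "blinfun_apply (snd p) h \<noteq> blinfun_apply (snd q) h"
    define v where "v = blinfun_apply (snd p) h - blinfun_apply (snd q) h"
    have v: "0 < norm v" using \<open>_ \<noteq> _\<close> by (simp add: v_def)
    have h: "0 < norm h" using v by (auto simp: v_def)
    obtain K where K: "0 < K" "\<And>p. p \<in> set_mset w \<union> set_mset w' \<Longrightarrow> norm (snd p) \<le> K"
      using finite_norm_bound[of "set_mset w \<union> set_mset w'" "\<lambda>p. norm (snd p)"] by auto
    obtain d where d: "0 < d" "\<And>x y. x \<in># f a \<Longrightarrow> y \<in># f a \<Longrightarrow> dist x y < d \<Longrightarrow> x = y"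
      using finite_separation[of "set_mset (f a)"] by auto
    obtain \<rho> where \<rho>: "0 < \<rho>" "ball a \<rho> \<subseteq> U" using U by (meson openE)
    define R where "R = norm h + 1"
    \<comment> \<open>The approximation error \<open>2 * e * (s * R)\<close> and the direction error
      \<open>2 * K * \<eta> * s\<close> are each at most a quarter of \<open>s * norm v\<close>, the
      size of the exact difference along \<open>s *\<^sub>R h\<close>.\<close>
    define e where "e = norm v / (8 * R)"
    define \<eta> where "\<eta> = min (min 1 (norm h / 2)) (norm v / (8 * K))"
    have R: "1 < R" using h by (simp add: R_def)
    have e: "0 < e" using v R by (simp add: e_def)
    have \<eta>: "0 < \<eta>" "\<eta> \<le> 1" "\<eta> \<le> norm h / 2" "8 * K * \<eta> \<le> norm v"
    proof -
      show "0 < \<eta>" "\<eta> \<le> 1" "\<eta> \<le> norm h / 2" using v h K by (simp_all add: \<eta>_def)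
      have "\<eta> \<le> norm v / (8 * K)" by (simp add: \<eta>_def)
      then show "8 * K * \<eta> \<le> norm v" using K by (simp add: pos_le_divide_eq mult.commute)
    qed
    \<comment> \<open>Small enough for \<open>x\<close> to lie in \<open>U\<close> and for coupled
      base points to be closer than the separation \<open>d\<close>.\<close>
    define \<delta> where "\<delta> = min (\<rho> / R) (d / ((2 * K + 2 * e) * R))"
    have \<delta>: "0 < \<delta>" using \<rho> d K e R by (simp add: \<delta>_def)
    let ?E = "\<lambda>w. {x. x \<noteq> a \<and> e * norm (x - a) \<le> Gdist (f x) (affine_tuple w a x)}"
    have dz: "density_zero (?E w \<union> ?E w') a" by (intro density_zero_Un W(3) W'(3) e)
    obtain x s where
      x: "x \<notin> ?E w \<union> ?E w'" "0 < s" "s < \<delta>" "norm (x - a - s *\<^sub>R h) \<le> \<eta> * s"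
      by (rule density_zero_avoid[OF dz \<eta>(1) \<delta>])
    have xa1: "norm (x - a) \<le> s * R"
    proof -
      have "norm (x - a) \<le> norm (x - a - s *\<^sub>R h) + norm (s *\<^sub>R h)"
        using norm_triangle_ineq[of "x - a - s *\<^sub>R h" "s *\<^sub>R h"] by simp
      also have "\<dots> \<le> 1 * s + s * norm h"
        using x \<eta> by (intro add_mono order_trans[OF x(4)] mult_right_mono) auto
      finally show ?thesis by (simp add: R_def algebra_simps)
    qed
    have "x \<noteq> a"
    proof
      assume "x = a"
      then have "s * norm h \<le> \<eta> * s" using x by simp
      then have "norm h \<le> \<eta>" using x by (simp add: mult.commute)
      then show False using \<eta> h by simp
    qed
    then have E: "Gdist (f x) (affine_tuple w a x) \<le> e * norm (x - a)" "Gdist (f x) (affine_tuple w' a x) \<le> e * norm (x - a)"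
      using x(1) by auto
    have sR: "s * R < \<rho>" "(2 * K + 2 * e) * (s * R) < d"
    proof -
      have pos: "0 < (2 * K + 2 * e) * R" using K e R by simp
      have "s < \<rho> / R" "s < d / ((2 * K + 2 * e) * R)" using x(3) by (auto simp: \<delta>_def)
      then show "s * R < \<rho>" "(2 * K + 2 * e) * (s * R) < d"
        using R pos by (auto simp: pos_less_divide_eq mult_ac)
    qed
    have "x \<in> U" using xa1 sR(1) \<rho>(2) by (auto simp: dist_norm norm_minus_commute)
    have sizes: "size (f x) = Q" "size w = Q" "size w' = Q"
      using U(3)[OF \<open>x \<in> U\<close>] U(3)[OF U(2)] W(4) W'(4) by auto
    have G: "Gdist (affine_tuple w a x) (affine_tuple w' a x) \<le> 2 * e * norm (x - a)"
      using Gdist_triangle[of "affine_tuple w a x" Q "f x" "affine_tuple w' a x"] E sizes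
      by (simp add: affine_tuple_def Gdist_commute)
    obtain c where c: "image_mset fst c = affine_tuple w a x" "image_mset snd c = w'"
      "\<forall>p\<in>#c. norm (fst p - (fst (snd p) + blinfun_apply (snd (snd p)) (x - a))) \<le> Gdist (affine_tuple w a x) (image_mset (\<lambda>p. fst p + blinfun_apply (snd p) (x - a)) w')"
      using sizes by (elim Gdist_coupling_le[rotated]) (simp_all add: affine_tuple_def)
    have "fst p + blinfun_apply (snd p) (x - a) \<in># image_mset fst c"
      unfolding c(1) using p by (auto simp: affine_tuple_def)
    then obtain t where t: "t \<in># c" "fst t = fst p + blinfun_apply (snd p) (x - a)" by auto
    obtain y L where yL: "snd t = (y, L)" by (cases "snd t")
    have yL': "(y, L) \<in># w'" using t yL c(2) by (metis image_eqI set_image_mset)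
    have n1: "norm (fst p + blinfun_apply (snd p) (x - a) - (y + blinfun_apply L (x - a))) \<le> 2 * e * norm (x - a)"
      using bspec[OF c(3) t(1)] G t yL by (simp add: affine_tuple_def)
    have b: "norm (blinfun_apply L' z) \<le> K * norm z" if "(y', L') \<in> set_mset w \<union> set_mset w'" for y' L' z
      using K(2)[OF that] by (metis norm_blinfun mult_right_mono norm_ge_zero order_trans snd_conv)
    have "norm (fst p - y) \<le> norm (fst p + blinfun_apply (snd p) (x - a) - (y + blinfun_apply L (x - a))) + norm (blinfun_apply (snd p) (x - a)) + norm (blinfun_apply L (x - a))"
      by norm
    also have "\<dots> \<le> 2 * e * norm (x - a) + K * norm (x - a) + K * norm (x - a)"
      using b[of "fst p" "snd p"] b[of y L] p yL' by (intro add_mono n1) auto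
    also have "\<dots> = (2 * K + 2 * e) * norm (x - a)" by (simp add: algebra_simps)
    also have "\<dots> \<le> (2 * K + 2 * e) * (s * R)" using K e by (intro mult_left_mono xa1) auto
    also have "\<dots> < d" by (rule sR)
    \<comment> \<open>The coupled branch sits over the same base point, and compatibility then makes
      its linear map \<open>snd q\<close>.\<close>
    finally have "fst p = y"
      using d(2)[of "fst p" y] W(1) W'(1) p yL' by (metis dist_norm fst_conv image_eqI set_image_mset)
    then have "snd q = L" using W'(2)[OF q yL'] pq by simp
    then have "norm (blinfun_apply (snd p) (x - a) - blinfun_apply (snd q) (x - a)) \<le> 2 * e * norm (x - a)"
      using n1 \<open>fst p = y\<close> by simp
    also have "\<dots> \<le> 2 * e * (s * R)" using e by (intro mult_left_mono xa1) simp
    finally have n2: "norm (blinfun_apply (snd p) (x - a) - blinfun_apply (snd q) (x - a)) \<le> 2 * e * (s * R)" .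
    have "s *\<^sub>R v = (blinfun_apply (snd p) (x - a) - blinfun_apply (snd q) (x - a))
        - (blinfun_apply (snd p) (x - a - s *\<^sub>R h) - blinfun_apply (snd q) (x - a - s *\<^sub>R h))"
      by (simp add: v_def blinfun.diff_right blinfun.scaleR_right scaleR_diff_right)
    then have "norm (s *\<^sub>R v) \<le> norm (blinfun_apply (snd p) (x - a) - blinfun_apply (snd q) (x - a))
        + (norm (blinfun_apply (snd p) (x - a - s *\<^sub>R h)) + norm (blinfun_apply (snd q) (x - a - s *\<^sub>R h)))"
      by (simp only:) (rule order_trans[OF norm_triangle_ineq4 add_left_mono[OF norm_triangle_ineq4]])
    then have "s * norm v \<le> norm (blinfun_apply (snd p) (x - a) - blinfun_apply (snd q) (x - a))
        + (norm (blinfun_apply (snd p) (x - a - s *\<^sub>R h)) + norm (blinfun_apply (snd q) (x - a - s *\<^sub>R h)))"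
      using x(2) by simp
    also have "\<dots> \<le> 2 * e * (s * R) + (K * (\<eta> * s) + K * (\<eta> * s))"
      using p q K
      by (intro add_mono n2 order_trans[OF b[of "fst p" "snd p"] mult_left_mono[OF x(4)]]
          order_trans[OF b[of "fst q" "snd q"] mult_left_mono[OF x(4)]]) auto
    also have "\<dots> = s * (norm v / 4 + 2 * (K * \<eta>))" using R by (simp add: e_def algebra_simps)
    also have "\<dots> \<le> s * (norm v / 4 + norm v / 4)" using x(2) \<eta>(4) by (intro mult_left_mono) auto
    finally show False using v x(2) by simp
  qed
qed

lemma finite_uniform_radius:
  fixes P :: "'a \<Rightarrow> 'b::real_normed_vector \<Rightarrow> bool"
  assumes "finite A" "\<And>y. y \<in> A \<Longrightarrow> \<exists>d>0. \<forall>k. norm k < d \<longrightarrow> P y k"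
  obtains d :: real where "0 < d" "\<And>y k. y \<in> A \<Longrightarrow> norm k < d \<Longrightarrow> P y k"
proof -
  obtain d where d: "\<And>y. y \<in> A \<Longrightarrow> 0 < d y \<and> (\<forall>k. norm k < d y \<longrightarrow> P y k)"
    using assms(2) by metis
  show ?thesis
  proof (rule that[of "Min (insert 1 (d ` A))"])
    show "0 < Min (insert 1 (d ` A))" using assms(1) d by (subst Min_gr_iff) auto
    fix y and k :: 'b assume "y \<in> A" "norm k < Min (insert 1 (d ` A))"
    then show "P y k" using d[of y] assms(1) by auto
  qed
qed

lemma has_derivativeD_norm:
  assumes "(F has_derivative F') (at p)" "0 < e"
  shows "\<exists>d>0. \<forall>k. norm k < d \<longrightarrow> norm (F (p + k) - F p - F' k) \<le> e * norm k"
proof -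
  obtain d where "0 < d" "\<And>y. norm (y - p) < d \<Longrightarrow> norm (F y - F p - F' (y - p)) \<le> e * norm (y - p)"
    using assms unfolding has_derivative_at_alt by metis
  from this(1) this(2)[of "p + _"] show ?thesis by (intro exI[of _ d]) auto
qed

lemma blinfun_norm_le:
  assumes "norm L \<le> K"
  shows "norm (blinfun_apply L z) \<le> K * norm z"
  using norm_blinfun[of L z] mult_right_mono[OF assms norm_ge_zero[of z]] by linarith

text \<open>Chain rule for a change of the values. Injectivity on the entries of \<open>f a\<close>
  protects the compatibility condition: merging two entries with different differentials could
  attach two linear maps to one point.\<close>

lemma has_approx_differential_squash:
  fixes f :: "real^'m \<Rightarrow> 'h::real_normed_vector multiset" and F :: "(real^'m) \<times> 'h \<Rightarrow> 'h"
  assumes U: "open U" "a \<in> U" "\<And>x. x \<in> U \<Longrightarrow> size (f x) = Q"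
    and w: "has_approx_differential f a w"
    and F: "\<And>y. y \<in># f a \<Longrightarrow> (F has_derivative F' y) (at (a, y))"
    and inj: "inj_on (\<lambda>y. F (a, y)) (set_mset (f a))"
  shows "has_approx_differential (\<lambda>x. image_mset (\<lambda>y. F (x, y)) (f x)) a
    (image_mset (\<lambda>p. (F (a, fst p), Blinfun (\<lambda>v. F' (fst p) (v, blinfun_apply (snd p) v)))) w)"
proof -
  note W = has_approx_differentialD[OF w]
  define w' where "w' = image_mset (\<lambda>p. (F (a, fst p), Blinfun (\<lambda>v. F' (fst p) (v, blinfun_apply (snd p) v)))) w"
  have fw: "fst p \<in># f a" if "p \<in># w" for p using that W(1) by (metis image_eqI set_image_mset)
  have blF: "bounded_linear (F' y)" if "y \<in># f a" for y using F[OF that] by (rule has_derivative_bounded_linear)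
  have bl: "bounded_linear (\<lambda>v. F' (fst p) (v, blinfun_apply (snd p) v))" if "p \<in># w" for p
    by (rule bounded_linear_compose[OF blF[OF fw[OF that]]])
      (intro bounded_linear_Pair bounded_linear_ident blinfun.bounded_linear_right)
  have aff': "affine_tuple w' a x = image_mset (\<lambda>p. F (a, fst p) + F' (fst p) (x - a, blinfun_apply (snd p) (x - a))) w" for x
    unfolding affine_tuple_def w'_def image_mset.compositionality o_def
    by (rule image_mset_cong) (simp add: bounded_linear_Blinfun_apply[OF bl])
  have "has_approx_differential (\<lambda>x. image_mset (\<lambda>y. F (x, y)) (f x)) a w'"
    unfolding has_approx_differential_iff
  proof (intro conjI allI impI)
    show "image_mset fst w' = image_mset (\<lambda>y. F (a, y)) (f a)"
      unfolding w'_def W(1)[symmetric] by (simp add: image_mset.compositionality o_def)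
    show "\<forall>p\<in>#w'. \<forall>q\<in>#w'. fst p = fst q \<longrightarrow> snd p = snd q"
    proof (intro ballI impI)
      fix p' q' assume "p' \<in># w'" "q' \<in># w'" and e: "fst p' = fst q'"
      then obtain p q where pq: "p \<in># w" "q \<in># w"
        "p' = (F (a, fst p), Blinfun (\<lambda>v. F' (fst p) (v, blinfun_apply (snd p) v)))"
        "q' = (F (a, fst q), Blinfun (\<lambda>v. F' (fst q) (v, blinfun_apply (snd q) v)))"
        unfolding w'_def by auto
      then have "fst p = fst q" using e inj fw by (auto simp: inj_on_def)
      moreover from this have "snd p = snd q" using W(2) pq by blast
      ultimately show "snd p' = snd q'" using pq by simp
    qed
    fix e :: real assume e: "0 < e"
    obtain K where K: "0 < K" "\<And>p. p \<in># w \<Longrightarrow> norm (snd p) \<le> K"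
      using finite_norm_bound[of "set_mset w" "\<lambda>p. norm (snd p)"] by auto
    obtain B where B: "0 < B" "\<And>y k. y \<in># f a \<Longrightarrow> norm (F' y k) \<le> B * norm k"
    proof -
      obtain B where B: "0 < B" "\<And>y. y \<in># f a \<Longrightarrow> onorm (F' y) \<le> B"
        using finite_norm_bound[of "set_mset (f a)" "\<lambda>y. onorm (F' y)"] blF onorm_pos_le by auto
      show ?thesis
      proof (rule that[OF B(1)])
        fix y k assume "y \<in># f a"
        then show "norm (F' y k) \<le> B * norm k"
          using onorm[OF blF, of y k] mult_right_mono[OF B(2) norm_ge_zero[of k], of y] by linarith
      qed
    qed
    \<comment> \<open>Each entry may err by \<open>e1\<close> relative to
      \<open>norm (x - a)\<close>: half through the remainder of \<open>F\<close>, whose increment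
      has norm at most \<open>(2 + K) * norm (x - a)\<close>, and half through the coupling error
      \<open>\<eta>\<close> magnified by \<open>B\<close>. Summed over \<open>size w\<close> entries
      this stays below \<open>e\<close>.\<close>
    define e1 where "e1 = e / (2 * (real (size w) + 1))"
    have e1: "0 < e1" using e by (simp add: e1_def)
    define \<eta> where "\<eta> = min 1 (e1 / (2 * B))"
    have \<eta>: "0 < \<eta>" "\<eta> \<le> 1" using e1 B by (simp_all add: \<eta>_def)
    have \<eta>B: "B * \<eta> \<le> e1 / 2"
    proof -
      have "\<eta> \<le> e1 / (2 * B)" by (simp add: \<eta>_def)
      then show ?thesis using B by (simp add: pos_le_divide_eq algebra_simps)
    qed
    define e0 where "e0 = e1 / (2 * (2 + K))"
    have e0: "0 < e0" using e1 K by (simp add: e0_def)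
    obtain d where d: "0 < d" "\<And>y k. y \<in># f a \<Longrightarrow> norm k < d \<Longrightarrow>
        norm (F ((a, y) + k) - F (a, y) - F' y k) \<le> e0 * norm k"
      using finite_uniform_radius[of "set_mset (f a)"
        "\<lambda>y k. norm (F ((a, y) + k) - F (a, y) - F' y k) \<le> e0 * norm k"] has_derivativeD_norm[OF F e0] by auto
    obtain \<rho> where \<rho>: "0 < \<rho>" "ball a \<rho> \<subseteq> U" using U by (meson openE)
    define \<delta> where "\<delta> = min \<rho> (d / (2 + K))"
    have \<delta>: "0 < \<delta>" using \<rho> d K by (simp add: \<delta>_def)
    have key: "Gdist (image_mset (\<lambda>y. F (x, y)) (f x)) (affine_tuple w' a x) < e * norm (x - a)"
      if x: "x \<in> ball a \<delta>" "x \<noteq> a" and G: "Gdist (f x) (affine_tuple w a x) < \<eta> * norm (x - a)" for x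
    proof -
      have xd: "norm (x - a) < \<rho>" "(2 + K) * norm (x - a) < d"
      proof -
        have "norm (x - a) < \<rho>" "norm (x - a) < d / (2 + K)"
          using x by (auto simp: \<delta>_def dist_norm norm_minus_commute)
        then show "norm (x - a) < \<rho>" "(2 + K) * norm (x - a) < d"
          using K by (auto simp: pos_less_divide_eq mult.commute)
      qed
      then have "x \<in> U" using \<rho> by (auto simp: dist_norm norm_minus_commute)
      then have sz: "size (f x) = size w" using U(3)[of x] U(3)[OF U(2)] W(4) by simp
      obtain c where c: "image_mset fst c = f x" "image_mset snd c = w"
        "\<forall>p\<in>#c. norm (fst p - (fst (snd p) + blinfun_apply (snd (snd p)) (x - a))) \<le>
           Gdist (f x) (image_mset (\<lambda>p. fst p + blinfun_apply (snd p) (x - a)) w)"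
        by (rule Gdist_coupling_le[OF sz])
      have "Gdist (image_mset (\<lambda>p. F (x, fst p)) c)
          (image_mset (\<lambda>p. F (a, fst (snd p)) + F' (fst (snd p)) (x - a, blinfun_apply (snd (snd p)) (x - a))) c)
          \<le> size c * (e1 * norm (x - a))"
      proof (rule Gdist_image_le)
        fix p assume p: "p \<in># c"
        obtain z y L where zyL: "p = (z, y, L)" by (cases p) auto
        have yL: "(y, L) \<in># w" using p zyL c(2) by (metis image_eqI set_image_mset snd_conv)
        have y: "y \<in># f a" using fw[OF yL] by simp
        have n1: "norm (z - (y + blinfun_apply L (x - a))) \<le> \<eta> * norm (x - a)"
          using bspec[OF c(3) p] zyL G by (simp add: affine_tuple_def)
        have n2: "norm (blinfun_apply L (x - a)) \<le> K * norm (x - a)"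
          by (rule blinfun_norm_le) (use K(2)[OF yL] in simp)
        have "norm (z - y) \<le> norm (z - (y + blinfun_apply L (x - a))) + norm (blinfun_apply L (x - a))" by norm
        also have "\<dots> \<le> 1 * norm (x - a) + K * norm (x - a)"
          using \<eta> by (intro add_mono n2 order_trans[OF n1] mult_right_mono) auto
        finally have n3: "norm (z - y) \<le> (1 + K) * norm (x - a)" by (simp add: algebra_simps)
        have "norm (x - a, z - y) \<le> norm (x - a) + norm (z - y)"
          by (metis norm_Pair_le)
        also have "\<dots> \<le> norm (x - a) + (1 + K) * norm (x - a)" by (intro add_left_mono n3)
        finally have n4: "norm (x - a, z - y) \<le> (2 + K) * norm (x - a)" by (simp add: algebra_simps)
        have n5: "norm (F ((a, y) + (x - a, z - y)) - F (a, y) - F' y (x - a, z - y)) \<le> e0 * norm (x - a, z - y)"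
          by (rule d(2)[OF y]) (use n4 xd in linarith)
        also have "\<dots> \<le> e0 * ((2 + K) * norm (x - a))" using e0 by (intro mult_left_mono n4) simp
        also have "\<dots> = e1 / 2 * norm (x - a)" using K by (simp add: e0_def field_simps)
        finally have n6: "norm (F (x, z) - F (a, y) - F' y (x - a, z - y)) \<le> e1 / 2 * norm (x - a)" by simp
        have eq: "F' y (x - a, z - y) - F' y (x - a, blinfun_apply L (x - a)) = F' y (0, z - (y + blinfun_apply L (x - a)))"
          using bounded_linear.linear[OF blF[OF y]] by (simp flip: linear_diff add: algebra_simps)
        have "norm (F' y (0, z - (y + blinfun_apply L (x - a)))) \<le> B * norm (z - (y + blinfun_apply L (x - a)))"
          using B(2)[OF y, of "(0, z - (y + blinfun_apply L (x - a)))"] by (simp add: norm_Pair)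
        also have "\<dots> \<le> B * (\<eta> * norm (x - a))" using B by (intro mult_left_mono n1) simp
        also have "\<dots> \<le> e1 / 2 * norm (x - a)" using mult_right_mono[OF \<eta>B norm_ge_zero[of "x - a"]] by (simp add: mult.assoc)
        finally have n7: "norm (F' y (x - a, z - y) - F' y (x - a, blinfun_apply L (x - a))) \<le> e1 / 2 * norm (x - a)"
          by (simp only: eq)
        have "norm (F (x, z) - (F (a, y) + F' y (x - a, blinfun_apply L (x - a))))
          \<le> norm (F (x, z) - F (a, y) - F' y (x - a, z - y)) + norm (F' y (x - a, z - y) - F' y (x - a, blinfun_apply L (x - a)))"
          by norm
        also have "\<dots> \<le> e1 * norm (x - a)" using n6 n7 by (simp add: field_simps)
        finally show "norm (F (x, fst p) - (F (a, fst (snd p)) + F' (fst (snd p)) (x - a, blinfun_apply (snd (snd p)) (x - a)))) \<le> e1 * norm (x - a)"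
          by (simp add: zyL)
      qed (use e1 in simp)
      moreover have "image_mset (\<lambda>p. F (x, fst p)) c = image_mset (\<lambda>y. F (x, y)) (f x)"
        unfolding c(1)[symmetric] by (simp add: image_mset.compositionality o_def)
      moreover have "image_mset (\<lambda>p. F (a, fst (snd p)) + F' (fst (snd p)) (x - a, blinfun_apply (snd (snd p)) (x - a))) c
          = affine_tuple w' a x"
        unfolding aff' c(2)[symmetric] by (simp add: image_mset.compositionality o_def)
      moreover have "size c = size w" using c(2) by (metis size_image_mset)
      ultimately have "Gdist (image_mset (\<lambda>y. F (x, y)) (f x)) (affine_tuple w' a x) \<le> size w * (e1 * norm (x - a))" by simp
      also have "\<dots> = (size w * e1) * norm (x - a)" by simp
      also have "\<dots> < e * norm (x - a)"
      proof (rule mult_strict_right_mono)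
        show "size w * e1 < e" using e by (simp add: e1_def field_simps add_nonneg_pos)
      qed (use x in simp)
      finally show ?thesis .
    qed
    show "density_zero {x. x \<noteq> a \<and> e * norm (x - a) \<le> Gdist (image_mset (\<lambda>y. F (x, y)) (f x)) (affine_tuple w' a x)} a"
    proof (rule density_zero_mono_local[OF W(3)[OF \<eta>(1)] \<delta>], rule subsetI)
      fix x assume "x \<in> {x. x \<noteq> a \<and> e * norm (x - a) \<le> Gdist (image_mset (\<lambda>y. F (x, y)) (f x)) (affine_tuple w' a x)} \<inter> ball a \<delta>"
      then show "x \<in> {x. x \<noteq> a \<and> \<eta> * norm (x - a) \<le> Gdist (f x) (affine_tuple w a x)}"
        using key[of x] by force
    qed
  qed
  then show ?thesis by (simp only: w'_def)
qed

text \<open>Chain rule for a change of the domain. The assumption \<open>dens\<close> transports the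
  exceptional set of \<open>f\<close> at \<open>\<Phi> a\<close> back to a set of density zero at
  \<open>a\<close>; differentiability of \<open>\<Phi>\<close> then handles the linear part.\<close>

lemma has_approx_differential_squeeze:
  fixes f :: "real^'m \<Rightarrow> 'h::real_normed_vector multiset" and \<Phi> :: "real^'m \<Rightarrow> real^'m"
  assumes U: "open U" "\<Phi> a \<in> U" "\<And>x. x \<in> U \<Longrightarrow> size (f x) = Q"
    and w: "has_approx_differential f (\<Phi> a) w"
    and D: "(\<Phi> has_derivative blinfun_apply \<Phi>') (at a)"
    and lip: "\<And>x. norm (\<Phi> x - \<Phi> a) \<le> M * norm (x - a)" "0 < M"
    and inj: "\<And>x. \<Phi> x = \<Phi> a \<Longrightarrow> x = a"
    and dens: "\<And>E. density_zero E (\<Phi> a) \<Longrightarrow> density_zero (\<Phi> -` E) a"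
  shows "has_approx_differential (\<lambda>x. f (\<Phi> x)) a (image_mset (\<lambda>p. (fst p, snd p o\<^sub>L \<Phi>')) w)"
  unfolding has_approx_differential_iff
proof (intro conjI allI impI)
  note W = has_approx_differentialD[OF w]
  let ?w' = "image_mset (\<lambda>p. (fst p, snd p o\<^sub>L \<Phi>')) w"
  show "image_mset fst ?w' = f (\<Phi> a)" using W(1) by (simp add: image_mset.compositionality o_def)
  show "\<forall>p\<in>#?w'. \<forall>q\<in>#?w'. fst p = fst q \<longrightarrow> snd p = snd q"
  proof (intro ballI impI)
    fix p' q' assume "p' \<in># ?w'" "q' \<in># ?w'" and e: "fst p' = fst q'"
    then obtain p q where pq: "p \<in># w" "q \<in># w" "p' = (fst p, snd p o\<^sub>L \<Phi>')" "q' = (fst q, snd q o\<^sub>L \<Phi>')"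
      by auto
    then have "snd p = snd q" using e W(2)[OF pq(1,2)] by simp
    then show "snd p' = snd q'" using pq by simp
  qed
  fix e :: real assume e: "0 < e"
  obtain K where K: "0 < K" "\<And>p. p \<in># w \<Longrightarrow> norm (snd p) \<le> K"
    using finite_norm_bound[of "set_mset w" "\<lambda>p. norm (snd p)"] by auto
  \<comment> \<open>Replacing \<open>\<Phi> x - \<Phi> a\<close> by its linearisation costs at most
    \<open>e / 2 * norm (x - a)\<close>, so a deviation of \<open>e\<close> at \<open>x\<close>
    leaves at least \<open>e / 2\<close> for the tuple at \<open>\<Phi> x\<close>.\<close>
  define e0 where "e0 = e / (2 * K * (real (size w) + 1))"
  have e0: "0 < e0" using e K by (simp add: e0_def)
  obtain d where d: "0 < d" "\<And>k. norm k < d \<Longrightarrow> norm (\<Phi> (a + k) - \<Phi> a - blinfun_apply \<Phi>' k) \<le> e0 * norm k"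
    using has_derivativeD_norm[OF D e0] by blast
  obtain \<rho> where \<rho>: "0 < \<rho>" "ball (\<Phi> a) \<rho> \<subseteq> U" using U by (meson openE)
  define \<delta> where "\<delta> = min d (\<rho> / M)"
  have \<delta>: "0 < \<delta>" using d \<rho> lip by (simp add: \<delta>_def)
  define \<eta> where "\<eta> = e / (2 * M)"
  have \<eta>: "0 < \<eta>" using e lip by (simp add: \<eta>_def)
  have key: "\<eta> * norm (\<Phi> x - \<Phi> a) \<le> Gdist (f (\<Phi> x)) (affine_tuple w (\<Phi> a) (\<Phi> x))"
    if x: "x \<in> ball a \<delta>" "e * norm (x - a) \<le> Gdist (f (\<Phi> x)) (affine_tuple ?w' a x)" for x
  proof -
    have xd: "norm (x - a) < d" "norm (x - a) < \<rho> / M"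
      using x(1) by (auto simp: \<delta>_def dist_norm norm_minus_commute)
    then have "norm (\<Phi> x - \<Phi> a) < \<rho>"
      using lip by (auto simp: pos_less_divide_eq mult.commute intro: le_less_trans)
    then have "\<Phi> x \<in> U" using \<rho> by (auto simp: dist_norm norm_minus_commute)
    then have sz: "size (f (\<Phi> x)) = Q" "size w = Q" using U(3)[of "\<Phi> x"] U(3)[OF U(2)] W(4) by auto
    have n: "norm (\<Phi> x - \<Phi> a - blinfun_apply \<Phi>' (x - a)) \<le> e0 * norm (x - a)"
      using d(2)[OF xd(1)] by simp
    have "Gdist (affine_tuple w (\<Phi> a) (\<Phi> x)) (affine_tuple ?w' a x) \<le> size w * (K * (e0 * norm (x - a)))"
      unfolding affine_tuple_def image_mset.compositionality o_def
    proof (rule Gdist_image_le)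
      fix p assume p: "p \<in># w"
      have "fst p + blinfun_apply (snd p) (\<Phi> x - \<Phi> a) - (fst p + blinfun_apply (snd p o\<^sub>L \<Phi>') (x - a))
          = blinfun_apply (snd p) (\<Phi> x - \<Phi> a - blinfun_apply \<Phi>' (x - a))"
        by (simp add: blinfun.bilinear_simps)
      also have "norm \<dots> \<le> K * norm (\<Phi> x - \<Phi> a - blinfun_apply \<Phi>' (x - a))"
        by (rule blinfun_norm_le[OF K(2)[OF p]])
      also have "\<dots> \<le> K * (e0 * norm (x - a))" using K by (intro mult_left_mono n) simp
      finally show "norm (fst p + blinfun_apply (snd p) (\<Phi> x - \<Phi> a) -
          (fst (fst p, snd p o\<^sub>L \<Phi>') + blinfun_apply (snd (fst p, snd p o\<^sub>L \<Phi>')) (x - a))) \<le> K * (e0 * norm (x - a))" by simp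
    qed (use K e0 in simp)
    also have "\<dots> = (size w * K * e0) * norm (x - a)" by simp
    also have "\<dots> \<le> e / 2 * norm (x - a)"
    proof (rule mult_right_mono)
      have "size w * K * e0 \<le> (size w + 1) * K * e0" using K e0 by (intro mult_right_mono) auto
      also have "\<dots> = ((size w + 1) * K) * (e / 2 / ((size w + 1) * K))" using K by (simp add: e0_def field_simps)
      also have "\<dots> = e / 2"
      proof -
        have "real (size w + 1) * K \<noteq> 0" using K by simp
        then show ?thesis by (metis nonzero_mult_div_cancel_left times_divide_eq_right)
      qed
      finally show "size w * K * e0 \<le> e / 2" .
    qed simp
    finally have "Gdist (affine_tuple w (\<Phi> a) (\<Phi> x)) (affine_tuple ?w' a x) \<le> e / 2 * norm (x - a)" .
    moreover have "Gdist (f (\<Phi> x)) (affine_tuple ?w' a x) \<le> Gdist (f (\<Phi> x)) (affine_tuple w (\<Phi> a) (\<Phi> x))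
        + Gdist (affine_tuple w (\<Phi> a) (\<Phi> x)) (affine_tuple ?w' a x)"
      using sz by (intro Gdist_triangle) (auto simp: affine_tuple_def)
    ultimately have "e / 2 * norm (x - a) \<le> Gdist (f (\<Phi> x)) (affine_tuple w (\<Phi> a) (\<Phi> x))" using x(2) by simp
    moreover have "\<eta> * norm (\<Phi> x - \<Phi> a) \<le> \<eta> * (M * norm (x - a))" using \<eta> by (intro mult_left_mono lip) simp
    moreover have "\<eta> * (M * norm (x - a)) = e / 2 * norm (x - a)" using lip by (simp add: \<eta>_def)
    ultimately show ?thesis by simp
  qed
  show "density_zero {x. x \<noteq> a \<and> e * norm (x - a) \<le> Gdist (f (\<Phi> x)) (affine_tuple ?w' a x)} a"
    by (rule density_zero_mono_local[OF dens[OF W(3)[OF \<eta>]] \<delta>]) (use key inj in auto)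
qed

section \<open>Change of variables\<close>

text \<open>An orthogonal map taking an axis to the direction of \<open>\<xi>\<close> conjugates the
  operator to a diagonal one, with entry \<open>\<alpha> + \<beta> * (\<xi> \<bullet> \<xi>)\<close>
  on that axis and \<open>\<alpha>\<close> elsewhere. Differentials of radial deformations have
  exactly this form.\<close>

lemma matrix_rank_one_det:
  fixes \<xi> :: "real^'n" and \<alpha> \<beta> :: real
  shows "det (matrix (\<lambda>v. \<alpha> *\<^sub>R v + (\<beta> * (\<xi> \<bullet> v)) *\<^sub>R \<xi>)) = \<alpha> ^ (CARD('n) - 1) * (\<alpha> + \<beta> * (\<xi> \<bullet> \<xi>))"
proof -
  fix k :: 'n
  define A where "A = (\<lambda>v. \<alpha> *\<^sub>R v + (\<beta> * (\<xi> \<bullet> v)) *\<^sub>R \<xi>)"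
  define D where "D = (\<lambda>v::real^'n. \<alpha> *\<^sub>R v + (\<beta> * (norm \<xi>)\<^sup>2 * v $ k) *\<^sub>R axis k 1)"
  obtain f :: "real^'n \<Rightarrow> real^'n" where f: "orthogonal_transformation f" "\<xi> = norm \<xi> *\<^sub>R f (axis k 1)"
  proof (cases "\<xi> = 0")
    case True
    then show thesis using that[of id] by (simp add: orthogonal_transformation_id[unfolded id_def[symmetric]])
  next
    case False
    have "norm (axis k (1::real)) = 1" "norm (\<xi> /\<^sub>R norm \<xi>) = 1" using False by (simp_all add: norm_axis_1)
    then obtain f :: "real^'n \<Rightarrow> real^'n" where "orthogonal_transformation f" "f (axis k 1) = \<xi> /\<^sub>R norm \<xi>"
      by (rule orthogonal_transformation_exists_1)
    then show thesis using False that[of f] by simp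
  qed
  have lf: "linear f" using f(1) by (rule orthogonal_transformation_linear)
  have lA: "linear A" unfolding A_def
    by (intro linearI) (simp_all add: inner_add_right scaleR_add_right scaleR_add_left distrib_left algebra_simps)
  have lD: "linear D" unfolding D_def
    by (intro linearI) (simp_all add: algebra_simps scaleR_add_left)
  have "A (f v) = f (D v)" for v
  proof -
    have "\<xi> \<bullet> f v = norm \<xi> * (f (axis k 1) \<bullet> f v)" by (subst f(2)) simp
    also have "f (axis k 1) \<bullet> f v = v $ k"
      using f(1) by (simp add: orthogonal_transformation_def inner_axis')
    finally have 1: "\<xi> \<bullet> f v = norm \<xi> * v $ k" .
    have "(\<beta> * (\<xi> \<bullet> f v)) *\<^sub>R \<xi> = (\<beta> * (norm \<xi>)\<^sup>2 * v $ k) *\<^sub>R f (axis k 1)"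
      unfolding 1 by (subst f(2)) (simp add: power2_eq_square)
    then show ?thesis
      unfolding A_def D_def by (simp add: linear_add[OF lf] linear_scale[OF lf])
  qed
  then have "A \<circ> f = f \<circ> D" by (simp add: fun_eq_iff)
  then have "matrix A ** matrix f = matrix f ** matrix D"
    using matrix_compose[OF lf lA] matrix_compose[OF lD lf] by simp
  then have "det (matrix A) * det (matrix f) = det (matrix D) * det (matrix f)"
    by (metis det_mul mult.commute)
  moreover have "det (matrix f) \<noteq> 0"
    using det_orthogonal_matrix[of "matrix f"] f(1) by (auto simp: orthogonal_transformation_matrix)
  ultimately have "det (matrix A) = det (matrix D)" by simp
  also have "\<dots> = (\<Prod>i\<in>UNIV. matrix D $ i $ i)"
    by (rule det_diagonal) (auto simp: matrix_def D_def axis_def)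
  also have "\<dots> = (\<Prod>i\<in>UNIV. if i = k then \<alpha> + \<beta> * (\<xi> \<bullet> \<xi>) else \<alpha>)"
    by (rule prod.cong) (auto simp: matrix_def D_def axis_def power2_norm_eq_inner)
  also have "\<dots> = (\<alpha> + \<beta> * (\<xi> \<bullet> \<xi>)) * (\<Prod>i\<in>UNIV - {k}. \<alpha>)"
    by (subst prod.remove[of UNIV k]) (auto intro!: prod.cong)
  finally show ?thesis by (simp add: A_def mult.commute card_Diff_singleton)
qed

text \<open>The change of variables theorem requires a well-ordered index type; the coordinates indexed by
  an arbitrary finite type are transported to such a copy.\<close>

typedef (overloaded) 'm windex = "{..<CARD('m::finite)}"
  by (intro exI[of _ 0]) simp

instantiation windex :: (finite) wellorder
begin
definition "x \<le> y \<longleftrightarrow> Rep_windex x \<le> Rep_windex y"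
definition "x < y \<longleftrightarrow> Rep_windex x < Rep_windex y"
instance
proof
  fix P :: "'a windex \<Rightarrow> bool" and a :: "'a windex"
  assume *: "\<And>x. (\<And>y. y < x \<Longrightarrow> P y) \<Longrightarrow> P x"
  show "P a" by (induction a rule: measure_induct_rule[of Rep_windex]) (rule *, simp add: less_windex_def)
qed (auto simp: less_eq_windex_def less_windex_def Rep_windex_inject)
end

lemma bij_betw_Rep_windex: "bij_betw (Rep_windex :: 'm::finite windex \<Rightarrow> nat) UNIV {..<CARD('m)}"
  by (metis (mono_tags) UNIV_I bij_betw_def inj_onI Rep_windex_inject type_definition.Rep_range type_definition_windex)

instance windex :: (finite) finite
  by standard (use bij_betw_finite[OF bij_betw_Rep_windex] in simp)

lemma CARD_windex: "CARD('m::finite windex) = CARD('m)"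
  using bij_betw_same_card[OF bij_betw_Rep_windex[where 'm='m]] by simp

definition reindex :: "('b::finite \<Rightarrow> 'a::finite) \<Rightarrow> real^'a \<Rightarrow> real^'b"
  where "reindex \<iota> x = (\<chi> i. x $ \<iota> i)"

lemma linear_reindex: "linear (reindex \<iota>)"
  by (intro linearI) (simp_all add: reindex_def vec_eq_iff)

lemma reindex_inv:
  assumes "bij \<iota>"
  shows "reindex (inv \<iota>) (reindex \<iota> x) = x" "reindex \<iota> (reindex (inv \<iota>) y) = y"
  using assms by (simp_all add: reindex_def vec_eq_iff surj_f_inv_f[OF bij_is_surj] inv_f_f[OF bij_is_inj])

lemma inner_reindex:
  assumes "bij \<iota>"
  shows "reindex \<iota> x \<bullet> reindex \<iota> y = x \<bullet> y"
  unfolding inner_vec_def reindex_def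
  using sum.reindex_bij_betw[OF assms, of "\<lambda>i. x $ i \<bullet> y $ i"] by simp

lemma borel_measurable_reindex: "reindex \<iota> \<in> borel_measurable borel"
  by (intro borel_measurable_continuous_onI linear_continuous_on linear_reindex)
    (simp add: linear_conv_bounded_linear[symmetric] linear_reindex)

text \<open>A permutation of coordinates maps boxes to boxes with the same product of side lengths,
  and the values on boxes characterise \<open>lborel\<close>.\<close>

lemma lborel_distr_reindex:
  fixes \<iota> :: "'b::finite \<Rightarrow> 'a::finite"
  assumes "bij \<iota>"
  shows "distr lborel borel (reindex \<iota>) = lborel"
proof (rule lborel_eqI[symmetric])
  fix l u :: "real^'b"
  assume lu: "\<And>b. b \<in> Basis \<Longrightarrow> l \<bullet> b \<le> u \<bullet> b"
  have lu': "l $ i \<le> u $ i" for i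
    using lu[of "axis i 1"] by (simp add: inner_axis axis_in_Basis_iff)
  have "reindex \<iota> -` box l u = box (reindex (inv \<iota>) l) (reindex (inv \<iota>) u)"
  proof (rule set_eqI)
    fix x show "x \<in> reindex \<iota> -` box l u \<longleftrightarrow> x \<in> box (reindex (inv \<iota>) l) (reindex (inv \<iota>) u)"
      unfolding mem_box_cart vimage_eq reindex_def using assms
      by simp (metis bij_inv_eq_iff)
  qed
  then have "emeasure (distr lborel borel (reindex \<iota>)) (box l u) = emeasure lborel (box (reindex (inv \<iota>) l) (reindex (inv \<iota>) u))"
    using borel_measurable_reindex[of \<iota>] by (simp add: emeasure_distr)
  also have "\<dots> = (\<Prod>b\<in>Basis. (reindex (inv \<iota>) u - reindex (inv \<iota>) l) \<bullet> b)"
    using lu' by (intro emeasure_lborel_box) (auto simp: Basis_vec_def inner_axis reindex_def)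
  also have "(\<Prod>b\<in>Basis. (reindex (inv \<iota>) u - reindex (inv \<iota>) l) \<bullet> b) = (\<Prod>i\<in>UNIV. (u - l) $ inv \<iota> i)"
    unfolding Basis_vec_def
    by (simp add: UNION_singleton_eq_range prod.reindex inj_on_def axis_eq_axis inner_axis reindex_def)
  also have "\<dots> = (\<Prod>i\<in>UNIV. (u - l) $ i)"
    by (rule prod.reindex_bij_betw[OF bij_imp_bij_inv[OF assms]])
  also have "\<dots> = (\<Prod>b\<in>Basis. (u - l) \<bullet> b)"
    unfolding Basis_vec_def
    by (simp add: UNION_singleton_eq_range prod.reindex inj_on_def axis_eq_axis inner_axis)
  finally show "emeasure (distr lborel borel (reindex \<iota>)) (box l u) = ennreal (\<Prod>b\<in>Basis. (u - l) \<bullet> b)" .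
qed simp

lemma lebesgue_distr_reindex:
  assumes "bij \<iota>"
  shows lebesgue_measurable_reindex: "reindex \<iota> \<in> lebesgue \<rightarrow>\<^sub>M lebesgue"
    and "distr lebesgue lebesgue (reindex \<iota>) = lebesgue"
proof -
  have [measurable]: "reindex \<iota> \<in> borel_measurable borel" by (rule borel_measurable_reindex)
  have eq: "distr lebesgue lborel (reindex \<iota>) = lborel"
    using lborel_distr_reindex[OF assms] by (simp add: distr_completion cong: distr_cong)
  show "reindex \<iota> \<in> lebesgue \<rightarrow>\<^sub>M lebesgue"
    by (rule completion.measurable_completion2) (simp_all add: eq measurable_completion)
  show "distr lebesgue lebesgue (reindex \<iota>) = lebesgue"
    by (subst completion.completion_distr_eq[symmetric]) (simp_all add: eq measurable_completion)
qed

lemma set_integrable_reindex: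
  fixes g :: "real^'b \<Rightarrow> real" and \<iota> :: "'b::finite \<Rightarrow> 'a::finite"
  assumes "bij \<iota>" "set_integrable lebesgue S g"
  shows "set_integrable lebesgue (reindex \<iota> -` S) (\<lambda>x. g (reindex \<iota> x))"
    "(LINT x:reindex \<iota> -` S|lebesgue. g (reindex \<iota> x)) = (LINT x:S|lebesgue. g x)"
proof -
  let ?G = "\<lambda>x. indicator S x *\<^sub>R g x"
  have G: "integrable (distr lebesgue lebesgue (reindex \<iota>)) ?G"
    using assms by (simp add: lebesgue_distr_reindex set_integrable_def)
  have meas: "?G \<in> borel_measurable lebesgue" using assms(2) by (auto simp: set_integrable_def)
  have ind: "indicator (reindex \<iota> -` S) x = (indicator S (reindex \<iota> x) :: real)" for x
    by (simp add: indicator_def)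
  show "set_integrable lebesgue (reindex \<iota> -` S) (\<lambda>x. g (reindex \<iota> x))"
    using integrable_distr[OF lebesgue_measurable_reindex[OF assms(1)] G] by (simp add: set_integrable_def ind)
  have "(LINT x|distr lebesgue lebesgue (reindex \<iota>). ?G x) = (LINT x|lebesgue. ?G (reindex \<iota> x))"
    by (rule integral_distr[OF lebesgue_measurable_reindex[OF assms(1)] meas])
  then show "(LINT x:reindex \<iota> -` S|lebesgue. g (reindex \<iota> x)) = (LINT x:S|lebesgue. g x)"
    by (simp add: set_lebesgue_integral_def ind lebesgue_distr_reindex[OF assms(1)])
qed

lemma set_integrable_reindex_iff:
  fixes g :: "real^'b \<Rightarrow> real" and \<iota> :: "'b::finite \<Rightarrow> 'a::finite"
  assumes "bij \<iota>"
  shows "set_integrable lebesgue (reindex \<iota> -` S) (\<lambda>x. g (reindex \<iota> x)) \<and>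
      (LINT x:reindex \<iota> -` S|lebesgue. g (reindex \<iota> x)) = b
    \<longleftrightarrow> set_integrable lebesgue S g \<and> (LINT x:S|lebesgue. g x) = b"
proof -
  have "set_integrable lebesgue S g" if "set_integrable lebesgue (reindex \<iota> -` S) (\<lambda>x. g (reindex \<iota> x))"
    using set_integrable_reindex(1)[OF bij_imp_bij_inv[OF assms] that] by (simp add: reindex_inv[OF assms] vimage_def)
  then show ?thesis
    using set_integrable_reindex[OF assms, of S g] by auto
qed

lemma change_of_variables_wellorder:
  fixes k :: "real^'m::{finite,wellorder} \<Rightarrow> real" and g :: "real^'m::_ \<Rightarrow> real^'m::_"
  assumes S: "S \<in> sets lebesgue"
    and der_g: "\<And>x. x \<in> S \<Longrightarrow> (g has_derivative g' x) (at x within S)"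
    and inj: "inj_on g S"
  shows "set_integrable lebesgue S (\<lambda>x. \<bar>det (matrix (g' x))\<bar> * k (g x)) \<and>
           (LINT x:S|lebesgue. \<bar>det (matrix (g' x))\<bar> * k (g x)) = b
     \<longleftrightarrow> set_integrable lebesgue (g ` S) k \<and> (LINT x:g ` S|lebesgue. k x) = b"
proof -
  have "(\<lambda>x. \<bar>det (matrix (g' x))\<bar> * k (g x)) absolutely_integrable_on S \<and>
           integral S (\<lambda>x. \<bar>det (matrix (g' x))\<bar> * k (g x)) = b
     \<longleftrightarrow> k absolutely_integrable_on (g ` S) \<and> integral (g ` S) k = b"
    \<comment> \<open>The general theorem concerns vector-valued integrands; a scalar one is read as
      a function into \<open>real^1\<close>.\<close>
    using has_absolute_integral_change_of_variables[OF S der_g inj, of "\<lambda>x. vec (k x) :: real^1" "vec b"]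
    by (simp add: absolutely_integrable_on_1_iff integral_on_1_eq)
  then show ?thesis
    using set_lebesgue_integral_eq_integral(2)[of S "\<lambda>x. \<bar>det (matrix (g' x))\<bar> * k (g x)"]
      set_lebesgue_integral_eq_integral(2)[of "g ` S" k]
    by (simp cong: conj_cong)
qed

text \<open>Conjugation by the coordinate permutation \<open>T\<close> preserves inner products, so
  the determinant formula survives the transport. The equivalence carries integrability together
  with the value, in both directions.\<close>

lemma change_of_variables_radial:
  fixes k :: "real^'m \<Rightarrow> real" and \<Phi> :: "real^'m \<Rightarrow> real^'m"
  assumes S: "S \<in> sets lebesgue"
    and D: "\<And>x. x \<in> S \<Longrightarrow> (\<Phi> has_derivative (\<lambda>v. \<alpha> x *\<^sub>R v + (\<beta> x * (\<xi> x \<bullet> v)) *\<^sub>R \<xi> x)) (at x)"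
    and inj: "inj_on \<Phi> S"
  defines "J \<equiv> \<lambda>x. \<bar>\<alpha> x ^ (CARD('m) - 1) * (\<alpha> x + \<beta> x * (\<xi> x \<bullet> \<xi> x))\<bar>"
  shows "set_integrable lebesgue S (\<lambda>x. J x * k (\<Phi> x)) \<and> (LINT x:S|lebesgue. J x * k (\<Phi> x)) = b
    \<longleftrightarrow> set_integrable lebesgue (\<Phi> ` S) k \<and> (LINT x:\<Phi> ` S|lebesgue. k x) = b"
proof -
  obtain \<iota> :: "'m windex \<Rightarrow> 'm" where \<iota>: "bij \<iota>"
    using finite_same_card_bij[of "UNIV :: 'm windex set" "UNIV :: 'm set"] by (auto simp: CARD_windex)
  note \<iota>' = bij_imp_bij_inv[OF \<iota>]
  define T where "T = reindex \<iota>"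
  define T' where "T' = reindex (inv \<iota>)"
  have TT': "T' (T x) = x" "T (T' y) = y" for x y
    using reindex_inv[OF \<iota>] by (auto simp: T_def T'_def)
  have lT: "linear T" "linear T'" by (simp_all add: T_def T'_def linear_reindex)
  have img: "T' -` A = T ` A" for A using TT' by (auto simp: image_iff) metis+
  define g where "g = T \<circ> \<Phi> \<circ> T'"
  define g' where "g' z = (\<lambda>v. \<alpha> (T' z) *\<^sub>R v + (\<beta> (T' z) * (T (\<xi> (T' z)) \<bullet> v)) *\<^sub>R T (\<xi> (T' z)))" for z
  have gS: "g ` (T' -` S) = T' -` (\<Phi> ` S)"
    unfolding img by (simp add: g_def image_comp o_def TT')
  have inner: "\<xi> x \<bullet> T' v = T (\<xi> x) \<bullet> v" for x v
    using inner_reindex[OF \<iota>, of "\<xi> x" "T' v"] TT' by (simp add: T_def)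
  have cov: "set_integrable lebesgue (T' -` S) (\<lambda>z. \<bar>det (matrix (g' z))\<bar> * k (T' (g z))) \<and>
           (LINT z:T' -` S|lebesgue. \<bar>det (matrix (g' z))\<bar> * k (T' (g z))) = b
     \<longleftrightarrow> set_integrable lebesgue (g ` (T' -` S)) (\<lambda>z. k (T' z)) \<and> (LINT z:g ` (T' -` S)|lebesgue. k (T' z)) = b"
  proof (rule change_of_variables_wellorder)
    show "T' -` S \<in> sets lebesgue"
      using measurable_sets[OF lebesgue_measurable_reindex[OF \<iota>'] S] by (simp add: T'_def)
    show "inj_on g (T' -` S)"
    proof (rule inj_onI)
      fix y z assume yz: "y \<in> T' -` S" "z \<in> T' -` S" "g y = g z"
      then have "\<Phi> (T' y) = \<Phi> (T' z)" using TT'(1) by (metis comp_apply g_def)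
      then have "T' y = T' z" using inj_onD[OF inj] yz by simp
      then show "y = z" using TT'(2) by metis
    qed
    fix z assume "z \<in> T' -` S"
    then have "(\<Phi> has_derivative (\<lambda>v. \<alpha> (T' z) *\<^sub>R v + (\<beta> (T' z) * (\<xi> (T' z) \<bullet> v)) *\<^sub>R \<xi> (T' z))) (at (T' z))"
      using D by simp
    from has_derivative_compose[OF has_derivative_compose[OF linear_imp_has_derivative[OF lT(2)] this] linear_imp_has_derivative[OF lT(1)]]
    have "(g has_derivative (\<lambda>v. T (\<alpha> (T' z) *\<^sub>R T' v + (\<beta> (T' z) * (\<xi> (T' z) \<bullet> T' v)) *\<^sub>R \<xi> (T' z)))) (at z within T' -` S)"
      by (simp add: g_def o_def)
    then show "(g has_derivative g' z) (at z within T' -` S)"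
      by (simp add: g'_def linear_add[OF lT(1)] linear_scale[OF lT(1)] TT' inner)
  qed
  have det: "\<bar>det (matrix (g' z))\<bar> = J (T' z)" for z
    unfolding g'_def matrix_rank_one_det J_def using inner_reindex[OF \<iota>] by (simp add: T_def CARD_windex)
  have Tg: "T' (g z) = \<Phi> (T' z)" for z by (simp add: g_def TT')
  show ?thesis
    using cov unfolding gS det Tg unfolding T'_def
      set_integrable_reindex_iff[OF \<iota>', of S "\<lambda>x. J x * k (\<Phi> x)" b]
      set_integrable_reindex_iff[OF \<iota>', of "\<Phi> ` S" k b] .
qed

section \<open>A smooth radial bump function\<close>

text \<open>For \<open>n = 0\<close> this is the classical flat function exp(-1/t). The negative
  powers of \<open>t\<close> make the family closed under differentiation up to linear combinations,
  which is the source of smoothness.\<close>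

definition bump :: "nat \<Rightarrow> real \<Rightarrow> real"
  where "bump n t = (if 0 < t then exp (- 1 / t) / t ^ n else 0)"

lemma bump_nonneg: "0 \<le> bump n t"
  by (simp add: bump_def)

lemma power_le_fact_exp: "0 \<le> (s::real) \<Longrightarrow> s ^ n \<le> fact n * exp s"
proof -
  assume s: "0 \<le> s"
  have "(\<Sum>k\<in>{n}. s ^ k /\<^sub>R fact k) \<le> exp s"
    unfolding exp_def using s by (intro sum_le_suminf summable_exp_generic) auto
  then show ?thesis by (simp add: field_simps)
qed

text \<open>One term of the exponential series at \<open>1 / t\<close> already outweighs the factor
  \<open>t ^ n\<close> in the denominator.\<close>

lemma bump_le: "bump n t \<le> fact n"
proof (cases "0 < t")
  case True
  have "(1 / t) ^ n \<le> fact n * exp (1 / t)" using True by (intro power_le_fact_exp) simp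
  then have "(1 / t) ^ n * exp (- (1 / t)) \<le> fact n * exp (1 / t) * exp (- (1 / t))" by (intro mult_right_mono) auto
  also have "\<dots> = fact n" by (simp add: mult.assoc flip: exp_add)
  finally show ?thesis using True by (simp add: bump_def power_divide field_simps)
qed (simp add: bump_def)

lemma bump_Suc: "bump (Suc n) t * t = bump n t"
  by (simp add: bump_def)

lemma bump_le_linear: "\<bar>bump n t\<bar> \<le> fact (Suc n) * \<bar>t\<bar>"
  using mult_right_mono[OF bump_le[of "Suc n" t] abs_ge_zero[of t]] bump_nonneg[of n t] bump_nonneg[of "Suc n" t]
  by (subst bump_Suc[symmetric]) (simp add: abs_mult)

lemma bump_has_derivative:
  "(bump n has_real_derivative (bump (n + 2) t - real n * bump (Suc n) t)) (at t)"
proof -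
  consider "0 < t" | "t < 0" | "t = 0" by linarith
  then show ?thesis
  proof cases
    case 1
    have "((\<lambda>t. exp (- 1 / t) / t ^ n) has_real_derivative (bump (n + 2) t - real n * bump (Suc n) t)) (at t)"
      using 1 by (cases n)
        (auto intro!: derivative_eq_intros simp: bump_def field_simps power2_eq_square, metis One_nat_def power_eq_if)
    moreover have "\<forall>\<^sub>F s in nhds t. exp (- 1 / s) / s ^ n = bump n s"
      using eventually_nhds_in_open[of "{0<..}" t] 1 by (auto simp: bump_def elim: eventually_mono)
    ultimately show ?thesis by (subst (asm) DERIV_cong_ev[OF refl _ refl]) auto
  next
    case 2
    have "\<forall>\<^sub>F s in nhds t. 0 = bump n s"
      using eventually_nhds_in_open[of "{..<0}" t] 2 by (auto simp: bump_def elim: eventually_mono)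
    then have "((\<lambda>_. 0) has_real_derivative 0) (at t) \<longleftrightarrow> (bump n has_real_derivative 0) (at t)"
      by (intro DERIV_cong_ev) auto
    then show ?thesis using 2 by (simp add: bump_def)
  next
    case 3
    \<comment> \<open>At the origin the difference quotient of \<open>bump n\<close> is
      \<open>bump (Suc n)\<close>, which is itself O(h).\<close>
    have "((\<lambda>h. bump n h / h) \<longlongrightarrow> 0) (at 0)"
    proof (rule Lim_null_comparison)
      show "\<forall>\<^sub>F h in at 0. norm (bump n h / h) \<le> fact (Suc (Suc n)) * \<bar>h\<bar>"
      proof (rule eventually_mono[OF eventually_neq_at_within])
        fix h :: real assume "h \<noteq> 0"
        then have "bump n h / h = bump (Suc n) h" by (subst bump_Suc[symmetric]) simp
        then show "norm (bump n h / h) \<le> fact (Suc (Suc n)) * \<bar>h\<bar>" using bump_le_linear[of "Suc n" h] by simp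
      qed
      show "((\<lambda>h::real. fact (Suc (Suc n)) * \<bar>h\<bar>) \<longlongrightarrow> 0) (at 0)"
        by (auto intro!: tendsto_eq_intros)
    qed
    then show ?thesis using 3 by (simp add: DERIV_def bump_def)
  qed
qed

lemma bump_mono: "s \<le> t \<Longrightarrow> bump 0 s \<le> bump 0 t"
  by (auto simp: bump_def field_simps)

lemma isCont_bump: "isCont (bump n) t"
  by (rule DERIV_isCont[OF bump_has_derivative])

lemma continuous_bump: "continuous_on A (bump n)"
  by (simp add: continuous_at_imp_continuous_on isCont_bump)

text \<open>A class of functions stable under all directional derivatives. Membership of one
  function yields derivatives of every order by induction, with no formula for the higher
  ones.\<close>

inductive bump_algebra :: "'a::euclidean_space \<Rightarrow> real \<Rightarrow> ('a \<Rightarrow> real) \<Rightarrow> bool" for a r where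
  const: "bump_algebra a r (\<lambda>x. c)"
| lin: "bump_algebra a r (\<lambda>x. (x - a) \<bullet> v)"
| bump: "bump_algebra a r (\<lambda>x. bump n (1 - (norm (x - a))\<^sup>2 / r\<^sup>2))"
| add: "bump_algebra a r f \<Longrightarrow> bump_algebra a r g \<Longrightarrow> bump_algebra a r (\<lambda>x. f x + g x)"
| mult: "bump_algebra a r f \<Longrightarrow> bump_algebra a r g \<Longrightarrow> bump_algebra a r (\<lambda>x. f x * g x)"

lemma bump_radial_has_derivative:
  fixes x a :: "'a::euclidean_space"
  shows "((\<lambda>x. bump n (1 - (norm (x - a))\<^sup>2 / r\<^sup>2)) has_derivative
    (\<lambda>v. (bump (n + 2) (1 - (norm (x - a))\<^sup>2 / r\<^sup>2) - real n * bump (Suc n) (1 - (norm (x - a))\<^sup>2 / r\<^sup>2)) *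
      (- 2 / r\<^sup>2 * ((x - a) \<bullet> v)))) (at x)"
proof -
  have "((\<lambda>x. 1 - (norm (x - a))\<^sup>2 / r\<^sup>2) has_derivative (\<lambda>v. - 2 / r\<^sup>2 * ((x - a) \<bullet> v))) (at x)"
    unfolding power2_norm_eq_inner
    by (auto intro!: derivative_eq_intros simp: inner_commute divide_inverse)
  from DERIV_compose_FDERIV[OF bump_has_derivative this] show ?thesis
    by (simp add: mult.commute)
qed

lemma bump_algebra_derivative:
  assumes "bump_algebra a r f"
  obtains f' where "\<And>x. (f has_derivative f' x) (at x)" "\<And>v. bump_algebra a r (\<lambda>x. f' x v)"
  using assms
proof (induction f arbitrary: thesis)
  case (const c)
  show ?case by (rule const[of "\<lambda>x v. 0"]) (auto intro: bump_algebra.const)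
next
  case (lin w)
  show ?case by (rule lin[of "\<lambda>x v. v \<bullet> w"]) (auto intro!: derivative_eq_intros bump_algebra.const)
next
  case (bump n)
  show ?case
  proof (rule bump[OF bump_radial_has_derivative])
    fix v
    have *: "(bump (n + 2) (1 - (norm (x - a))\<^sup>2 / r\<^sup>2) - real n * bump (Suc n) (1 - (norm (x - a))\<^sup>2 / r\<^sup>2)) * (- 2 / r\<^sup>2 * ((x - a) \<bullet> v))
      = (bump (n + 2) (1 - (norm (x - a))\<^sup>2 / r\<^sup>2) + (- real n) * bump (Suc n) (1 - (norm (x - a))\<^sup>2 / r\<^sup>2)) * (- 2 / r\<^sup>2 * ((x - a) \<bullet> v))" for x
      by simp
    show "bump_algebra a r (\<lambda>x. (bump (n + 2) (1 - (norm (x - a))\<^sup>2 / r\<^sup>2) - real n * bump (Suc n) (1 - (norm (x - a))\<^sup>2 / r\<^sup>2)) * (- 2 / r\<^sup>2 * ((x - a) \<bullet> v)))"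
      unfolding * by (intro bump_algebra.intros)
  qed
next
  case (add f g)
  obtain f' where f': "\<And>x. (f has_derivative f' x) (at x)" "\<And>v. bump_algebra a r (\<lambda>x. f' x v)" using add.IH(1) by blast
  obtain g' where g': "\<And>x. (g has_derivative g' x) (at x)" "\<And>v. bump_algebra a r (\<lambda>x. g' x v)" using add.IH(2) by blast
  show ?case
    by (rule add.prems[of "\<lambda>x v. f' x v + g' x v"]) (intro has_derivative_add f' g' bump_algebra.add)+
next
  case (mult f g)
  obtain f' where f': "\<And>x. (f has_derivative f' x) (at x)" "\<And>v. bump_algebra a r (\<lambda>x. f' x v)" using mult.IH(1) by blast
  obtain g' where g': "\<And>x. (g has_derivative g' x) (at x)" "\<And>v. bump_algebra a r (\<lambda>x. g' x v)" using mult.IH(2) by blast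
  show ?case
    by (rule mult.prems[of "\<lambda>x v. f x * g' x v + f' x v * g x"])
      (intro has_derivative_mult f' g' bump_algebra.add bump_algebra.mult mult.hyps)+
qed

text \<open>Vector-valued companion of \<open>bump_algebra\<close>: it contains the radial field and
  is again stable under differentiation.\<close>

inductive bump_field :: "'a::euclidean_space \<Rightarrow> real \<Rightarrow> ('a \<Rightarrow> 'a) \<Rightarrow> bool" for a r where
  const: "bump_algebra a r f \<Longrightarrow> bump_field a r (\<lambda>x. f x *\<^sub>R c)"
| radial: "bump_algebra a r f \<Longrightarrow> bump_field a r (\<lambda>x. f x *\<^sub>R (x - a))"
| add: "bump_field a r f \<Longrightarrow> bump_field a r g \<Longrightarrow> bump_field a r (\<lambda>x. f x + g x)"

lemma bump_field_derivative:
  assumes "bump_field a r f"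
  obtains f' where "\<And>x. (f has_derivative f' x) (at x)" "\<And>v. bump_field a r (\<lambda>x. f' x v)"
  using assms
proof (induction f arbitrary: thesis)
  case (const f c)
  obtain f' where f': "\<And>x. (f has_derivative f' x) (at x)" "\<And>v. bump_algebra a r (\<lambda>x. f' x v)"
    using bump_algebra_derivative[OF const.hyps] by blast
  show ?case
    by (rule const.prems[of "\<lambda>x v. f' x v *\<^sub>R c"]) (auto intro!: derivative_eq_intros f' bump_field.const)
next
  case (radial f)
  obtain f' where f': "\<And>x. (f has_derivative f' x) (at x)" "\<And>v. bump_algebra a r (\<lambda>x. f' x v)"
    using bump_algebra_derivative[OF radial.hyps] by blast
  show ?case
    by (rule radial.prems[of "\<lambda>x v. f x *\<^sub>R v + f' x v *\<^sub>R (x - a)"])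
      (auto intro!: derivative_eq_intros f' bump_field.intros radial.hyps)
next
  case (add f g)
  obtain f' where f': "\<And>x. (f has_derivative f' x) (at x)" "\<And>v. bump_field a r (\<lambda>x. f' x v)" using add.IH(1) by blast
  obtain g' where g': "\<And>x. (g has_derivative g' x) (at x)" "\<And>v. bump_field a r (\<lambda>x. g' x v)" using add.IH(2) by blast
  show ?case
    by (rule add.prems[of "\<lambda>x v. f' x v + g' x v"]) (intro has_derivative_add f' g' bump_field.add)+
qed

lemma Ck_bump_field: "bump_field a r f \<Longrightarrow> Ck k f"
proof (induction k arbitrary: f)
  case 0
  obtain f' where "\<And>x. (f has_derivative f' x) (at x)" using bump_field_derivative[OF 0] by blast
  then show ?case by (auto intro!: continuous_at_imp_continuous_on has_derivative_continuous)
next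
  case (Suc k)
  obtain f' where f': "\<And>x. (f has_derivative f' x) (at x)" "\<And>v. bump_field a r (\<lambda>x. f' x v)"
    using bump_field_derivative[OF Suc.prems] by blast
  have "frechet_derivative f (at x) = f' x" for x using frechet_derivative_at[OF f'(1)] by simp
  then show ?case using f' Suc.IH by (auto simp: differentiable_def)
qed

definition radial_bump :: "'a::euclidean_space \<Rightarrow> real \<Rightarrow> 'a \<Rightarrow> real"
  where "radial_bump a r x = bump 0 (1 - (norm (x - a))\<^sup>2 / r\<^sup>2)"

lemma radial_bump_eq_0: "0 < r \<Longrightarrow> x \<notin> ball a r \<Longrightarrow> bump n (1 - (norm (x - a))\<^sup>2 / r\<^sup>2) = 0"
proof -
  assume "0 < r" "x \<notin> ball a r"
  then have "r\<^sup>2 \<le> (norm (x - a))\<^sup>2" by (intro power_mono) (auto simp: dist_norm norm_minus_commute)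
  then have "1 \<le> (norm (x - a))\<^sup>2 / r\<^sup>2" using \<open>0 < r\<close> by (simp add: pos_le_divide_eq)
  then show ?thesis by (simp add: bump_def)
qed

lemma radial_bump_field_Cc_infinity:
  assumes "0 < r" "cball a r \<subseteq> U"
  shows "(\<lambda>x. radial_bump a r x *\<^sub>R (x - a)) \<in> Cc_infinity U"
proof -
  have "bump_field a r (\<lambda>x. radial_bump a r x *\<^sub>R (x - a))"
    unfolding radial_bump_def by (intro bump_field.radial bump_algebra.bump)
  moreover have "closure {x. radial_bump a r x *\<^sub>R (x - a) \<noteq> 0} \<subseteq> cball a r"
    using radial_bump_eq_0[OF assms(1), of _ a 0] by (intro closure_minimal) (force simp: radial_bump_def)+
  moreover from this have "compact (closure {x. radial_bump a r x *\<^sub>R (x - a) \<noteq> 0})"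
    by (meson bounded_cball bounded_subset closed_closure compact_eq_bounded_closed)
  ultimately show ?thesis using assms Ck_bump_field by (auto simp: Cc_infinity_def compactly_inside_def)
qed

section \<open>Energy densities\<close>

text \<open>Dominated convergence for the difference quotients at the single parameter
  \<open>t0\<close>. The domination concerns increments from \<open>t0\<close> only, and the
  integrability of \<open>G\<close>, in particular its measurability, comes out as a
  conclusion.\<close>

lemma DERIV_integral:
  fixes F :: "real \<Rightarrow> 'a \<Rightarrow> real"
  assumes int: "\<forall>\<^sub>F t in nhds t0. integrable M (F t)"
    and der: "\<And>x. x \<in> space M \<Longrightarrow> ((\<lambda>t. F t x) has_real_derivative G x) (at t0)"
    and dom: "\<forall>\<^sub>F t in at t0. \<forall>x\<in>space M. \<bar>F t x - F t0 x\<bar> \<le> \<bar>t - t0\<bar> * W x"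
    and W: "integrable M W"
  shows "integrable M G" "((\<lambda>t. LINT x|M. F t x) has_real_derivative (LINT x|M. G x)) (at t0)"
proof -
  have int0: "integrable M (F t0)" using int by (rule eventually_nhds_x_imp_x)
  have ev: "\<forall>\<^sub>F h in at 0. integrable M (F (t0 + h)) \<and> (\<forall>x\<in>space M. \<bar>F (t0 + h) x - F t0 x\<bar> \<le> \<bar>h\<bar> * W x)"
  proof -
    have "\<forall>\<^sub>F t in at t0. integrable M (F t)" using int by (simp add: eventually_nhds_conv_at)
    from eventually_conj[OF this dom] show ?thesis
      by (subst (asm) at_to_0) (simp add: eventually_filtermap add.commute)
  qed
  let ?q = "\<lambda>h x. (F (t0 + h) x - F t0 x) / h"
  have pt: "((\<lambda>h. ?q h x) \<longlongrightarrow> G x) (at 0)" if "x \<in> space M" for x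
    using der[OF that] by (simp add: DERIV_def)
  have key: "integrable M G \<and> (\<lambda>n. LINT x|M. ?q (X n) x) \<longlonglongrightarrow> (LINT x|M. G x)"
    if X: "\<And>n. X n \<noteq> 0" "X \<longlonglongrightarrow> 0" for X :: "nat \<Rightarrow> real"
  proof -
    have Xf: "filterlim X (at 0) sequentially" using X by (auto simp: filterlim_at)
    from eventually_compose_filterlim[OF ev Xf] obtain N where N: "\<And>n. N \<le> n \<Longrightarrow>
       integrable M (F (t0 + X n)) \<and> (\<forall>x\<in>space M. \<bar>F (t0 + X n) x - F t0 x\<bar> \<le> \<bar>X n\<bar> * W x)"
      by (auto simp: eventually_sequentially)
    \<comment> \<open>Discarding finitely many terms makes domination and integrability hold along
      the whole sequence.\<close>
    let ?Y = "\<lambda>n. X (n + N)"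
    have intq: "integrable M (?q (?Y n))" for n
      using N[of "n + N"] int0 by auto
    have lim: "(\<lambda>n. ?q (?Y n) x) \<longlonglongrightarrow> G x" if "x \<in> space M" for x
      using LIMSEQ_ignore_initial_segment[OF filterlim_compose[OF pt[OF that] Xf], of N] .
    have Gm: "G \<in> borel_measurable M"
      by (rule borel_measurable_LIMSEQ_real[OF lim]) (use intq in auto)
    have bound: "norm (?q (?Y n) x) \<le> W x" if "x \<in> space M" for n x
      using N[of "n + N"] that X(1)[of "n + N"] by (auto simp: divide_le_eq abs_mult mult.commute)
    have iG: "integrable M G"
      by (rule integrable_dominated_convergence[OF Gm _ W, of "\<lambda>n. ?q (?Y n)"]) (use intq lim bound in auto)
    have "(\<lambda>n. LINT x|M. ?q (?Y n) x) \<longlonglongrightarrow> (LINT x|M. G x)"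
      by (rule integral_dominated_convergence[OF Gm _ W, of "\<lambda>n. ?q (?Y n)"]) (use intq lim bound in auto)
    with iG show ?thesis by (auto dest: LIMSEQ_offset)
  qed
  have X0: "(\<lambda>n. 1 / real (Suc n)) \<longlonglongrightarrow> 0" using LIMSEQ_inverse_real_of_nat by (simp add: inverse_eq_divide)
  show "integrable M G" using key[OF _ X0] by simp
  have "((\<lambda>h. LINT x|M. ?q h x) \<longlongrightarrow> (LINT x|M. G x)) (at 0)"
    unfolding tendsto_at_iff_sequentially comp_def using key by auto
  moreover have "\<forall>\<^sub>F h in at 0. (LINT x|M. ?q h x) = ((LINT x|M. F (t0 + h) x) - (LINT x|M. F t0 x)) / h"
    using ev by eventually_elim (simp add: int0)
  ultimately show "((\<lambda>t. LINT x|M. F t x) has_real_derivative (LINT x|M. G x)) (at t0)"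
    unfolding DERIV_def by (rule Lim_transform_eventually)
qed

lemma hs_norm_sq: "(hs_norm L)\<^sup>2 = (\<Sum>b\<in>Basis. (norm (blinfun_apply L b))\<^sup>2)"
  by (simp add: hs_norm_def sum_nonneg)

lemma blinfun_apply_basis:
  fixes L :: "'a::euclidean_space \<Rightarrow>\<^sub>L 'h::real_normed_vector"
  shows "blinfun_apply L \<gamma> = (\<Sum>b\<in>Basis. (\<gamma> \<bullet> b) *\<^sub>R blinfun_apply L b)"
proof -
  have "blinfun_apply L \<gamma> = blinfun_apply L (\<Sum>b\<in>Basis. (\<gamma> \<bullet> b) *\<^sub>R b)" by (simp add: euclidean_representation)
  then show ?thesis by (simp add: blinfun.sum_right blinfun.scaleR_right)
qed

lemma norm_le_hs_norm:
  fixes L :: "'a::euclidean_space \<Rightarrow>\<^sub>L 'h::real_normed_vector"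
  shows "norm (blinfun_apply L \<gamma>) \<le> norm \<gamma> * hs_norm L"
proof -
  have "norm (blinfun_apply L \<gamma>) \<le> (\<Sum>b\<in>Basis. \<bar>\<gamma> \<bullet> b\<bar> * \<bar>norm (blinfun_apply L b)\<bar>)"
    unfolding blinfun_apply_basis[of L \<gamma>] by (rule order_trans[OF norm_sum]) simp
  also have "\<dots> \<le> L2_set (\<lambda>b. \<gamma> \<bullet> b) Basis * L2_set (\<lambda>b. norm (blinfun_apply L b)) Basis"
    by (rule L2_set_mult_ineq)
  also have "L2_set (\<lambda>b. \<gamma> \<bullet> b) Basis = norm \<gamma>"
    using euclidean_inner[of \<gamma> \<gamma>] by (simp add: L2_set_def norm_eq_sqrt_inner power2_eq_square)
  finally show ?thesis by (simp add: hs_norm_def L2_set_def)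
qed

text \<open>Expanding the square leaves sums over the orthonormal \<open>Basis\<close>, which
  collapse: the vectors \<open>(\<gamma> \<bullet> b) *\<^sub>R L b\<close> add up to
  \<open>L \<gamma>\<close> and the numbers \<open>(\<gamma> \<bullet> b)\<^sup>2\<close> to
  \<open>(norm \<gamma>)\<^sup>2\<close>. Both kinds of variation change \<open>Df\<close> by such a
  rank-one term.\<close>

lemma hs_norm_rank_one:
  fixes L L' :: "'a::euclidean_space \<Rightarrow>\<^sub>L 'h::real_inner"
  assumes "\<And>v. blinfun_apply L' v = \<alpha> *\<^sub>R blinfun_apply L v + (\<gamma> \<bullet> v) *\<^sub>R y"
  shows "(hs_norm L')\<^sup>2 = \<alpha>\<^sup>2 * (hs_norm L)\<^sup>2 + 2 * \<alpha> * (blinfun_apply L \<gamma> \<bullet> y) + (norm \<gamma>)\<^sup>2 * (norm y)\<^sup>2"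
proof -
  have "(norm (blinfun_apply L' b))\<^sup>2 = \<alpha>\<^sup>2 * (norm (blinfun_apply L b))\<^sup>2
      + 2 * \<alpha> * (((\<gamma> \<bullet> b) *\<^sub>R blinfun_apply L b) \<bullet> y) + (\<gamma> \<bullet> b)\<^sup>2 * (norm y)\<^sup>2" for b
    unfolding assms power2_norm_eq_inner
    by (simp add: inner_add_left inner_add_right inner_commute power2_eq_square algebra_simps)
  then have "(hs_norm L')\<^sup>2 = \<alpha>\<^sup>2 * (hs_norm L)\<^sup>2 + 2 * \<alpha> * (blinfun_apply L \<gamma> \<bullet> y) + (\<Sum>b\<in>Basis. (\<gamma> \<bullet> b)\<^sup>2) * (norm y)\<^sup>2"
    unfolding hs_norm_sq blinfun_apply_basis[of L \<gamma>]
    by (simp only: sum.distrib sum_distrib_left sum_distrib_right inner_sum_left)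
  also have "(\<Sum>b\<in>Basis. (\<gamma> \<bullet> b)\<^sup>2) = (norm \<gamma>)\<^sup>2"
    unfolding power2_norm_eq_inner unfolding power2_eq_square using euclidean_inner[of \<gamma> \<gamma>] by simp
  finally show ?thesis .
qed

definition tuple_energy :: "('h::real_normed_vector \<times> ((real^'m) \<Rightarrow>\<^sub>L 'h)) multiset \<Rightarrow> real"
  where "tuple_energy w = (\<Sum>p\<in>#w. (hs_norm (snd p))\<^sup>2)"

definition some_differential :: "(real^'m \<Rightarrow> 'h::real_normed_vector multiset) \<Rightarrow> real^'m \<Rightarrow> ('h \<times> ((real^'m) \<Rightarrow>\<^sub>L 'h)) multiset"
  where "some_differential f x = (SOME w. has_approx_differential f x w)"

definition approx_differentiable :: "(real^'m \<Rightarrow> 'h::real_normed_vector multiset) \<Rightarrow> real^'m \<Rightarrow> bool"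
  where "approx_differentiable f x \<longleftrightarrow> (\<exists>w. has_approx_differential f x w)"

text \<open>The value that \<^const>\<open>Df\<close> takes wherever there is no approximate differential.\<close>

definition junk_energy :: "('h::real_normed_vector \<times> ((real^'m) \<Rightarrow>\<^sub>L 'h)) itself \<Rightarrow> real"
  where "junk_energy _ = tuple_energy (SOME w :: ('h \<times> ((real^'m) \<Rightarrow>\<^sub>L 'h)) multiset. False)"

lemma tuple_energy_nonneg: "0 \<le> tuple_energy w"
  unfolding tuple_energy_def by (rule sum_mset_nonneg') simp

lemma junk_energy_nonneg: "0 \<le> junk_energy x"
  unfolding junk_energy_def by (rule tuple_energy_nonneg)

lemma Df_norm_sq: "(Df_norm f x)\<^sup>2 = tuple_energy (some_differential f x)"
  unfolding Df_norm_def Df_def tuple_energy_def some_differential_def image_mset.compositionality o_def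
  by (rule real_sqrt_pow2) (rule sum_mset_nonneg', simp)

lemma some_differential: "approx_differentiable f x \<Longrightarrow> has_approx_differential f x (some_differential f x)"
  unfolding approx_differentiable_def some_differential_def by (rule someI_ex)

text \<open>Without a differential the predicate under \<open>SOME\<close> is identically false, so
  the choice is the same for every map and every point.\<close>

lemma Df_norm_sq_junk:
  fixes f :: "real^'m \<Rightarrow> 'h::real_normed_vector multiset"
  assumes "\<not> approx_differentiable f x"
  shows "(Df_norm f x)\<^sup>2 = junk_energy TYPE('h \<times> ((real^'m) \<Rightarrow>\<^sub>L 'h))"
proof -
  have "has_approx_differential f x = (\<lambda>w. False)" using assms by (auto simp: approx_differentiable_def)
  then show ?thesis by (simp add: Df_norm_sq junk_energy_def some_differential_def)
qed

lemma Df_norm_sq_eq: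
  fixes f :: "real^'m \<Rightarrow> 'h::real_normed_vector multiset"
  assumes "open U" "x \<in> U" "\<And>x. x \<in> U \<Longrightarrow> size (f x) = Q" "has_approx_differential f x w"
  shows "(Df_norm f x)\<^sup>2 = tuple_energy w"
proof -
  have "approx_differentiable f x" using assms by (auto simp: approx_differentiable_def)
  then have "some_differential f x = w"
    using has_approx_differential_unique[OF assms(1-3) some_differential assms(4)] by simp
  then show ?thesis by (simp add: Df_norm_sq)
qed

text \<open>Genuine energy density, as opposed to the constant one left over by \<open>SOME\<close>.
  The two are separated because they respond differently to variations and to multiplication of
  \<open>f\<close> by a constant.\<close>

definition good_energy :: "(real^'m \<Rightarrow> 'h::real_normed_vector multiset) \<Rightarrow> real^'m \<Rightarrow> real"
  where "good_energy f x = (if approx_differentiable f x then tuple_energy (some_differential f x) else 0)"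

definition bad_energy :: "(real^'m \<Rightarrow> 'h::real_normed_vector multiset) \<Rightarrow> real^'m \<Rightarrow> real"
  where "bad_energy f x = (if approx_differentiable f x then 0 else junk_energy TYPE('h \<times> ((real^'m) \<Rightarrow>\<^sub>L 'h)))"

text \<open>Formally half the derivative of \<open>(QQ_norm (f x))\<^sup>2\<close> along
  \<open>v\<close>.\<close>

definition cross_term :: "(real^'m \<Rightarrow> 'h::real_inner multiset) \<Rightarrow> real^'m \<Rightarrow> real^'m \<Rightarrow> real"
  where "cross_term f x v = (if approx_differentiable f x
     then (\<Sum>p\<in>#some_differential f x. blinfun_apply (snd p) v \<bullet> fst p) else 0)"

definition directional_energy :: "(real^'m \<Rightarrow> 'h::real_normed_vector multiset) \<Rightarrow> real^'m \<Rightarrow> real^'m \<Rightarrow> real"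
  where "directional_energy f x v = (if approx_differentiable f x
     then (\<Sum>p\<in>#some_differential f x. (norm (blinfun_apply (snd p) v))\<^sup>2) else 0)"

lemma Df_norm_sq_split: "(Df_norm f x)\<^sup>2 = good_energy f x + bad_energy f x"
  using Df_norm_sq_junk[of f x] by (simp add: good_energy_def bad_energy_def Df_norm_sq)

lemma good_energy_nonneg: "0 \<le> good_energy f x"
  by (simp add: good_energy_def tuple_energy_nonneg)

lemma bad_energy_nonneg: "0 \<le> bad_energy f x"
  by (simp add: bad_energy_def junk_energy_nonneg)

lemma bad_energy_le:
  fixes f :: "real^'m \<Rightarrow> 'h::real_normed_vector multiset"
  shows "bad_energy f x \<le> junk_energy TYPE('h \<times> ((real^'m) \<Rightarrow>\<^sub>L 'h))"
  by (simp add: bad_energy_def junk_energy_nonneg)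

lemma directional_energy_nonneg: "0 \<le> directional_energy f x v"
  by (auto simp: directional_energy_def intro: sum_mset_nonneg')

lemma directional_energy_le: "directional_energy f x v \<le> (norm v)\<^sup>2 * good_energy f x"
proof (cases "approx_differentiable f x")
  case True
  have "(norm (blinfun_apply L v))\<^sup>2 \<le> (norm v)\<^sup>2 * (hs_norm L)\<^sup>2" for L :: "(real^'a) \<Rightarrow>\<^sub>L 'b"
    using power_mono[OF norm_le_hs_norm norm_ge_zero, of L v 2] by (simp add: power_mult_distrib)
  then show ?thesis
    using True by (simp add: directional_energy_def good_energy_def tuple_energy_def sum_mset_distrib_left sum_mset_mono)
qed (simp add: directional_energy_def good_energy_def)

lemma QQ_norm_sq_differential:
  "approx_differentiable f x \<Longrightarrow> (\<Sum>p\<in>#some_differential f x. (norm (fst p))\<^sup>2) = (QQ_norm (f x))\<^sup>2"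
  unfolding QQ_norm_sq has_approx_differentialD(1)[OF some_differential, symmetric]
  by (simp add: image_mset.compositionality o_def)

text \<open>AM-GM for \<open>\<langle>f, Df v\<rangle>\<close>, with a free weight \<open>l\<close> to be optimised later.\<close>

lemma cross_term_le:
  assumes "0 < l"
  shows "2 * \<bar>cross_term f x v\<bar> \<le> l * (QQ_norm (f x))\<^sup>2 + directional_energy f x v / l"
proof (cases "approx_differentiable f x")
  case True
  let ?w = "some_differential f x"
  have *: "2 * \<bar>b \<bullet> y\<bar> \<le> l * (norm y)\<^sup>2 + (norm b)\<^sup>2 / l" for b y :: 'b
  proof -
    have "\<bar>b \<bullet> y\<bar> \<le> norm b * norm y" by (rule Cauchy_Schwarz_ineq2)
    moreover have "0 \<le> (l * norm y - norm b)\<^sup>2 / l" using assms by simp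
    moreover have "(l * norm y - norm b)\<^sup>2 / l = l * (norm y)\<^sup>2 + (norm b)\<^sup>2 / l - 2 * (norm b * norm y)"
      using assms by (simp add: power2_diff field_simps power2_eq_square)
    ultimately show ?thesis by linarith
  qed
  have "\<bar>\<Sum>p\<in>#w. blinfun_apply (snd p) v \<bullet> fst p\<bar> \<le> (\<Sum>p\<in>#w. \<bar>blinfun_apply (snd p) v \<bullet> fst p\<bar>)" for w :: "('b \<times> ((real^'a) \<Rightarrow>\<^sub>L 'b)) multiset"
    by (induction w) auto
  then have "2 * \<bar>cross_term f x v\<bar> \<le> (\<Sum>p\<in>#?w. 2 * \<bar>blinfun_apply (snd p) v \<bullet> fst p\<bar>)"
    using True by (simp add: cross_term_def sum_mset_distrib_left[symmetric])
  also have "\<dots> \<le> (\<Sum>p\<in>#?w. l * (norm (fst p))\<^sup>2 + (norm (blinfun_apply (snd p) v))\<^sup>2 / l)"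
    by (rule sum_mset_mono) (rule *)
  also have "\<dots> = l * (\<Sum>p\<in>#?w. (norm (fst p))\<^sup>2) + (\<Sum>p\<in>#?w. (norm (blinfun_apply (snd p) v))\<^sup>2) / l"
    by (simp add: sum_mset.distrib sum_mset_distrib_left divide_inverse sum_mset_distrib_right)
  finally show ?thesis
    using True by (simp add: QQ_norm_sq_differential directional_energy_def)
qed (use assms in \<open>simp add: cross_term_def directional_energy_def\<close>)

lemma cross_term_scale: "cross_term f x (c *\<^sub>R v) = c * cross_term f x v"
  by (simp add: cross_term_def blinfun.scaleR_right sum_mset_distrib_left)

section \<open>Squash variations\<close>

text \<open>Linear squashing is the case \<open>H = 1\<close>; a growing profile \<open>H\<close>
  serves to detect large values.\<close>

lemma radial_product_has_derivative:
  fixes \<phi> :: "'a::euclidean_space \<Rightarrow> real" and y :: "'h::real_inner"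
  assumes \<phi>: "(\<phi> has_derivative (\<lambda>v. g \<bullet> v)) (at x)"
    and H: "(H has_real_derivative H') (at (y \<bullet> y))"
  shows "((\<lambda>(x, y). (\<phi> x * H (y \<bullet> y)) *\<^sub>R y) has_derivative
    (\<lambda>(v, k). (\<phi> x * H (y \<bullet> y)) *\<^sub>R k + (\<phi> x * H' * (2 * (y \<bullet> k)) + H (y \<bullet> y) * (g \<bullet> v)) *\<^sub>R y)) (at (x, y))"
proof -
  have 1: "((\<lambda>p. \<phi> (fst p)) has_derivative (\<lambda>p. g \<bullet> fst p)) (at (x, y))"
    using has_derivative_compose[OF has_derivative_fst[OF has_derivative_ident], of \<phi> _ "(x, y)"] \<phi> by simp
  have "((\<lambda>p::'a \<times> 'h. snd p \<bullet> snd p) has_derivative (\<lambda>p. 2 * (y \<bullet> snd p))) (at (x, y))"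
    by (auto intro!: derivative_eq_intros simp: inner_commute)
  moreover have "(H has_real_derivative H') (at (snd (x, y) \<bullet> snd (x, y)))" using H by simp
  ultimately have 2: "((\<lambda>p. H (snd p \<bullet> snd p)) has_derivative (\<lambda>p. (2 * (y \<bullet> snd p)) * H')) (at (x, y))"
    by (intro DERIV_compose_FDERIV) auto
  have "((\<lambda>p. (\<phi> (fst p) * H (snd p \<bullet> snd p)) *\<^sub>R snd p) has_derivative
    (\<lambda>p. (\<phi> x * H (y \<bullet> y)) *\<^sub>R snd p + (\<phi> x * ((2 * (y \<bullet> snd p)) * H') + (g \<bullet> fst p) * H (y \<bullet> y)) *\<^sub>R y)) (at (x, y))"
    using has_derivative_scaleR[OF has_derivative_mult[OF 1 2] has_derivative_snd[OF has_derivative_ident]] by simp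
  then show ?thesis
    by (simp add: case_prod_unfold mult_ac)
qed

text \<open>The derivative is assembled from operator-valued constructors, so that its continuity
  holds in operator norm, as \<open>C1_map_on\<close> demands.\<close>

lemma radial_product_C1:
  fixes \<phi> :: "'a::euclidean_space \<Rightarrow> real"
  assumes \<phi>: "\<And>x. (\<phi> has_derivative (\<lambda>v. g x \<bullet> v)) (at x)" "continuous_on UNIV g"
    and H: "\<And>s. (H has_real_derivative H' s) (at s)" "continuous_on UNIV H'"
  shows "C1_map_on S (\<lambda>(x, y::'h::real_inner). (\<phi> x * H (y \<bullet> y)) *\<^sub>R y)"
proof -
  define Y' where "Y' p = (\<phi> (fst p) * H (snd p \<bullet> snd p)) *\<^sub>R snd_blinfun
    + (blinfun_scaleR_left (snd p) o\<^sub>L ((2 * \<phi> (fst p) * H' (snd p \<bullet> snd p)) *\<^sub>R (blinfun_inner_right (snd p) o\<^sub>L snd_blinfun)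
        + H (snd p \<bullet> snd p) *\<^sub>R (blinfun_inner_right (g (fst p)) o\<^sub>L fst_blinfun)))" for p :: "'a \<times> 'h"
  have ap: "blinfun_apply (Y' p) = (\<lambda>(v, k). (\<phi> (fst p) * H (snd p \<bullet> snd p)) *\<^sub>R k
     + (\<phi> (fst p) * H' (snd p \<bullet> snd p) * (2 * (snd p \<bullet> k)) + H (snd p \<bullet> snd p) * (g (fst p) \<bullet> v)) *\<^sub>R snd p)" for p
    by (auto simp: Y'_def blinfun.bilinear_simps fun_eq_iff mult_ac)
  have c\<phi>: "continuous_on UNIV \<phi>"
    using \<phi>(1) by (auto intro!: continuous_at_imp_continuous_on has_derivative_continuous)
  have cH: "continuous_on UNIV H"
    using H(1) by (auto intro!: continuous_at_imp_continuous_on DERIV_isCont)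
  have 1: "continuous_on UNIV (\<lambda>p::'a \<times> 'h. \<phi> (fst p))" "continuous_on UNIV (\<lambda>p::'a \<times> 'h. g (fst p))"
    using continuous_on_compose2[OF c\<phi> continuous_on_fst[OF continuous_on_id]] continuous_on_compose2[OF \<phi>(2) continuous_on_fst[OF continuous_on_id]] by auto
  have 2: "continuous_on UNIV (\<lambda>p::'a \<times> 'h. H (snd p \<bullet> snd p))" "continuous_on UNIV (\<lambda>p::'a \<times> 'h. H' (snd p \<bullet> snd p))"
    by (rule continuous_on_compose2[OF cH] continuous_on_compose2[OF H(2)]; auto intro!: continuous_intros)+
  have "continuous_on UNIV Y'"
    unfolding Y'_def
    by (intro continuous_intros 1 2 bounded_bilinear.continuous_on[OF bounded_bilinear_blinfun_compose]
      bounded_linear.continuous_on[OF bounded_linear_blinfun_scaleR_left] bounded_linear.continuous_on[OF bounded_linear_blinfun_inner_right])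
  then have "continuous_on S Y'" by (rule continuous_on_subset) simp
  moreover have "((\<lambda>(x, y::'h). (\<phi> x * H (y \<bullet> y)) *\<^sub>R y) has_derivative blinfun_apply (Y' p)) (at p)" for p
    using radial_product_has_derivative[OF \<phi>(1) H(1), of "fst p" "snd p"] by (simp add: ap)
  ultimately show ?thesis unfolding C1_map_on_def by blast
qed

lemma space_QQ_borel: "space (QQ_borel Q) = QQ Q"
  unfolding QQ_borel_def
  by (rule space_measure_of) (auto simp: Metric_space.openin_mtopology[OF Metric_space_QQ])

lemma set_integrable_lebesgue_on:
  fixes f :: "'a::euclidean_space \<Rightarrow> real"
  assumes "U \<in> sets lebesgue"
  shows "set_integrable lebesgue U f \<longleftrightarrow> integrable (lebesgue_on U) f"
    "(LINT x:U|lebesgue. f x) = (LINT x|lebesgue_on U. f x)"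
  using assms by (simp_all add: set_integrable_def set_lebesgue_integral_def integrable_restrict_space integral_restrict_space)

locale stationary_map =
  fixes U :: "(real^'m) set" and Q :: nat and f :: "real^'m \<Rightarrow> 'h::{real_inner, banach, second_countable_topology} multiset"
  assumes open_U: "open U" and ball_U: "ball 0 3 \<subseteq> U" and f_W12: "f \<in> W12 U Q"
    and squeeze: "squeeze_stationary U f" and squash: "squash_stationary U f"
begin

lemma U_lebesgue: "U \<in> sets lebesgue"
  using open_U by simp

lemma size_f: "x \<in> U \<Longrightarrow> size (f x) = Q"
proof -
  assume "x \<in> U"
  have "f \<in> lebesgue_on U \<rightarrow>\<^sub>M QQ_borel Q" using f_W12 by (simp add: W12_def)
  from measurable_space[OF this, of x] \<open>x \<in> U\<close> show ?thesis
    by (simp add: space_QQ_borel QQ_def space_restrict_space)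
qed

lemma integrable_QQ_norm: "integrable (lebesgue_on U) (\<lambda>x. (QQ_norm (f x))\<^sup>2)"
  using f_W12 by (simp add: W12_def set_integrable_lebesgue_on[OF U_lebesgue])

text \<open>The zero field gives a constant family, for which criticality still includes finiteness
  of the energy.\<close>

lemma integrable_Df_norm: "integrable (lebesgue_on U) (\<lambda>x. (Df_norm f x)\<^sup>2)"
proof -
  have Ck0: "Ck k (\<lambda>x::real^'m. 0::real^'m)" for k
    by (induction k) (auto simp: frechet_derivative_const)
  then have "(\<lambda>x. 0::real^'m) \<in> Cc_infinity U" by (simp add: Cc_infinity_def compactly_inside_def)
  then have "energy_critical U (\<lambda>t x. f (x + t *\<^sub>R 0))"
    by (rule bspec[OF squeeze[unfolded squeeze_stationary_def]])
  then have "\<forall>\<^sub>F t::real in nhds 0. set_integrable lebesgue U (\<lambda>x. (Df_norm f x)\<^sup>2)"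
    by (simp add: energy_critical_def)
  then have "set_integrable lebesgue U (\<lambda>x. (Df_norm f x)\<^sup>2)" by (rule eventually_nhds_x_imp_x)
  then show ?thesis by (simp add: set_integrable_lebesgue_on[OF U_lebesgue])
qed

lemma scaled_has_approx_differential:
  fixes h :: "real^'m \<Rightarrow> 'h multiset"
  assumes h: "\<And>x. x \<in> U \<Longrightarrow> size (h x) = Q" and x: "x \<in> U" and w: "has_approx_differential h x w"
    and \<beta>: "(\<beta> has_derivative (\<lambda>v. g \<bullet> v)) (at x)" "\<beta> x \<noteq> 0"
  shows "has_approx_differential (\<lambda>x. image_mset (\<lambda>y. \<beta> x *\<^sub>R y) (h x)) x
    (image_mset (\<lambda>p. (\<beta> x *\<^sub>R fst p, Blinfun (\<lambda>v. \<beta> x *\<^sub>R blinfun_apply (snd p) v + (g \<bullet> v) *\<^sub>R fst p))) w)"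
proof -
  have D: "((\<lambda>(x, y). \<beta> x *\<^sub>R y) has_derivative (\<lambda>(v, k). \<beta> x *\<^sub>R k + (g \<bullet> v) *\<^sub>R y)) (at (x, y))" for y :: 'h
    using radial_product_has_derivative[OF \<beta>(1), of "\<lambda>_. 1" 0] by simp
  show ?thesis
    using has_approx_differential_squash[OF open_U x h w D] \<beta>(2) by (simp add: inj_on_def)
qed

lemma Blinfun_rank_one:
  fixes L :: "(real^'m) \<Rightarrow>\<^sub>L 'h"
  shows "blinfun_apply (Blinfun (\<lambda>v. c *\<^sub>R blinfun_apply L v + (g \<bullet> v) *\<^sub>R y)) v = c *\<^sub>R blinfun_apply L v + (g \<bullet> v) *\<^sub>R y"
  by (subst bounded_linear_Blinfun_apply) (auto intro!: bounded_linear_intros)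

text \<open>At a point of differentiability every branch undergoes a rank-one perturbation.
  Elsewhere, dividing by the nonvanishing scalar shows that the scaled map is not differentiable
  either, so \<open>bad_energy\<close> does not depend on \<open>t\<close>.\<close>

lemma scaled_energy:
  assumes x: "x \<in> U" and \<phi>: "\<And>x. (\<phi> has_derivative (\<lambda>v. g x \<bullet> v)) (at x)" and pos: "\<And>x. 0 < 1 + t * \<phi> x"
  shows "(Df_norm (\<lambda>x. image_mset (\<lambda>y. (1 + t * \<phi> x) *\<^sub>R y) (f x)) x)\<^sup>2
    = (1 + t * \<phi> x)\<^sup>2 * good_energy f x + 2 * t * (1 + t * \<phi> x) * cross_term f x (g x)
      + t\<^sup>2 * (norm (g x))\<^sup>2 * (if approx_differentiable f x then (QQ_norm (f x))\<^sup>2 else 0) + bad_energy f x"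
    (is "(Df_norm ?h x)\<^sup>2 = _")
proof -
  have sz: "size (?h x) = Q" if "x \<in> U" for x using size_f[OF that] by simp
  have D: "((\<lambda>x. 1 + t * \<phi> x) has_derivative (\<lambda>v. (t *\<^sub>R g x) \<bullet> v)) (at x)"
    by (auto intro!: derivative_eq_intros \<phi>)
  show ?thesis
  proof (cases "approx_differentiable f x")
    case True
    let ?w = "some_differential f x"
    let ?w' = "image_mset (\<lambda>p. ((1 + t * \<phi> x) *\<^sub>R fst p,
      Blinfun (\<lambda>v. (1 + t * \<phi> x) *\<^sub>R blinfun_apply (snd p) v + ((t *\<^sub>R g x) \<bullet> v) *\<^sub>R fst p))) ?w"
    have nz: "1 + t * \<phi> x \<noteq> 0" using pos[of x] by simp
    have "has_approx_differential ?h x ?w'"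
      by (rule scaled_has_approx_differential[OF size_f x some_differential[OF True] D nz])
    then have "(Df_norm ?h x)\<^sup>2 = tuple_energy ?w'"
      by (intro Df_norm_sq_eq[where f="?h", OF open_U x]) (auto simp: size_f)
    also have "\<dots> = (\<Sum>p\<in>#?w. (1 + t * \<phi> x)\<^sup>2 * (hs_norm (snd p))\<^sup>2
        + 2 * t * (1 + t * \<phi> x) * (blinfun_apply (snd p) (g x) \<bullet> fst p) + t\<^sup>2 * (norm (g x))\<^sup>2 * (norm (fst p))\<^sup>2)"
      unfolding tuple_energy_def image_mset.compositionality o_def snd_conv
      by (intro arg_cong[of _ _ sum_mset] image_mset_cong)
        (subst hs_norm_rank_one[OF Blinfun_rank_one], simp add: blinfun.scaleR_right power_mult_distrib)
    also have "\<dots> = (1 + t * \<phi> x)\<^sup>2 * tuple_energy ?w + 2 * t * (1 + t * \<phi> x) * cross_term f x (g x)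
      + t\<^sup>2 * (norm (g x))\<^sup>2 * (QQ_norm (f x))\<^sup>2"
      unfolding QQ_norm_sq_differential[OF True, symmetric] using True
      by (simp only: sum_mset.distrib sum_mset_distrib_left tuple_energy_def cross_term_def if_True)
    finally show ?thesis using True by (simp add: good_energy_def bad_energy_def)
  next
    case False
    have "\<not> approx_differentiable ?h x"
    proof
      assume "approx_differentiable ?h x"
      then obtain w where w: "has_approx_differential ?h x w" by (auto simp: approx_differentiable_def)
      have D': "((\<lambda>x. inverse (1 + t * \<phi> x)) has_derivative (\<lambda>v. (- ((inverse (1 + t * \<phi> x))\<^sup>2 * t) *\<^sub>R g x) \<bullet> v)) (at x)"
        using Deriv.has_derivative_inverse[OF _ D] pos[of x] by (simp add: power2_eq_square mult_ac)
      have nz: "inverse (1 + t * \<phi> x) \<noteq> 0" using pos[of x] by simp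
      have "image_mset (\<lambda>y. inverse (1 + t * \<phi> x) *\<^sub>R y) (?h x) = f x" for x
        using pos[of x] by (simp add: image_mset.compositionality o_def)
      then show False
        using scaled_has_approx_differential[OF sz x w D' nz] False by (auto simp: approx_differentiable_def)
    qed
    then show ?thesis
      using False by (simp add: Df_norm_sq_junk good_energy_def bad_energy_def cross_term_def)
  qed
qed

text \<open>By \<open>scaled_energy\<close> the squashed density is, at every point, a quadratic
  polynomial in \<open>t\<close>; the first variation integrates its linear coefficient.\<close>

lemma squash_identity:
  assumes \<phi>: "\<And>x. (\<phi> has_derivative (\<lambda>v. g x \<bullet> v)) (at x)" "continuous_on UNIV g"
    and supp: "compactly_inside {x. \<phi> x \<noteq> 0} U"
    and C: "\<And>x. \<bar>\<phi> x\<bar> \<le> C" "\<And>x. norm (g x) \<le> C"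
  shows "integrable (lebesgue_on U) (\<lambda>x. 2 * \<phi> x * good_energy f x + 2 * cross_term f x (g x))"
    "(LINT x|lebesgue_on U. 2 * \<phi> x * good_energy f x + 2 * cross_term f x (g x)) = 0"
proof -
  define P where "P t x = (1 + t * \<phi> x)\<^sup>2 * good_energy f x + 2 * t * (1 + t * \<phi> x) * cross_term f x (g x)
      + t\<^sup>2 * (norm (g x))\<^sup>2 * (if approx_differentiable f x then (QQ_norm (f x))\<^sup>2 else 0) + bad_energy f x" for t x
  have C0: "0 \<le> C" using C(1) abs_ge_zero order_trans by blast
  let ?Y = "\<lambda>(x, y::'h). (\<phi> x * 1) *\<^sub>R y"
  let ?h = "\<lambda>t x. {# y + t *\<^sub>R ?Y (x, y). y \<in># f x #}"
  have "C1_map_on (U \<times> UNIV) ?Y"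
    by (rule radial_product_C1[OF \<phi>, of "\<lambda>_. 1" "\<lambda>_. 0"]) auto
  moreover have "compactly_inside {x\<in>U. \<exists>y. ?Y (x, y) \<noteq> 0} U"
  proof -
    have sub: "{x\<in>U. \<exists>y. ?Y (x, y) \<noteq> 0} \<subseteq> {x. \<phi> x \<noteq> 0}" by auto
    have "bounded {x. \<phi> x \<noteq> 0}" "closure {x. \<phi> x \<noteq> 0} \<subseteq> U" using supp by (simp_all add: compactly_inside_def)
    then show ?thesis
      unfolding compactly_inside_def compact_closure using bounded_subset[OF _ sub] closure_mono[OF sub] by blast
  qed
  ultimately have crit: "energy_critical U ?h" using squash unfolding squash_stationary_def by blast
  have heq: "?h t = (\<lambda>x. image_mset (\<lambda>y. (1 + t * \<phi> x) *\<^sub>R y) (f x))" for t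
    by (simp add: scaleR_add_left)
  have small: "\<forall>\<^sub>F t in nhds 0. \<bar>t\<bar> * (C + 1) < 1"
  proof -
    have "((\<lambda>t::real. \<bar>t\<bar> * (C + 1)) \<longlongrightarrow> \<bar>0\<bar> * (C + 1)) (nhds 0)" by (intro tendsto_intros filterlim_ident)
    then show ?thesis by (rule order_tendstoD) simp
  qed
  have ev: "\<forall>\<^sub>F t in nhds 0. \<forall>x\<in>U. (Df_norm (?h t) x)\<^sup>2 = P t x"
    using small
  proof eventually_elim
    case (elim t)
    have "0 < 1 + t * \<phi> x" for x
    proof -
      have "\<bar>t * \<phi> x\<bar> \<le> \<bar>t\<bar> * (C + 1)" unfolding abs_mult using C(1)[of x] by (intro mult_left_mono) auto
      then show ?thesis using elim by linarith
    qed
    then show ?case unfolding heq P_def using scaled_energy[OF _ \<phi>(1)] by blast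
  qed
  have int: "\<forall>\<^sub>F t in nhds 0. integrable (lebesgue_on U) (P t)"
  proof -
    have "\<forall>\<^sub>F t in nhds 0. integrable (lebesgue_on U) (\<lambda>x. (Df_norm (?h t) x)\<^sup>2)"
      using crit unfolding energy_critical_def set_integrable_lebesgue_on[OF U_lebesgue] by (rule conjunct1)
    then show ?thesis
      using ev
    proof eventually_elim
      case (elim t)
      then show ?case
        by (subst Bochner_Integration.integrable_cong[OF refl, of _ _ "\<lambda>x. (Df_norm (?h t) x)\<^sup>2"])
          (simp_all add: space_restrict_space)
    qed
  qed
  \<comment> \<open>A generous Lipschitz majorant at \<open>t = 0\<close>, valid while
    \<open>\<bar>t\<bar> * (C + 1) < 1\<close>. The cross term is bounded by
    \<open>cross_term_le\<close> with weight \<open>1\<close>.\<close>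
  define W where "W x = (4 * C + 2 * C\<^sup>2 + 3) * ((Df_norm f x)\<^sup>2 + (QQ_norm (f x))\<^sup>2 * (1 + C\<^sup>2) + C\<^sup>2 * (Df_norm f x)\<^sup>2)" for x
  have Wi: "integrable (lebesgue_on U) W"
    unfolding W_def using integrable_Df_norm integrable_QQ_norm by simp
  have dom: "\<forall>\<^sub>F t in at 0. \<forall>x\<in>space (lebesgue_on U). \<bar>P t x - P 0 x\<bar> \<le> \<bar>t - 0\<bar> * W x"
  proof (rule filter_leD[OF at_within_le_nhds], use small in eventually_elim, rule ballI)
    fix t :: real and x assume t: "\<bar>t\<bar> * (C + 1) < 1"
    define e where "e = good_energy f x"
    define q where "q = (QQ_norm (f x))\<^sup>2"
    define c where "c = cross_term f x (g x)"
    have e: "0 \<le> e" "e \<le> (Df_norm f x)\<^sup>2"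
      using good_energy_nonneg[of f x] bad_energy_nonneg[of f x] Df_norm_sq_split[of f x] by (auto simp: e_def)
    have q: "0 \<le> q" by (simp add: q_def)
    have t1: "\<bar>t\<bar> \<le> 1" "\<bar>t\<bar> * C \<le> 1"
    proof -
      have "0 \<le> \<bar>t\<bar> * C" using C0 by simp
      moreover have "\<bar>t\<bar> * C + \<bar>t\<bar> < 1" using t by (simp add: distrib_left)
      ultimately show "\<bar>t\<bar> \<le> 1" "\<bar>t\<bar> * C \<le> 1" by linarith+
    qed
    have g2: "(norm (g x))\<^sup>2 \<le> C\<^sup>2" using C(2)[of x] by (intro power_mono) auto
    have "2 * \<bar>c\<bar> \<le> 1 * q + directional_energy f x (g x) / 1"
      unfolding c_def q_def by (rule cross_term_le) simp
    also have "directional_energy f x (g x) / 1 \<le> C\<^sup>2 * e"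
      using directional_energy_le[of f x "g x"] mult_right_mono[OF g2 e(1)] by (simp add: e_def)
    finally have c: "2 * \<bar>c\<bar> \<le> q + C\<^sup>2 * e" by simp
    have "P t x - P 0 x = t * ((2 * \<phi> x + t * (\<phi> x)\<^sup>2) * e) + t * ((1 + t * \<phi> x) * (2 * c))
       + t * (t * ((norm (g x))\<^sup>2 * (if approx_differentiable f x then q else 0)))"
      by (simp add: P_def e_def c_def q_def power2_eq_square algebra_simps)
    also have "\<bar>\<dots>\<bar> \<le> \<bar>t\<bar> * (\<bar>2 * \<phi> x + t * (\<phi> x)\<^sup>2\<bar> * e) + \<bar>t\<bar> * (\<bar>1 + t * \<phi> x\<bar> * (2 * \<bar>c\<bar>))
       + \<bar>t\<bar> * (\<bar>t\<bar> * ((norm (g x))\<^sup>2 * (if approx_differentiable f x then q else 0)))"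
      using e q by (intro order_trans[OF abs_triangle_ineq] add_mono) (auto simp: abs_mult)
    also have "\<dots> \<le> \<bar>t\<bar> * ((2 * C + C\<^sup>2) * e) + \<bar>t\<bar> * (2 * (q + C\<^sup>2 * e)) + \<bar>t\<bar> * (1 * (C\<^sup>2 * q))"
    proof (intro add_mono mult_left_mono mult_mono abs_ge_zero)
      have p2: "(\<phi> x)\<^sup>2 \<le> C\<^sup>2" using C(1)[of x] abs_le_square_iff[of "\<phi> x" C] C0 by simp
      have "\<bar>t * (\<phi> x)\<^sup>2\<bar> \<le> 1 * C\<^sup>2" unfolding abs_mult using t1 p2 by (intro mult_mono) auto
      then show "\<bar>2 * \<phi> x + t * (\<phi> x)\<^sup>2\<bar> \<le> 2 * C + C\<^sup>2" using C(1)[of x] by linarith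
      have "\<bar>t * \<phi> x\<bar> \<le> \<bar>t\<bar> * C" unfolding abs_mult using C(1)[of x] by (intro mult_left_mono) auto
      then show "\<bar>1 + t * \<phi> x\<bar> \<le> 2" using t1 by linarith
    qed (use e q c t1 g2 C0 in auto)
    also have "\<dots> = \<bar>t\<bar> * ((2 * C + 3 * C\<^sup>2) * e + (2 + C\<^sup>2) * q)" by (simp add: algebra_simps)
    also have "\<dots> \<le> \<bar>t\<bar> * W x"
    proof (rule mult_left_mono)
      have k: "1 \<le> 4 * C + 2 * C\<^sup>2 + 3" "0 \<le> 4 * C + 2 * C\<^sup>2 + 3" using C0 by auto
      have "(2 * C + 3 * C\<^sup>2) * e \<le> (4 * C + 2 * C\<^sup>2 + 3) * ((1 + C\<^sup>2) * e)"
      proof -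
        have "2 * C + 3 * C\<^sup>2 \<le> (4 * C + 2 * C\<^sup>2 + 3) * (1 + C\<^sup>2)"
          using C0 by (auto simp: algebra_simps intro!: add_nonneg_nonneg)
        from mult_right_mono[OF this e(1)] show ?thesis by (simp only: mult.assoc)
      qed
      also have "\<dots> \<le> (4 * C + 2 * C\<^sup>2 + 3) * ((1 + C\<^sup>2) * (Df_norm f x)\<^sup>2)"
        using e k by (intro mult_left_mono) auto
      finally have 1: "(2 * C + 3 * C\<^sup>2) * e \<le> (4 * C + 2 * C\<^sup>2 + 3) * ((1 + C\<^sup>2) * (Df_norm f x)\<^sup>2)" .
      have "(2 + C\<^sup>2) * q \<le> (4 * C + 2 * C\<^sup>2 + 3) * ((1 + C\<^sup>2) * q)"
      proof -
        have "2 + C\<^sup>2 \<le> (4 * C + 2 * C\<^sup>2 + 3) * (1 + C\<^sup>2)"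
          using C0 by (auto simp: algebra_simps intro!: add_nonneg_nonneg)
        from mult_right_mono[OF this q] show ?thesis by (simp only: mult.assoc)
      qed
      with 1 show "(2 * C + 3 * C\<^sup>2) * e + (2 + C\<^sup>2) * q \<le> W x"
        unfolding W_def q_def by (simp add: algebra_simps)
    qed simp
    finally show "\<bar>P t x - P 0 x\<bar> \<le> \<bar>t - 0\<bar> * W x" by simp
  qed
  have der: "((\<lambda>t. P t x) has_real_derivative 2 * \<phi> x * good_energy f x + 2 * cross_term f x (g x)) (at 0)" for x
    unfolding P_def by (auto intro!: derivative_eq_intros)
  note * = DERIV_integral[OF int der dom Wi]
  show "integrable (lebesgue_on U) (\<lambda>x. 2 * \<phi> x * good_energy f x + 2 * cross_term f x (g x))" by (rule *)
  have "\<forall>\<^sub>F t in nhds 0. dirichlet U (?h t) = (LINT x|lebesgue_on U. P t x)"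
    using ev by eventually_elim
      (auto simp: dirichlet_def set_integrable_lebesgue_on[OF U_lebesgue] space_restrict_space intro!: Bochner_Integration.integral_cong)
  moreover have "((\<lambda>t. dirichlet U (?h t)) has_real_derivative 0) (at 0)" using crit by (simp add: energy_critical_def)
  ultimately have "((\<lambda>t. LINT x|lebesgue_on U. P t x) has_real_derivative 0) (at 0)"
    by (subst (asm) DERIV_cong_ev[OF refl _ refl])
  from DERIV_unique[OF *(2) this]
  show "(LINT x|lebesgue_on U. 2 * \<phi> x * good_energy f x + 2 * cross_term f x (g x)) = 0" .
qed

end

section \<open>Radial squeezing flow\<close>

text \<open>The Lipschitz bound sends the ball of radius \<open>r\<close> into one of radius
  \<open>2 * r\<close>, and \<open>meas\<close> controls preimages of Borel hulls. Together they
  cost a factor \<open>2 * 2 ^ DIM('a)\<close>.\<close>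

lemma density_zero_vimage:
  fixes \<Phi> :: "'a::euclidean_space \<Rightarrow> 'a"
  assumes E: "density_zero E (\<Phi> a)"
    and lip: "\<And>x. norm (\<Phi> x - \<Phi> a) \<le> 2 * norm (x - a)"
    and meas: "\<And>T. T \<in> sets borel \<Longrightarrow> emeasure lborel T < \<infinity> \<Longrightarrow>
      \<Phi> -` T \<in> sets borel \<and> emeasure lborel (\<Phi> -` T) \<le> 2 * emeasure lborel T"
  shows "density_zero (\<Phi> -` E) a"
  unfolding density_zero_iff
proof (intro allI impI)
  fix \<theta> :: real assume \<theta>: "0 < \<theta>"
  define \<theta>' where "\<theta>' = \<theta> / (2 * 2 ^ DIM('a))"
  have \<theta>': "0 < \<theta>'" using \<theta> by (simp add: \<theta>'_def)
  then obtain \<delta> where \<delta>: "0 < \<delta>" "\<And>r. 0 < r \<Longrightarrow> r < \<delta> \<Longrightarrow>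
    outer_measure_of lebesgue (E \<inter> ball (\<Phi> a) r) \<le> ennreal \<theta>' * emeasure lebesgue (ball (\<Phi> a) r)"
    using E unfolding density_zero_iff by metis
  show "\<exists>\<delta>>0. \<forall>r. 0 < r \<and> r < \<delta> \<longrightarrow> outer_measure_of lebesgue (\<Phi> -` E \<inter> ball a r) \<le> ennreal \<theta> * emeasure lebesgue (ball a r)"
  proof (intro exI[of _ "\<delta> / 2"] conjI allI impI)
    fix r assume r: "0 < r \<and> r < \<delta> / 2"
    let ?B = "E \<inter> ball (\<Phi> a) (2 * r)"
    \<comment> \<open>The set \<open>E\<close> need not be measurable, so it is replaced by a Borel
      superset of the same outer measure.\<close>
    obtain T0 where T0: "T0 \<in> sets lebesgue" "?B \<subseteq> T0" "outer_measure_of lebesgue ?B = emeasure lebesgue T0"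
      using outer_measure_of_attain[of ?B lebesgue] by auto
    obtain T where T: "T0 \<subseteq> T" "T \<in> sets lborel" "emeasure lebesgue T0 = emeasure lborel T"
      using completion_upper[OF T0(1)] by metis
    have oT: "emeasure lborel T \<le> ennreal \<theta>' * emeasure lebesgue (ball (\<Phi> a) (2 * r))"
      using \<delta>(2)[of "2 * r"] r T0(3) T(3) by simp
    have fin: "emeasure lborel T < \<infinity>"
      using oT r by (auto simp: emeasure_ball ennreal_mult_less_top intro: le_less_trans)
    have "outer_measure_of lebesgue (\<Phi> -` E \<inter> ball a r) \<le> outer_measure_of lebesgue (\<Phi> -` T)"
    proof (rule outer_measure_of_mono, rule subsetI)
      fix x assume x: "x \<in> \<Phi> -` E \<inter> ball a r"
      then have "norm (\<Phi> x - \<Phi> a) < 2 * r" using lip[of x] by (simp add: dist_norm norm_minus_commute)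
      with x have "\<Phi> x \<in> ?B" by (simp add: dist_norm norm_minus_commute)
      then show "x \<in> \<Phi> -` T" using T0(2) T(1) by auto
    qed
    also have "\<dots> = emeasure lborel (\<Phi> -` T)"
      using meas[of T] T(2) fin by simp
    also have "\<dots> \<le> 2 * emeasure lborel T" using meas[of T] T(2) fin by simp
    also have "\<dots> \<le> 2 * (ennreal \<theta>' * emeasure lebesgue (ball (\<Phi> a) (2 * r)))"
      by (rule mult_left_mono[OF oT]) simp
    also have "\<dots> = ennreal 2 * (ennreal \<theta>' * ennreal (unit_ball_vol DIM('a) * (2 * r) ^ DIM('a)))"
      using r by (subst emeasure_lebesgue_ball) auto
    also have "\<dots> = ennreal (2 * (\<theta>' * (unit_ball_vol DIM('a) * (2 * r) ^ DIM('a))))"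
      using r \<theta>' by (simp add: ennreal_mult)
    also have "2 * (\<theta>' * (unit_ball_vol DIM('a) * (2 * r) ^ DIM('a))) = \<theta> * (unit_ball_vol DIM('a) * r ^ DIM('a))"
      by (simp add: \<theta>'_def power_mult_distrib)
    also have "ennreal \<dots> = ennreal \<theta> * emeasure lebesgue (ball a r)"
      using r \<theta> by (subst emeasure_lebesgue_ball) (auto simp: ennreal_mult)
    finally show "outer_measure_of lebesgue (\<Phi> -` E \<inter> ball a r) \<le> ennreal \<theta> * emeasure lebesgue (ball a r)" .
  qed (use \<delta> in simp)
qed

text \<open>The scalar for which \<open>bump_slope a r x *\<^sub>R (x - a)\<close> is the gradient
  of \<open>radial_bump a r\<close> at \<open>x\<close>. It is nonpositive, so its negative serves
  as a weight.\<close>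

definition bump_slope :: "'a::euclidean_space \<Rightarrow> real \<Rightarrow> 'a \<Rightarrow> real"
  where "bump_slope a r x = - 2 / r\<^sup>2 * bump 2 (1 - (norm (x - a))\<^sup>2 / r\<^sup>2)"

lemma radial_bump_has_derivative:
  "(radial_bump a r has_derivative (\<lambda>v. (bump_slope a r x *\<^sub>R (x - a)) \<bullet> v)) (at x)"
proof -
  have "radial_bump a r = (\<lambda>x. bump 0 (1 - (norm (x - a))\<^sup>2 / r\<^sup>2))" by (simp add: fun_eq_iff radial_bump_def)
  then show ?thesis
    using bump_radial_has_derivative[of 0 a r x] by (simp add: bump_slope_def mult_ac numeral_2_eq_2)
qed

lemma continuous_radial_bump: "continuous_on A (radial_bump a r)"
  using radial_bump_has_derivative has_derivative_continuous
  by (intro continuous_at_imp_continuous_on) blast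

lemma continuous_bump_slope: "continuous_on A (bump_slope a r)"
proof -
  have "continuous_on A (\<lambda>x. bump 2 (1 - (norm (x - a))\<^sup>2 * inverse (r\<^sup>2)))"
    by (rule continuous_on_compose2[OF continuous_bump[of UNIV]]) (auto intro!: continuous_intros)
  then show ?thesis unfolding bump_slope_def divide_inverse by (intro continuous_intros)
qed

lemma radial_bump_bounds: "0 \<le> radial_bump a r x" "radial_bump a r x \<le> 1"
  using bump_nonneg bump_le[of 0] by (auto simp: radial_bump_def)

lemma radial_bump_outside: "0 < r \<Longrightarrow> x \<notin> ball a r \<Longrightarrow> radial_bump a r x = 0"
  by (simp add: radial_bump_def radial_bump_eq_0)

lemma bump_slope_outside: "0 < r \<Longrightarrow> x \<notin> ball a r \<Longrightarrow> bump_slope a r x = 0"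
  by (simp add: bump_slope_def radial_bump_eq_0)

lemma bump_slope_nonpos: "bump_slope a r x \<le> 0"
  by (simp add: bump_slope_def bump_nonneg)

lemma bump_slope_bound: "\<bar>bump_slope a r x\<bar> \<le> 4 / r\<^sup>2"
proof -
  have "2 / r\<^sup>2 * bump 2 (1 - (norm (x - a))\<^sup>2 / r\<^sup>2) \<le> 2 / r\<^sup>2 * 2"
    using bump_le[of 2] by (intro mult_left_mono) auto
  then show ?thesis using bump_nonneg by (simp add: bump_slope_def abs_mult)
qed

lemma bump_slope_norm_sq:
  assumes "0 < r"
  shows "\<bar>bump_slope a r x\<bar> * (norm (x - a))\<^sup>2 \<le> 4"
proof (cases "x \<in> ball a r")
  case True
  then have "(norm (x - a))\<^sup>2 \<le> r\<^sup>2" by (intro power_mono) (auto simp: dist_norm norm_minus_commute)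
  then have "\<bar>bump_slope a r x\<bar> * (norm (x - a))\<^sup>2 \<le> 4 / r\<^sup>2 * r\<^sup>2"
    using bump_slope_bound by (intro mult_mono) auto
  then show ?thesis using assms by simp
qed (use assms in \<open>simp add: bump_slope_outside\<close>)

lemma bump_slope_norm:
  assumes "0 < r"
  shows "norm (bump_slope a r x *\<^sub>R (x - a)) \<le> 4 / r"
proof (cases "x \<in> ball a r")
  case True
  then have "norm (x - a) \<le> r" by (auto simp: dist_norm norm_minus_commute)
  then have "\<bar>bump_slope a r x\<bar> * norm (x - a) \<le> 4 / r\<^sup>2 * r"
    using bump_slope_bound by (intro mult_mono) auto
  then show ?thesis using assms by (simp add: power2_eq_square)
qed (use assms in \<open>simp add: bump_slope_outside\<close>)

definition squeeze_flow :: "'a::euclidean_space \<Rightarrow> real \<Rightarrow> real \<Rightarrow> 'a \<Rightarrow> 'a"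
  where "squeeze_flow a r t x = x + t *\<^sub>R (radial_bump a r x *\<^sub>R (x - a))"

lemma radial_field_has_derivative:
  "((\<lambda>x. radial_bump a r x *\<^sub>R (x - a)) has_derivative
    (\<lambda>v. radial_bump a r x *\<^sub>R v + (bump_slope a r x * ((x - a) \<bullet> v)) *\<^sub>R (x - a))) (at x)"
  by (auto intro!: derivative_eq_intros radial_bump_has_derivative)

lemma squeeze_flow_has_derivative:
  "(squeeze_flow a r t has_derivative
    (\<lambda>v. (1 + t * radial_bump a r x) *\<^sub>R v + ((t * bump_slope a r x) * ((x - a) \<bullet> v)) *\<^sub>R (x - a))) (at x)"
proof -
  have "squeeze_flow a r t = (\<lambda>x. x + t *\<^sub>R (radial_bump a r x *\<^sub>R (x - a)))" by (simp add: fun_eq_iff squeeze_flow_def)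
  moreover have "((\<lambda>x. x + t *\<^sub>R (radial_bump a r x *\<^sub>R (x - a))) has_derivative
    (\<lambda>v. v + t *\<^sub>R (radial_bump a r x *\<^sub>R v + (bump_slope a r x * ((x - a) \<bullet> v)) *\<^sub>R (x - a)))) (at x)"
    by (intro has_derivative_add has_derivative_ident has_derivative_scaleR_right radial_field_has_derivative)
  ultimately show ?thesis by (simp add: algebra_simps)
qed

text \<open>The constant is \<open>1\<close> from the bump plus \<open>4\<close> from its slope; by
  \<open>bump_slope_norm_sq\<close> it does not depend on \<open>r\<close>.\<close>

lemma radial_field_lipschitz:
  assumes "0 < r"
  shows "norm (radial_bump a r x *\<^sub>R (x - a) - radial_bump a r y *\<^sub>R (y - a)) \<le> 5 * norm (x - y)"
proof (rule differentiable_bound[OF convex_UNIV, of "\<lambda>x. radial_bump a r x *\<^sub>R (x - a)"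
    "\<lambda>x v. radial_bump a r x *\<^sub>R v + (bump_slope a r x * ((x - a) \<bullet> v)) *\<^sub>R (x - a)" 5])
  fix x
  show "onorm (\<lambda>v. radial_bump a r x *\<^sub>R v + (bump_slope a r x * ((x - a) \<bullet> v)) *\<^sub>R (x - a)) \<le> 5"
  proof (rule onorm_le)
    fix v
    have "\<bar>(x - a) \<bullet> v\<bar> \<le> norm (x - a) * norm v" by (rule Cauchy_Schwarz_ineq2)
    then have "\<bar>bump_slope a r x\<bar> * \<bar>(x - a) \<bullet> v\<bar> * norm (x - a) \<le> \<bar>bump_slope a r x\<bar> * (norm (x - a) * norm v) * norm (x - a)"
      by (intro mult_right_mono mult_left_mono) auto
    also have "\<dots> = \<bar>bump_slope a r x\<bar> * (norm (x - a))\<^sup>2 * norm v" by (simp add: power2_eq_square)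
    also have "\<dots> \<le> 4 * norm v" using bump_slope_norm_sq[OF assms] by (intro mult_right_mono) auto
    finally have "norm ((bump_slope a r x * ((x - a) \<bullet> v)) *\<^sub>R (x - a)) \<le> 4 * norm v" by (simp add: abs_mult)
    moreover have "norm (radial_bump a r x *\<^sub>R v) \<le> 1 * norm v"
      unfolding norm_scaleR using radial_bump_bounds[of a r x] by (intro mult_right_mono) auto
    ultimately show "norm (radial_bump a r x *\<^sub>R v + (bump_slope a r x * ((x - a) \<bullet> v)) *\<^sub>R (x - a)) \<le> 5 * norm v"
      by (intro order_trans[OF norm_triangle_ineq]) linarith
  qed
qed (auto intro: has_derivative_at_withinI radial_field_has_derivative)

section \<open>The radial flow as a small perturbation of the identity\<close>

context
  fixes a :: "'a::euclidean_space" and r t :: real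
  assumes r: "0 < r" and t: "10 * \<bar>t\<bar> \<le> 1"
begin

text \<open>With \<open>10 * \<bar>t\<bar> \<le> 1\<close> the displacement has Lipschitz constant
  at most 1/2, which leaves two-sided bounds for the flow.\<close>

lemma squeeze_flow_lipschitz:
  "norm (x - y) \<le> 2 * norm (squeeze_flow a r t x - squeeze_flow a r t y)"
  "norm (squeeze_flow a r t x - squeeze_flow a r t y) \<le> 2 * norm (x - y)"
proof -
  let ?d = "t *\<^sub>R (radial_bump a r x *\<^sub>R (x - a) - radial_bump a r y *\<^sub>R (y - a))"
  have eq: "squeeze_flow a r t x - squeeze_flow a r t y = (x - y) + ?d"
    by (simp add: squeeze_flow_def algebra_simps)
  have "norm ?d \<le> \<bar>t\<bar> * (5 * norm (x - y))"
    unfolding norm_scaleR using radial_field_lipschitz[OF r] by (intro mult_left_mono) auto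
  also have "\<dots> \<le> 1 / 2 * norm (x - y)"
    using mult_right_mono[of "5 * \<bar>t\<bar>" "1 / 2" "norm (x - y)"] t by simp
  finally have d: "norm ?d \<le> 1 / 2 * norm (x - y)" .
  show "norm (x - y) \<le> 2 * norm (squeeze_flow a r t x - squeeze_flow a r t y)"
    unfolding eq using d norm_diff_ineq[of "x - y" ?d] by linarith
  show "norm (squeeze_flow a r t x - squeeze_flow a r t y) \<le> 2 * norm (x - y)"
    unfolding eq using d norm_triangle_ineq[of "x - y" ?d] norm_ge_zero[of "x - y"] by linarith
qed

lemma inj_squeeze_flow: "inj (squeeze_flow a r t)"
proof (rule injI)
  fix x y assume "squeeze_flow a r t x = squeeze_flow a r t y"
  then show "x = y" using squeeze_flow_lipschitz(1)[of x y] by simp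
qed

lemma surj_squeeze_flow: "surj (squeeze_flow a r t)"
  unfolding surj_def
proof
  fix y
  \<comment> \<open>Solving \<open>squeeze_flow a r t x = y\<close> is a fixed-point problem for a
    contraction with factor 1/2.\<close>
  have "\<exists>!x. y - t *\<^sub>R (radial_bump a r x *\<^sub>R (x - a)) = x"
  proof (rule banach_fix_type[of "1 / 2"])
    show "\<forall>x z. dist (y - t *\<^sub>R (radial_bump a r x *\<^sub>R (x - a))) (y - t *\<^sub>R (radial_bump a r z *\<^sub>R (z - a))) \<le> 1 / 2 * dist x z"
    proof (intro allI)
      fix x z
      have "dist (y - t *\<^sub>R (radial_bump a r x *\<^sub>R (x - a))) (y - t *\<^sub>R (radial_bump a r z *\<^sub>R (z - a)))
        = norm (t *\<^sub>R (radial_bump a r z *\<^sub>R (z - a) - radial_bump a r x *\<^sub>R (x - a)))"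
        unfolding dist_norm by (rule arg_cong[of _ _ norm]) (simp add: algebra_simps)
      also have "\<dots> \<le> \<bar>t\<bar> * (5 * norm (z - x))"
        unfolding norm_scaleR using radial_field_lipschitz[OF r] by (intro mult_left_mono) auto
      also have "\<dots> \<le> 1 / 2 * norm (z - x)"
        using mult_right_mono[of "5 * \<bar>t\<bar>" "1 / 2" "norm (z - x)"] t by simp
      finally show "dist (y - t *\<^sub>R (radial_bump a r x *\<^sub>R (x - a))) (y - t *\<^sub>R (radial_bump a r z *\<^sub>R (z - a))) \<le> 1 / 2 * dist x z"
        by (simp add: dist_norm norm_minus_commute)
    qed
  qed auto
  then obtain x where "y - t *\<^sub>R (radial_bump a r x *\<^sub>R (x - a)) = x" by blast
  then have "y = squeeze_flow a r t x" by (simp add: squeeze_flow_def algebra_simps)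
  then show "\<exists>x. y = squeeze_flow a r t x" ..
qed

lemma squeeze_flow_outside: "x \<notin> ball a r \<Longrightarrow> squeeze_flow a r t x = x"
  by (simp add: squeeze_flow_def radial_bump_outside[OF r])

lemma squeeze_flow_ball: "x \<in> ball a r \<Longrightarrow> squeeze_flow a r t x \<in> ball a r"
  using squeeze_flow_outside[of "squeeze_flow a r t x"] inj_squeeze_flow by (metis injD)

lemma squeeze_flow_image:
  assumes "ball a r \<subseteq> U"
  shows "squeeze_flow a r t ` U = U"
proof
  show "squeeze_flow a r t ` U \<subseteq> U"
    using assms squeeze_flow_ball squeeze_flow_outside by (metis image_subsetI subsetD)
  show "U \<subseteq> squeeze_flow a r t ` U"
  proof
    fix y assume "y \<in> U"
    obtain x where x: "y = squeeze_flow a r t x" using surj_squeeze_flow by (metis surjD)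
    then have "x \<in> U" using \<open>y \<in> U\<close> assms squeeze_flow_outside by (metis subsetD)
    then show "y \<in> squeeze_flow a r t ` U" using x by simp
  qed
qed

lemma inv_squeeze_flow:
  "squeeze_flow a r t (inv (squeeze_flow a r t) y) = y" "inv (squeeze_flow a r t) (squeeze_flow a r t x) = x"
  by (simp_all add: surj_f_inv_f[OF surj_squeeze_flow] inv_f_f[OF inj_squeeze_flow])

lemma continuous_squeeze_flow: "continuous_on A (squeeze_flow a r t)"
  by (rule continuous_at_imp_continuous_on) (use has_derivative_continuous[OF squeeze_flow_has_derivative] in blast)

lemma inv_squeeze_flow_lipschitz:
  "norm (inv (squeeze_flow a r t) x - inv (squeeze_flow a r t) y) \<le> 2 * norm (x - y)"
  using squeeze_flow_lipschitz(1)[of "inv (squeeze_flow a r t) x" "inv (squeeze_flow a r t) y"]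
  by (simp add: inv_squeeze_flow)

lemma continuous_inv_squeeze_flow: "continuous_on A (inv (squeeze_flow a r t))"
  unfolding continuous_on_iff
proof (intro ballI allI impI)
  fix x and e :: real assume "0 < e"
  show "\<exists>d>0. \<forall>x'\<in>A. dist x' x < d \<longrightarrow> dist (inv (squeeze_flow a r t) x') (inv (squeeze_flow a r t) x) < e"
  proof (intro exI[of _ "e / 2"] conjI ballI impI)
    fix x' assume "dist x' x < e / 2"
    then show "dist (inv (squeeze_flow a r t) x') (inv (squeeze_flow a r t) x) < e"
      using inv_squeeze_flow_lipschitz[of x' x] by (simp add: dist_norm)
  qed (use \<open>0 < e\<close> in simp)
qed

lemma inv_squeeze_flow_close: "norm (inv (squeeze_flow a r t) y - y) \<le> \<bar>t\<bar> * r"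
proof -
  define z where "z = inv (squeeze_flow a r t) y"
  have "y = z + t *\<^sub>R (radial_bump a r z *\<^sub>R (z - a))"
    using inv_squeeze_flow(1)[of y] by (simp add: z_def squeeze_flow_def)
  then have "norm (z - y) = \<bar>t\<bar> * (\<bar>radial_bump a r z\<bar> * norm (z - a))"
    by (metis add_diff_cancel_left' norm_minus_commute norm_scaleR)
  also have "\<dots> \<le> \<bar>t\<bar> * r"
  proof (rule mult_left_mono)
    show "\<bar>radial_bump a r z\<bar> * norm (z - a) \<le> r"
    proof (cases "z \<in> ball a r")
      case True
      then have "\<bar>radial_bump a r z\<bar> * norm (z - a) \<le> 1 * r"
        using radial_bump_bounds[of a r z] by (intro mult_mono) (auto simp: dist_norm norm_minus_commute)
      then show ?thesis by simp
    qed (use r in \<open>simp add: radial_bump_outside\<close>)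
  qed simp
  finally show ?thesis by (simp add: z_def)
qed

text \<open>The lower Lipschitz bound passes to the differential: a kernel vector would displace the
  flow by at most a quarter of its length, although at least half is forced. An injective
  \<open>D\<close> has a left inverse, which is the derivative of the inverse flow.\<close>

lemma inv_squeeze_flow_has_derivative:
  obtains \<Psi>' where "(inv (squeeze_flow a r t) has_derivative blinfun_apply \<Psi>') (at y)"
proof -
  define z where "z = inv (squeeze_flow a r t) y"
  define D where "D = (\<lambda>v. (1 + t * radial_bump a r z) *\<^sub>R v + ((t * bump_slope a r z) * ((z - a) \<bullet> v)) *\<^sub>R (z - a))"
  have D: "(squeeze_flow a r t has_derivative D) (at z)" unfolding D_def by (rule squeeze_flow_has_derivative)
  have lD: "linear D" using has_derivative_linear[OF D] .
  have "inj D"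
    unfolding linear_injective_0[OF lD]
  proof (intro allI impI)
    fix v assume v: "D v = 0"
    show "v = 0"
    proof (rule ccontr)
      assume "v \<noteq> 0"
      obtain d where d: "0 < d" "\<And>k. norm k < d \<Longrightarrow> norm (squeeze_flow a r t (z + k) - squeeze_flow a r t z - D k) \<le> 1 / 4 * norm k"
        using has_derivativeD_norm[OF D, of "1 / 4"] by auto
      define s where "s = d / (2 * norm v)"
      have s: "0 < s" "norm (s *\<^sub>R v) < d" using d(1) \<open>v \<noteq> 0\<close> by (auto simp: s_def)
      have "norm (squeeze_flow a r t (z + s *\<^sub>R v) - squeeze_flow a r t z) \<le> 1 / 4 * norm (s *\<^sub>R v)"
        using d(2)[OF s(2)] v by (simp add: linear_scale[OF lD])
      moreover have "norm (s *\<^sub>R v) \<le> 2 * norm (squeeze_flow a r t (z + s *\<^sub>R v) - squeeze_flow a r t z)"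
        using squeeze_flow_lipschitz(1)[of "z + s *\<^sub>R v" z] by simp
      moreover have "0 < norm (s *\<^sub>R v)" using s \<open>v \<noteq> 0\<close> by simp
      ultimately show False by linarith
    qed
  qed
  then obtain D' where D': "linear D'" "D' \<circ> D = id" using linear_injective_left_inverse[OF lD] by blast
  have "(inv (squeeze_flow a r t) has_derivative D') (at y)"
  proof (rule has_derivative_inverse_basic[of "squeeze_flow a r t" D _ _ _ UNIV])
    show "isCont (inv (squeeze_flow a r t)) y"
      using continuous_inv_squeeze_flow[of UNIV] by (simp add: continuous_on_eq_continuous_at)
  qed (use D D' in \<open>auto simp: z_def inv_squeeze_flow linear_conv_bounded_linear\<close>)
  moreover have "bounded_linear D'" using D'(1) by (simp add: linear_conv_bounded_linear)
  ultimately show ?thesis using that[of "Blinfun D'"] by (simp add: bounded_linear_Blinfun_apply)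
qed

end

definition flow_jacobian :: "real^'m \<Rightarrow> real \<Rightarrow> real \<Rightarrow> real^'m \<Rightarrow> real"
  where "flow_jacobian a r t x = (1 + t * radial_bump a r x) ^ (CARD('m) - 1) *
    (1 + t * radial_bump a r x + t * bump_slope a r x * ((x - a) \<bullet> (x - a)))"

section \<open>The Jacobian of the flow and its effect on measures\<close>

context
  fixes a :: "real^'m" and r t :: real
  assumes r: "0 < r" and t: "20 * real CARD('m) * \<bar>t\<bar> \<le> 1"
begin

lemma small_t: "10 * \<bar>t\<bar> \<le> 1"
proof -
  have "1 * \<bar>t\<bar> \<le> real CARD('m) * \<bar>t\<bar>" by (intro mult_right_mono) (auto simp: Suc_le_eq)
  then show ?thesis using t by linarith
qed

lemma flow_scale_bounds: "1 / 2 \<le> 1 + t * radial_bump a r x" "1 + t * radial_bump a r x \<le> 2"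
proof -
  have "\<bar>t * radial_bump a r x\<bar> \<le> \<bar>t\<bar> * 1"
    unfolding abs_mult using radial_bump_bounds[of a r x] by (intro mult_left_mono) auto
  then show "1 / 2 \<le> 1 + t * radial_bump a r x" "1 + t * radial_bump a r x \<le> 2"
    using small_t by linarith+
qed

text \<open>Every factor lies within \<open>s = 5 * \<bar>t\<bar>\<close> of \<open>1\<close>, and
  Bernoulli gives \<open>(1 - s) ^ m \<ge> 3 / 4\<close> from
  \<open>4 * (real m * s) \<le> 1\<close>. The upper bound follows because
  \<open>(1 + s) ^ m * (1 - s) ^ m \<le> 1\<close>.\<close>

lemma flow_jacobian_bounds: "1 / 2 \<le> flow_jacobian a r t x" "flow_jacobian a r t x \<le> 2"
proof -
  define s where "s = 5 * \<bar>t\<bar>"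
  define m where "m = CARD('m)"
  have m: "0 < m" by (simp add: m_def)
  have s: "0 \<le> s" "4 * (real m * s) \<le> 1" "s \<le> 1 / 2" using t small_t by (auto simp: s_def m_def)
  define u where "u = 1 + t * radial_bump a r x"
  define v where "v = 1 + t * radial_bump a r x + t * bump_slope a r x * ((x - a) \<bullet> (x - a))"
  have tp: "\<bar>t * radial_bump a r x\<bar> \<le> \<bar>t\<bar> * 1"
    unfolding abs_mult using radial_bump_bounds[of a r x] by (intro mult_left_mono) auto
  have "\<bar>t * bump_slope a r x * ((x - a) \<bullet> (x - a))\<bar> = \<bar>t\<bar> * (\<bar>bump_slope a r x\<bar> * (norm (x - a))\<^sup>2)"
    by (simp add: abs_mult power2_norm_eq_inner)
  also have "\<dots> \<le> \<bar>t\<bar> * 4" using bump_slope_norm_sq[OF r] by (intro mult_left_mono) auto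
  finally have tk: "\<bar>t * bump_slope a r x * ((x - a) \<bullet> (x - a))\<bar> \<le> \<bar>t\<bar> * 4" .
  have u: "1 - s \<le> u" "u \<le> 1 + s" using tp by (auto simp: u_def s_def)
  have v: "1 - s \<le> v" "v \<le> 1 + s" unfolding v_def s_def using tp tk by linarith+
  have J: "flow_jacobian a r t x = u ^ (m - 1) * v" by (simp add: flow_jacobian_def u_def v_def m_def)
  have mm: "y ^ (m - 1) * y = y ^ m" for y :: real using m by (metis Suc_pred' power_Suc2)
  have lo: "3 / 4 \<le> (1 - s) ^ m" using Bernoulli_inequality[of "- s" m] s by simp
  have "(1 - s) ^ m \<le> u ^ (m - 1) * v"
    unfolding mm[symmetric] using u v s by (intro mult_mono power_mono) auto
  then show "1 / 2 \<le> flow_jacobian a r t x" using lo J by linarith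
  have "u ^ (m - 1) * v \<le> (1 + s) ^ m"
    unfolding mm[symmetric] using u v s by (intro mult_mono power_mono) auto
  moreover have "(1 + s) ^ m * (3 / 4) \<le> 1"
  proof -
    have "(1 + s) ^ m * (3 / 4) \<le> (1 + s) ^ m * (1 - s) ^ m" using lo s by (intro mult_left_mono) auto
    also have "\<dots> = (1 - s * s) ^ m" by (simp add: algebra_simps flip: power_mult_distrib)
    also have "\<dots> \<le> 1" using s by (intro power_le_one) (auto simp: mult_le_one)
    finally show ?thesis .
  qed
  ultimately show "flow_jacobian a r t x \<le> 2" using J by linarith
qed

lemma flow_change_of_variables:
  fixes k :: "real^'m \<Rightarrow> real"
  assumes "S \<in> sets lebesgue"
  shows "set_integrable lebesgue S (\<lambda>x. flow_jacobian a r t x * k (squeeze_flow a r t x)) \<and>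
      (LINT x:S|lebesgue. flow_jacobian a r t x * k (squeeze_flow a r t x)) = b
    \<longleftrightarrow> set_integrable lebesgue (squeeze_flow a r t ` S) k \<and> (LINT x:squeeze_flow a r t ` S|lebesgue. k x) = b"
proof -
  have *: "\<bar>(1 + t * radial_bump a r x) ^ (CARD('m) - 1) *
    (1 + t * radial_bump a r x + t * bump_slope a r x * ((x - a) \<bullet> (x - a)))\<bar> = flow_jacobian a r t x" for x
    using flow_jacobian_bounds[of x] unfolding flow_jacobian_def by linarith
  show ?thesis
    using change_of_variables_radial[OF assms squeeze_flow_has_derivative[of a r t]
        inj_on_subset[OF inj_squeeze_flow[OF r small_t, of a] subset_UNIV], where k=k and b=b]
    by (simp only: *)
qed

lemma continuous_flow_jacobian: "continuous_on A (flow_jacobian a r t)"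
  unfolding flow_jacobian_def by (intro continuous_intros continuous_radial_bump continuous_bump_slope)

lemma vimage_inv_flow: "inv (squeeze_flow a r t) -` T = squeeze_flow a r t ` T"
proof (intro set_eqI iffI)
  fix x assume "x \<in> inv (squeeze_flow a r t) -` T"
  then show "x \<in> squeeze_flow a r t ` T"
    by (intro image_eqI[of _ _ "inv (squeeze_flow a r t) x"]) (simp_all add: inv_squeeze_flow[OF r small_t])
qed (auto simp: inv_squeeze_flow[OF r small_t])

text \<open>The Jacobian integrates over the preimage to the measure of \<open>T\<close>, and it is
  at least 1/2 there.\<close>

lemma flow_vimage_measure:
  assumes T: "T \<in> sets borel" "emeasure lborel T < \<infinity>"
  shows "squeeze_flow a r t -` T \<in> sets borel \<and> emeasure lborel (squeeze_flow a r t -` T) \<le> 2 * emeasure lborel T"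
proof
  let ?S = "squeeze_flow a r t -` T"
  have "squeeze_flow a r t \<in> borel_measurable borel"
    by (rule borel_measurable_continuous_onI) (rule continuous_squeeze_flow[OF r small_t])
  from measurable_sets[OF this T(1)] show S: "?S \<in> sets borel" by simp
  have im: "squeeze_flow a r t ` ?S = T" by (rule surj_image_vimage_eq[OF surj_squeeze_flow[OF r small_t]])
  have "set_integrable lebesgue T (\<lambda>_. 1::real)"
    using T by (simp add: set_integrable_def)
  then have J: "set_integrable lebesgue ?S (flow_jacobian a r t)" "(LINT x:?S|lebesgue. flow_jacobian a r t x) = (LINT x:T|lebesgue. 1)"
    using flow_change_of_variables[of ?S "\<lambda>_. 1" "LINT x:T|lebesgue. 1"] S im by auto
  have nn: "0 \<le> indicator ?S x * flow_jacobian a r t x" for x using flow_jacobian_bounds[of x] by (auto simp: indicator_def)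
  have "emeasure lborel ?S = (\<integral>\<^sup>+x. indicator ?S x \<partial>lebesgue)" using S by simp
  also have "\<dots> \<le> (\<integral>\<^sup>+x. 2 * ennreal (indicator ?S x * flow_jacobian a r t x) \<partial>lebesgue)"
  proof (rule nn_integral_mono)
    fix x
    have "1 \<le> 2 * flow_jacobian a r t x" using flow_jacobian_bounds[of x] by simp
    then have "ennreal 1 \<le> ennreal 2 * ennreal (flow_jacobian a r t x)" using flow_jacobian_bounds[of x] by (subst ennreal_mult[symmetric]) auto
    then show "indicator ?S x \<le> 2 * ennreal (indicator ?S x * flow_jacobian a r t x)" by (auto simp: indicator_def)
  qed
  also have "\<dots> = 2 * (\<integral>\<^sup>+x. ennreal (indicator ?S x * flow_jacobian a r t x) \<partial>lebesgue)"
    using J(1) by (intro nn_integral_cmult) (auto simp: set_integrable_def)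
  also have "(\<integral>\<^sup>+x. ennreal (indicator ?S x * flow_jacobian a r t x) \<partial>lebesgue) = ennreal (LINT x:?S|lebesgue. flow_jacobian a r t x)"
    unfolding set_lebesgue_integral_def real_scaleR_def
    using J(1) nn by (intro nn_integral_eq_integral) (auto simp: set_integrable_def)
  also have "\<dots> = emeasure lborel T"
    unfolding J(2) using T by (simp add: set_lebesgue_integral_def emeasure_eq_ennreal_measure)
  finally show "emeasure lborel ?S \<le> 2 * emeasure lborel T" .
qed

text \<open>The preimage under the inverse flow is the image of \<open>T\<close> under the flow,
  whose measure is the integral over \<open>T\<close> of a Jacobian bounded by
  \<open>2\<close>.\<close>

lemma inv_flow_vimage_measure:
  assumes T: "T \<in> sets borel" "emeasure lborel T < \<infinity>"
  shows "inv (squeeze_flow a r t) -` T \<in> sets borel \<and> emeasure lborel (inv (squeeze_flow a r t) -` T) \<le> 2 * emeasure lborel T"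
proof
  let ?S = "inv (squeeze_flow a r t) -` T"
  have "inv (squeeze_flow a r t) \<in> borel_measurable borel"
    by (rule borel_measurable_continuous_onI) (rule continuous_inv_squeeze_flow[OF r small_t])
  from measurable_sets[OF this T(1)] show S: "?S \<in> sets borel" by simp
  have im: "squeeze_flow a r t ` T = ?S" by (simp add: vimage_inv_flow)
  have 1: "set_integrable lebesgue T (\<lambda>_. 2::real)"
    using T by (simp add: set_integrable_def)
  have Jm: "flow_jacobian a r t \<in> borel_measurable lebesgue"
    by (intro measurable_completion) (simp add: borel_measurable_continuous_onI continuous_flow_jacobian)
  have J1: "set_integrable lebesgue T (flow_jacobian a r t)"
    unfolding set_integrable_def
  proof (rule Bochner_Integration.integrable_bound[OF 1[unfolded set_integrable_def]])
    show "(\<lambda>x. indicator T x *\<^sub>R flow_jacobian a r t x) \<in> borel_measurable lebesgue"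
      using Jm T by (intro borel_measurable_scaleR borel_measurable_indicator) auto
    show "AE x in lebesgue. norm (indicator T x *\<^sub>R flow_jacobian a r t x) \<le> norm (indicator T x *\<^sub>R (2::real))"
    proof (rule AE_I2)
      fix x show "norm (indicator T x *\<^sub>R flow_jacobian a r t x) \<le> norm (indicator T x *\<^sub>R (2::real))"
        using flow_jacobian_bounds[of x] by (auto simp: indicator_def)
    qed
  qed
  then have J: "set_integrable lebesgue ?S (\<lambda>_. 1::real)" "(LINT x:?S|lebesgue. 1) = (LINT x:T|lebesgue. flow_jacobian a r t x)"
    using flow_change_of_variables[of T "\<lambda>_. 1" "LINT x:T|lebesgue. flow_jacobian a r t x"] T im by auto
  have "emeasure lebesgue ?S < \<infinity>" using J(1) S by (simp add: set_integrable_def integrable_indicator_iff)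
  then have "emeasure lborel ?S = ennreal (LINT x:?S|lebesgue. 1)"
    using S by (simp add: set_lebesgue_integral_def emeasure_eq_ennreal_measure)
  also have "\<dots> \<le> ennreal (LINT x:T|lebesgue. 2)"
    unfolding J(2) using flow_jacobian_bounds by (intro ennreal_leI set_integral_mono J1 1) auto
  also have "\<dots> = 2 * emeasure lborel T"
    using T by (simp add: set_lebesgue_integral_def emeasure_eq_ennreal_measure ennreal_mult mult.commute)
  finally show "emeasure lborel ?S \<le> 2 * emeasure lborel T" .
qed

end

text \<open>The differential of the flow is a scalar plus a rank-one map along \<open>x - a\<close>,
  so besides the full energy only the derivative of \<open>f\<close> in that direction enters. The
  chain rule for the inverse flow shows that non-differentiability is preserved, hence the unchanged
  \<open>bad_energy f y\<close>.\<close>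

lemma (in stationary_map) squeezed_energy:
  assumes r: "0 < r" and t: "20 * real CARD('m) * \<bar>t\<bar> \<le> 1" and aU: "ball a r \<subseteq> U" and x: "x \<in> U"
  defines "\<alpha> \<equiv> 1 + t * radial_bump a r x" and "\<beta> \<equiv> t * bump_slope a r x" and "y \<equiv> squeeze_flow a r t x"
  shows "(Df_norm (\<lambda>x. f (squeeze_flow a r t x)) x)\<^sup>2
    = \<alpha>\<^sup>2 * good_energy f y + (2 * \<alpha> * \<beta> + \<beta>\<^sup>2 * (norm (x - a))\<^sup>2) * directional_energy f y (x - a) + bad_energy f y"
    (is "(Df_norm ?h x)\<^sup>2 = _")
proof -
  note st = small_t[OF r t]
  have im: "squeeze_flow a r t ` U = U" by (rule squeeze_flow_image[OF r st aU])
  have yU: "y \<in> U" using x im unfolding y_def by blast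
  have sz: "size (?h x) = Q" if "x \<in> U" for x using size_f im that by blast
  have bl: "bounded_linear (\<lambda>v. \<alpha> *\<^sub>R v + (\<beta> * ((x - a) \<bullet> v)) *\<^sub>R (x - a))"
    by (rule has_derivative_bounded_linear[OF squeeze_flow_has_derivative[of a r t x, folded \<alpha>_def \<beta>_def]])
  define D where "D = Blinfun (\<lambda>v. \<alpha> *\<^sub>R v + (\<beta> * ((x - a) \<bullet> v)) *\<^sub>R (x - a))"
  have Dap: "blinfun_apply D v = \<alpha> *\<^sub>R v + (\<beta> * ((x - a) \<bullet> v)) *\<^sub>R (x - a)" for v
    unfolding D_def by (simp add: bounded_linear_Blinfun_apply[OF bl])
  have der: "(squeeze_flow a r t has_derivative blinfun_apply D) (at x)"
    unfolding D_def bounded_linear_Blinfun_apply[OF bl] unfolding \<alpha>_def \<beta>_def by (rule squeeze_flow_has_derivative)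
  show ?thesis
  proof (cases "approx_differentiable f y")
    case True
    let ?w = "some_differential f y"
    have "has_approx_differential ?h x (image_mset (\<lambda>p. (fst p, snd p o\<^sub>L D)) ?w)"
    proof (rule has_approx_differential_squeeze[OF open_U _ size_f _ der])
      show "squeeze_flow a r t x \<in> U" using yU by (simp add: y_def)
      show "has_approx_differential f (squeeze_flow a r t x) ?w" using some_differential[OF True] by (simp add: y_def)
      show "norm (squeeze_flow a r t x' - squeeze_flow a r t x) \<le> 2 * norm (x' - x)" for x'
        by (rule squeeze_flow_lipschitz(2)[OF r st])
      show "x' = x" if "squeeze_flow a r t x' = squeeze_flow a r t x" for x'
        using injD[OF inj_squeeze_flow[OF r st] that] .
      show "density_zero (squeeze_flow a r t -` E) x" if "density_zero E (squeeze_flow a r t x)" for E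
        using that squeeze_flow_lipschitz(2)[OF r st] flow_vimage_measure[OF r t] by (rule density_zero_vimage)
    qed auto
    then have "(Df_norm ?h x)\<^sup>2 = tuple_energy (image_mset (\<lambda>p. (fst p, snd p o\<^sub>L D)) ?w)"
      by (intro Df_norm_sq_eq[where f="?h", OF open_U x]) (use sz in auto)
    also have "\<dots> = (\<Sum>p\<in>#?w. \<alpha>\<^sup>2 * (hs_norm (snd p))\<^sup>2 + (2 * \<alpha> * \<beta> + \<beta>\<^sup>2 * (norm (x - a))\<^sup>2) * (norm (blinfun_apply (snd p) (x - a)))\<^sup>2)"
      unfolding tuple_energy_def image_mset.compositionality o_def snd_conv
    proof (intro arg_cong[of _ _ sum_mset] image_mset_cong)
      fix p
      have "(hs_norm (snd p o\<^sub>L D))\<^sup>2 = \<alpha>\<^sup>2 * (hs_norm (snd p))\<^sup>2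
        + 2 * \<alpha> * (blinfun_apply (snd p) (\<beta> *\<^sub>R (x - a)) \<bullet> blinfun_apply (snd p) (x - a)) + (norm (\<beta> *\<^sub>R (x - a)))\<^sup>2 * (norm (blinfun_apply (snd p) (x - a)))\<^sup>2"
        by (rule hs_norm_rank_one) (simp add: Dap blinfun.add_right blinfun.scaleR_right)
      then show "(hs_norm (snd p o\<^sub>L D))\<^sup>2 = \<alpha>\<^sup>2 * (hs_norm (snd p))\<^sup>2 + (2 * \<alpha> * \<beta> + \<beta>\<^sup>2 * (norm (x - a))\<^sup>2) * (norm (blinfun_apply (snd p) (x - a)))\<^sup>2"
        by (simp add: blinfun.scaleR_right power_mult_distrib distrib_right flip: power2_norm_eq_inner)
    qed
    also have "\<dots> = \<alpha>\<^sup>2 * tuple_energy ?w + (2 * \<alpha> * \<beta> + \<beta>\<^sup>2 * (norm (x - a))\<^sup>2) * directional_energy f y (x - a)"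
      using True by (simp only: sum_mset.distrib sum_mset_distrib_left tuple_energy_def directional_energy_def if_True)
    finally show ?thesis using True by (simp add: good_energy_def bad_energy_def)
  next
    case False
    have "\<not> approx_differentiable ?h x"
    proof
      assume "approx_differentiable ?h x"
      then obtain w where w: "has_approx_differential ?h x w" by (auto simp: approx_differentiable_def)
      let ?\<Psi> = "inv (squeeze_flow a r t)"
      have \<Psi>y: "?\<Psi> y = x" by (simp add: y_def inv_squeeze_flow[OF r st])
      obtain \<Psi>' where d: "(?\<Psi> has_derivative blinfun_apply \<Psi>') (at y)" by (rule inv_squeeze_flow_has_derivative[OF r st])
      have "has_approx_differential (\<lambda>z. ?h (?\<Psi> z)) y (image_mset (\<lambda>p. (fst p, snd p o\<^sub>L \<Psi>')) w)"
      proof (rule has_approx_differential_squeeze[OF open_U _ _ _ d])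
        show "?\<Psi> y \<in> U" using x \<Psi>y by simp
        show "size (?h z) = Q" if "z \<in> U" for z using sz[OF that] .
        show "has_approx_differential ?h (?\<Psi> y) w" using w \<Psi>y by simp
        show "norm (?\<Psi> x' - ?\<Psi> y) \<le> 2 * norm (x' - y)" for x' by (rule inv_squeeze_flow_lipschitz[OF r st])
        show "x' = y" if "?\<Psi> x' = ?\<Psi> y" for x' using that inv_squeeze_flow(1)[OF r st] by metis
        show "density_zero (?\<Psi> -` E) y" if "density_zero E (?\<Psi> y)" for E
          using that inv_squeeze_flow_lipschitz[OF r st] inv_flow_vimage_measure[OF r t] by (rule density_zero_vimage)
      qed auto
      then show False using False by (auto simp: approx_differentiable_def inv_squeeze_flow[OF r st])
    qed
    then show ?thesis using False by (simp add: Df_norm_sq_junk good_energy_def bad_energy_def directional_energy_def)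
  qed
qed

lemma tendsto_directional_energy:
  fixes f :: "real^'m \<Rightarrow> 'h::real_normed_vector multiset"
  assumes "(v \<longlongrightarrow> v0) F"
  shows "((\<lambda>t. directional_energy f y (v t)) \<longlongrightarrow> directional_energy f y v0) F"
proof -
  have "((\<lambda>t. \<Sum>p\<in>#w. (norm (blinfun_apply (snd p) (v t)))\<^sup>2) \<longlongrightarrow> (\<Sum>p\<in>#w. (norm (blinfun_apply (snd p) v0))\<^sup>2)) F"
    for w :: "('h \<times> ((real^'m) \<Rightarrow>\<^sub>L 'h)) multiset"
    by (induction w) (auto intro!: tendsto_intros bounded_linear.tendsto[OF blinfun.bounded_linear_right] assms)
  then show ?thesis by (simp add: directional_energy_def)
qed

section \<open>First variation under the radial flow\<close>

context stationary_map
begin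

context
  fixes a :: "real^'m" and r :: real
  assumes r: "0 < r" and aU: "cball a r \<subseteq> U"
begin

private definition flow_inv :: "real \<Rightarrow> real^'m \<Rightarrow> real^'m"
  where "flow_inv t = inv (squeeze_flow a r t)"

text \<open>The energy density of the squeezed map, transported to the point \<open>y\<close> at
  which \<open>f\<close> is evaluated. There \<open>t\<close> enters only through the flow, so the
  density can be differentiated in \<open>t\<close> although \<open>Df\<close> has no regularity in
  space.\<close>

private definition pushed_energy :: "real \<Rightarrow> real^'m \<Rightarrow> real"
  where "pushed_energy t y = (let z = flow_inv t y; \<alpha> = 1 + t * radial_bump a r z; \<beta> = t * bump_slope a r z in
    (\<alpha>\<^sup>2 * good_energy f y + (2 * \<alpha> * \<beta> + \<beta>\<^sup>2 * (norm (z - a))\<^sup>2) * directional_energy f y (z - a) + bad_energy f y)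
      / flow_jacobian a r t z)"

text \<open>The quotient \<open>(flow_jacobian a r t z - 1) / t\<close> in closed form: a difference
  of powers is expanded as a geometric sum, so that the formula is meaningful at
  \<open>t = 0\<close>.\<close>

private definition jacobian_quotient :: "real \<Rightarrow> real^'m \<Rightarrow> real"
  where "jacobian_quotient t z = radial_bump a r z * (\<Sum>i<CARD('m). (1 + t * radial_bump a r z) ^ i)
    + bump_slope a r z * (norm (z - a))\<^sup>2 * (1 + t * radial_bump a r z) ^ (CARD('m) - 1)"

text \<open>The difference quotient of \<open>pushed_energy\<close> at \<open>0\<close> with the
  factor \<open>t\<close> cancelled, so that bounds and limits can be read off.\<close>

private definition energy_quotient :: "real \<Rightarrow> real^'m \<Rightarrow> real"
  where "energy_quotient t y = (let z = flow_inv t y; p = radial_bump a r z; k = bump_slope a r z in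
    ((2 * p + t * p\<^sup>2) * good_energy f y + (2 * (1 + t * p) * k + t * k\<^sup>2 * (norm (z - a))\<^sup>2) * directional_energy f y (z - a)
     - (good_energy f y + bad_energy f y) * jacobian_quotient t z) / flow_jacobian a r t z)"

private lemma jacobian_eq: "flow_jacobian a r t z = 1 + t * jacobian_quotient t z"
proof -
  define \<alpha> where "\<alpha> = 1 + t * radial_bump a r z"
  have "\<alpha> ^ (CARD('m) - 1) * \<alpha> = \<alpha> ^ CARD('m)" by (metis Suc_pred' power_Suc2 zero_less_card_finite)
  then have "flow_jacobian a r t z = \<alpha> ^ CARD('m) + t * bump_slope a r z * (norm (z - a))\<^sup>2 * \<alpha> ^ (CARD('m) - 1)"
    by (simp add: flow_jacobian_def \<alpha>_def power2_norm_eq_inner algebra_simps)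
  also have "\<alpha> ^ CARD('m) = 1 + t * radial_bump a r z * (\<Sum>i<CARD('m). \<alpha> ^ i)"
    using power_diff_1_eq[of \<alpha> "CARD('m)"] by (simp add: \<alpha>_def)
  finally show ?thesis by (simp add: jacobian_quotient_def \<alpha>_def algebra_simps)
qed

private lemma flow_inv_0: "flow_inv 0 y = y"
proof -
  have "squeeze_flow a r 0 = id" by (simp add: fun_eq_iff squeeze_flow_def)
  then show ?thesis by (simp add: flow_inv_def)
qed

private lemma pushed_energy_0: "pushed_energy 0 y = (Df_norm f y)\<^sup>2"
  by (simp add: pushed_energy_def flow_inv_0 flow_jacobian_def Df_norm_sq_split)

private lemma pushed_energy_diff:
  assumes t: "20 * real CARD('m) * \<bar>t\<bar> \<le> 1"
  shows "pushed_energy t y - pushed_energy 0 y = t * energy_quotient t y"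
proof -
  define z where "z = flow_inv t y"
  define p where "p = radial_bump a r z"
  define k where "k = bump_slope a r z"
  define n where "n = (norm (z - a))\<^sup>2"
  define e where "e = good_energy f y"
  define b where "b = bad_energy f y"
  define d where "d = directional_energy f y (z - a)"
  define R where "R = jacobian_quotient t z"
  have J: "1 + t * R \<noteq> 0" using flow_jacobian_bounds[OF r t, of a z] by (simp add: jacobian_eq R_def)
  have "pushed_energy t y = ((1 + t * p)\<^sup>2 * e + (2 * (1 + t * p) * (t * k) + (t * k)\<^sup>2 * n) * d + b) / (1 + t * R)"
    by (simp add: pushed_energy_def Let_def jacobian_eq z_def p_def k_def n_def e_def b_def d_def R_def)
  moreover have "energy_quotient t y = ((2 * p + t * p\<^sup>2) * e + (2 * (1 + t * p) * k + t * k\<^sup>2 * n) * d - (e + b) * R) / (1 + t * R)"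
    by (simp add: energy_quotient_def Let_def jacobian_eq z_def p_def k_def n_def e_def b_def d_def R_def)
  moreover have "pushed_energy 0 y = e + b" by (simp add: pushed_energy_0 Df_norm_sq_split e_def b_def)
  moreover have "((1 + t * p)\<^sup>2 * e + (2 * (1 + t * p) * (t * k) + (t * k)\<^sup>2 * n) * d + b) - (e + b) * (1 + t * R)
    = t * ((2 * p + t * p\<^sup>2) * e + (2 * (1 + t * p) * k + t * k\<^sup>2 * n) * d - (e + b) * R)"
    by (simp add: power2_eq_square algebra_simps)
  ultimately show ?thesis using J by (simp add: divide_diff_eq_iff)
qed

text \<open>The scale-free estimate \<open>\<bar>k\<bar> * n \<le> 4\<close> tames every slope term.
  The constant collects \<open>3 + 32\<close> from the energy terms and
  \<open>(m + 4) * 2 ^ m\<close> from the Jacobian, doubled because the denominator is at least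
  1/2.\<close>

private lemma energy_quotient_bound:
  assumes t: "20 * real CARD('m) * \<bar>t\<bar> \<le> 1"
  shows "\<bar>energy_quotient t y\<bar> \<le> (70 + 2 * ((real CARD('m) + 4) * 2 ^ CARD('m))) * (Df_norm f y)\<^sup>2"
proof -
  define m where "m = CARD('m)"
  define z where "z = flow_inv t y"
  define p where "p = radial_bump a r z"
  define k where "k = bump_slope a r z"
  define n where "n = (norm (z - a))\<^sup>2"
  define e where "e = good_energy f y"
  define b where "b = bad_energy f y"
  define d where "d = directional_energy f y (z - a)"
  define R where "R = jacobian_quotient t z"
  note st = small_t[OF r t]
  have p: "0 \<le> p" "p \<le> 1" using radial_bump_bounds by (auto simp: p_def)
  have \<alpha>: "1 / 2 \<le> 1 + t * p" "1 + t * p \<le> 2" using flow_scale_bounds[OF r t] by (auto simp: p_def)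
  have e: "0 \<le> e" by (simp add: e_def good_energy_nonneg)
  have b: "0 \<le> b" by (simp add: b_def bad_energy_nonneg)
  have n: "0 \<le> n" by (simp add: n_def)
  have kn: "\<bar>k\<bar> * n \<le> 4" using bump_slope_norm_sq[OF r] by (simp add: k_def n_def)
  have d: "0 \<le> d" "d \<le> n * e"
    using directional_energy_nonneg directional_energy_le by (auto simp: d_def n_def e_def)
  have kd: "\<bar>k\<bar> * d \<le> 4 * e"
    using mult_left_mono[OF d(2), of "\<bar>k\<bar>"] mult_right_mono[OF kn e] by simp
  have kkd: "\<bar>k\<bar> * n * (\<bar>k\<bar> * d) \<le> 4 * (4 * e)" by (rule mult_mono) (use kn kd n d e in auto)
  have 1: "\<bar>(2 * p + t * p\<^sup>2) * e\<bar> \<le> 3 * e"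
  proof -
    have "\<bar>t * p\<^sup>2\<bar> \<le> 1 * 1" unfolding abs_mult using st p by (intro mult_mono) (auto simp: power_le_one)
    then have "\<bar>2 * p + t * p\<^sup>2\<bar> \<le> 3" using p by linarith
    then show ?thesis using e by (simp add: abs_mult mult_right_mono)
  qed
  have 2: "\<bar>(2 * (1 + t * p) * k + t * k\<^sup>2 * n) * d\<bar> \<le> 32 * e"
  proof -
    have "\<bar>(2 * (1 + t * p) * k + t * k\<^sup>2 * n) * d\<bar> = \<bar>(2 * (1 + t * p)) * (k * d) + t * (k * n * (k * d))\<bar>"
      by (simp add: power2_eq_square algebra_simps)
    also have "\<dots> \<le> \<bar>2 * (1 + t * p)\<bar> * (\<bar>k\<bar> * d) + \<bar>t\<bar> * (\<bar>k\<bar> * n * (\<bar>k\<bar> * d))"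
      by (rule order_trans[OF abs_triangle_ineq]) (use n d in \<open>simp add: abs_mult\<close>)
    also have "\<dots> \<le> 4 * (4 * e) + 1 * (4 * (4 * e))"
      by (rule add_mono; rule mult_mono; use \<alpha> st kd kkd n d in auto)
    finally show ?thesis by simp
  qed
  have 3: "\<bar>R\<bar> \<le> (real m + 4) * 2 ^ m"
  proof -
    have pw: "\<bar>1 + t * p\<bar> ^ i \<le> 2 ^ m" if "i \<le> m" for i
    proof -
      have "\<bar>1 + t * p\<bar> ^ i \<le> 2 ^ i" using \<alpha> by (intro power_mono) auto
      also have "\<dots> \<le> 2 ^ m" using that by (intro power_increasing) auto
      finally show ?thesis .
    qed
    have "\<bar>\<Sum>i<m. (1 + t * p) ^ i\<bar> \<le> (\<Sum>i<m. 2 ^ m)"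
      by (rule order_trans[OF sum_abs]) (intro sum_mono, use pw in \<open>auto simp: power_abs\<close>)
    then have s: "\<bar>\<Sum>i<m. (1 + t * p) ^ i\<bar> \<le> real m * 2 ^ m" by simp
    have "\<bar>R\<bar> \<le> \<bar>p\<bar> * \<bar>\<Sum>i<m. (1 + t * p) ^ i\<bar> + \<bar>k\<bar> * n * \<bar>1 + t * p\<bar> ^ (m - 1)"
      unfolding R_def jacobian_quotient_def p_def[symmetric] k_def[symmetric] n_def[symmetric] m_def[symmetric]
      by (rule order_trans[OF abs_triangle_ineq]) (use n in \<open>simp add: abs_mult power_abs\<close>)
    also have "\<dots> \<le> 1 * (real m * 2 ^ m) + 4 * 2 ^ m"
      by (rule add_mono; rule mult_mono; use p s kn n pw[of "m - 1"] in auto)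
    finally show ?thesis by (simp add: algebra_simps)
  qed
  define J where "J = flow_jacobian a r t z"
  define N where "N = (2 * p + t * p\<^sup>2) * e + (2 * (1 + t * p) * k + t * k\<^sup>2 * n) * d - (e + b) * R"
  have J: "1 / 2 \<le> J" using flow_jacobian_bounds[OF r t] by (simp add: J_def)
  have EN: "energy_quotient t y = N / J"
    by (simp add: energy_quotient_def Let_def N_def J_def z_def p_def k_def n_def e_def b_def d_def R_def)
  have "\<bar>(e + b) * R\<bar> \<le> (e + b) * ((real m + 4) * 2 ^ m)"
    unfolding abs_mult using 3 e b by (intro mult_mono) auto
  then have "\<bar>N\<bar> \<le> 3 * e + 32 * e + (e + b) * ((real m + 4) * 2 ^ m)"
    unfolding N_def using 1 2 by linarith
  also have "\<dots> \<le> 35 * (e + b) + (e + b) * ((real m + 4) * 2 ^ m)" using b by simp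
  finally have N: "\<bar>N\<bar> \<le> (35 + (real m + 4) * 2 ^ m) * (e + b)" by (simp add: algebra_simps)
  have "\<bar>N / J\<bar> \<le> \<bar>N\<bar> * 2"
  proof -
    have "\<bar>N\<bar> * 1 \<le> \<bar>N\<bar> * (2 * J)" using J by (intro mult_left_mono) auto
    then show ?thesis using J by (simp add: abs_divide divide_le_eq mult_ac)
  qed
  also have "\<dots> \<le> (35 + (real m + 4) * 2 ^ m) * (e + b) * 2" using N by simp
  finally show ?thesis unfolding EN by (simp add: Df_norm_sq_split e_def b_def m_def algebra_simps)
qed

private lemma small_eventually: "\<forall>\<^sub>F t in nhds 0. 20 * real CARD('m) * \<bar>t\<bar> \<le> 1"
proof -
  have "((\<lambda>t::real. 20 * real CARD('m) * \<bar>t\<bar>) \<longlongrightarrow> 20 * real CARD('m) * \<bar>0\<bar>) (nhds 0)" by (intro tendsto_intros filterlim_ident)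
  then have "\<forall>\<^sub>F t in nhds 0. 20 * real CARD('m) * \<bar>t\<bar> < 1" by (rule order_tendstoD) simp
  then show ?thesis by eventually_elim simp
qed

private lemma flow_inv_tendsto: "((\<lambda>t. flow_inv t y) \<longlongrightarrow> y) (at 0)"
proof -
  have "((\<lambda>t. flow_inv t y - y) \<longlongrightarrow> 0) (at 0)"
  proof (rule Lim_null_comparison)
    show "\<forall>\<^sub>F t in at 0. norm (flow_inv t y - y) \<le> \<bar>t\<bar> * r"
      by (rule filter_leD[OF at_within_le_nhds], use small_eventually in eventually_elim)
        (simp add: flow_inv_def inv_squeeze_flow_close[OF r small_t[OF r]])
    show "((\<lambda>t::real. \<bar>t\<bar> * r) \<longlongrightarrow> 0) (at 0)" by (auto intro!: tendsto_eq_intros)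
  qed
  then show ?thesis by (simp add: Lim_null[symmetric])
qed

private lemma energy_quotient_tendsto:
  "((\<lambda>t. energy_quotient t y) \<longlongrightarrow> 2 * radial_bump a r y * good_energy f y + 2 * bump_slope a r y * directional_energy f y (y - a)
    - (real CARD('m) * radial_bump a r y + bump_slope a r y * (norm (y - a))\<^sup>2) * (good_energy f y + bad_energy f y)) (at 0)"
proof -
  note z = flow_inv_tendsto[of y]
  have p: "((\<lambda>t. radial_bump a r (flow_inv t y)) \<longlongrightarrow> radial_bump a r y) (at 0)"
    by (rule isCont_tendsto_compose[OF _ z]) (use continuous_radial_bump[of UNIV a r] in \<open>simp add: continuous_on_eq_continuous_at\<close>)
  have k: "((\<lambda>t. bump_slope a r (flow_inv t y)) \<longlongrightarrow> bump_slope a r y) (at 0)"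
    by (rule isCont_tendsto_compose[OF _ z]) (use continuous_bump_slope[of UNIV a r] in \<open>simp add: continuous_on_eq_continuous_at\<close>)
  have d: "((\<lambda>t. directional_energy f y (flow_inv t y - a)) \<longlongrightarrow> directional_energy f y (y - a)) (at 0)"
    by (intro tendsto_directional_energy tendsto_intros z)
  have R: "((\<lambda>t. jacobian_quotient t (flow_inv t y)) \<longlongrightarrow> real CARD('m) * radial_bump a r y + bump_slope a r y * (norm (y - a))\<^sup>2) (at 0)"
    unfolding jacobian_quotient_def by (rule tendsto_eq_rhs, (rule tendsto_intros p k z)+) simp
  have J: "((\<lambda>t. flow_jacobian a r t (flow_inv t y)) \<longlongrightarrow> 1) (at 0)"
    unfolding jacobian_eq by (rule tendsto_eq_rhs, (rule tendsto_intros R)+) simp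
  show ?thesis
    unfolding energy_quotient_def Let_def
    by (rule tendsto_eq_rhs, (rule tendsto_intros p k d R J z)+) simp_all
qed

text \<open>\<open>bad_energy\<close> enters through the Jacobian factor only: squeezing moves it
  without deforming it, whereas \<open>good_energy\<close> also feels the differential of the
  flow.\<close>

lemma squeeze_identity:
  defines "G \<equiv> \<lambda>x. 2 * radial_bump a r x * good_energy f x + 2 * bump_slope a r x * directional_energy f x (x - a)
    - (real CARD('m) * radial_bump a r x + bump_slope a r x * (norm (x - a))\<^sup>2) * (good_energy f x + bad_energy f x)"
  shows "integrable (lebesgue_on U) G" "(LINT x|lebesgue_on U. G x) = 0"
proof -
  have bU: "ball a r \<subseteq> U" using aU ball_subset_cball by blast
  define h where "h t x = f (squeeze_flow a r t x)" for t x
  have crit: "energy_critical U h"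
    using bspec[OF squeeze[unfolded squeeze_stationary_def] radial_bump_field_Cc_infinity[OF r aU]]
    by (simp add: h_def[abs_def] squeeze_flow_def)
  \<comment> \<open>Integrability of the squeezed energy, part of criticality, passes through the
    change of variables to \<open>pushed_energy\<close>, and measurability comes along.\<close>
  have push: "set_integrable lebesgue U (pushed_energy t) \<and> (LINT x:U|lebesgue. pushed_energy t x) = dirichlet U (h t)"
    if t: "20 * real CARD('m) * \<bar>t\<bar> \<le> 1" and int: "set_integrable lebesgue U (\<lambda>x. (Df_norm (h t) x)\<^sup>2)" for t
  proof -
    have im: "squeeze_flow a r t ` U = U" by (rule squeeze_flow_image[OF r small_t[OF r t] bU])
    have eq: "flow_jacobian a r t x * pushed_energy t (squeeze_flow a r t x) = (Df_norm (h t) x)\<^sup>2" if "x \<in> U" for x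
    proof -
      have fi: "flow_inv t (squeeze_flow a r t x) = x" unfolding flow_inv_def by (rule inv_squeeze_flow(2)[OF r small_t[OF r t]])
      have "flow_jacobian a r t x \<noteq> 0" using flow_jacobian_bounds[OF r t, of a x] by auto
      then show ?thesis
        unfolding h_def squeezed_energy[OF r t bU that] pushed_energy_def Let_def fi by simp
    qed
    have "set_integrable lebesgue U (\<lambda>x. flow_jacobian a r t x * pushed_energy t (squeeze_flow a r t x))
      \<and> (LINT x:U|lebesgue. flow_jacobian a r t x * pushed_energy t (squeeze_flow a r t x)) = dirichlet U (h t)"
      using int eq unfolding dirichlet_def
      by (auto simp: U_lebesgue intro!: set_lebesgue_integral_cong cong: set_integrable_cong)
    then show ?thesis unfolding flow_change_of_variables[OF r t U_lebesgue] im .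
  qed
  have int': "\<forall>\<^sub>F t in nhds 0. set_integrable lebesgue U (\<lambda>x. (Df_norm (h t) x)\<^sup>2)"
    using crit unfolding energy_critical_def by (rule conjunct1)
  have ev: "\<forall>\<^sub>F t in nhds 0. set_integrable lebesgue U (pushed_energy t) \<and> (LINT x:U|lebesgue. pushed_energy t x) = dirichlet U (h t)"
    using small_eventually int' by eventually_elim (rule push)
  have int: "\<forall>\<^sub>F t in nhds 0. integrable (lebesgue_on U) (pushed_energy t)"
    using ev by eventually_elim (simp add: set_integrable_lebesgue_on[OF U_lebesgue])
  have der: "((\<lambda>t. pushed_energy t x) has_real_derivative G x) (at 0)" for x
  proof -
    have "\<forall>\<^sub>F t in at 0. energy_quotient t x = (pushed_energy (0 + t) x - pushed_energy 0 x) / t"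
    proof -
      have "\<forall>\<^sub>F t in at 0. 20 * real CARD('m) * \<bar>t\<bar> \<le> 1" by (rule filter_leD[OF at_within_le_nhds small_eventually])
      moreover have "\<forall>\<^sub>F t in at (0::real). t \<noteq> 0" by (rule eventually_neq_at_within)
      ultimately show ?thesis by eventually_elim (simp add: pushed_energy_diff)
    qed
    from Lim_transform_eventually[OF energy_quotient_tendsto this] show ?thesis unfolding DERIV_def G_def .
  qed
  define W where "W x = (70 + 2 * ((real CARD('m) + 4) * 2 ^ CARD('m))) * (Df_norm f x)\<^sup>2" for x
  have Wi: "integrable (lebesgue_on U) W" unfolding W_def using integrable_Df_norm by simp
  have dom: "\<forall>\<^sub>F t in at 0. \<forall>x\<in>space (lebesgue_on U). \<bar>pushed_energy t x - pushed_energy 0 x\<bar> \<le> \<bar>t - 0\<bar> * W x"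
  proof (rule filter_leD[OF at_within_le_nhds], use small_eventually in eventually_elim, rule ballI)
    fix t x assume t: "20 * real CARD('m) * \<bar>t\<bar> \<le> 1"
    show "\<bar>pushed_energy t x - pushed_energy 0 x\<bar> \<le> \<bar>t - 0\<bar> * W x"
      unfolding pushed_energy_diff[OF t] abs_mult W_def using energy_quotient_bound[OF t] by (simp add: mult_left_mono)
  qed
  note * = DERIV_integral[OF int der dom Wi]
  show "integrable (lebesgue_on U) G" by (rule *)
  have "\<forall>\<^sub>F t in nhds 0. dirichlet U (h t) = (LINT x|lebesgue_on U. pushed_energy t x)"
    using ev by eventually_elim (simp add: set_integrable_lebesgue_on[OF U_lebesgue])
  moreover have "((\<lambda>t. dirichlet U (h t)) has_real_derivative 0) (at 0)" using crit by (simp add: energy_critical_def)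
  ultimately have "((\<lambda>t. LINT x|lebesgue_on U. pushed_energy t x) has_real_derivative 0) (at 0)"
    by (subst (asm) DERIV_cong_ev[OF refl _ refl])
  from DERIV_unique[OF *(2) this] show "(LINT x|lebesgue_on U. G x) = 0" .
qed

end

end

section \<open>Monotonicity and decay\<close>

text \<open>The inequality says that \<open>1 / F + c ln\<close> has nonpositive derivative. Its
  values at \<open>r\<close> and \<open>R\<close> are compared, and the positive term
  \<open>1 / F R\<close> is dropped.\<close>

lemma log_decay:
  fixes F F' :: "real \<Rightarrow> real"
  assumes D: "\<And>r. 0 < r \<Longrightarrow> r \<le> R \<Longrightarrow> (F has_real_derivative F' r) (at r)"
    and pos: "\<And>r. 0 < r \<Longrightarrow> r \<le> R \<Longrightarrow> 0 < F r"
    and ineq: "\<And>r. 0 < r \<Longrightarrow> r \<le> R \<Longrightarrow> c * (F r)\<^sup>2 \<le> r * F' r"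
    and c: "0 < c" and r: "0 < r" "r < R"
  shows "F r \<le> 1 / (c * ln (R / r))"
proof -
  define h where "h s = inverse (F s) + c * ln s" for s
  have "h R \<le> h r"
  proof (rule DERIV_nonpos_imp_nonincreasing[of r R h])
    fix s assume s: "r \<le> s" "s \<le> R"
    then have s0: "0 < s" "0 < F s" using r pos by auto
    have "(h has_real_derivative - (inverse (F s) * F' s * inverse (F s)) + c * (1 / s)) (at s)"
      unfolding h_def using s0 s D[of s] by (auto intro!: derivative_eq_intros simp: divide_inverse)
    moreover have "- (inverse (F s) * F' s * inverse (F s)) + c * (1 / s) \<le> 0"
    proof -
      have "c \<le> s * F' s / (F s)\<^sup>2" using ineq[OF s0(1) s(2)] s0 by (simp add: pos_le_divide_eq)
      then have "c / s \<le> F' s / (F s)\<^sup>2" using s0 by (simp add: field_simps)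
      then show ?thesis by (simp add: field_simps power2_eq_square)
    qed
    ultimately show "\<exists>y. (h has_real_derivative y) (at s) \<and> y \<le> 0" by blast
  qed (use r in simp)
  moreover have "0 < inverse (F R)" using pos[of R] r by simp
  moreover have "c * ln (R / r) = c * ln R - c * ln r" using r by (simp add: ln_div right_diff_distrib)
  ultimately have 1: "c * ln (R / r) \<le> inverse (F r)"
    unfolding h_def by linarith
  have 2: "0 < c * ln (R / r)" using c r by simp
  have "F r = inverse (inverse (F r))" by simp
  also have "\<dots> \<le> inverse (c * ln (R / r))" using 1 2 by (rule le_imp_inverse_le)
  finally show ?thesis by (simp add: inverse_eq_divide)
qed

text \<open>The choice \<open>l = D / A\<close> suffices. In this way Cauchy-Schwarz for integrals
  is obtained from pointwise weighted inequalities, without square roots of densities.\<close>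

lemma quadratic_weight:
  fixes A :: real
  assumes "\<And>l. 0 < l \<Longrightarrow> 2 * D \<le> l * A + N / l" "0 < A" "0 \<le> D" "0 \<le> N"
  shows "D\<^sup>2 \<le> A * N"
proof (cases "D = 0")
  case False
  then have D: "0 < D" using assms(3) by simp
  have "2 * D \<le> D / A * A + N / (D / A)" using D assms(2) by (intro assms(1)) simp
  then have "D \<le> N * A / D" using assms(2) by simp
  then show ?thesis using D by (simp add: pos_le_divide_eq power2_eq_square mult.commute)
qed (use assms in simp)

section \<open>A cutoff equal to \<open>1\<close> on the ball of radius 2\<close>

definition sq_pos :: "real \<Rightarrow> real"
  where "sq_pos s = (max 0 s)\<^sup>2"

lemma sq_pos_has_derivative: "(sq_pos has_real_derivative 2 * max 0 s) (at s)"
proof -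
  consider "0 < s" | "s < 0" | "s = 0" by linarith
  then show ?thesis
  proof cases
    case 1
    have "\<forall>\<^sub>F u in nhds s. u\<^sup>2 = sq_pos u"
      using eventually_nhds_in_open[of "{0<..}" s] 1 by (auto simp: sq_pos_def elim: eventually_mono)
    moreover have "((\<lambda>u. u\<^sup>2) has_real_derivative 2 * max 0 s) (at s)" using 1 by (auto intro!: derivative_eq_intros)
    ultimately show ?thesis by (subst (asm) DERIV_cong_ev[OF refl _ refl]) auto
  next
    case 2
    have "\<forall>\<^sub>F u in nhds s. 0 = sq_pos u"
      using eventually_nhds_in_open[of "{..<0}" s] 2 by (auto simp: sq_pos_def elim: eventually_mono)
    then have "((\<lambda>_. 0) has_real_derivative 0) (at s) \<longleftrightarrow> (sq_pos has_real_derivative 0) (at s)"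
      by (intro DERIV_cong_ev) auto
    then show ?thesis using 2 by simp
  next
    case 3
    have "((\<lambda>h. sq_pos h / h) \<longlongrightarrow> 0) (at 0)"
    proof (rule Lim_null_comparison)
      show "\<forall>\<^sub>F h in at 0. norm (sq_pos h / h) \<le> \<bar>h\<bar>"
        by (auto simp: sq_pos_def max_def power2_eq_square)
      show "((\<lambda>h::real. \<bar>h\<bar>) \<longlongrightarrow> 0) (at 0)" by (auto intro!: tendsto_eq_intros)
    qed
    then show ?thesis using 3 by (simp add: DERIV_def sq_pos_def)
  qed
qed

text \<open>Two nested truncated squares give \<open>1\<close> for |x|^2 <= 4 and \<open>0\<close>
  for |x|^2 >= 5, hence outside radius 5/2. Squashing asks for a map of class C^1, and unlike
  \<open>radial_bump\<close> this function is constant on a large ball.\<close>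

definition cutoff :: "'a::euclidean_space \<Rightarrow> real"
  where "cutoff x = sq_pos (1 - sq_pos (x \<bullet> x - 4))"

definition cutoff_grad :: "'a::euclidean_space \<Rightarrow> 'a"
  where "cutoff_grad x = (- 8 * max 0 (1 - sq_pos (x \<bullet> x - 4)) * max 0 (x \<bullet> x - 4)) *\<^sub>R x"

lemma cutoff_has_derivative: "(cutoff has_derivative (\<lambda>v. cutoff_grad x \<bullet> v)) (at x)"
proof -
  have "((\<lambda>x. x \<bullet> x - 4) has_derivative (\<lambda>v. 2 * (x \<bullet> v))) (at x)"
    by (auto intro!: derivative_eq_intros simp: inner_commute)
  from DERIV_compose_FDERIV[OF sq_pos_has_derivative this]
  have "((\<lambda>x. 1 - sq_pos (x \<bullet> x - 4)) has_derivative (\<lambda>v. - (2 * (x \<bullet> v) * (2 * max 0 (x \<bullet> x - 4))))) (at x)"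
    by (auto intro!: derivative_eq_intros)
  from DERIV_compose_FDERIV[OF sq_pos_has_derivative this]
  show ?thesis by (simp add: cutoff_def[abs_def] cutoff_grad_def mult_ac)
qed

lemma continuous_cutoff_grad: "continuous_on A cutoff_grad"
proof -
  have sq: "continuous_on UNIV sq_pos"
    using sq_pos_has_derivative by (auto intro!: continuous_at_imp_continuous_on DERIV_isCont)
  show ?thesis
    unfolding cutoff_grad_def by (intro continuous_intros continuous_on_compose2[OF sq]) auto
qed

lemma cutoff_inside: "x \<in> ball 0 2 \<Longrightarrow> cutoff x = 1" "x \<in> ball 0 2 \<Longrightarrow> cutoff_grad x = 0"
proof -
  assume "x \<in> ball 0 2"
  then have "(norm x)\<^sup>2 < 2\<^sup>2" by (intro power_strict_mono) auto
  then have "x \<bullet> x - 4 \<le> 0" by (simp add: power2_norm_eq_inner)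
  then show "cutoff x = 1" "cutoff_grad x = 0" by (simp_all add: cutoff_def cutoff_grad_def sq_pos_def)
qed

lemma cutoff_support:
  assumes "x \<notin> cball 0 (5 / 2)"
  shows "cutoff x = 0" "cutoff_grad x = 0"
proof -
  have "(5 / 2)\<^sup>2 \<le> (norm x)\<^sup>2" using assms by (intro power_mono) auto
  then have "(5 / 2)\<^sup>2 \<le> x \<bullet> x" unfolding power2_norm_eq_inner .
  moreover have "(5 / 2 :: real)\<^sup>2 = 25 / 4" by (simp add: power2_eq_square)
  ultimately have "1 \<le> x \<bullet> x - 4" by linarith
  then have "1 \<le> sq_pos (x \<bullet> x - 4)" by (simp add: sq_pos_def)
  then show "cutoff x = 0" "cutoff_grad x = 0" by (simp_all add: cutoff_def cutoff_grad_def sq_pos_def)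
qed

lemma cutoff_bounds: "0 \<le> cutoff x" "cutoff x \<le> 1" "norm (cutoff_grad x) \<le> 20"
proof -
  have sq: "0 \<le> sq_pos s" for s by (simp add: sq_pos_def)
  show "0 \<le> cutoff x" by (simp add: cutoff_def sq)
  have m: "0 \<le> max 0 (1 - sq_pos (x \<bullet> x - 4))" "max 0 (1 - sq_pos (x \<bullet> x - 4)) \<le> 1" using sq[of "x \<bullet> x - 4"] by auto
  show "cutoff x \<le> 1" unfolding cutoff_def sq_pos_def[of "1 - _"] using m by (rule power_le_one)
  show "norm (cutoff_grad x) \<le> 20"
  proof (cases "max 0 (1 - sq_pos (x \<bullet> x - 4)) = 0")
    case False
    then have 1: "sq_pos (x \<bullet> x - 4) < 1" by auto
    have 2: "max 0 (x \<bullet> x - 4) \<le> 1"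
    proof (rule ccontr)
      assume "\<not> max 0 (x \<bullet> x - 4) \<le> 1"
      then have "1 < (max 0 (x \<bullet> x - 4))\<^sup>2" by (intro one_less_power) auto
      then show False using 1 by (simp add: sq_pos_def)
    qed
    have "norm x \<le> 5 / 2"
    proof (rule power2_le_imp_le)
      have "x \<bullet> x \<le> 5" using 2 by simp
      moreover have "(5 / 2 :: real)\<^sup>2 = 25 / 4" by (simp add: power2_eq_square)
      ultimately show "(norm x)\<^sup>2 \<le> (5 / 2)\<^sup>2" unfolding power2_norm_eq_inner by linarith
    qed simp
    \<comment> \<open>Where the gradient does not vanish, \<open>norm x \<le> 5 / 2\<close> and both
      truncated factors are at most \<open>1\<close>.\<close>
    then have "norm (cutoff_grad x) \<le> 8 * 1 * 1 * (5 / 2)"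
      unfolding cutoff_grad_def norm_scaleR abs_mult using m 2 by (intro mult_mono) auto
    then show ?thesis by simp
  qed (simp add: cutoff_grad_def)
qed

lemma cutoff_compactly_inside: "ball 0 3 \<subseteq> U \<Longrightarrow> compactly_inside {x. cutoff x \<noteq> 0} U"
proof -
  assume U: "ball 0 3 \<subseteq> U"
  have sub: "closure {x. cutoff x \<noteq> 0} \<subseteq> cball (0::'a) (5 / 2)"
    by (rule closure_minimal) (use cutoff_support(1) in blast, simp)
  also have "\<dots> \<subseteq> ball 0 3" by auto
  finally have "closure {x. cutoff x \<noteq> 0} \<subseteq> U" using U by blast
  moreover have "compact (closure {x. cutoff x \<noteq> (0::real)} :: 'a set)"
    using sub by (meson bounded_cball bounded_subset closed_closure compact_eq_bounded_closed)
  ultimately show ?thesis by (simp add: compactly_inside_def)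
qed

text \<open>The radius 2 leaves room for all balls of radius at most \<open>1\<close> about points
  of the ball of radius 1/2, and stays inside the ball of radius 3 contained in
  \<open>U\<close>.\<close>

abbreviation "M2 \<equiv> lebesgue_on (ball 0 2)"

lemma integrable_M2_continuous_mult:
  fixes u :: "'a::euclidean_space \<Rightarrow> real"
  assumes "continuous_on UNIV u" "\<And>x. x \<in> ball 0 2 \<Longrightarrow> \<bar>u x\<bar> \<le> C" "integrable M2 h"
  shows "integrable M2 (\<lambda>x. u x * h x)"
proof (rule Bochner_Integration.integrable_bound[of _ "\<lambda>x. C * h x"])
  show "integrable M2 (\<lambda>x. C * h x)" using assms by simp
  have "u \<in> borel_measurable M2"
    using assms(1) by (intro measurable_restrict_space1 measurable_completion) (simp add: borel_measurable_continuous_onI)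
  then show "(\<lambda>x. u x * h x) \<in> borel_measurable M2" using assms(3) by auto
  show "AE x in M2. norm (u x * h x) \<le> norm (C * h x)"
  proof (rule AE_I2)
    fix x assume "x \<in> space (M2 :: 'a measure)"
    then have "\<bar>u x\<bar> \<le> C" using assms(2) by (simp add: space_restrict_space)
    then have "\<bar>u x\<bar> \<le> \<bar>C\<bar>" by linarith
    then show "norm (u x * h x) \<le> norm (C * h x)" by (simp add: abs_mult mult_right_mono)
  qed
qed

section \<open>Integrability over the ball of radius 2\<close>

context stationary_map
begin

lemma ball2_U: "ball 0 2 \<subseteq> U"
  using ball_U by (rule order_trans[rotated]) auto

lemma to_M2:
  fixes G :: "real^'m \<Rightarrow> real"
  assumes "integrable (lebesgue_on U) G" "\<And>x. x \<in> U \<Longrightarrow> x \<notin> ball 0 2 \<Longrightarrow> G x = 0"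
  shows "integrable M2 G" "(LINT x|M2. G x) = (LINT x|lebesgue_on U. G x)"
proof -
  have eq: "(\<lambda>x. indicator U x *\<^sub>R G x) = (\<lambda>x. indicator (ball 0 2) x *\<^sub>R G x)"
    using assms(2) ball2_U by (auto simp: fun_eq_iff indicator_def)
  show "integrable M2 G"
    using assms(1) eq by (simp add: set_integrable_lebesgue_on(1)[symmetric] U_lebesgue set_integrable_def)
  show "(LINT x|M2. G x) = (LINT x|lebesgue_on U. G x)"
    using eq by (simp add: set_integrable_lebesgue_on(2)[symmetric] U_lebesgue set_lebesgue_integral_def)
qed

lemma restrict_M2:
  fixes G :: "real^'m \<Rightarrow> real"
  assumes "integrable (lebesgue_on U) G"
  shows "integrable M2 G"
  using set_integrable_subset[of lebesgue U G "ball 0 2"] assms ball2_U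
  by (simp add: set_integrable_lebesgue_on U_lebesgue)

text \<open>Where \<open>cutoff\<close> equals \<open>1\<close> its gradient vanishes, and the
  integrand of the first variation reduces to \<open>2 * good_energy f x\<close>. Measurability of
  \<open>good_energy\<close> is thus a consequence of squash stationarity.\<close>

lemma integrable_good_energy: "integrable M2 (good_energy f)"
proof -
  have "integrable M2 (\<lambda>x. 2 * cutoff x * good_energy f x + 2 * cross_term f x (cutoff_grad x))"
  proof (rule restrict_M2, rule squash_identity(1)[of _ _ 20])
    show "\<bar>cutoff x\<bar> \<le> 20" for x :: "real^'m" using cutoff_bounds(1,2)[of x] by simp
  qed (use cutoff_bounds continuous_cutoff_grad cutoff_has_derivative cutoff_compactly_inside[OF ball_U] in auto)
  then have "integrable M2 (\<lambda>x. 2 * good_energy f x)"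
    by (rule Bochner_Integration.integrable_cong[THEN iffD1, rotated 2])
      (auto simp: space_restrict_space cutoff_inside cross_term_scale[of _ _ 0, simplified])
  from integrable_mult_right[OF this, of "1 / 2"] show ?thesis by simp
qed

lemma integrable_Df_norm_M2: "integrable M2 (\<lambda>x. (Df_norm f x)\<^sup>2)"
  by (rule restrict_M2[OF integrable_Df_norm])

lemma integrable_bad_energy: "integrable M2 (bad_energy f)"
proof -
  have "bad_energy f = (\<lambda>x. (Df_norm f x)\<^sup>2 - good_energy f x)" by (simp add: Df_norm_sq_split)
  then show ?thesis using integrable_Df_norm_M2 integrable_good_energy by simp
qed

end

lemma abs_radial_bump_le: "\<bar>radial_bump a r x\<bar> \<le> 1"
  using radial_bump_bounds[of a r x] by simp

text \<open>The bump depends on |x - a| / r only, so differentiation in \<open>r\<close> reproduces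
  its slope. This is how the squeeze identity comes to express the derivative of the energy in the
  radius.\<close>

lemma radial_bump_radius_derivative:
  assumes "0 < r"
  shows "((\<lambda>r. radial_bump a r x) has_real_derivative - bump_slope a r x * (norm (x - a))\<^sup>2 / r) (at r)"
proof -
  have "((\<lambda>r. 1 - (norm (x - a))\<^sup>2 / r\<^sup>2) has_real_derivative 2 * (norm (x - a))\<^sup>2 / r ^ 3) (at r)"
    using assms by (auto intro!: derivative_eq_intros simp: field_simps power2_eq_square power3_eq_cube)
  from DERIV_chain2[OF bump_has_derivative this, of 0]
  show ?thesis using assms by (simp add: radial_bump_def bump_slope_def numeral_2_eq_2 field_simps power3_eq_cube)
qed

section \<open>Smoothed energies and the two first-variation relations\<close>

context stationary_map
begin

definition bump_energy :: "real^'m \<Rightarrow> real \<Rightarrow> real"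
  where "bump_energy a r = (LINT x|M2. radial_bump a r x * (Df_norm f x)\<^sup>2)"

context
  fixes a :: "real^'m"
  assumes a: "a \<in> ball 0 (1 / 2)"
begin

lemma dist_ball2: "x \<in> ball 0 2 \<Longrightarrow> (norm (x - a))\<^sup>2 \<le> 9"
proof -
  assume "x \<in> ball 0 2"
  then have "norm (x - a) \<le> 3" using a norm_triangle_ineq4[of x a] by simp
  then have "(norm (x - a))\<^sup>2 \<le> 3\<^sup>2" by (intro power_mono) auto
  then show ?thesis by simp
qed

lemma ball_a_subset: "0 < r \<Longrightarrow> r \<le> 1 \<Longrightarrow> ball a r \<subseteq> ball 0 2" "0 < r \<Longrightarrow> r \<le> 1 \<Longrightarrow> cball a r \<subseteq> U"
  "0 < r \<Longrightarrow> r \<le> 1 / 2 \<Longrightarrow> ball a r \<subseteq> ball 0 1"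
proof -
  have *: "norm x < 1 / 2 + s" if "dist a x \<le> s" for x s
    using a that norm_triangle_ineq4[of a "a - x"] by (simp add: dist_norm)
  have **: "norm x < 1 / 2 + s" if "dist a x < s" for x s
    using *[of x s] that by simp
  show "0 < r \<Longrightarrow> r \<le> 1 \<Longrightarrow> ball a r \<subseteq> ball 0 2" using ** by force
  show "0 < r \<Longrightarrow> r \<le> 1 / 2 \<Longrightarrow> ball a r \<subseteq> ball 0 1" using ** by force
  have "0 < r \<Longrightarrow> r \<le> 1 \<Longrightarrow> cball a r \<subseteq> ball 0 3" using * by force
  then show "0 < r \<Longrightarrow> r \<le> 1 \<Longrightarrow> cball a r \<subseteq> U" using ball_U by blast
qed

lemma bump_energy_DERIV:
  assumes r: "0 < r"
  shows "(bump_energy a has_real_derivative (LINT x|M2. (- bump_slope a r x * (norm (x - a))\<^sup>2 / r) * (Df_norm f x)\<^sup>2)) (at r)"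
proof -
  have "((\<lambda>t. LINT x|M2. radial_bump a t x * (Df_norm f x)\<^sup>2) has_real_derivative
      (LINT x|M2. (- bump_slope a r x * (norm (x - a))\<^sup>2 / r) * (Df_norm f x)\<^sup>2)) (at r)"
  \<comment> \<open>For \<open>s\<close> in \<open>{r / 2..2 * r}\<close> and distances at most
    \<open>3\<close>, the derivative is at most \<open>4 / s\<^sup>2 * 9 / s\<close>, hence at most
    \<open>288 / r ^ 3\<close>.\<close>
  proof (rule DERIV_integral(2)[of _ _ _ _ "\<lambda>x. (288 / r ^ 3) * (Df_norm f x)\<^sup>2"])
    show "\<forall>\<^sub>F t in nhds r. integrable M2 (\<lambda>x. radial_bump a t x * (Df_norm f x)\<^sup>2)"
      by (intro always_eventually allI integrable_M2_continuous_mult[of _ 1] continuous_radial_bump integrable_Df_norm_M2 abs_radial_bump_le)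
    show "((\<lambda>t. radial_bump a t x * (Df_norm f x)\<^sup>2) has_real_derivative (- bump_slope a r x * (norm (x - a))\<^sup>2 / r) * (Df_norm f x)\<^sup>2) (at r)" for x
      by (intro DERIV_cmult_right radial_bump_radius_derivative r)
    show "integrable M2 (\<lambda>x. 288 / r ^ 3 * (Df_norm f x)\<^sup>2)" using integrable_Df_norm_M2 by simp
    have "\<forall>\<^sub>F t in nhds r. t \<in> {r / 2<..<2 * r}" using r by (intro eventually_nhds_in_open) auto
    then show "\<forall>\<^sub>F t in at r. \<forall>x\<in>space M2. \<bar>radial_bump a t x * (Df_norm f x)\<^sup>2 - radial_bump a r x * (Df_norm f x)\<^sup>2\<bar>
        \<le> \<bar>t - r\<bar> * (288 / r ^ 3 * (Df_norm f x)\<^sup>2)"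
    proof (rule eventually_mono[OF filter_leD[OF at_within_le_nhds]], intro ballI)
      fix t and x :: "real^'m" assume t: "t \<in> {r / 2<..<2 * r}" and "x \<in> space M2"
      then have n: "(norm (x - a))\<^sup>2 \<le> 9" using dist_ball2 by (simp add: space_restrict_space)
      have "norm (radial_bump a t x - radial_bump a r x) \<le> 288 / r ^ 3 * norm (t - r)"
      proof (rule field_differentiable_bound[of "{r / 2..2 * r}" "\<lambda>t. radial_bump a t x" "\<lambda>s. - bump_slope a s x * (norm (x - a))\<^sup>2 / s"])
        fix s assume s: "s \<in> {r / 2..2 * r}"
        then have s0: "0 < s" using r by auto
        show "((\<lambda>t. radial_bump a t x) has_real_derivative - bump_slope a s x * (norm (x - a))\<^sup>2 / s) (at s within {r / 2..2 * r})"
          by (rule has_field_derivative_at_within[OF radial_bump_radius_derivative[OF s0]])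
        have "\<bar>bump_slope a s x\<bar> * (norm (x - a))\<^sup>2 / s \<le> 4 / s\<^sup>2 * 9 / s"
          using bump_slope_bound[of a s x] n s0 by (intro divide_right_mono mult_mono) auto
        also have "\<dots> = 36 / s ^ 3" using s0 by (simp add: power2_eq_square power3_eq_cube)
        also have "\<dots> \<le> 36 / (r / 2) ^ 3" using s r by (intro divide_left_mono power_mono) auto
        also have "\<dots> = 288 / r ^ 3" by (simp add: power_divide)
        finally show "norm (- bump_slope a s x * (norm (x - a))\<^sup>2 / s) \<le> 288 / r ^ 3"
          using s0 by (simp add: abs_mult)
      qed (use t r in auto)
      then have "\<bar>radial_bump a t x - radial_bump a r x\<bar> * (Df_norm f x)\<^sup>2 \<le> 288 / r ^ 3 * \<bar>t - r\<bar> * (Df_norm f x)\<^sup>2"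
        by (intro mult_right_mono) auto
      then show "\<bar>radial_bump a t x * (Df_norm f x)\<^sup>2 - radial_bump a r x * (Df_norm f x)\<^sup>2\<bar> \<le> \<bar>t - r\<bar> * (288 / r ^ 3 * (Df_norm f x)\<^sup>2)"
        by (simp add: abs_mult mult_ac flip: left_diff_distrib)
    qed
  qed
  then show ?thesis by (simp add: bump_energy_def[abs_def])
qed

definition good_bump_energy :: "real \<Rightarrow> real"
  where "good_bump_energy r = (LINT x|M2. radial_bump a r x * good_energy f x)"

definition bad_bump_energy :: "real \<Rightarrow> real"
  where "bad_bump_energy r = (LINT x|M2. radial_bump a r x * bad_energy f x)"

text \<open>Smoothed counterpart of the radial boundary integral that appears for sharp
  balls.\<close>

definition radial_energy :: "real \<Rightarrow> real"
  where "radial_energy r = (LINT x|M2. - bump_slope a r x * directional_energy f x (x - a))"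

lemma integrable_bump_energies:
  "integrable M2 (\<lambda>x. radial_bump a r x * good_energy f x)"
  "integrable M2 (\<lambda>x. radial_bump a r x * bad_energy f x)"
  by (intro integrable_M2_continuous_mult[of _ 1] continuous_radial_bump integrable_good_energy integrable_bad_energy abs_radial_bump_le)+

lemma bump_energy_split: "bump_energy a r = good_bump_energy r + bad_bump_energy r"
  unfolding bump_energy_def good_bump_energy_def bad_bump_energy_def Df_norm_sq_split distrib_left
  by (rule Bochner_Integration.integral_add) (rule integrable_bump_energies)+

lemma good_bump_energy_nonneg: "0 \<le> good_bump_energy r"
  unfolding good_bump_energy_def
  by (intro Bochner_Integration.integral_nonneg mult_nonneg_nonneg radial_bump_bounds good_energy_nonneg)

lemma bad_bump_energy_nonneg: "0 \<le> bad_bump_energy r"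
  unfolding bad_bump_energy_def
  by (intro Bochner_Integration.integral_nonneg mult_nonneg_nonneg radial_bump_bounds bad_energy_nonneg)

lemma radial_energy_nonneg: "0 \<le> radial_energy r"
  unfolding radial_energy_def using bump_slope_nonpos directional_energy_nonneg
  by (intro Bochner_Integration.integral_nonneg mult_nonneg_nonneg) auto

lemma measure_ball: "0 < r \<Longrightarrow> measure lebesgue (ball a r) = unit_ball_vol (real CARD('m)) * r ^ CARD('m)"
  using content_ball[of r a] by simp

lemma integral_indicator_ball:
  assumes "0 < r" "r \<le> 1"
  shows "integrable M2 (indicator (ball a r) :: _ \<Rightarrow> real)"
    "(LINT x|M2. indicator (ball a r) x) = unit_ball_vol (real CARD('m)) * r ^ CARD('m)"
proof -
  have eq: "(\<lambda>x. indicator (ball 0 2) x *\<^sub>R (indicator (ball a r) x :: real)) = indicator (ball a r)"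
    using ball_a_subset(1)[OF assms] by (auto simp: fun_eq_iff indicator_def)
  have fin: "emeasure lebesgue (ball a r) < \<infinity>" using assms by (simp add: emeasure_ball)
  show "integrable M2 (indicator (ball a r) :: _ \<Rightarrow> real)"
    using fin by (simp add: set_integrable_lebesgue_on(1)[symmetric] set_integrable_def eq del: real_scaleR_def)
  have "(LINT x|M2. indicator (ball a r) x) = (LINT x:ball 0 2|lebesgue. (indicator (ball a r) x :: real))"
    by (rule set_integrable_lebesgue_on(2)[symmetric]) simp
  also have "\<dots> = measure lebesgue (ball a r)" unfolding set_lebesgue_integral_def eq by simp
  also have "\<dots> = unit_ball_vol (real CARD('m)) * r ^ CARD('m)" by (rule measure_ball[OF assms(1)])
  finally show "(LINT x|M2. indicator (ball a r) x) = unit_ball_vol (real CARD('m)) * r ^ CARD('m)" .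
qed

text \<open>The density is bounded by a constant, so after multiplication by r^(2-m) this part is of
  order r^2.\<close>

lemma bad_bump_energy_le:
  assumes "0 < r" "r \<le> 1"
  shows "bad_bump_energy r \<le> junk_energy TYPE('h \<times> ((real^'m) \<Rightarrow>\<^sub>L 'h)) * unit_ball_vol (real CARD('m)) * r ^ CARD('m)"
proof -
  let ?J = "junk_energy TYPE('h \<times> ((real^'m) \<Rightarrow>\<^sub>L 'h))"
  have "bad_bump_energy r \<le> (LINT x|M2. ?J * indicator (ball a r) x)"
    unfolding bad_bump_energy_def
  proof (rule integral_mono[OF integrable_bump_energies(2)])
    show "integrable M2 (\<lambda>x. ?J * indicator (ball a r) x)" using integral_indicator_ball[OF assms] by simp
    show "radial_bump a r x * bad_energy f x \<le> ?J * indicator (ball a r) x" for x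
    proof (cases "x \<in> ball a r")
      case True
      have "radial_bump a r x * bad_energy f x \<le> 1 * ?J"
        using radial_bump_bounds bad_energy_nonneg bad_energy_le by (intro mult_mono) auto
      then show ?thesis using True by simp
    qed (use assms in \<open>simp add: radial_bump_outside\<close>)
  qed
  also have "\<dots> = ?J * unit_ball_vol (real CARD('m)) * r ^ CARD('m)"
    using integral_indicator_ball[OF assms] by simp
  finally show ?thesis .
qed

text \<open>The left side of the identity is \<open>r\<close> times the derivative of
  \<open>bump_energy\<close> in the radius: this is the monotonicity formula before scaling.\<close>

lemma squeeze_relation:
  assumes r: "0 < r" "r \<le> 1"
  shows "integrable M2 (\<lambda>x. - bump_slope a r x * directional_energy f x (x - a))"
    "(LINT x|M2. - bump_slope a r x * (norm (x - a))\<^sup>2 * (Df_norm f x)\<^sup>2)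
      = real CARD('m) * bump_energy a r - 2 * good_bump_energy r + 2 * radial_energy r"
proof -
  define G where "G = (\<lambda>x. 2 * radial_bump a r x * good_energy f x + 2 * bump_slope a r x * directional_energy f x (x - a)
    - (real CARD('m) * radial_bump a r x + bump_slope a r x * (norm (x - a))\<^sup>2) * (good_energy f x + bad_energy f x))"
  note id = squeeze_identity[OF r(1) ball_a_subset(2)[OF r], folded G_def]
  have out: "G x = 0" if "x \<in> U" "x \<notin> ball 0 2" for x
  proof -
    have "x \<notin> ball a r" using ball_a_subset(1)[OF r] that by blast
    then show ?thesis using r by (simp add: G_def radial_bump_outside bump_slope_outside)
  qed
  have G: "integrable M2 G" "(LINT x|M2. G x) = (LINT x|lebesgue_on U. G x)"
    by (rule to_M2[OF id(1)], rule out, assumption+)+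
  have e: "integrable M2 (\<lambda>x. radial_bump a r x * (Df_norm f x)\<^sup>2)"
    by (intro integrable_M2_continuous_mult[of _ 1] continuous_radial_bump integrable_Df_norm_M2 abs_radial_bump_le)
  have k: "integrable M2 (\<lambda>x. (bump_slope a r x * (norm (x - a))\<^sup>2) * (Df_norm f x)\<^sup>2)"
    using bump_slope_norm_sq[OF r(1)]
    by (intro integrable_M2_continuous_mult[of _ 4] continuous_intros continuous_bump_slope integrable_Df_norm_M2) (auto simp: abs_mult)
  note i = integrable_bump_energies(1)[of r]
  \<comment> \<open>The directional term is solved for from \<open>G\<close>; its integrability is
    inherited from terms already known to be integrable.\<close>
  have eq: "- bump_slope a r x * directional_energy f x (x - a) = radial_bump a r x * good_energy f x
      - real CARD('m) / 2 * (radial_bump a r x * (Df_norm f x)\<^sup>2) - 1 / 2 * ((bump_slope a r x * (norm (x - a))\<^sup>2) * (Df_norm f x)\<^sup>2) - 1 / 2 * G x" for x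
    by (simp add: G_def Df_norm_sq_split field_simps)
  show "integrable M2 (\<lambda>x. - bump_slope a r x * directional_energy f x (x - a))"
    unfolding eq using i e k G(1) by (intro Bochner_Integration.integrable_diff integrable_mult_right)
  have "radial_energy r = good_bump_energy r - real CARD('m) / 2 * bump_energy a r
      - 1 / 2 * (LINT x|M2. (bump_slope a r x * (norm (x - a))\<^sup>2) * (Df_norm f x)\<^sup>2) - 1 / 2 * (LINT x|M2. G x)"
    unfolding radial_energy_def good_bump_energy_def bump_energy_def eq using i e k G(1)
    by (subst Bochner_Integration.integral_diff | intro Bochner_Integration.integrable_diff integrable_mult_right | simp only: integral_mult_right_zero | assumption)+
  then show "(LINT x|M2. - bump_slope a r x * (norm (x - a))\<^sup>2 * (Df_norm f x)\<^sup>2)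
      = real CARD('m) * bump_energy a r - 2 * good_bump_energy r + 2 * radial_energy r"
    using G(2) id(2) by simp
qed

text \<open>The squash identity turns the energy into a cross term, and \<open>cross_term_le\<close>
  separates its two factors with a free weight \<open>l\<close>. Using \<open>M\<^sup>2 + 1\<close>
  keeps the coefficient positive even for \<open>M = 0\<close>, as \<open>quadratic_weight\<close>
  requires.\<close>

lemma squash_relation:
  assumes r: "0 < r" "r \<le> 1 / 2" and l: "0 < l"
    and M: "AE x in lebesgue. x \<in> ball 0 1 \<longrightarrow> QQ_norm (f x) \<le> M" "0 \<le> M"
  shows "2 * good_bump_energy r \<le> l * (4 / r\<^sup>2 * (M\<^sup>2 + 1) * (unit_ball_vol (real CARD('m)) * r ^ CARD('m))) + radial_energy r / l"
proof -
  have r1: "r \<le> 1" using r by simp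
  let ?g = "\<lambda>x. bump_slope a r x *\<^sub>R (x - a)"
  define G where "G = (\<lambda>x. 2 * radial_bump a r x * good_energy f x + 2 * cross_term f x (?g x))"
  have supp: "compactly_inside {x. radial_bump a r x \<noteq> 0} U"
  proof -
    have sub: "closure {x. radial_bump a r x \<noteq> 0} \<subseteq> cball a r"
      by (rule closure_minimal) (use radial_bump_outside[OF r(1)] ball_subset_cball[of a r] in blast, simp)
    moreover have "compact (closure {x. radial_bump a r x \<noteq> 0})"
      using sub by (meson bounded_cball bounded_subset closed_closure compact_eq_bounded_closed)
    ultimately show ?thesis using ball_a_subset(2)[OF r(1) r1] by (auto simp: compactly_inside_def)
  qed
  have b1: "\<bar>radial_bump a r x\<bar> \<le> max 1 (4 / r)" for x using radial_bump_bounds[of a r x] by simp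
  have b2: "norm (?g x) \<le> max 1 (4 / r)" for x using bump_slope_norm[OF r(1), of a x] by simp
  have cont: "continuous_on UNIV ?g" by (intro continuous_intros continuous_bump_slope)
  note id = squash_identity[OF radial_bump_has_derivative cont supp b1 b2, folded G_def]
  have out: "G x = 0" if "x \<in> U" "x \<notin> ball 0 2" for x
  proof -
    have "x \<notin> ball a r" using ball_a_subset(1)[OF r(1) r1] that by blast
    then show ?thesis using r by (simp add: G_def radial_bump_outside bump_slope_outside cross_term_scale[of _ _ 0, simplified])
  qed
  have G: "integrable M2 G" "(LINT x|M2. G x) = (LINT x|lebesgue_on U. G x)"
    by (rule to_M2[OF id(1)], rule out, assumption+)+
  note i = integrable_bump_energies(1)[of r]
  \<comment> \<open>Measurability of the cross term is read off from \<open>G\<close> as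
    well.\<close>
  have ic: "integrable M2 (\<lambda>x. cross_term f x (?g x))"
  proof -
    have "cross_term f x (?g x) = 1 / 2 * G x - radial_bump a r x * good_energy f x" for x by (simp add: G_def field_simps)
    then show ?thesis using i G(1) by (simp only: ) (intro Bochner_Integration.integrable_diff integrable_mult_right)
  qed
  have "(LINT x|M2. G x) = 2 * good_bump_energy r + 2 * (LINT x|M2. cross_term f x (?g x))"
  proof -
    have "G = (\<lambda>x. 2 * (radial_bump a r x * good_energy f x) + 2 * cross_term f x (?g x))"
      by (simp add: G_def mult.assoc)
    then show ?thesis
      unfolding good_bump_energy_def
      using Bochner_Integration.integral_add[OF integrable_mult_right[OF i, of 2] integrable_mult_right[OF ic, of 2]] by simp
  qed
  then have "2 * good_bump_energy r = (LINT x|M2. - 2 * cross_term f x (?g x))"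
    using G(2) id(2) ic by simp
  also have "\<dots> \<le> (LINT x|M2. l * (4 / r\<^sup>2 * (M\<^sup>2 + 1)) * indicator (ball a r) x + (- bump_slope a r x * directional_energy f x (x - a)) / l)"
  proof (rule integral_mono_AE)
    show "integrable M2 (\<lambda>x. - 2 * cross_term f x (?g x))" using ic by simp
    show "integrable M2 (\<lambda>x. l * (4 / r\<^sup>2 * (M\<^sup>2 + 1)) * indicator (ball a r) x + (- bump_slope a r x * directional_energy f x (x - a)) / l)"
      using integral_indicator_ball(1)[OF r(1) r1] squeeze_relation(1)[OF r(1) r1]
      by (intro Bochner_Integration.integrable_add integrable_mult_right integrable_divide) auto
    have "AE x in M2. x \<in> ball 0 1 \<longrightarrow> QQ_norm (f x) \<le> M"
      using M(1) by (simp add: AE_restrict_space_iff) (auto elim: eventually_mono)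
    then show "AE x in M2. - 2 * cross_term f x (?g x) \<le> l * (4 / r\<^sup>2 * (M\<^sup>2 + 1)) * indicator (ball a r) x + (- bump_slope a r x * directional_energy f x (x - a)) / l"
    proof eventually_elim
      case (elim x)
      show ?case
      proof (cases "x \<in> ball a r")
        case True
        then have "QQ_norm (f x) \<le> M" using elim ball_a_subset(3)[OF r] by blast
        then have q: "(QQ_norm (f x))\<^sup>2 \<le> M\<^sup>2 + 1" using power_mono[OF _ QQ_norm_nonneg, of "f x" M 2] by simp
        let ?k = "- bump_slope a r x"
        have k: "0 \<le> ?k" "?k \<le> 4 / r\<^sup>2" using bump_slope_nonpos[of a r x] bump_slope_bound[of a r x] by auto
        have "- 2 * cross_term f x (?g x) = ?k * (2 * cross_term f x (x - a))" by (simp add: cross_term_scale)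
        also have "\<dots> \<le> ?k * (l * (QQ_norm (f x))\<^sup>2 + directional_energy f x (x - a) / l)"
          using cross_term_le[OF l, of f x "x - a"] k(1) by (intro mult_left_mono) auto
        also have "\<dots> = l * (?k * (QQ_norm (f x))\<^sup>2) + ?k * directional_energy f x (x - a) / l" by (simp add: algebra_simps)
        also have "l * (?k * (QQ_norm (f x))\<^sup>2) \<le> l * (4 / r\<^sup>2 * (M\<^sup>2 + 1))"
          using k q l by (intro mult_left_mono mult_mono) auto
        finally show ?thesis using True by simp
      qed (use r in \<open>simp add: bump_slope_outside cross_term_scale[of _ _ 0, simplified]\<close>)
    qed
  qed
  also have "\<dots> = l * (4 / r\<^sup>2 * (M\<^sup>2 + 1)) * (unit_ball_vol (real CARD('m)) * r ^ CARD('m)) + radial_energy r / l"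
    unfolding radial_energy_def
      Bochner_Integration.integral_add[OF integrable_mult_right[OF integral_indicator_ball(1)[OF r(1) r1]]
        integrable_divide[OF squeeze_relation(1)[OF r(1) r1]]]
      integral_mult_right_zero integral_divide_zero integral_indicator_ball(2)[OF r(1) r1] ..
  finally show ?thesis by (simp add: mult.assoc)
qed

end

end

text \<open>The first entry comes from Cauchy-Schwarz and the bound \<open>M\<close>; the second
  controls the square of the correction \<open>K * s\<^sup>2\<close> in the differential
  inequality.\<close>

definition decay_rate :: "('h::real_normed_vector \<times> ((real^'m) \<Rightarrow>\<^sub>L 'h)) itself \<Rightarrow> real \<Rightarrow> real"
  where "decay_rate T M = min (1 / (4 * (M\<^sup>2 + 1) * unit_ball_vol (real CARD('m))))
    (1 / (4 * (junk_energy T * unit_ball_vol (real CARD('m)) + 1)))"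

text \<open>The first summand covers radii of at least 1/16 by the total energy, the second the
  smaller radii by logarithmic decay.\<close>

definition decay_const :: "('h::real_normed_vector \<times> ((real^'m) \<Rightarrow>\<^sub>L 'h)) itself \<Rightarrow> real \<Rightarrow> real \<Rightarrow> real"
  where "decay_const T M E = 4 * 16 ^ CARD('m) * \<bar>E\<bar> + 2 * 2 ^ CARD('m) / (bump 0 (3 / 4) * decay_rate T M)"

lemma decay_rate_pos: "0 < decay_rate T M"
  by (auto simp: decay_rate_def intro!: mult_pos_pos add_nonneg_pos mult_nonneg_nonneg junk_energy_nonneg less_imp_le[OF unit_ball_vol_pos])

lemma bump_pos: "0 < t \<Longrightarrow> 0 < bump n t"
  by (simp add: bump_def)

lemma decay_const_pos: "0 < decay_const T M E"
  unfolding decay_const_def by (intro add_nonneg_pos divide_pos_pos mult_pos_pos decay_rate_pos bump_pos) auto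

lemma powr_eq_quotient: "0 < (r::real) \<Longrightarrow> r powr (2 - real n) = r\<^sup>2 / r ^ n"
  by (simp add: powr_diff powr_realpow powr_numeral)

section \<open>The differential inequality and its integration\<close>

context stationary_map
begin

context
  fixes a :: "real^'m" and M :: real
  assumes a: "a \<in> ball 0 (1 / 2)"
    and M: "AE x in lebesgue. x \<in> ball 0 1 \<longrightarrow> QQ_norm (f x) \<le> M" "0 \<le> M"
begin

text \<open>Multiplication by \<open>s powr (2 - real m)\<close> cancels the dimensional terms of
  the squeeze relation. The squash relation then bounds the square of the scaled good energy by the
  scaled radial energy, which is the inequality that \<open>log_decay\<close> asks for.\<close>

lemma bump_energy_decay:
  assumes r: "0 < r" "r < 1 / 2"
  shows "r powr (2 - real CARD('m)) * bump_energy a r \<le> 1 / (decay_rate TYPE('h \<times> ((real^'m) \<Rightarrow>\<^sub>L 'h)) M * ln (1 / 2 / r))"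
proof -
  define m where "m = CARD('m)"
  define V where "V = unit_ball_vol (real m)"
  define K where "K = junk_energy TYPE('h \<times> ((real^'m) \<Rightarrow>\<^sub>L 'h)) * V + 1"
  define c where "c = decay_rate TYPE('h \<times> ((real^'m) \<Rightarrow>\<^sub>L 'h)) M"
  have V: "0 < V" by (simp add: V_def)
  have K: "1 \<le> K" using mult_nonneg_nonneg[OF junk_energy_nonneg less_imp_le[OF V]] by (simp add: K_def)
  have c: "0 < c" "c \<le> 1 / (4 * (M\<^sup>2 + 1) * V)" "c \<le> 1 / (4 * K)"
    using decay_rate_pos by (auto simp: c_def decay_rate_def V_def K_def m_def)
  \<comment> \<open>The term \<open>K * s\<^sup>2\<close> makes \<open>F\<close> positive and
    dominates the scaled bad energy; its own derivative pays for its square.\<close>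
  define F where "F s = s powr (2 - real m) * bump_energy a s + K * s\<^sup>2" for s
  define F' where "F' s = ((2 - real m) * s powr (2 - real m - 1)) * bump_energy a s
    + ((real m * bump_energy a s - 2 * good_bump_energy a s + 2 * radial_energy a s) / s) * s powr (2 - real m) + K * (2 * s)" for s
  have "F r \<le> 1 / (c * ln (1 / 2 / r))"
  proof (rule log_decay[of "1 / 2" F F'])
    fix s :: real assume s: "0 < s" "s \<le> 1 / 2"
    have s1: "s \<le> 1" using s by simp
    have "(LINT x|M2. - bump_slope a s x * (norm (x - a))\<^sup>2 / s * (Df_norm f x)\<^sup>2)
        = (LINT x|M2. - bump_slope a s x * (norm (x - a))\<^sup>2 * (Df_norm f x)\<^sup>2) / s"
      by (simp flip: integral_divide_zero)
    then have "(bump_energy a has_real_derivative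
        (real m * bump_energy a s - 2 * good_bump_energy a s + 2 * radial_energy a s) / s) (at s)"
      using bump_energy_DERIV[OF a s(1)] unfolding squeeze_relation(2)[OF a s(1) s1] m_def by simp
    from DERIV_mult[OF has_real_derivative_powr[OF s(1), of "2 - real m"] this]
    have 1: "((\<lambda>s. s powr (2 - real m) * bump_energy a s) has_real_derivative
      ((2 - real m) * s powr (2 - real m - 1)) * bump_energy a s
    + ((real m * bump_energy a s - 2 * good_bump_energy a s + 2 * radial_energy a s) / s) * s powr (2 - real m)) (at s)" .
    have 2: "((\<lambda>s. K * s\<^sup>2) has_real_derivative K * (2 * s)) (at s)" by (auto intro!: derivative_eq_intros)
    show "(F has_real_derivative F' s) (at s)"
      using DERIV_add[OF 1 2] by (simp add: F_def[abs_def] F'_def)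
    define w where "w = s powr (2 - real m)"
    have w: "0 < w" "w * s ^ m = s\<^sup>2" using s by (auto simp: w_def powr_eq_quotient)
    define X where "X = w * good_bump_energy a s"
    have X: "0 \<le> X" using w good_bump_energy_nonneg[OF a] by (simp add: X_def)
    have wB: "w * bad_bump_energy a s \<le> K * s\<^sup>2"
    proof -
      have "w * bad_bump_energy a s \<le> w * ((K - 1) * s ^ m)"
        using bad_bump_energy_le[OF a s(1) s1] w by (intro mult_left_mono) (auto simp: K_def V_def m_def)
      also have "\<dots> = (K - 1) * s\<^sup>2" using w(2) by (simp add: mult.left_commute)
      also have "\<dots> \<le> K * s\<^sup>2" by (intro mult_right_mono) auto
      finally show ?thesis .
    qed
    have F: "F s = X + w * bad_bump_energy a s + K * s\<^sup>2"
      by (simp add: F_def X_def w_def bump_energy_split[OF a] distrib_left)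
    show "0 < F s"
      unfolding F using X w K s bad_bump_energy_nonneg[OF a] by (intro add_nonneg_pos add_nonneg_nonneg) auto
    have pw: "s * s powr (2 - real m - 1) = w"
      using s powr_mult_base[of s "2 - real m - 1"] by (simp add: w_def)
    define q where "q = real m * bump_energy a s - 2 * good_bump_energy a s + 2 * radial_energy a s"
    have "s * F' s = (2 - real m) * (s * s powr (2 - real m - 1)) * bump_energy a s + (s * (q / s)) * w + 2 * (K * s\<^sup>2)"
      unfolding F'_def w_def q_def[symmetric] by (simp only: distrib_left power2_eq_square mult_ac)
    also have "s * (q / s) = q" using s by simp
    finally have "s * F' s = (2 - real m) * (s * s powr (2 - real m - 1)) * bump_energy a s + q * w + 2 * (K * s\<^sup>2)" .
    \<comment> \<open>The terms with \<open>real m\<close> cancel between the power and the squeeze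
      relation, and so do the good energies.\<close>
    also have "\<dots> = 2 * (w * bad_bump_energy a s) + 2 * (w * radial_energy a s) + 2 * (K * s\<^sup>2)"
      unfolding pw q_def bump_energy_split[OF a] by (simp add: algebra_simps)
    finally have sF': "s * F' s = 2 * (w * bad_bump_energy a s) + 2 * (w * radial_energy a s) + 2 * (K * s\<^sup>2)" .
    define A where "A = 4 / s\<^sup>2 * (M\<^sup>2 + 1) * (V * s ^ m)"
    have M1: "0 < M\<^sup>2 + 1" by (simp add: add_nonneg_pos)
    have A: "0 < A" using s V M1 by (simp add: A_def)
    have wA: "w * A = 4 * (M\<^sup>2 + 1) * V"
    proof -
      have "w * A = 4 / s\<^sup>2 * (M\<^sup>2 + 1) * V * (w * s ^ m)" by (simp add: A_def mult_ac)
      then show ?thesis using w(2) s by simp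
    qed
    \<comment> \<open>The bound of \<open>squash_relation\<close> holds for every weight, so
      \<open>quadratic_weight\<close> upgrades it to Cauchy-Schwarz.\<close>
    have "(good_bump_energy a s)\<^sup>2 \<le> A * radial_energy a s"
      using squash_relation[OF a s _ M] A good_bump_energy_nonneg[OF a] radial_energy_nonneg[OF a]
      by (intro quadratic_weight) (auto simp: A_def V_def m_def)
    from mult_left_mono[OF this, of "w\<^sup>2"] have "X\<^sup>2 \<le> w * A * (w * radial_energy a s)"
      by (simp add: X_def power_mult_distrib power2_eq_square mult_ac)
    then have XN: "X\<^sup>2 \<le> (4 * (M\<^sup>2 + 1) * V) * (w * radial_energy a s)" by (simp only: wA)
    have "c * (2 * X\<^sup>2) \<le> 2 * (w * radial_energy a s)"
    proof -
      have pos: "0 < 4 * (M\<^sup>2 + 1) * V" using M1 V by simp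
      have "c * X\<^sup>2 \<le> 1 / (4 * (M\<^sup>2 + 1) * V) * X\<^sup>2" using c(2) by (intro mult_right_mono) auto
      also have "\<dots> \<le> w * radial_energy a s" using XN pos by (simp add: divide_le_eq mult.commute)
      finally show ?thesis by simp
    qed
    moreover have "c * (8 * (K * s\<^sup>2)\<^sup>2) \<le> 2 * (K * s\<^sup>2)"
    proof -
      have "c * (4 * K) \<le> 1" using c(3) K by (simp add: le_divide_eq)
      moreover have "s\<^sup>2 \<le> 1" using s by (simp add: power_le_one)
      ultimately have "c * (4 * K) * s\<^sup>2 \<le> 1 * 1" using c K by (intro mult_mono) auto
      then have "2 * (K * s\<^sup>2) * (c * (4 * K) * s\<^sup>2) \<le> 2 * (K * s\<^sup>2) * 1" using K by (intro mult_left_mono) auto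
      then show ?thesis by (simp add: power2_eq_square mult_ac)
    qed
    moreover have "(F s)\<^sup>2 \<le> 2 * X\<^sup>2 + 8 * (K * s\<^sup>2)\<^sup>2"
    proof -
      have nn: "0 \<le> w * bad_bump_energy a s" using w bad_bump_energy_nonneg[OF a] by simp
      have "0 \<le> F s" using \<open>0 < F s\<close> by simp
      moreover have "F s \<le> X + 2 * (K * s\<^sup>2)" using wB by (simp add: F)
      ultimately have "(F s)\<^sup>2 \<le> (X + 2 * (K * s\<^sup>2))\<^sup>2" by (intro power_mono)
      also have "\<dots> \<le> 2 * X\<^sup>2 + 8 * (K * s\<^sup>2)\<^sup>2"
        using zero_le_power2[of "X - 2 * (K * s\<^sup>2)"] unfolding power2_sum power2_diff power_mult_distrib[of 2] by simp
      finally show ?thesis .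
    qed
    then have "c * (F s)\<^sup>2 \<le> c * (2 * X\<^sup>2 + 8 * (K * s\<^sup>2)\<^sup>2)" using c(1) by (intro mult_left_mono) auto
    moreover have "0 \<le> w * bad_bump_energy a s" using w bad_bump_energy_nonneg[OF a] by simp
    ultimately show "c * (F s)\<^sup>2 \<le> s * F' s" unfolding sF' distrib_left by linarith
  qed (use c r in auto)
  moreover have "r powr (2 - real m) * bump_energy a r \<le> F r" using K by (simp add: F_def)
  ultimately show ?thesis by (simp add: m_def c_def)
qed

lemma dirichlet_mono:
  assumes "A \<in> sets lebesgue" "B \<in> sets lebesgue" "A \<subseteq> B" "B \<subseteq> U"
  shows "dirichlet A f \<le> dirichlet B f"
proof -
  have U: "set_integrable lebesgue U (\<lambda>x. (Df_norm f x)\<^sup>2)"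
    using integrable_Df_norm by (simp add: set_integrable_lebesgue_on U_lebesgue)
  have "set_integrable lebesgue A (\<lambda>x. (Df_norm f x)\<^sup>2)" "set_integrable lebesgue B (\<lambda>x. (Df_norm f x)\<^sup>2)"
    using assms by (auto intro: set_integrable_subset[OF U])
  then show ?thesis
    unfolding dirichlet_def set_lebesgue_integral_def set_integrable_def
    using assms(3) by (intro integral_mono) (auto simp: indicator_def)
qed

text \<open>At distance at most \<open>r\<close> from the centre, the bump of radius
  \<open>2 * r\<close> is evaluated at an argument of at least \<open>1 - 1 / 4\<close>.\<close>

lemma dirichlet_le_bump_energy:
  assumes r: "0 < r" "2 * r \<le> 1"
  shows "bump 0 (3 / 4) * dirichlet (ball a r) f \<le> bump_energy a (2 * r)"
proof -
  have r1: "0 < 2 * r" using r by simp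
  have sub: "ball a r \<subseteq> ball 0 2" by (rule ball_a_subset(1)[OF a r(1)]) (use r in simp)
  have B: "set_integrable lebesgue (ball a r) (\<lambda>x. (Df_norm f x)\<^sup>2)"
  proof (rule set_integrable_subset)
    show "set_integrable lebesgue U (\<lambda>x. (Df_norm f x)\<^sup>2)"
      using integrable_Df_norm by (simp add: set_integrable_lebesgue_on U_lebesgue)
    show "ball a r \<subseteq> U" using sub ball2_U by (rule order_trans)
  qed simp
  have I: "integrable M2 (\<lambda>x. radial_bump a (2 * r) x * (Df_norm f x)\<^sup>2)"
    by (intro integrable_M2_continuous_mult[of _ 1] continuous_radial_bump integrable_Df_norm_M2 abs_radial_bump_le)
  have "(LINT x|lebesgue. bump 0 (3 / 4) * (indicator (ball a r) x *\<^sub>R (Df_norm f x)\<^sup>2))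
     \<le> (LINT x|lebesgue. indicator (ball 0 2) x *\<^sub>R (radial_bump a (2 * r) x * (Df_norm f x)\<^sup>2))"
  proof (rule integral_mono)
    show "integrable lebesgue (\<lambda>x. bump 0 (3 / 4) * (indicator (ball a r) x *\<^sub>R (Df_norm f x)\<^sup>2))"
      using B unfolding set_integrable_def by (rule integrable_mult_right)
    show "integrable lebesgue (\<lambda>x. indicator (ball 0 2) x *\<^sub>R (radial_bump a (2 * r) x * (Df_norm f x)\<^sup>2))"
      using I by (simp add: set_integrable_lebesgue_on(1)[symmetric] set_integrable_def del: real_scaleR_def)
    fix x
    show "bump 0 (3 / 4) * (indicator (ball a r) x *\<^sub>R (Df_norm f x)\<^sup>2) \<le> indicator (ball 0 2) x *\<^sub>R (radial_bump a (2 * r) x * (Df_norm f x)\<^sup>2)"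
    proof (cases "x \<in> ball a r")
      case True
      then have "(norm (x - a))\<^sup>2 \<le> r\<^sup>2" by (intro power_mono) (auto simp: dist_norm norm_minus_commute)
      then have "3 / 4 \<le> 1 - (norm (x - a))\<^sup>2 / (2 * r)\<^sup>2"
        using r by (simp add: power_mult_distrib divide_le_eq)
      then have "bump 0 (3 / 4) \<le> radial_bump a (2 * r) x" unfolding radial_bump_def by (rule bump_mono)
      then have "bump 0 (3 / 4) * (Df_norm f x)\<^sup>2 \<le> radial_bump a (2 * r) x * (Df_norm f x)\<^sup>2" by (rule mult_right_mono) simp
      moreover have "x \<in> ball 0 2" using True sub by blast
      ultimately show ?thesis using True by simp
    next
      case False
      then show ?thesis using radial_bump_bounds(1)[of a "2 * r" x] by (simp add: indicator_def)
    qed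
  qed
  then show ?thesis
    by (simp add: dirichlet_def bump_energy_def set_lebesgue_integral_def set_integrable_lebesgue_on(2)[symmetric])
qed

lemma dirichlet_decay:
  assumes r: "0 < r" "r \<le> 1 / 2"
  shows "r powr (2 - real CARD('m)) * dirichlet (ball a r) f
    \<le> decay_const TYPE('h \<times> ((real^'m) \<Rightarrow>\<^sub>L 'h)) M (dirichlet (ball 0 1) f) * (1 / \<bar>ln r\<bar>) powr (1 / 2)"
proof -
  define m where "m = CARD('m)"
  define c where "c = decay_rate TYPE('h \<times> ((real^'m) \<Rightarrow>\<^sub>L 'h)) M"
  define \<kappa> where "\<kappa> = bump 0 (3 / 4)"
  define E where "E = dirichlet (ball 0 1) f"
  define D where "D = dirichlet (ball a r) f"
  have c: "0 < c" by (simp add: c_def decay_rate_pos)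
  have \<kappa>: "0 < \<kappa>" by (simp add: \<kappa>_def bump_pos)
  have ball1: "ball 0 1 \<subseteq> U" using ball_U by (rule order_trans[rotated]) auto
  have D0: "0 \<le> D" by (simp add: D_def dirichlet_def set_lebesgue_integral_def)
  have DE: "D \<le> E" unfolding D_def E_def using ball_a_subset(3)[OF a r] ball1 by (intro dirichlet_mono) auto
  have ln16: "ln (16::real) = 4 * ln 2"
  proof -
    have "ln (16::real) = ln (2 ^ 4)" by simp
    also have "\<dots> = 4 * ln 2" by (subst ln_realpow) auto
    finally show ?thesis .
  qed
  have ln2: "2 / 3 \<le> ln (2::real)" "ln (2::real) \<le> 1" using ln2_ge_two_thirds ln_2_less_1 by auto
  have lnr: "ln r < 0" using r by simp
  define L where "L = \<bar>ln r\<bar>"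
  have L: "0 < L" "L = - ln r" using lnr by (auto simp: L_def)
  have C: "decay_const TYPE('h \<times> ((real^'m) \<Rightarrow>\<^sub>L 'h)) M E = 4 * 16 ^ m * \<bar>E\<bar> + 2 * 2 ^ m / (\<kappa> * c)"
    by (simp add: decay_const_def m_def \<kappa>_def c_def)
  have w: "0 < r powr (2 - real m)" using r by simp
  show ?thesis
  \<comment> \<open>Below 1/16 the doubling of the radius costs at most half of the logarithm, since
    \<open>ln 4 \<le> L / 2\<close>, and moreover \<open>L \<ge> 1\<close>. From 1/16 on,
    \<open>L \<le> 4\<close> and the total energy suffices.\<close>
  proof (cases "r < 1 / 16")
    case True
    have r2: "0 < 2 * r" "2 * r < 1 / 2" "2 * r \<le> 1" using True r by auto
    have T: "\<kappa> * D \<le> bump_energy a (2 * r)" unfolding \<kappa>_def D_def by (rule dirichlet_le_bump_energy[OF r(1) r2(3)])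
    have dec: "(2 * r) powr (2 - real m) * bump_energy a (2 * r) \<le> 1 / (c * ln (1 / 2 / (2 * r)))"
      using bump_energy_decay[OF r2(1,2)] by (simp add: m_def c_def)
    have lnL: "L / 2 \<le> ln (1 / 2 / (2 * r))"
    proof -
      have "ln (1 / 2 / (2 * r)) = ln (1 / (4 * r))" by simp
      also have "\<dots> = - ln (4 * r)" using r by (simp add: ln_div)
      also have "\<dots> = - ln 4 - ln r" using r by (simp add: ln_mult)
      finally have 1: "ln (1 / 2 / (2 * r)) = L - ln 4" using L by simp
      have "ln r \<le> ln (1 / 16)" using True r by (subst ln_le_cancel_iff) auto
      then have "ln 16 \<le> L" using L by (simp add: ln_div)
      moreover have "ln (4::real) = 2 * ln 2" using ln_realpow[of "2::real" 2] by simp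
      ultimately show ?thesis using 1 ln16 by simp
    qed
    have "1 / (c * ln (1 / 2 / (2 * r))) \<le> 1 / (c * (L / 2))"
      using lnL L(1) c by (intro divide_left_mono mult_left_mono mult_pos_pos) auto
    also have "\<dots> = 2 / c * (1 / L)" by simp
    \<comment> \<open>The order \<open>1 / L\<close> is weakened to the exponent 1/2, using
      \<open>L \<ge> 1\<close>.\<close>
    also have "1 / L \<le> (1 / L) powr (1 / 2)"
    proof -
      have "ln r \<le> ln (1 / 16)" using True r by (subst ln_le_cancel_iff) auto
      then have "1 \<le> L" using L ln16 ln2 by (simp add: ln_div)
      then have "(1 / L) powr 1 \<le> (1 / L) powr (1 / 2)" by (intro powr_mono') auto
      then show ?thesis using L(1) by simp
    qed
    finally have dec2: "(2 * r) powr (2 - real m) * bump_energy a (2 * r) \<le> 2 / c * (1 / L) powr (1 / 2)"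
      using dec c by (simp add: mult_left_mono divide_right_mono)
    \<comment> \<open>The numerical factor \<open>2 ^ m * 2 powr (2 - real m)\<close> equals
      \<open>4\<close>.\<close>
    have pw: "r powr (2 - real m) \<le> 2 ^ m * (2 * r) powr (2 - real m)"
    proof -
      have "(1::real) \<le> 2 ^ m * 2 powr (2 - real m)" by (simp add: powr_diff powr_realpow)
      from mult_right_mono[OF this, of "r powr (2 - real m)"] show ?thesis
        using r by (simp add: powr_mult mult.assoc)
    qed
    have "r powr (2 - real m) * D \<le> r powr (2 - real m) * (bump_energy a (2 * r) / \<kappa>)"
      using T \<kappa> w by (intro mult_left_mono) (auto simp: pos_le_divide_eq mult.commute)
    also have "\<dots> \<le> (2 ^ m * (2 * r) powr (2 - real m)) * (bump_energy a (2 * r) / \<kappa>)"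
    proof (rule mult_right_mono[OF pw])
      have "0 \<le> \<kappa> * D" using \<kappa> D0 by simp
      then show "0 \<le> bump_energy a (2 * r) / \<kappa>" using T \<kappa> by simp
    qed
    also have "\<dots> = 2 ^ m / \<kappa> * ((2 * r) powr (2 - real m) * bump_energy a (2 * r))" by simp
    also have "\<dots> \<le> 2 ^ m / \<kappa> * (2 / c * (1 / L) powr (1 / 2))" using dec2 \<kappa> by (intro mult_left_mono) auto
    also have "\<dots> = 2 * 2 ^ m / (\<kappa> * c) * (1 / L) powr (1 / 2)" by simp
    also have "\<dots> \<le> (4 * 16 ^ m * \<bar>E\<bar> + 2 * 2 ^ m / (\<kappa> * c)) * (1 / L) powr (1 / 2)"
      by (intro mult_right_mono) auto
    finally show ?thesis using C by (simp add: D_def E_def L_def m_def)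
  next
    case False
    have "r powr (2 - real m) \<le> 16 ^ m"
    proof -
      have "r powr (2 - real m) = r\<^sup>2 * (1 / r) ^ m" using r by (simp add: powr_eq_quotient power_divide)
      also have "\<dots> \<le> 1 * 16 ^ m"
        using False r by (intro mult_mono power_mono) (auto simp: power_le_one divide_le_eq)
      finally show ?thesis by simp
    qed
    then have "r powr (2 - real m) * D \<le> 16 ^ m * \<bar>E\<bar>" using D0 DE by (intro mult_mono) auto
    also have "\<dots> \<le> (4 * 16 ^ m * \<bar>E\<bar>) * (1 / L) powr (1 / 2)"
    proof -
      have "ln (1 / 16) \<le> ln r" using False r by (subst ln_le_cancel_iff) auto
      then have "L \<le> 4" using L ln16 ln2 by (simp add: ln_div)
      then have "1 / 4 \<le> 1 / L" using L(1) by (intro divide_left_mono) auto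
      then have "(1 / 4) powr (1 / 2) \<le> (1 / L) powr (1 / 2)" by (intro powr_mono2) auto
      moreover have "(1 / 4) powr 1 \<le> (1 / 4 :: real) powr (1 / 2)" by (intro powr_mono') auto
      ultimately have "1 \<le> 4 * (1 / L) powr (1 / 2)" by simp
      from mult_left_mono[OF this, of "16 ^ m * \<bar>E\<bar>"] show ?thesis by (simp add: mult_ac)
    qed
    also have "\<dots> \<le> (4 * 16 ^ m * \<bar>E\<bar> + 2 * 2 ^ m / (\<kappa> * c)) * (1 / L) powr (1 / 2)"
      using \<kappa> c by (intro mult_right_mono) auto
    finally show ?thesis using C by (simp add: D_def E_def L_def m_def)
  qed
qed

end

end

section \<open>Functions with vanishing approximate derivative\<close>

lemma lborel_translation:
  fixes f :: "'a::euclidean_space \<Rightarrow> real"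
  assumes "integrable lborel f"
  shows "integrable lborel (\<lambda>x. f (x + z))" "(LINT x|lborel. f (x + z)) = (LINT x|lborel. f x)"
proof -
  have f: "integrable (distr lborel borel ((+) z)) f" using assms by (simp add: lborel_distr_plus)
  have m: "f \<in> borel_measurable borel" using assms by auto
  show "integrable lborel (\<lambda>x. f (x + z))"
    using integrable_distr[OF _ f] by (simp add: add.commute)
  show "(LINT x|lborel. f (x + z)) = (LINT x|lborel. f x)"
    using integral_distr[of "(+) z" lborel borel f] m by (simp add: lborel_distr_plus add.commute)
qed

lemma nn_integral_lborel_translation:
  fixes f :: "'a::euclidean_space \<Rightarrow> ennreal"
  assumes [measurable]: "f \<in> borel_measurable borel"
  shows "(\<integral>\<^sup>+x. f (x + z) \<partial>lborel) = (\<integral>\<^sup>+x. f x \<partial>lborel)"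
proof -
  have "(\<integral>\<^sup>+x. f x \<partial>lborel) = (\<integral>\<^sup>+x. f x \<partial>distr lborel borel ((+) z))" by (simp add: lborel_distr_plus)
  also have "\<dots> = (\<integral>\<^sup>+x. f (z + x) \<partial>lborel)" by (subst nn_integral_distr) auto
  finally show ?thesis by (simp add: add.commute)
qed

text \<open>Points of \<open>G\<close> stay in \<open>G\<close> under small shifts, so the mass
  leaving \<open>G\<close> tends to \<open>0\<close> by dominated convergence. Translation
  invariance makes the mass entering equal to the mass leaving, hence the factor \<open>2\<close>;
  no separate argument at boundary points arises.\<close>

lemma translate_open_L1:
  fixes G :: "'a::euclidean_space set"
  assumes G: "open G" "emeasure lborel G < \<infinity>" and Z: "Z \<longlonglongrightarrow> 0"
  shows "(\<lambda>n. LINT x|lborel. \<bar>indicator G (x + Z n) - (indicator G x :: real)\<bar>) \<longlonglongrightarrow> 0"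
proof -
  have i: "integrable lborel (indicator G :: 'a \<Rightarrow> real)" using G by simp
  note it = lborel_translation[OF i]
  have "(\<lambda>n. LINT x|lborel. indicator G x * (1 - indicator G (x + Z n) :: real)) \<longlonglongrightarrow> (LINT x|(lborel :: 'a measure). 0)"
  proof (rule integral_dominated_convergence[OF _ _ i])
    show "AE x in lborel. (\<lambda>n. indicator G x * (1 - indicator G (x + Z n) :: real)) \<longlonglongrightarrow> 0"
    proof (rule AE_I2)
      fix x :: 'a
      show "(\<lambda>n. indicator G x * (1 - indicator G (x + Z n) :: real)) \<longlonglongrightarrow> 0"
      proof (cases "x \<in> G")
        case True
        have "(\<lambda>n. x + Z n) \<longlonglongrightarrow> x + 0" by (intro tendsto_intros Z)
        then have "\<forall>\<^sub>F n in sequentially. x + Z n \<in> G" using topological_tendstoD[OF _ G(1)] True by auto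
        then have "\<forall>\<^sub>F n in sequentially. indicator G x * (1 - indicator G (x + Z n) :: real) = 0"
          by eventually_elim simp
        then show ?thesis by (rule tendsto_eventually)
      qed simp
    qed
    show "AE x in lborel. norm (indicator G x * (1 - indicator G (x + Z n) :: real)) \<le> indicator G x" for n
      by (intro AE_I2) (auto simp: indicator_def)
  qed (use borel_measurable_integrable[OF it(1)] borel_measurable_integrable[OF i] in auto)
  then have lim: "(\<lambda>n. 2 * (LINT x|lborel. indicator G x * (1 - indicator G (x + Z n) :: real))) \<longlonglongrightarrow> 0"
    by (auto intro: tendsto_mult_right_zero)
  have "(LINT x|lborel. \<bar>indicator G (x + Z n) - (indicator G x :: real)\<bar>)
      = 2 * (LINT x|lborel. indicator G x * (1 - indicator G (x + Z n) :: real))" for n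
  proof -
    have ip: "integrable lborel (\<lambda>x. indicator G x * (1 - indicator G (x + Z n) :: real))"
    proof (rule Bochner_Integration.integrable_bound[OF i])
      show "(\<lambda>x. indicator G x * (1 - indicator G (x + Z n) :: real)) \<in> borel_measurable lborel"
        using borel_measurable_integrable[OF it(1)] borel_measurable_integrable[OF i] by auto
    qed (auto simp: indicator_def intro!: AE_I2)
    have "(LINT x|lborel. \<bar>indicator G (x + Z n) - (indicator G x :: real)\<bar>)
      = (LINT x|lborel. 2 * (indicator G x * (1 - indicator G (x + Z n))) + (indicator G (x + Z n) - (indicator G x :: real)))"
      by (rule Bochner_Integration.integral_cong) (auto simp: indicator_def)
    also have "\<dots> = 2 * (LINT x|lborel. indicator G x * (1 - indicator G (x + Z n) :: real)) + ((LINT x|lborel. indicator G (x + Z n)) - (LINT x|lborel. (indicator G x :: real)))"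
      using ip i it(1)[of "Z n"] by simp
    finally show ?thesis using it(2)[of "Z n"] by simp
  qed
  then show ?thesis using lim by simp
qed

text \<open>By outer regularity \<open>A\<close> differs little from an open superset; the small
  difference is counted twice, once shifted.\<close>

lemma translate_set_L1:
  fixes A :: "'a::euclidean_space set"
  assumes A: "A \<in> sets borel" "emeasure lborel A < \<infinity>" and Z: "Z \<longlonglongrightarrow> 0"
  shows "(\<lambda>n. LINT x|lborel. \<bar>indicator A (x + Z n) - (indicator A x :: real)\<bar>) \<longlonglongrightarrow> 0"
proof (rule LIMSEQ_I)
  fix e :: real assume e: "0 < e"
  obtain G where G: "open G" "A \<subseteq> G" "emeasure lborel (G - A) < ennreal (e / 4)"
    using outer_regular_lborel[OF A(1), of "e / 4"] e by auto
  have [measurable]: "G \<in> sets borel" "A \<in> sets borel" using G A by auto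
  have "emeasure lborel G \<le> emeasure lborel A + emeasure lborel (G - A)"
    using G(2) by (metis Diff_partition Un_Diff_cancel \<open>A \<in> sets borel\<close> \<open>G \<in> sets borel\<close> emeasure_subadditive sets.Diff sets_lborel)
  also have "\<dots> < \<infinity>"
    using A(2) less_trans[OF G(3) ennreal_less_top] unfolding infinity_ennreal_def less_top[symmetric] by simp
  finally have Gf: "emeasure lborel G < \<infinity>" .
  have GAf: "emeasure lborel (G - A) < \<infinity>" using G(3) by (rule less_trans) simp
  have iGA: "integrable lborel (indicator (G - A) :: 'a \<Rightarrow> real)" using GAf by simp
  have iA: "integrable lborel (indicator A :: 'a \<Rightarrow> real)" using A by simp
  have iG: "integrable lborel (indicator G :: 'a \<Rightarrow> real)" using Gf by simp
  have mGA: "measure lborel (G - A) < e / 4"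
    using G(3) GAf e by (simp add: emeasure_eq_ennreal_measure ennreal_less_iff)
  obtain N where N: "\<And>n. N \<le> n \<Longrightarrow> \<bar>LINT x|lborel. \<bar>indicator G (x + Z n) - (indicator G x :: real)\<bar>\<bar> < e / 2"
    using LIMSEQ_D[OF translate_open_L1[OF G(1) Gf Z], of "e / 2"] e by auto
  show "\<exists>N. \<forall>n\<ge>N. norm ((LINT x|lborel. \<bar>indicator A (x + Z n) - (indicator A x :: real)\<bar>) - 0) < e"
  proof (intro exI[of _ N] allI impI)
    fix n assume n: "N \<le> n"
    have "(LINT x|lborel. \<bar>indicator A (x + Z n) - (indicator A x :: real)\<bar>)
      \<le> (LINT x|lborel. \<bar>indicator G (x + Z n) - (indicator G x :: real)\<bar> + (indicator (G - A) (x + Z n) + indicator (G - A) x))"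
    proof (rule integral_mono)
      fix x show "\<bar>indicator A (x + Z n) - (indicator A x :: real)\<bar> \<le> \<bar>indicator G (x + Z n) - (indicator G x :: real)\<bar> + (indicator (G - A) (x + Z n) + indicator (G - A) x)"
        using G(2) by (auto simp: indicator_def)
    qed (intro integrable_abs Bochner_Integration.integrable_add Bochner_Integration.integrable_diff
        lborel_translation(1) iA iG iGA)+
    also have "\<dots> = (LINT x|lborel. \<bar>indicator G (x + Z n) - (indicator G x :: real)\<bar>) + 2 * measure lborel (G - A)"
      using lborel_translation[OF iGA, of "Z n"] lborel_translation(1)[OF iG, of "Z n"] iG iGA by simp
    also have "\<dots> < e" using N[OF n] mGA by linarith
    finally show "norm ((LINT x|lborel. \<bar>indicator A (x + Z n) - (indicator A x :: real)\<bar>) - 0) < e"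
      by (simp add: integral_nonneg_AE)
  qed
qed

lemma translate_L1:
  fixes f :: "'a::euclidean_space \<Rightarrow> real"
  assumes "integrable lborel f" "Z \<longlonglongrightarrow> 0"
  shows "(\<lambda>n. LINT x|lborel. \<bar>f (x + Z n) - f x\<bar>) \<longlonglongrightarrow> 0"
  using assms(1)
proof (induction rule: integrable_induct)
  case (base A c)
  have "(\<lambda>n. \<bar>c\<bar> * (LINT x|lborel. \<bar>indicator A (x + Z n) - (indicator A x :: real)\<bar>)) \<longlonglongrightarrow> \<bar>c\<bar> * 0"
    using base by (intro tendsto_mult tendsto_const translate_set_L1 assms(2)) auto
  moreover have "(LINT x|lborel. \<bar>indicator A (x + Z n) *\<^sub>R c - indicator A x *\<^sub>R c\<bar>) = \<bar>c\<bar> * (LINT x|lborel. \<bar>indicator A (x + Z n) - (indicator A x :: real)\<bar>)" for n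
  proof -
    have "(LINT x|lborel. \<bar>indicator A (x + Z n) *\<^sub>R c - indicator A x *\<^sub>R c\<bar>) = (LINT x|lborel. \<bar>c\<bar> * \<bar>indicator A (x + Z n) - (indicator A x :: real)\<bar>)"
      by (rule Bochner_Integration.integral_cong) (auto simp: indicator_def)
    then show ?thesis by simp
  qed
  ultimately show ?case by simp
next
  case (add f g)
  have "(\<lambda>n. (LINT x|lborel. \<bar>f (x + Z n) - f x\<bar>) + (LINT x|lborel. \<bar>g (x + Z n) - g x\<bar>)) \<longlonglongrightarrow> 0"
    using tendsto_add[OF add.IH] by simp
  then show ?case
  proof (rule Lim_null_comparison[rotated], intro always_eventually allI)
    fix n
    have "(LINT x|lborel. \<bar>f (x + Z n) + g (x + Z n) - (f x + g x)\<bar>) \<le> (LINT x|lborel. \<bar>f (x + Z n) - f x\<bar> + \<bar>g (x + Z n) - g x\<bar>)"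
      using add.hyps lborel_translation(1)[of _ "Z n"]
      by (intro integral_mono integrable_abs Bochner_Integration.integrable_add Bochner_Integration.integrable_diff) auto
    also have "\<dots> = (LINT x|lborel. \<bar>f (x + Z n) - f x\<bar>) + (LINT x|lborel. \<bar>g (x + Z n) - g x\<bar>)"
      using add.hyps lborel_translation(1)[of _ "Z n"] by (intro Bochner_Integration.integral_add) auto
    finally show "norm (LINT x|lborel. \<bar>f (x + Z n) + g (x + Z n) - (f x + g x)\<bar>) \<le> (LINT x|lborel. \<bar>f (x + Z n) - f x\<bar>) + (LINT x|lborel. \<bar>g (x + Z n) - g x\<bar>)"
      by (simp add: integral_nonneg_AE)
  qed
next
  case (lim f s)
  \<comment> \<open>The simple approximants satisfy
    \<open>norm (s i x) \<le> 2 * norm (f x)\<close>, which gives the majorant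
    \<open>3 * \<bar>f x\<bar>\<close>.\<close>
  have d: "(\<lambda>i. LINT x|lborel. \<bar>s i x - f x\<bar>) \<longlonglongrightarrow> (LINT x|(lborel :: 'a measure). 0)"
  proof (rule integral_dominated_convergence[of _ _ _ "\<lambda>x. 3 * \<bar>f x\<bar>"])
    show "AE x in lborel. (\<lambda>i. \<bar>s i x - f x\<bar>) \<longlonglongrightarrow> 0"
    proof (rule AE_I2)
      fix x :: 'a
      have "(\<lambda>i. s i x - f x) \<longlonglongrightarrow> f x - f x" using lim.hyps(2)[of x] by (intro tendsto_intros) auto
      then show "(\<lambda>i. \<bar>s i x - f x\<bar>) \<longlonglongrightarrow> 0" by (simp add: tendsto_rabs_zero)
    qed
    show "AE x in lborel. norm \<bar>s i x - f x\<bar> \<le> 3 * \<bar>f x\<bar>" for i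
    proof (rule AE_I2)
      fix x :: 'a
      show "norm \<bar>s i x - f x\<bar> \<le> 3 * \<bar>f x\<bar>" using lim.hyps(3)[of x i] by simp
    qed
  qed (use lim.hyps in auto)
  show ?case
  proof (rule LIMSEQ_I)
    fix e :: real assume e: "0 < e"
    obtain i where i: "(LINT x|lborel. \<bar>s i x - f x\<bar>) < e / 4"
      using LIMSEQ_D[OF d, of "e / 4"] e by (auto simp: integral_nonneg_AE)
    obtain N where N: "\<And>n. N \<le> n \<Longrightarrow> (LINT x|lborel. \<bar>s i (x + Z n) - s i x\<bar>) < e / 2"
      using LIMSEQ_D[OF lim.IH[of i], of "e / 2"] e by (auto simp: integral_nonneg_AE)
    show "\<exists>N. \<forall>n\<ge>N. norm ((LINT x|lborel. \<bar>f (x + Z n) - f x\<bar>) - 0) < e"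
    proof (intro exI[of _ N] allI impI)
      fix n assume n: "N \<le> n"
      have sf: "integrable lborel (\<lambda>x. \<bar>s i x - f x\<bar>)" using lim.hyps by auto
      note t = lborel_translation(1)[OF lim.hyps(1)[of i], of "Z n"] lborel_translation(1)[OF lim.hyps(4), of "Z n"] lborel_translation[OF sf, of "Z n"]
      have "(LINT x|lborel. \<bar>f (x + Z n) - f x\<bar>) \<le> (LINT x|lborel. \<bar>s i (x + Z n) - s i x\<bar> + (\<bar>s i (x + Z n) - f (x + Z n)\<bar> + \<bar>s i x - f x\<bar>))"
        using t lim.hyps by (intro integral_mono) auto
      also have "\<dots> = (LINT x|lborel. \<bar>s i (x + Z n) - s i x\<bar>) + 2 * (LINT x|lborel. \<bar>s i x - f x\<bar>)"
        using t lim.hyps by simp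
      also have "\<dots> < e" using N[OF n] i by linarith
      finally show "norm ((LINT x|lborel. \<bar>f (x + Z n) - f x\<bar>) - 0) < e" by (simp add: integral_nonneg_AE)
    qed
  qed
qed

section \<open>Averages over small balls\<close>

lemma nn_integral_ball_average:
  fixes g :: "'a::euclidean_space \<Rightarrow> ennreal"
  assumes [measurable]: "g \<in> borel_measurable borel"
  shows "(\<lambda>a. \<integral>\<^sup>+y. g y * indicator (ball a r) y \<partial>lborel) \<in> borel_measurable borel"
    "(\<integral>\<^sup>+a. (\<integral>\<^sup>+y. g y * indicator (ball a r) y \<partial>lborel) \<partial>lborel) = emeasure lborel (ball (0::'a) r) * (\<integral>\<^sup>+y. g y \<partial>lborel)"
proof -
  have "open {p :: 'a \<times> 'a. dist (fst p) (snd p) < r}"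
    by (intro open_Collect_less continuous_intros)
  then have S: "{p :: 'a \<times> 'a. dist (fst p) (snd p) < r} \<in> sets (borel \<Otimes>\<^sub>M borel)"
    unfolding borel_prod by (rule borel_open)
  have "(\<lambda>p :: 'a \<times> 'a. g (snd p) * indicator {p. dist (fst p) (snd p) < r} p) \<in> borel_measurable (borel \<Otimes>\<^sub>M borel)"
    using S by measurable
  also have "(\<lambda>p :: 'a \<times> 'a. g (snd p) * indicator {p. dist (fst p) (snd p) < r} p) = (\<lambda>(a, y). g y * indicator (ball a r) y)"
    by (auto simp: fun_eq_iff indicator_def)
  finally have m: "(\<lambda>(a, y). g y * indicator (ball a r) y) \<in> borel_measurable (lborel \<Otimes>\<^sub>M lborel)"
    by (simp cong: measurable_cong_sets)
  show "(\<lambda>a. \<integral>\<^sup>+y. g y * indicator (ball a r) y \<partial>lborel) \<in> borel_measurable borel"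
    using lborel.borel_measurable_nn_integral[OF m] by simp
  have "(\<integral>\<^sup>+a. (\<integral>\<^sup>+y. g y * indicator (ball a r) y \<partial>lborel) \<partial>lborel) = (\<integral>\<^sup>+y. (\<integral>\<^sup>+a. g y * indicator (ball a r) y \<partial>lborel) \<partial>lborel)"
    using lborel_pair.Fubini'[OF m] by simp
  also have "\<dots> = (\<integral>\<^sup>+y. g y * emeasure lborel (ball (0::'a) r) \<partial>lborel)"
  proof (rule nn_integral_cong)
    fix y :: 'a
    have "(\<integral>\<^sup>+a. g y * indicator (ball a r) y \<partial>lborel) = (\<integral>\<^sup>+a. g y * indicator (ball y r) a \<partial>lborel)"
      by (intro nn_integral_cong) (auto simp: indicator_def dist_commute)
    also have "\<dots> = g y * emeasure lborel (ball y r)" by (simp add: nn_integral_cmult_indicator)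
    also have "emeasure lborel (ball y r) = emeasure lborel (ball (0::'a) r)"
      by (cases "0 \<le> r") (simp_all add: emeasure_ball ball_empty)
    finally show "(\<integral>\<^sup>+a. g y * indicator (ball a r) y \<partial>lborel) = g y * emeasure lborel (ball (0::'a) r)" .
  qed
  also have "\<dots> = emeasure lborel (ball (0::'a) r) * (\<integral>\<^sup>+y. g y \<partial>lborel)"
    by (simp add: nn_integral_multc mult.commute)
  finally show "(\<integral>\<^sup>+a. (\<integral>\<^sup>+y. g y * indicator (ball a r) y \<partial>lborel) \<partial>lborel) = emeasure lborel (ball (0::'a) r) * (\<integral>\<^sup>+y. g y \<partial>lborel)" .
qed

definition ball_average :: "('a::euclidean_space \<Rightarrow> real) \<Rightarrow> real \<Rightarrow> 'a \<Rightarrow> real"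
  where "ball_average e r a = (LINT y:ball a r|lborel. e y) / measure lborel (ball (0::'a) r)"

text \<open>The average minus the function is a mean over short \<open>z\<close> of the differences
  \<open>e (a + z) - e a\<close>. After exchanging integrals, its mean-norm is controlled by those
  of the translated differences, which tend to \<open>0\<close> by
  \<open>translate_L1\<close>.\<close>

lemma ball_average_L1:
  fixes e :: "'a::euclidean_space \<Rightarrow> real"
  assumes e: "integrable lborel e" and R: "\<And>n. 0 < R n" "R \<longlonglongrightarrow> 0"
  shows "integrable lborel (\<lambda>a. ball_average e (R n) a - e a)"
    "(\<lambda>n. LINT a|lborel. norm (ball_average e (R n) a - e a)) \<longlonglongrightarrow> 0"
proof -
  have em[measurable]: "e \<in> borel_measurable borel" using e by auto
  have tend: "\<exists>d>0. \<forall>z. norm z < d \<longrightarrow> (LINT x|lborel. \<bar>e (x + z) - e x\<bar>) < t" if t: "0 < t" for t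
  proof -
    have "((\<lambda>z. LINT x|lborel. \<bar>e (x + z) - e x\<bar>) \<longlongrightarrow> 0) (at 0)"
      unfolding tendsto_at_iff_sequentially comp_def using translate_L1[OF e] by auto
    from tendstoD[OF this t] obtain d where d: "0 < d" "\<And>z. z \<noteq> 0 \<Longrightarrow> norm z < d \<Longrightarrow> \<bar>LINT x|lborel. \<bar>e (x + z) - e x\<bar>\<bar> < t"
      by (auto simp: eventually_at dist_norm)
    have "(LINT x|lborel. \<bar>e (x + z) - e x\<bar>) < t" if "norm z < d" for z
      using d(2)[of z] that t by (cases "z = 0") auto
    then show ?thesis using d(1) by blast
  qed
  define V where "V r = measure lborel (ball (0::'a) r)" for r
  have V: "0 < V r" "emeasure lborel (ball (b::'a) r) = ennreal (V r)" if "0 < r" for r b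
    using that by (simp_all add: V_def content_ball emeasure_ball)
  have avg: "ball_average e r a = (\<integral>z. indicator (ball 0 r) z * e (a + z) \<partial>lborel) / V r" for r a
  proof -
    have i: "(LINT y:ball a r|lborel. e y) = (\<integral>y. (\<lambda>z. indicator (ball 0 r) z * e (a + z)) (y + - a) \<partial>lborel)"
      unfolding set_lebesgue_integral_def by (rule Bochner_Integration.integral_cong) (auto simp: indicator_def dist_norm norm_minus_commute)
    have m: "integrable lborel (\<lambda>z. indicator (ball 0 r) z * e (a + z))"
      using integrable_real_mult_indicator[OF _ lborel_translation(1)[OF e, of a], of "ball 0 r"] by (simp add: mult.commute add.commute)
    show ?thesis unfolding ball_average_def i lborel_translation(2)[OF m] V_def by simp
  qed
  have me: "(\<lambda>p :: 'a \<times> 'a. e (fst p + snd p)) \<in> borel_measurable (borel \<Otimes>\<^sub>M borel)"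
    by (rule measurable_compose[OF _ em]) measurable
  have mb: "(\<lambda>p :: 'a \<times> 'a. indicator (ball 0 r) (snd p) :: real) \<in> borel_measurable (borel \<Otimes>\<^sub>M borel)" for r
    by (rule measurable_compose[OF measurable_snd borel_measurable_indicator]) simp
  have m1: "(\<lambda>(a, z). indicator (ball 0 r) z * e (a + z)) \<in> borel_measurable (lborel \<Otimes>\<^sub>M lborel)" for r
    using borel_measurable_times[OF mb me, of r] by (simp add: case_prod_beta' cong: measurable_cong_sets)
  have avm[measurable]: "ball_average e r \<in> borel_measurable borel" for r
    unfolding avg[abs_def] using lborel.borel_measurable_lebesgue_integral[OF m1[of r]] by simp
  have bound: "(\<integral>\<^sup>+a. ennreal \<bar>ball_average e r a - e a\<bar> \<partial>lborel) \<le> ennreal t"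
    if r: "0 < r" and t: "\<And>z. norm z < r \<Longrightarrow> (LINT x|lborel. \<bar>e (x + z) - e x\<bar>) \<le> t" "0 \<le> t" for r t
  proof -
    have pt: "ennreal \<bar>ball_average e r a - e a\<bar> \<le> ennreal (1 / V r) * (\<integral>\<^sup>+z. indicator (ball 0 r) z * ennreal \<bar>e (a + z) - e a\<bar> \<partial>lborel)" for a
    proof -
      have i1: "integrable lborel (\<lambda>z. indicator (ball 0 r) z * e (a + z))"
        using integrable_real_mult_indicator[OF _ lborel_translation(1)[OF e, of a], of "ball 0 r"] by (simp add: mult.commute add.commute)
      have i2: "integrable lborel (\<lambda>z. indicator (ball (0::'a) r) z * e a)"
        using V(2)[OF r, of 0] by (intro integrable_mult_left) simp
      have "(\<integral>z. indicator (ball (0::'a) r) z * e a \<partial>lborel) = V r * e a"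
        by (simp add: V_def)
      then have "(\<integral>z. indicator (ball 0 r) z * e (a + z) - indicator (ball 0 r) z * e a \<partial>lborel)
         = (\<integral>z. indicator (ball 0 r) z * e (a + z) \<partial>lborel) - V r * e a"
        using Bochner_Integration.integral_diff[OF i1 i2] by (simp only:)
      then have "ball_average e r a - e a = (1 / V r) * (\<integral>z. indicator (ball 0 r) z * e (a + z) - indicator (ball 0 r) z * e a \<partial>lborel)"
        unfolding avg using V(1)[OF r] by (simp add: field_simps del: Bochner_Integration.integral_diff)
      then have "ennreal \<bar>ball_average e r a - e a\<bar> = ennreal (1 / V r) * ennreal (norm (\<integral>z. indicator (ball 0 r) z * e (a + z) - indicator (ball 0 r) z * e a \<partial>lborel))"
        using V(1)[OF r] by (subst ennreal_mult[symmetric]) (auto simp: abs_mult)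
      also have "\<dots> \<le> ennreal (1 / V r) * (\<integral>\<^sup>+z. ennreal (norm (indicator (ball 0 r) z * e (a + z) - indicator (ball 0 r) z * e a)) \<partial>lborel)"
        using i1 i2 by (intro mult_left_mono integral_norm_bound_ennreal) auto
      also have "(\<integral>\<^sup>+z. ennreal (norm (indicator (ball 0 r) z * e (a + z) - indicator (ball 0 r) z * e a)) \<partial>lborel)
         = (\<integral>\<^sup>+z. indicator (ball 0 r) z * ennreal \<bar>e (a + z) - e a\<bar> \<partial>lborel)"
        by (intro nn_integral_cong) (auto simp: indicator_def)
      finally show ?thesis .
    qed
    have m2: "(\<lambda>(a, z). indicator (ball (0::'a) r) z * ennreal \<bar>e (a + z) - e a\<bar>) \<in> borel_measurable (lborel \<Otimes>\<^sub>M lborel)"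
    proof -
      have "(\<lambda>p :: 'a \<times> 'a. e (fst p)) \<in> borel_measurable (borel \<Otimes>\<^sub>M borel)"
        by (rule measurable_compose[OF measurable_fst em])
      then have "(\<lambda>p :: 'a \<times> 'a. ennreal (indicator (ball 0 r) (snd p) * \<bar>e (fst p + snd p) - e (fst p)\<bar>)) \<in> borel_measurable (borel \<Otimes>\<^sub>M borel)"
        using mb[of r] me by measurable
      moreover have "(\<lambda>p :: 'a \<times> 'a. ennreal (indicator (ball 0 r) (snd p) * \<bar>e (fst p + snd p) - e (fst p)\<bar>))
         = (\<lambda>(a, z). indicator (ball (0::'a) r) z * ennreal \<bar>e (a + z) - e a\<bar>)"
        by (auto simp: fun_eq_iff indicator_def)
      ultimately show ?thesis by (simp cong: measurable_cong_sets)
    qed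
    have "(\<integral>\<^sup>+a. ennreal \<bar>ball_average e r a - e a\<bar> \<partial>lborel)
      \<le> (\<integral>\<^sup>+a. ennreal (1 / V r) * (\<integral>\<^sup>+z. indicator (ball 0 r) z * ennreal \<bar>e (a + z) - e a\<bar> \<partial>lborel) \<partial>lborel)"
      by (intro nn_integral_mono pt)
    also have "\<dots> = ennreal (1 / V r) * (\<integral>\<^sup>+a. (\<integral>\<^sup>+z. indicator (ball 0 r) z * ennreal \<bar>e (a + z) - e a\<bar> \<partial>lborel) \<partial>lborel)"
      using lborel.borel_measurable_nn_integral[OF m2] by (intro nn_integral_cmult) simp
    also have "(\<integral>\<^sup>+a. (\<integral>\<^sup>+z. indicator (ball 0 r) z * ennreal \<bar>e (a + z) - e a\<bar> \<partial>lborel) \<partial>lborel)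
       = (\<integral>\<^sup>+z. (\<integral>\<^sup>+a. indicator (ball 0 r) z * ennreal \<bar>e (a + z) - e a\<bar> \<partial>lborel) \<partial>lborel)"
      using lborel_pair.Fubini'[OF m2] by simp
    also have "\<dots> \<le> (\<integral>\<^sup>+z. ennreal t * indicator (ball (0::'a) r) z \<partial>lborel)"
    proof (rule nn_integral_mono)
      fix z :: 'a
      show "(\<integral>\<^sup>+a. indicator (ball 0 r) z * ennreal \<bar>e (a + z) - e a\<bar> \<partial>lborel) \<le> ennreal t * indicator (ball 0 r) z"
      proof (cases "z \<in> ball 0 r")
        case True
        have "(\<integral>\<^sup>+a. ennreal \<bar>e (a + z) - e a\<bar> \<partial>lborel) = ennreal (LINT a|lborel. \<bar>e (a + z) - e a\<bar>)"
          using lborel_translation(1)[OF e, of z] e by (intro nn_integral_eq_integral) auto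
        then show ?thesis using True t(1)[of z] by (simp add: ennreal_leI)
      qed simp
    qed
    also have "\<dots> = ennreal t * ennreal (V r)" using V(2)[OF r] by (simp add: nn_integral_cmult_indicator)
    also have "ennreal (1 / V r) * (ennreal t * ennreal (V r)) = ennreal t"
      using V(1)[OF r] t(2) by (simp flip: ennreal_mult)
    finally show ?thesis by (simp add: mult_left_mono)
  qed
  have b1: "(LINT x|lborel. \<bar>e (x + z) - e x\<bar>) \<le> 2 * (LINT x|lborel. \<bar>e x\<bar>)" for z
  proof -
    have ea: "integrable lborel (\<lambda>x. \<bar>e x\<bar>)" using e by simp
    note t = lborel_translation[OF ea, of z] lborel_translation(1)[OF e, of z]
    have "(LINT x|lborel. \<bar>e (x + z) - e x\<bar>) \<le> (LINT x|lborel. \<bar>e (x + z)\<bar> + \<bar>e x\<bar>)"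
      using t e by (intro integral_mono) auto
    also have "\<dots> = 2 * (LINT x|lborel. \<bar>e x\<bar>)" using t ea by simp
    finally show ?thesis .
  qed
  have intg: "integrable lborel (\<lambda>a. ball_average e r a - e a)" if r: "0 < r" for r
  proof (rule integrableI_bounded)
    have "(\<integral>\<^sup>+a. ennreal \<bar>ball_average e r a - e a\<bar> \<partial>lborel) \<le> ennreal (2 * (LINT x|lborel. \<bar>e x\<bar>))"
      by (rule bound[OF r b1]) simp
    then show "(\<integral>\<^sup>+a. ennreal (norm (ball_average e r a - e a)) \<partial>lborel) < \<infinity>" by (simp add: le_less_trans)
  qed simp
  show "integrable lborel (\<lambda>a. ball_average e (R n) a - e a)" by (rule intg[OF R(1)])
  show "(\<lambda>n. LINT a|lborel. norm (ball_average e (R n) a - e a)) \<longlonglongrightarrow> 0"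
  proof (rule LIMSEQ_I)
    fix t :: real assume t: "0 < t"
    have t2: "0 \<le> t / 2" using t by simp
    obtain d where d: "0 < d" "\<And>z. norm z < d \<Longrightarrow> (LINT x|lborel. \<bar>e (x + z) - e x\<bar>) < t / 2"
      using tend[of "t / 2"] t by auto
    obtain N where N: "\<And>n. N \<le> n \<Longrightarrow> R n < d"
      using LIMSEQ_D[OF R(2) d(1)] R(1) by (auto simp: abs_of_pos)
    show "\<exists>N. \<forall>n\<ge>N. norm ((LINT a|lborel. norm (ball_average e (R n) a - e a)) - 0) < t"
    proof (intro exI[of _ N] allI impI)
      fix n assume n: "N \<le> n"
      have le: "(LINT x|lborel. \<bar>e (x + z) - e x\<bar>) \<le> t / 2" if "norm z < R n" for z
        using d(2)[of z] that N[OF n] by simp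
      have "(\<integral>\<^sup>+a. ennreal \<bar>ball_average e (R n) a - e a\<bar> \<partial>lborel) \<le> ennreal (t / 2)" by (rule bound[OF R(1) le t2])
      moreover have "(\<integral>\<^sup>+a. ennreal \<bar>ball_average e (R n) a - e a\<bar> \<partial>lborel) = ennreal (LINT a|lborel. \<bar>ball_average e (R n) a - e a\<bar>)"
        using intg[OF R(1), of n] by (intro nn_integral_eq_integral) auto
      ultimately have "(LINT a|lborel. \<bar>ball_average e (R n) a - e a\<bar>) \<le> t / 2" by (simp only: ennreal_le_iff[OF t2])
      then show "norm ((LINT a|lborel. norm (ball_average e (R n) a - e a)) - 0) < t"
        using t by (simp add: integral_nonneg_AE)
    qed
  qed
qed

section \<open>Difference quotients along a fixed shift\<close>

lemma ennreal_tendsto_0I: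
  fixes X :: "'i \<Rightarrow> ennreal"
  assumes "\<And>t::real. 0 < t \<Longrightarrow> \<forall>\<^sub>F k in F. X k \<le> ennreal t"
  shows "(X \<longlongrightarrow> 0) F"
proof (rule order_tendstoI)
  fix c :: ennreal assume "0 < c"
  then obtain t where t: "0 < t" "ennreal t < c"
  proof (cases c)
    case (real r)
    then show thesis using that[of "r / 2"] \<open>0 < c\<close> by (auto simp: ennreal_less_iff)
  next
    case top
    then show thesis using that[of 1] by simp
  qed
  from assms[OF t(1)] show "\<forall>\<^sub>F k in F. X k < c" by eventually_elim (use t(2) in auto)
qed simp

lemma measure_lborel_ball:
  fixes a :: "'a::euclidean_space"
  assumes "0 < r"
  shows "emeasure lborel (ball a r) = ennreal (unit_ball_vol DIM('a) * r ^ DIM('a))"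
    "measure lborel (ball a r) = unit_ball_vol DIM('a) * r ^ DIM('a)"
  using assms by (simp_all add: emeasure_ball content_ball)

lemma telescoping_abs:
  fixes h :: "nat \<Rightarrow> real"
  shows "\<bar>h n - h 0\<bar> \<le> (\<Sum>i<n. \<bar>h (Suc i) - h i\<bar>)"
  by (induction n) auto

text \<open>The density \<open>e\<close> need not be the energy of \<open>u\<close>: it may be
  positive where the approximate derivative of \<open>u\<close> vanishes, so constancy is not
  immediate from \<open>poincare\<close>. In the application the alternative \<open>e a = 0\<close>
  covers points without approximate differential, and \<open>\<delta>\<close> is the error left by
  removing \<open>bad_energy\<close>.\<close>

locale vanishing_derivative =
  fixes u e :: "'a::euclidean_space \<Rightarrow> real" and K :: real
  assumes um[measurable]: "u \<in> borel_measurable borel"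
    and ei: "integrable lborel e" and e0: "\<And>x. 0 \<le> e x" and K: "0 \<le> K"
    and poincare: "\<And>a r \<delta>. 0 < r \<Longrightarrow> ball a r \<subseteq> ball 0 2 \<Longrightarrow> 0 < \<delta> \<Longrightarrow>
      \<exists>c. (\<integral>\<^sup>+x. ennreal ((u x - c)\<^sup>2) * indicator (ball a r) x \<partial>lborel) \<le> ennreal (K * r\<^sup>2 * ((LINT x:ball a r|lborel. e x) + \<delta>))"
    and vanish: "AE a in lborel. a \<in> ball 0 2 \<longrightarrow> e a = 0 \<or>
      (\<forall>\<eta>>0. density_zero {x. x \<noteq> a \<and> \<eta> * norm (x - a) \<le> \<bar>u x - u a\<bar>} a)"
begin


context
  fixes v :: 'a and n :: nat
  assumes v: "v \<noteq> 0" "norm v < 5 / 4" and n: "16 \<le> n"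
begin

text \<open>The shift \<open>v\<close> is divided into \<open>n\<close> steps of length
  \<open>rad\<close>; \<open>quot\<close> is then the absolute difference quotient of
  \<open>u\<close> in the direction of \<open>v\<close>, times \<open>norm v\<close>.\<close>

definition "step = v /\<^sub>R real n"
definition "rad = norm v / real n"
definition "vol = measure lborel (ball (0::'a) rad)"
definition "quot y = real n * \<bar>u (y + step) - u y\<bar>"
definition "avg a = ennreal (1 / vol) * (\<integral>\<^sup>+y. ennreal (quot y) * indicator (ball a rad) y \<partial>lborel)"

lemma rad: "0 < rad" "rad < 1 / 8" "norm step = rad" "real n * rad = norm v"
proof -
  have nn: "16 \<le> real n" using n by simp
  show "0 < rad" using v(1) nn by (simp add: rad_def)
  show "norm step = rad" using nn by (simp add: rad_def step_def divide_inverse mult.commute)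
  show "real n * rad = norm v" using nn by (simp add: rad_def)
  have "norm v < 1 / 8 * real n" using v(2) nn by linarith
  then show "rad < 1 / 8" using nn by (simp add: rad_def divide_less_eq)
qed

lemma vol: "0 < vol" "vol = unit_ball_vol DIM('a) * rad ^ DIM('a)" "emeasure lborel (ball a rad) = ennreal vol" for a :: 'a
  using measure_lborel_ball[OF rad(1), where 'a='a] rad(1) by (simp_all add: vol_def)

lemma quot_measurable[measurable]: "quot \<in> borel_measurable borel"
  unfolding quot_def by measurable

text \<open>Both \<open>y\<close> and \<open>y + step\<close> lie in the ball of radius
  \<open>2 * rad\<close>, where Poincare compares \<open>u\<close> with one constant
  \<open>c\<close>. The factor \<open>rad\<^sup>2\<close> cancels \<open>(real n)\<^sup>2\<close> up
  to \<open>(norm v)\<^sup>2\<close>, so the mean square of \<open>quot\<close> is bounded by an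
  average of \<open>e\<close> without loss in \<open>n\<close>.\<close>

lemma square_bound:
  assumes a: "a \<in> ball 0 (7 / 4)"
  shows "(\<integral>\<^sup>+y. ennreal ((quot y)\<^sup>2) * indicator (ball a rad) y \<partial>lborel)
    \<le> ennreal (16 * K * 2 ^ DIM('a) * (norm v)\<^sup>2 * (ball_average e (2 * rad) a + 1 / real n) * vol)"
proof -
  have r2: "0 < 2 * rad" using rad by simp
  have sub: "ball a (2 * rad) \<subseteq> ball 0 2"
  proof
    fix x assume "x \<in> ball a (2 * rad)"
    then show "x \<in> ball 0 2" using a rad(2) norm_triangle_ineq4[of a "a - x"] by (simp add: dist_norm)
  qed
  have nn: "0 < real n" using n by simp
  define V2 where "V2 = measure lborel (ball (0::'a) (2 * rad))"
  have V2: "V2 = 2 ^ DIM('a) * vol" "0 < V2" using rad vol(1) by (auto simp: V2_def content_ball vol(2) power_mult_distrib)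
  define S where "S = ball_average e (2 * rad) a + 1 / real n"
  have Se: "(LINT x:ball a (2 * rad)|lborel. e x) + V2 / real n = V2 * S"
    using V2(2) by (simp add: S_def ball_average_def V2_def distrib_left)
  \<comment> \<open>The admissible error \<open>V2 / real n\<close> becomes
    \<open>1 / real n\<close> after division by the volume.\<close>
  obtain c where c: "(\<integral>\<^sup>+x. ennreal ((u x - c)\<^sup>2) * indicator (ball a (2 * rad)) x \<partial>lborel) \<le> ennreal (K * (2 * rad)\<^sup>2 * (V2 * S))"
    using poincare[OF r2 sub, of "V2 / real n"] V2(2) nn unfolding Se by auto
  define g where "g x = ennreal ((u x - c)\<^sup>2) * indicator (ball a (2 * rad)) x" for x
  have [measurable]: "g \<in> borel_measurable borel" unfolding g_def
    by (intro borel_measurable_times_ennreal borel_measurable_indicator) simp_all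
  have pt: "ennreal ((quot y)\<^sup>2) * indicator (ball a rad) y \<le> ennreal (2 * (real n)\<^sup>2) * (g (y + step) + g y)" for y
  proof (cases "y \<in> ball a rad")
    case True
    then have "y \<in> ball a (2 * rad)" "y + step \<in> ball a (2 * rad)"
      using rad norm_triangle_ineq4[of "a - y" step] by (auto simp: dist_norm diff_diff_eq)
    moreover have "(u (y + step) - u y)\<^sup>2 \<le> 2 * ((u (y + step) - c)\<^sup>2 + (u y - c)\<^sup>2)"
      using zero_le_power2[of "(u (y + step) - c) + (u y - c)"] by (simp add: power2_eq_square algebra_simps)
    then have "(real n)\<^sup>2 * (u (y + step) - u y)\<^sup>2 \<le> (real n)\<^sup>2 * (2 * ((u (y + step) - c)\<^sup>2 + (u y - c)\<^sup>2))" by (intro mult_left_mono) auto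
    then have "(quot y)\<^sup>2 \<le> 2 * (real n)\<^sup>2 * ((u (y + step) - c)\<^sup>2 + (u y - c)\<^sup>2)"
      by (simp add: quot_def power_mult_distrib algebra_simps)
    then have "ennreal ((quot y)\<^sup>2) \<le> ennreal (2 * (real n)\<^sup>2) * (ennreal ((u (y + step) - c)\<^sup>2) + ennreal ((u y - c)\<^sup>2))"
      by (subst ennreal_plus[symmetric], simp, simp, subst ennreal_mult[symmetric]) (auto intro: ennreal_leI)
    ultimately show ?thesis using True by (simp add: g_def)
  qed simp
  have "(\<integral>\<^sup>+y. ennreal ((quot y)\<^sup>2) * indicator (ball a rad) y \<partial>lborel) \<le> (\<integral>\<^sup>+y. ennreal (2 * (real n)\<^sup>2) * (g (y + step) + g y) \<partial>lborel)"
    by (intro nn_integral_mono pt)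
  also have "\<dots> = ennreal (2 * (real n)\<^sup>2) * ((\<integral>\<^sup>+y. g (y + step) \<partial>lborel) + (\<integral>\<^sup>+y. g y \<partial>lborel))"
    by (simp add: nn_integral_cmult nn_integral_add)
  also have "(\<integral>\<^sup>+y. g (y + step) \<partial>lborel) = (\<integral>\<^sup>+y. g y \<partial>lborel)" by (rule nn_integral_lborel_translation) simp
  also have "ennreal (2 * (real n)\<^sup>2) * ((\<integral>\<^sup>+y. g y \<partial>lborel) + (\<integral>\<^sup>+y. g y \<partial>lborel))
      \<le> ennreal (2 * (real n)\<^sup>2) * (ennreal (K * (2 * rad)\<^sup>2 * (V2 * S)) + ennreal (K * (2 * rad)\<^sup>2 * (V2 * S)))"
    using c by (intro mult_left_mono add_mono) (auto simp: g_def)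
  also have "\<dots> = ennreal (2 * (real n)\<^sup>2 * (2 * (K * (2 * rad)\<^sup>2 * (V2 * S))))"
  proof -
    have "0 \<le> V2 * S" unfolding Se[symmetric] using V2(2) nn e0
      by (intro add_nonneg_nonneg) (auto simp: set_lebesgue_integral_def intro!: integral_nonneg_AE AE_I2)
    then have "0 \<le> K * (2 * rad)\<^sup>2 * (V2 * S)" by (rule mult_nonneg_nonneg[rotated]) (simp add: K)
    from ennreal_plus[OF this this, symmetric] show ?thesis
      by (simp only: mult_2[symmetric, of "K * (2 * rad)\<^sup>2 * (V2 * S)"]) (rule ennreal_mult'[symmetric], simp)
  qed
  also have "2 * (real n)\<^sup>2 * (2 * (K * (2 * rad)\<^sup>2 * (V2 * S))) = 16 * K * 2 ^ DIM('a) * (real n * rad)\<^sup>2 * S * vol"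
    by (simp add: V2(1) power_mult_distrib)
  finally show ?thesis by (simp add: rad(4) S_def)
qed

text \<open>On \<open>E\<close> the inequality q <= l + q^2 / l is used: a large \<open>l\<close>
  makes the square term small, while the relative measure \<open>t\<close> of \<open>E\<close>
  controls \<open>l * t\<close>. This is the uniform integrability hidden in
  \<open>square_bound\<close>.\<close>

lemma avg_bound:
  assumes a: "a \<in> ball 0 (7 / 4)" and l: "0 < l" and k: "0 \<le> k" and E[measurable]: "E \<in> sets borel"
    and off: "\<And>y. y \<in> ball a rad \<Longrightarrow> y \<notin> E \<Longrightarrow> quot y \<le> k" and Em: "emeasure lborel (E \<inter> ball a rad) \<le> ennreal (t * vol)" "0 \<le> t"
  shows "avg a \<le> ennreal (k + l * t + 16 * K * 2 ^ DIM('a) * (norm v)\<^sup>2 * (ball_average e (2 * rad) a + 1 / real n) / l)"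
proof -
  define S where "S = 16 * K * 2 ^ DIM('a) * (norm v)\<^sup>2 * (ball_average e (2 * rad) a + 1 / real n)"
  have "0 \<le> ball_average e (2 * rad) a"
    unfolding ball_average_def using e0 by (auto simp: set_lebesgue_integral_def intro!: integral_nonneg_AE AE_I2 divide_nonneg_nonneg)
  then have S: "0 \<le> S" unfolding S_def using K by (intro mult_nonneg_nonneg add_nonneg_nonneg) auto
  have pt: "ennreal (quot y) * indicator (ball a rad) y \<le> ennreal k * indicator (ball a rad) y + ennreal l * indicator (E \<inter> ball a rad) y
     + ennreal (1 / l) * (ennreal ((quot y)\<^sup>2) * indicator (ball a rad) y)" for y
  proof (cases "y \<in> ball a rad")
    case True
    have q: "0 \<le> quot y" by (simp add: quot_def)
    have "quot y \<le> l + 1 / l * (quot y)\<^sup>2"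
    proof (cases "quot y \<le> l")
      case False
      then have "quot y * l \<le> quot y * quot y" using q by (intro mult_left_mono) auto
      then have "quot y \<le> 1 / l * (quot y)\<^sup>2" using l by (simp add: pos_le_divide_eq power2_eq_square)
      then show ?thesis using l by simp
    qed (use l in \<open>simp add: add_increasing2\<close>)
    then have 1: "ennreal (quot y) \<le> ennreal l + ennreal (1 / l) * ennreal ((quot y)\<^sup>2)"
      using l by (subst ennreal_mult[symmetric], simp, simp, subst ennreal_plus[symmetric]) (auto intro: ennreal_leI simp del: ennreal_plus)
    show ?thesis
    proof (cases "y \<in> E")
      case True
      have "ennreal (quot y) \<le> ennreal k + (ennreal l + ennreal (1 / l) * ennreal ((quot y)\<^sup>2))"
        by (rule add_increasing[OF _ 1]) simp
      then show ?thesis using True \<open>y \<in> ball a rad\<close> by (simp add: add.assoc)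
    next
      case False
      have "ennreal (quot y) \<le> ennreal k" using off[OF \<open>y \<in> ball a rad\<close> False] by (rule ennreal_leI)
      then have "ennreal (quot y) \<le> ennreal k + ennreal (1 / l) * ennreal ((quot y)\<^sup>2)" by (intro add_increasing2) simp_all
      then show ?thesis using False \<open>y \<in> ball a rad\<close> by simp
    qed
  qed simp
  have "(\<integral>\<^sup>+y. ennreal (quot y) * indicator (ball a rad) y \<partial>lborel)
     \<le> (\<integral>\<^sup>+y. ennreal k * indicator (ball a rad) y + ennreal l * indicator (E \<inter> ball a rad) y
     + ennreal (1 / l) * (ennreal ((quot y)\<^sup>2) * indicator (ball a rad) y) \<partial>lborel)"
    by (intro nn_integral_mono pt)
  also have "\<dots> = ennreal k * emeasure lborel (ball a rad) + ennreal l * emeasure lborel (E \<inter> ball a rad)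
     + ennreal (1 / l) * (\<integral>\<^sup>+y. ennreal ((quot y)\<^sup>2) * indicator (ball a rad) y \<partial>lborel)"
  proof -
    have 1: "(\<lambda>y. ennreal k * indicator (ball a rad) y) \<in> borel_measurable lborel"
      and 2: "(\<lambda>y. ennreal l * indicator (E \<inter> ball a rad) y) \<in> borel_measurable lborel"
      and 3: "(\<lambda>y. ennreal ((quot y)\<^sup>2) * indicator (ball a rad) y) \<in> borel_measurable lborel"
      using E by (intro borel_measurable_times_ennreal borel_measurable_indicator; simp)+
    have 4: "E \<inter> ball a rad \<in> sets lborel" "ball a rad \<in> sets lborel" using E by simp_all
    show ?thesis
      unfolding nn_integral_add[OF borel_measurable_add[OF 1 2] borel_measurable_times_ennreal[OF borel_measurable_const 3]]
        nn_integral_add[OF 1 2] nn_integral_cmult[OF 3] nn_integral_cmult_indicator[OF 4(1)] nn_integral_cmult_indicator[OF 4(2)] ..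
  qed
  also have "\<dots> \<le> ennreal k * ennreal vol + ennreal l * ennreal (t * vol) + ennreal (1 / l) * ennreal (S * vol)"
    using square_bound[OF a] Em by (intro add_mono mult_left_mono) (auto simp: vol(3) S_def)
  also have "\<dots> = ennreal ((k + l * t + S / l) * vol)"
    using k l Em(2) S vol(1) by (simp add: distrib_right flip: ennreal_mult ennreal_plus)
  finally have "avg a \<le> ennreal (1 / vol) * ennreal ((k + l * t + S / l) * vol)"
    unfolding avg_def by (intro mult_left_mono) auto
  also have "\<dots> = ennreal (k + l * t + S / l)"
    using vol(1) k l Em(2) S by (subst ennreal_mult[symmetric]) auto
  finally show ?thesis by (simp add: S_def)
qed

lemma avg_bound_simple:
  assumes a: "a \<in> ball 0 (7 / 4)" and l: "0 < l"
  shows "avg a \<le> ennreal (l + 16 * K * 2 ^ DIM('a) * (norm v)\<^sup>2 * (ball_average e (2 * rad) a + 1 / real n) / l)"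
  using avg_bound[OF a l, of 0 UNIV 1] by (simp add: vol(3))

lemma avg_measurable[measurable]: "avg \<in> borel_measurable borel"
  unfolding avg_def using nn_integral_ball_average(1)[of "\<lambda>y. ennreal (quot y)" rad] by simp

text \<open>Averaging over balls of radius \<open>rad\<close> preserves the integral once the domain
  is enlarged, and \<open>rad < 1 / 8\<close> fits between 3/2 and 7/4.\<close>

lemma integral_quot_le:
  "(\<integral>\<^sup>+y. ennreal (quot y) * indicator (ball 0 (3 / 2)) y \<partial>lborel) \<le> (\<integral>\<^sup>+a. avg a * indicator (ball 0 (7 / 4)) a \<partial>lborel)"
proof -
  define g where "g y = ennreal (quot y) * indicator (ball 0 (3 / 2)) y" for y
  have [measurable]: "g \<in> borel_measurable borel" unfolding g_def
    by (intro borel_measurable_times_ennreal borel_measurable_indicator) simp_all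
  have v1: "ennreal (1 / vol) * ennreal vol = 1" using vol(1) by (simp flip: ennreal_mult)
  have "(\<integral>\<^sup>+y. g y \<partial>lborel) = ennreal (1 / vol) * (ennreal vol * (\<integral>\<^sup>+y. g y \<partial>lborel))"
    by (simp add: v1 flip: mult.assoc)
  also have "ennreal vol * (\<integral>\<^sup>+y. g y \<partial>lborel) = (\<integral>\<^sup>+a. (\<integral>\<^sup>+y. g y * indicator (ball a rad) y \<partial>lborel) \<partial>lborel)"
    by (simp add: nn_integral_ball_average(2) vol(3))
  also have "ennreal (1 / vol) * \<dots> = (\<integral>\<^sup>+a. ennreal (1 / vol) * (\<integral>\<^sup>+y. g y * indicator (ball a rad) y \<partial>lborel) \<partial>lborel)"
    using nn_integral_ball_average(1)[of g rad] by (simp add: nn_integral_cmult)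
  also have "\<dots> \<le> (\<integral>\<^sup>+a. avg a * indicator (ball 0 (7 / 4)) a \<partial>lborel)"
  proof (rule nn_integral_mono)
    fix a
    show "ennreal (1 / vol) * (\<integral>\<^sup>+y. g y * indicator (ball a rad) y \<partial>lborel) \<le> avg a * indicator (ball 0 (7 / 4)) a"
    proof (cases "a \<in> ball 0 (7 / 4)")
      case True
      then show ?thesis unfolding avg_def g_def
        by (auto simp: indicator_def intro!: mult_left_mono nn_integral_mono)
    next
      case False
      have z: "g y * indicator (ball a rad) y = 0" for y
      proof (rule ccontr)
        assume "g y * indicator (ball a rad) y \<noteq> 0"
        then have "norm y < 3 / 2" "dist a y < rad" by (auto simp: g_def indicator_def split: if_splits)
        then have "norm a < 7 / 4" using rad(2) norm_triangle_ineq[of y "a - y"] by (simp add: dist_norm)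
        then show False using False by simp
      qed
      show ?thesis unfolding z by simp
    qed
  qed
  finally show ?thesis by (simp add: g_def)
qed

text \<open>Telescoping along the \<open>n\<close> steps. Starting within radius 1/4, the starting
  points of all steps stay within 1/4 + 5/4 = 3/2, and every step contributes the same integral by
  translation invariance.\<close>

lemma integral_shift_le:
  "(\<integral>\<^sup>+y. ennreal \<bar>u (y + v) - u y\<bar> * indicator (ball 0 (1 / 4)) y \<partial>lborel) \<le> (\<integral>\<^sup>+y. ennreal (quot y) * indicator (ball 0 (3 / 2)) y \<partial>lborel)"
proof -
  have nn: "0 < real n" using n by simp
  define g where "g y = ennreal \<bar>u (y + step) - u y\<bar> * indicator (ball 0 (3 / 2)) y" for y
  have [measurable]: "g \<in> borel_measurable borel" unfolding g_def
    by (intro borel_measurable_times_ennreal borel_measurable_indicator) simp_all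
  have pt: "ennreal \<bar>u (y + v) - u y\<bar> * indicator (ball 0 (1 / 4)) y \<le> (\<Sum>i<n. g (y + real i *\<^sub>R step))" for y
  proof (cases "y \<in> ball 0 (1 / 4)")
    case True
    have "y + v = y + real n *\<^sub>R step" using nn by (simp add: step_def)
    then have "\<bar>u (y + v) - u y\<bar> \<le> (\<Sum>i<n. \<bar>u (y + real (Suc i) *\<^sub>R step) - u (y + real i *\<^sub>R step)\<bar>)"
      using telescoping_abs[of "\<lambda>i. u (y + real i *\<^sub>R step)" n] by simp
    then have "ennreal \<bar>u (y + v) - u y\<bar> \<le> ennreal (\<Sum>i<n. \<bar>u (y + real (Suc i) *\<^sub>R step) - u (y + real i *\<^sub>R step)\<bar>)" by (rule ennreal_leI)
    also have "\<dots> = (\<Sum>i<n. ennreal \<bar>u (y + real (Suc i) *\<^sub>R step) - u (y + real i *\<^sub>R step)\<bar>)" by (simp add: sum_ennreal)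
    also have "\<dots> = (\<Sum>i<n. g (y + real i *\<^sub>R step))"
    proof (rule sum.cong)
      fix i assume "i \<in> {..<n}"
      then have "norm (real i *\<^sub>R step) \<le> norm v" using rad n mult_right_mono[of "real i" "real n" rad] by simp
      then have "norm (y + real i *\<^sub>R step) < 3 / 2" using True v(2) norm_triangle_ineq[of y "real i *\<^sub>R step"] by simp
      then show "ennreal \<bar>u (y + real (Suc i) *\<^sub>R step) - u (y + real i *\<^sub>R step)\<bar> = g (y + real i *\<^sub>R step)"
        by (simp add: g_def scaleR_add_left add.commute add.left_commute)
    qed simp
    finally show ?thesis using True by simp
  qed simp
  have "(\<integral>\<^sup>+y. ennreal \<bar>u (y + v) - u y\<bar> * indicator (ball 0 (1 / 4)) y \<partial>lborel) \<le> (\<integral>\<^sup>+y. (\<Sum>i<n. g (y + real i *\<^sub>R step)) \<partial>lborel)"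
    by (intro nn_integral_mono pt)
  also have "\<dots> = (\<Sum>i<n. \<integral>\<^sup>+y. g (y + real i *\<^sub>R step) \<partial>lborel)" by (rule nn_integral_sum) simp
  also have "\<dots> = (\<Sum>i<n. \<integral>\<^sup>+y. g y \<partial>lborel)" by (simp add: nn_integral_lborel_translation)
  also have "\<dots> = ennreal (real n) * (\<integral>\<^sup>+y. g y \<partial>lborel)" by (simp add: ennreal_of_nat_eq_real_of_nat)
  also have "\<dots> = (\<integral>\<^sup>+y. ennreal (real n) * g y \<partial>lborel)" by (simp add: nn_integral_cmult)
  also have "\<dots> = (\<integral>\<^sup>+y. ennreal (quot y) * indicator (ball 0 (3 / 2)) y \<partial>lborel)"
    by (intro nn_integral_cong) (simp add: g_def quot_def ennreal_mult mult.assoc)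
  finally show ?thesis .
qed

end

end

section \<open>Vanishing of the quotients and constancy\<close>

lemma outer_measure_of_lebesgue_borel:
  assumes "A \<in> sets borel"
  shows "outer_measure_of lebesgue A = emeasure lborel A"
  using assms by (simp add: outer_measure_of_eq)

lemma emeasure_lborel_translation:
  fixes A :: "'a::euclidean_space set"
  assumes [measurable]: "A \<in> sets borel"
  shows "emeasure lborel {y. y + z \<in> A} = emeasure lborel A"
proof -
  have "{y. y + z \<in> A} = (\<lambda>y. y + z) -` A \<inter> space borel" by auto
  also have "\<dots> \<in> sets borel" by measurable
  finally have m: "{y. y + z \<in> A} \<in> sets lborel" by simp
  have "emeasure lborel {y. y + z \<in> A} = (\<integral>\<^sup>+y. indicator {y. y + z \<in> A} y \<partial>lborel)"
    by (rule nn_integral_indicator[OF m, symmetric])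
  also have "\<dots> = (\<integral>\<^sup>+y. indicator A (y + z) \<partial>lborel)" by (simp add: indicator_def)
  also have "\<dots> = (\<integral>\<^sup>+y. indicator A y \<partial>lborel)" by (rule nn_integral_lborel_translation) simp
  finally show ?thesis by simp
qed

context vanishing_derivative
begin

lemma rad_tendsto:
  assumes "v \<noteq> 0" "norm v < 5 / 4" "\<And>k. 16 \<le> N k" "filterlim N at_top F"
  shows "((\<lambda>k. rad v (N k)) \<longlongrightarrow> 0) F"
  unfolding rad_def[OF assms(1-3)]
  by (rule tendsto_divide_0[OF tendsto_const filterlim_at_top_imp_at_infinity])
    (rule filterlim_compose[OF filterlim_real_sequentially assms(4)])

text \<open>If \<open>e a = 0\<close>, the mean-square bound alone can be made arbitrarily small.
  Otherwise the exceptional set has density zero: off it \<open>quot\<close> is small, and on it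
  \<open>avg_bound\<close> applies with a large truncation level.\<close>

lemma avg_tendsto:
  assumes v: "v \<noteq> 0" "norm v < 5 / 4" and a: "a \<in> ball 0 (7 / 4)"
    and alt: "e a = 0 \<or> (\<forall>\<eta>>0. density_zero {x. x \<noteq> a \<and> \<eta> * norm (x - a) \<le> \<bar>u x - u a\<bar>} a)"
    and N: "filterlim N at_top sequentially" "\<And>k. 16 \<le> N k"
    and conv: "(\<lambda>k. ball_average e (2 * rad v (N k)) a) \<longlonglongrightarrow> e a"
  shows "(\<lambda>k. avg v (N k) a) \<longlonglongrightarrow> 0"
proof (rule ennreal_tendsto_0I)
  fix t :: real assume t: "0 < t"
  define C1 where "C1 = 16 * K * 2 ^ DIM('a) * (norm v)\<^sup>2"
  have C1: "0 \<le> C1" using K by (simp add: C1_def)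
  define S where "S k = ball_average e (2 * rad v (N k)) a + 1 / real (N k)" for k
  have "(\<lambda>k. 1 / real (N k)) \<longlonglongrightarrow> 0"
    by (rule tendsto_divide_0[OF tendsto_const filterlim_at_top_imp_at_infinity])
      (rule filterlim_compose[OF filterlim_real_sequentially N(1)])
  from tendsto_add[OF conv this] have S: "S \<longlonglongrightarrow> e a" by (simp add: S_def[abs_def])
  have CS: "(\<lambda>k. C1 * S k / l) \<longlonglongrightarrow> C1 * e a / l" for l
    using tendsto_mult[OF tendsto_mult[OF tendsto_const[of C1] S] tendsto_const[of "inverse l"]] by (simp only: divide_inverse)
  show "\<forall>\<^sub>F k in sequentially. avg v (N k) a \<le> ennreal t"
    using alt
  proof
    assume "e a = 0"
    then have "\<forall>\<^sub>F k in sequentially. C1 * S k / (t / 2) < t / 2"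
      using order_tendstoD(2)[OF CS[of "t / 2"], of "t / 2"] t by simp
    then show ?thesis
    proof eventually_elim
      case (elim k)
      have "avg v (N k) a \<le> ennreal (t / 2 + C1 * S k / (t / 2))"
        using avg_bound_simple[OF v N(2)[of k] a, of "t / 2"] t by (simp add: C1_def S_def)
      also have "\<dots> \<le> ennreal t" using elim by (intro ennreal_leI) simp
      finally show ?case .
    qed
  next
    assume dens: "\<forall>\<eta>>0. density_zero {x. x \<noteq> a \<and> \<eta> * norm (x - a) \<le> \<bar>u x - u a\<bar>} a"
    have v0: "0 < norm v" using v by simp
    \<comment> \<open>The values of \<open>l\<close>, \<open>\<theta>\<close> and
      \<open>\<eta>\<close> make the square term, the exceptional set and the regular part
      contribute at most \<open>t / 3\<close> each.\<close>
    define l where "l = 3 * (C1 * e a + 1) / t"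
    have ce: "0 \<le> C1 * e a" using C1 e0 by simp
    have l: "0 < l" using t ce by (simp add: l_def)
    define \<theta> where "\<theta> = t / (6 * 2 ^ DIM('a) * l)"
    have \<theta>: "0 < \<theta>" using t l by (simp add: \<theta>_def)
    define \<eta> where "\<eta> = t / (9 * norm v)"
    have \<eta>: "0 < \<eta>" using t v0 by (simp add: \<eta>_def)
    define A where "A = {x. x \<noteq> a \<and> \<eta> * norm (x - a) \<le> \<bar>u x - u a\<bar>}"
    have "A = {x\<in>space borel. x \<noteq> a \<and> \<eta> * norm (x - a) \<le> \<bar>u x - u a\<bar>}" by (simp add: A_def)
    also have "\<dots> \<in> sets borel" by measurable
    finally have A[measurable]: "A \<in> sets borel" .
    obtain \<delta> where \<delta>: "0 < \<delta>" "\<And>r. 0 < r \<Longrightarrow> r < \<delta> \<Longrightarrow> outer_measure_of lebesgue (A \<inter> ball a r) \<le> ennreal \<theta> * emeasure lebesgue (ball a r)"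
      using dens[rule_format, OF \<eta>] \<theta> unfolding density_zero_iff A_def[symmetric] by blast
    have "C1 * e a / l < t / 3"
    proof -
      have "C1 * e a / l = t / 3 * (C1 * e a / (C1 * e a + 1))" using t ce by (simp add: l_def field_simps)
      also have "\<dots> < t / 3 * 1" using t ce by (intro mult_strict_left_mono) (simp_all add: divide_less_eq)
      finally show ?thesis by simp
    qed
    then have "\<forall>\<^sub>F k in sequentially. C1 * S k / l < t / 3" using order_tendstoD(2)[OF CS[of l], of "t / 3"] by simp
    moreover have "\<forall>\<^sub>F k in sequentially. rad v (N k) < \<delta> / 2"
      using order_tendstoD(2)[OF rad_tendsto[OF v N(2,1)], of "\<delta> / 2"] \<delta>(1) by simp
    ultimately show ?thesis
    proof eventually_elim
      case (elim k)
      note r = rad[OF v N(2)[of k]] and V = vol[OF v N(2)[of k]]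
      let ?r = "rad v (N k)" and ?h = "step v (N k)"
      \<comment> \<open>The quotient involves \<open>u\<close> at \<open>y\<close> and at
        \<open>y + ?h\<close>, so both points must avoid \<open>A\<close>.\<close>
      define E where "E = A \<union> {y. y + ?h \<in> A}"
      have "{y. y + ?h \<in> A} = (\<lambda>y. y + ?h) -` A \<inter> space borel" by auto
      also have "\<dots> \<in> sets borel" by measurable
      finally have Eb: "E \<in> sets borel" unfolding E_def by simp
      have off: "quot v (N k) y \<le> t / 3" if y: "y \<in> ball a ?r" "y \<notin> E" for y
      proof -
        have y': "norm (y - a) < ?r" using y(1) by (simp add: dist_norm norm_minus_commute)
        have "norm (y + ?h - a) \<le> norm (y - a) + norm ?h" using norm_triangle_ineq[of "y - a" ?h] by (simp add: algebra_simps)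
        then have y'': "norm (y + ?h - a) \<le> 2 * ?r" using y' r(3) by simp
        have *: "\<bar>u z - u a\<bar> \<le> \<eta> * norm (z - a)" if "z \<notin> A" for z using that by (cases "z = a") (auto simp: A_def)
        have "\<bar>u y - u a\<bar> \<le> \<eta> * ?r"
        proof -
          have "\<eta> * norm (y - a) \<le> \<eta> * ?r" using y' \<eta> by (intro mult_left_mono) auto
          then show ?thesis using *[of y] y(2) unfolding E_def by (blast intro: order_trans)
        qed
        moreover have "\<bar>u (y + ?h) - u a\<bar> \<le> \<eta> * (2 * ?r)"
        proof -
          have "\<eta> * norm (y + ?h - a) \<le> \<eta> * (2 * ?r)" using y'' \<eta> by (intro mult_left_mono) auto
          then show ?thesis using *[of "y + ?h"] y(2) unfolding E_def by (blast intro: order_trans)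
        qed
        ultimately have "\<bar>u (y + ?h) - u y\<bar> \<le> \<eta> * ?r + \<eta> * (2 * ?r)" by linarith
        then have "\<bar>u (y + ?h) - u y\<bar> \<le> 3 * \<eta> * ?r" by (simp only: distrib_left[symmetric]) simp
        then have "quot v (N k) y \<le> real (N k) * (3 * \<eta> * ?r)" unfolding quot_def[OF v N(2)] by (intro mult_left_mono) auto
        also have "\<dots> = 3 * \<eta> * norm v" using r(4) by (simp add: mult_ac)
        also have "\<dots> = t / 3" using v0 by (simp add: \<eta>_def)
        finally show ?thesis .
      qed
      have Em: "emeasure lborel (E \<inter> ball a ?r) \<le> ennreal (2 * 2 ^ DIM('a) * \<theta> * vol v (N k))"
      proof -
        let ?D = "A \<inter> ball a (2 * ?r)"
        have Db: "?D \<in> sets borel" using A by simp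
        have "{y. y + ?h \<in> ?D} = (\<lambda>y. y + ?h) -` ?D \<inter> space borel" by auto
        also have "\<dots> \<in> sets borel" using Db by measurable
        finally have Db': "{y. y + ?h \<in> ?D} \<in> sets borel" .
        have sub: "E \<inter> ball a ?r \<subseteq> ?D \<union> {y. y + ?h \<in> ?D}"
        proof
          fix y assume y: "y \<in> E \<inter> ball a ?r"
          then have "norm (y - a) < ?r" by (simp add: dist_norm norm_minus_commute)
          moreover have "norm (y + ?h - a) \<le> norm (y - a) + norm ?h" using norm_triangle_ineq[of "y - a" ?h] by (simp add: algebra_simps)
          ultimately have "y \<in> ball a (2 * ?r)" "y + ?h \<in> ball a (2 * ?r)"
            using r(1,3) norm_minus_commute[of a y] norm_minus_commute[of a "y + ?h"] by (simp_all add: dist_norm)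
          then show "y \<in> ?D \<union> {y. y + ?h \<in> ?D}" using y by (auto simp: E_def)
        qed
        have "emeasure lborel (E \<inter> ball a ?r) \<le> emeasure lborel (?D \<union> {y. y + ?h \<in> ?D})"
          by (rule emeasure_mono[OF sub]) (simp only: sets_lborel sets.Un[OF Db Db'])
        also have "\<dots> \<le> emeasure lborel ?D + emeasure lborel {y. y + ?h \<in> ?D}"
          by (rule emeasure_subadditive) (simp_all only: sets_lborel Db Db')
        also have "\<dots> = 2 * emeasure lborel ?D" unfolding emeasure_lborel_translation[OF Db] by (rule mult_2[symmetric])
        also have "\<dots> \<le> 2 * (ennreal \<theta> * ennreal (2 ^ DIM('a) * vol v (N k)))"
        proof (rule mult_left_mono)
          have "outer_measure_of lebesgue ?D \<le> ennreal \<theta> * emeasure lebesgue (ball a (2 * ?r))"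
            using elim(2) r(1) by (intro \<delta>(2)) simp_all
          moreover have "emeasure lebesgue (ball a (2 * ?r)) = ennreal (2 ^ DIM('a) * vol v (N k))"
            using r(1) measure_lborel_ball(1)[of "2 * ?r" a]
            by (simp add: V(2) power_mult_distrib mult.left_commute)
          ultimately show "emeasure lborel ?D \<le> ennreal \<theta> * ennreal (2 ^ DIM('a) * vol v (N k))"
            by (simp only: outer_measure_of_lebesgue_borel[OF Db])
        qed simp
        also have "\<dots> = ennreal (2 * (\<theta> * (2 ^ DIM('a) * vol v (N k))))"
          using \<theta> V(1) by (simp add: ennreal_mult)
        finally show ?thesis by (simp add: mult_ac)
      qed
      have "0 \<le> 2 * 2 ^ DIM('a) * \<theta>" "0 \<le> t / 3" using \<theta> t by simp_all
      from avg_bound[OF v N(2) a l this(2) Eb off Em this(1)]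
      have "avg v (N k) a \<le> ennreal (t / 3 + l * (2 * 2 ^ DIM('a) * \<theta>) + C1 * S k / l)"
        by (simp add: C1_def S_def)
      also have "\<dots> \<le> ennreal t"
      proof (rule ennreal_leI)
        have "l * (2 * 2 ^ DIM('a) * \<theta>) = t / 3" using l by (simp add: \<theta>_def)
        then show "t / 3 + l * (2 * 2 ^ DIM('a) * \<theta>) + C1 * S k / l \<le> t" using elim(1) by linarith
      qed
      finally show ?case .
    qed
  qed
qed

text \<open>Pointwise convergence of \<open>avg\<close> does not by itself pass to the integral.
  Therefore \<open>avg\<close> is cut off at a level \<open>l\<close>, where dominated convergence
  applies, and what exceeds \<open>l\<close> is bounded in mean by \<open>C1 / l\<close> times
  integrals of ball averages, which stay bounded.\<close>

lemma shift_invariant: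
  assumes v: "v \<noteq> 0" "norm v < 5 / 4"
  shows "AE y in lborel. y \<in> ball 0 (1 / 4) \<longrightarrow> u (y + v) = u y"
proof -
  define R where "R k = 2 * rad v (k + 16)" for k
  have R: "0 < R k" for k using rad(1)[OF v, of "k + 16"] by (simp add: R_def)
  have fl: "filterlim (\<lambda>k. k + 16 :: nat) at_top sequentially" by (rule filterlim_add_const_nat_at_top)
  have "R \<longlonglongrightarrow> 2 * 0" unfolding R_def by (intro tendsto_mult tendsto_const rad_tendsto v fl) simp
  then have R0: "R \<longlonglongrightarrow> 0" by simp
  note L1 = ball_average_L1[OF ei R R0]
  \<comment> \<open>Convergence of the ball averages in mean becomes convergence almost everywhere
    along a subsequence, and only these step numbers are used.\<close>
  obtain s where s: "strict_mono s" "AE a in lborel. (\<lambda>k. ball_average e (R (s k)) a - e a) \<longlonglongrightarrow> 0"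
    using tendsto_L1_AE_subseq[OF L1] by blast
  define N where "N k = s k + 16" for k
  have N: "filterlim N at_top sequentially" "16 \<le> N k" for k
    unfolding N_def using filterlim_compose[OF fl filterlim_subseq[OF s(1)]] by simp_all
  have RN: "R (s k) = 2 * rad v (N k)" for k by (simp add: R_def N_def)
  have pt: "AE a in lborel. a \<in> ball 0 (7 / 4) \<longrightarrow> (\<lambda>k. avg v (N k) a) \<longlonglongrightarrow> 0"
    using s(2) vanish
  proof eventually_elim
    case (elim a)
    have "(\<lambda>k. ball_average e (2 * rad v (N k)) a) \<longlonglongrightarrow> e a"
      using tendsto_add[OF elim(1) tendsto_const[of "e a"]] by (simp add: RN)
    then show ?case using avg_tendsto[OF v _ _ N] elim(2) by auto
  qed
  define W where "W = measure lborel (ball (0::'a) (7 / 4))"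
  have W: "emeasure lborel (ball (0::'a) (7 / 4)) = ennreal W" "0 \<le> W"
    using measure_lborel_ball[of "7/4" "0::'a"] by (simp_all add: W_def)
  define I where "I = (LINT x|lborel. e x)"
  have I: "0 \<le> I" unfolding I_def using e0 by (simp add: integral_nonneg_AE)
  define C1 where "C1 = 16 * K * 2 ^ DIM('a) * (norm v)\<^sup>2"
  have C1: "0 \<le> C1" using K by (simp add: C1_def)
  have bnn: "0 \<le> ball_average e r a" for r a
    unfolding ball_average_def using e0 by (auto simp: set_lebesgue_integral_def intro!: integral_nonneg_AE AE_I2 divide_nonneg_nonneg)
  have am: "avg v (N k) \<in> borel_measurable borel" for k using avg_measurable[OF v N(2)] .
  have bm: "(\<lambda>a. ball_average e (R k) a) \<in> borel_measurable borel" for k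
  proof -
    have "(\<lambda>a. (ball_average e (R k) a - e a) + e a) \<in> borel_measurable lborel"
      using L1(1) ei by (intro borel_measurable_add borel_measurable_integrable)
    then show ?thesis by simp
  qed
  have lim: "(\<lambda>k. \<integral>\<^sup>+a. avg v (N k) a * indicator (ball 0 (7 / 4)) a \<partial>lborel) \<longlonglongrightarrow> 0"
  proof (rule ennreal_tendsto_0I)
    fix t :: real assume t: "0 < t"
    \<comment> \<open>Large enough for the part of \<open>avg\<close> above \<open>l\<close> to
      integrate to at most \<open>t / 2\<close>.\<close>
    define l where "l = 2 * (C1 * (I + 1 + W) + 1) / t"
    have cw: "0 \<le> C1 * (I + 1 + W)" using C1 I W by simp
    have l: "0 < l" using t cw by (simp add: l_def)
    have il: "(\<integral>\<^sup>+a. ennreal l * indicator (ball (0::'a) (7 / 4)) a \<partial>lborel) < \<infinity>"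
      using W(1) by (simp add: nn_integral_cmult_indicator ennreal_mult_less_top)
    have mm: "(\<lambda>a. min (avg v (N k) a) (ennreal l) * indicator (ball 0 (7 / 4)) a) \<in> borel_measurable lborel" for k
      using am[of k] by (intro borel_measurable_times_ennreal borel_measurable_indicator borel_measurable_min) simp_all
    have ml: "(\<lambda>a. ennreal l * indicator (ball (0::'a) (7 / 4)) a) \<in> borel_measurable lborel"
      by (intro borel_measurable_times_ennreal borel_measurable_indicator) simp_all
    have "(\<lambda>k. \<integral>\<^sup>+a. min (avg v (N k) a) (ennreal l) * indicator (ball 0 (7 / 4)) a \<partial>lborel) \<longlonglongrightarrow> (\<integral>\<^sup>+(a::'a). 0 \<partial>lborel)"
    proof (rule nn_integral_dominated_convergence[OF mm _ ml _ il])
      show "AE a in lborel. min (avg v (N k) a) (ennreal l) * indicator (ball 0 (7 / 4)) a \<le> ennreal l * indicator (ball 0 (7 / 4)) a" for k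
        by (intro AE_I2 mult_right_mono) simp_all
      show "AE a in lborel. (\<lambda>k. min (avg v (N k) a) (ennreal l) * indicator (ball 0 (7 / 4)) a) \<longlonglongrightarrow> 0"
        using pt
      proof eventually_elim
        case (elim a)
        show ?case
        proof (cases "a \<in> ball 0 (7 / 4)")
          case True
          then have "(\<lambda>k. min (avg v (N k) a) (ennreal l)) \<longlonglongrightarrow> min 0 (ennreal l)"
            using elim by (intro tendsto_min tendsto_const) simp
          then show ?thesis using True by simp
        qed simp
      qed
    qed simp
    then have 1: "(\<lambda>k. \<integral>\<^sup>+a. min (avg v (N k) a) (ennreal l) * indicator (ball 0 (7 / 4)) a \<partial>lborel) \<longlonglongrightarrow> 0" by simp
    have "\<forall>\<^sub>F k in sequentially. (\<integral>\<^sup>+a. min (avg v (N k) a) (ennreal l) * indicator (ball 0 (7 / 4)) a \<partial>lborel) < ennreal (t / 2)"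
      using order_tendstoD(2)[OF 1, of "ennreal (t / 2)"] t by simp
    moreover have "\<forall>\<^sub>F k in sequentially. (LINT a|lborel. norm (ball_average e (R (s k)) a - e a)) < 1"
      using order_tendstoD(2)[OF LIMSEQ_subseq_LIMSEQ[OF L1(2) s(1)], of 1] by (simp add: o_def)
    ultimately show "\<forall>\<^sub>F k in sequentially. (\<integral>\<^sup>+a. avg v (N k) a * indicator (ball 0 (7 / 4)) a \<partial>lborel) \<le> ennreal t"
    proof eventually_elim
      case (elim k)
      let ?B = "\<lambda>a. ball_average e (R (s k)) a"
      let ?i = "indicator (ball (0::'a) (7 / 4))"
      have Bi: "integrable lborel ?B" using Bochner_Integration.integrable_add[OF L1(1)[of "s k"] ei] by simp
      have BI: "(\<integral>\<^sup>+a. ennreal (?B a) \<partial>lborel) \<le> ennreal (I + 1)"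
      proof -
        have "(LINT a|lborel. ?B a) \<le> (LINT a|lborel. e a + norm (?B a - e a))"
          using Bi ei L1(1)[of "s k"] by (intro integral_mono) auto
        also have "\<dots> = I + (LINT a|lborel. norm (?B a - e a))"
          unfolding I_def using ei L1(1)[of "s k"] by (intro Bochner_Integration.integral_add) auto
        also have "\<dots> \<le> I + 1" using elim(2) by simp
        finally show ?thesis using nn_integral_eq_integral[OF Bi] bnn by (simp add: ennreal_leI)
      qed
      have b: "avg v (N k) a * ?i a \<le> min (avg v (N k) a) (ennreal l) * ?i a + ennreal (C1 / l) * (ennreal (?B a) + ?i a)" for a
      proof (cases "a \<in> ball 0 (7 / 4)")
        case True
        show ?thesis
        proof (cases "avg v (N k) a \<le> ennreal l")
          case False
          have "avg v (N k) a \<le> ennreal (l + C1 * (?B a + 1 / real (N k)) / l)"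
            using avg_bound_simple[OF v N(2) True l, of k] by (simp add: C1_def RN)
          also have "\<dots> \<le> ennreal (l + C1 / l * (?B a + 1))"
          proof (rule ennreal_leI)
            have "1 / real (N k) \<le> 1" using N(2)[of k] by simp
            then have "C1 / l * (?B a + 1 / real (N k)) \<le> C1 / l * (?B a + 1)" using C1 l by (intro mult_left_mono) auto
            then show "l + C1 * (?B a + 1 / real (N k)) / l \<le> l + C1 / l * (?B a + 1)" by simp
          qed
          also have "\<dots> = ennreal l + ennreal (C1 / l) * (ennreal (?B a) + 1)"
          proof -
            have "ennreal (?B a) + 1 = ennreal (?B a + 1)" using bnn[of "R (s k)" a] by simp
            moreover have "ennreal (C1 / l) * ennreal (?B a + 1) = ennreal (C1 / l * (?B a + 1))"
              using bnn[of "R (s k)" a] C1 l by (intro ennreal_mult[symmetric]) auto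
            moreover have "ennreal l + ennreal (C1 / l * (?B a + 1)) = ennreal (l + C1 / l * (?B a + 1))"
              using bnn[of "R (s k)" a] C1 l by (intro ennreal_plus[symmetric]) auto
            ultimately show ?thesis by simp
          qed
          finally show ?thesis using True False by (simp add: min_def)
        qed (use True in \<open>simp add: min_def\<close>)
      qed simp
      have m1: "(\<lambda>a. ennreal (?B a) + ?i a) \<in> borel_measurable lborel"
        using bm[of "s k"] by (intro borel_measurable_add borel_measurable_indicator) simp_all
      have "(\<integral>\<^sup>+a. avg v (N k) a * ?i a \<partial>lborel)
        \<le> (\<integral>\<^sup>+a. min (avg v (N k) a) (ennreal l) * ?i a + ennreal (C1 / l) * (ennreal (?B a) + ?i a) \<partial>lborel)"
        by (intro nn_integral_mono b)
      also have "\<dots> = (\<integral>\<^sup>+a. min (avg v (N k) a) (ennreal l) * ?i a \<partial>lborel) + ennreal (C1 / l) * (\<integral>\<^sup>+a. ennreal (?B a) + ?i a \<partial>lborel)"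
        using nn_integral_add[OF mm borel_measurable_times_ennreal[OF borel_measurable_const m1]] nn_integral_cmult[OF m1] by simp
      also have "(\<integral>\<^sup>+a. ennreal (?B a) + ?i a \<partial>lborel) = (\<integral>\<^sup>+a. ennreal (?B a) \<partial>lborel) + ennreal W"
        using bm[of "s k"] W(1) by (subst nn_integral_add) (auto intro: borel_measurable_indicator)
      also have "(\<integral>\<^sup>+a. min (avg v (N k) a) (ennreal l) * ?i a \<partial>lborel) + ennreal (C1 / l) * ((\<integral>\<^sup>+a. ennreal (?B a) \<partial>lborel) + ennreal W)
         \<le> ennreal (t / 2) + ennreal (C1 / l) * (ennreal (I + 1) + ennreal W)"
        using elim(1) BI by (intro add_mono mult_left_mono) auto
      also have "\<dots> = ennreal (t / 2 + C1 / l * (I + 1 + W))"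
      proof -
        have "ennreal (I + 1) + ennreal W = ennreal (I + 1 + W)" using I W by (intro ennreal_plus[symmetric]) auto
        moreover have "ennreal (C1 / l) * ennreal (I + 1 + W) = ennreal (C1 / l * (I + 1 + W))"
          using I W C1 l by (intro ennreal_mult[symmetric]) auto
        moreover have "ennreal (t / 2) + ennreal (C1 / l * (I + 1 + W)) = ennreal (t / 2 + C1 / l * (I + 1 + W))"
          using I W C1 l t by (intro ennreal_plus[symmetric]) auto
        ultimately show ?thesis by simp
      qed
      also have "\<dots> \<le> ennreal t"
      proof (rule ennreal_leI)
        have "C1 / l * (I + 1 + W) = t / 2 * (C1 * (I + 1 + W) / (C1 * (I + 1 + W) + 1))"
          by (simp add: l_def)
        also have "\<dots> \<le> t / 2 * 1" using t cw by (intro mult_left_mono) (simp_all add: divide_le_eq)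
        finally have "C1 / l * (I + 1 + W) \<le> t / 2" by (simp only: mult_1_right)
        then show "t / 2 + C1 / l * (I + 1 + W) \<le> t" by linarith
      qed
      finally show ?case .
    qed
  qed
  define X where "X = (\<integral>\<^sup>+y. ennreal \<bar>u (y + v) - u y\<bar> * indicator (ball 0 (1 / 4)) y \<partial>lborel)"
  have "X \<le> (\<integral>\<^sup>+a. avg v (N k) a * indicator (ball 0 (7 / 4)) a \<partial>lborel)" for k
    unfolding X_def by (rule order_trans[OF integral_shift_le[OF v N(2)] integral_quot_le[OF v N(2)]])
  then have "X \<le> 0" using LIMSEQ_le_const[OF lim] by blast
  then have X0: "X = 0" by simp
  have mX: "(\<lambda>y. ennreal \<bar>u (y + v) - u y\<bar> * indicator (ball 0 (1 / 4)) y) \<in> borel_measurable lborel"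
    by (intro borel_measurable_times_ennreal borel_measurable_indicator) simp_all
  have "AE y in lborel. ennreal \<bar>u (y + v) - u y\<bar> * indicator (ball 0 (1 / 4)) y = 0"
    using X0 nn_integral_0_iff_AE[OF mX] by (simp add: X_def)
  then show ?thesis by eventually_elim (auto simp: indicator_def)
qed

text \<open>Fubini exchanges the quantifiers over shifts and points and yields one \<open>y0\<close>
  with \<open>u (y0 + w) = u y0\<close> for almost all short \<open>w\<close>. Shifts up to 5/4 = 1
  + 1/4 reach the whole unit ball from \<open>y0\<close>.\<close>

theorem AE_constant: "\<exists>c. AE x in lborel. x \<in> ball 0 1 \<longrightarrow> u x = c"
proof -
  define P where "P w y \<longleftrightarrow> (w \<in> ball 0 (5 / 4) \<longrightarrow> y \<in> ball 0 (1 / 4) \<longrightarrow> u (y + w) = u y)" for w y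
  have b: "ball (0::'a) r \<in> sets borel" for r by simp
  have 1: "(\<lambda>p :: 'a \<times> 'a. u (snd p + fst p)) \<in> borel_measurable (borel \<Otimes>\<^sub>M borel)"
    by (rule measurable_compose[OF _ um]) measurable
  have 2: "(\<lambda>p :: 'a \<times> 'a. u (snd p)) \<in> borel_measurable (borel \<Otimes>\<^sub>M borel)"
    by (rule measurable_compose[OF measurable_snd um])
  have "{p \<in> space (borel \<Otimes>\<^sub>M borel :: ('a \<times> 'a) measure). P (fst p) (snd p)}
     = (- (ball 0 (5 / 4) \<times> ball 0 (1 / 4))) \<union> {p \<in> space (borel \<Otimes>\<^sub>M borel). u (snd p + fst p) = u (snd p)}"
  proof (rule set_eqI)
    fix p :: "'a \<times> 'a"
    show "p \<in> {p \<in> space (borel \<Otimes>\<^sub>M borel :: ('a \<times> 'a) measure). P (fst p) (snd p)} \<longleftrightarrow>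
      p \<in> (- (ball 0 (5 / 4) \<times> ball 0 (1 / 4))) \<union> {p \<in> space (borel \<Otimes>\<^sub>M borel). u (snd p + fst p) = u (snd p)}"
      by (simp only: P_def space_pair_measure space_borel Un_iff Compl_iff mem_Collect_eq mem_Times_iff UNIV_I) blast
  qed
  also have "\<dots> \<in> sets (borel \<Otimes>\<^sub>M borel)"
  proof (rule sets.Un)
    have "space (borel \<Otimes>\<^sub>M borel :: ('a \<times> 'a) measure) - ball 0 (5 / 4) \<times> ball 0 (1 / 4) \<in> sets (borel \<Otimes>\<^sub>M borel)"
      by (intro sets.compl_sets pair_measureI b)
    then show "- (ball (0::'a) (5 / 4) \<times> ball (0::'a) (1 / 4)) \<in> sets (borel \<Otimes>\<^sub>M borel)"
      by (simp add: space_pair_measure Compl_eq_Diff_UNIV)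
    show "{p \<in> space (borel \<Otimes>\<^sub>M borel). u (snd p + fst p) = u (snd p)} \<in> sets (borel \<Otimes>\<^sub>M borel)"
      by (rule borel_measurable_eq[OF 1 2])
  qed
  finally have meas: "{p \<in> space (lborel \<Otimes>\<^sub>M lborel). P (fst p) (snd p)} \<in> sets (lborel \<Otimes>\<^sub>M lborel)"
    by (simp only: space_pair_measure space_borel space_lborel sets_pair_measure_cong[OF sets_lborel sets_lborel])
  have "AE y in lborel. P w y" for w
  proof (cases "w \<noteq> 0 \<and> norm w < 5 / 4")
    case True
    from shift_invariant[OF conjunct1[OF True] conjunct2[OF True]] show ?thesis by eventually_elim (simp add: P_def)
  next
    case False
    then have "P w y" for y by (auto simp: P_def)
    then show ?thesis by simp
  qed
  then have "AE w in lborel. AE y in lborel. P w y" by simp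
  then have AE: "AE y in lborel. AE w in lborel. P w y" using lborel_pair.AE_commute[OF meas] by blast
  have "\<exists>y0\<in>ball 0 (1 / 4). AE w in lborel. P w y0"
  proof (rule ccontr)
    assume "\<not> (\<exists>y0\<in>ball 0 (1 / 4). AE w in lborel. P w y0)"
    then have "\<not> (AE w in lborel. P w y)" if "y \<in> ball 0 (1 / 4)" for y using that by blast
    with AE have "AE y in lborel. y \<notin> ball (0::'a) (1 / 4)" by (auto elim!: eventually_mono)
    moreover have "{y \<in> space lborel. \<not> y \<notin> ball (0::'a) (1 / 4)} = ball 0 (1 / 4)" by auto
    ultimately have "emeasure lborel (ball (0::'a) (1 / 4)) = 0"
      using AE_iff_measurable[of "ball (0::'a) (1/4)" lborel "\<lambda>y. y \<notin> ball 0 (1 / 4)"] b[of "1/4"] sets_lborel by blast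
    then show False using measure_lborel_ball(1)[of "1 / 4" "0::'a"] unit_ball_vol_pos[of "real DIM('a)"] by simp
  qed
  then obtain y0 where y0: "y0 \<in> ball 0 (1 / 4)" "AE w in lborel. P w y0" by blast
  define Pr where "Pr x \<longleftrightarrow> (x \<in> ball 0 1 \<longrightarrow> u x = u y0)" for x
  have "{x \<in> space borel. Pr x} = - ball 0 1 \<union> {x \<in> space borel. u x = u y0}" by (auto simp: Pr_def)
  also have "\<dots> \<in> sets borel" by (intro sets.Un borel_comp borel_measurable_eq um b) measurable
  finally have Pm: "{x \<in> space borel. Pr x} \<in> sets borel" .
  have "AE w in lborel. Pr (y0 + w)"
    using y0(2)
  proof eventually_elim
    case (elim w)
    show ?case unfolding Pr_def
    proof
      assume "y0 + w \<in> ball 0 1"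
      then have "w \<in> ball 0 (5 / 4)" using y0(1) norm_triangle_ineq4[of "y0 + w" y0] by simp
      then show "u (y0 + w) = u y0" using elim y0(1) by (simp add: P_def)
    qed
  qed
  then have "AE x in distr lborel borel ((+) y0). Pr x"
    by (subst AE_distr_iff[OF _ Pm]) simp_all
  then show ?thesis unfolding lborel_distr_plus Pr_def by blast
qed

end

section \<open>Essential boundedness\<close>

lemma fast_growing_C1:
  fixes b :: "nat \<Rightarrow> real"
  assumes b: "\<And>n. 0 \<le> b n"
  shows "\<exists>H H'. (\<forall>s. (H has_real_derivative H' s) (at s)) \<and> continuous_on UNIV H' \<and>
    (\<forall>s. 0 \<le> H s) \<and> (\<forall>s. 0 \<le> H' s) \<and> (\<forall>n s. real n + 1 \<le> s \<longrightarrow> b n \<le> H s)"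
proof -
  \<comment> \<open>The profile \<open>H\<close> is the sum over all \<open>n\<close> of
    \<open>b n * sq_pos (s - real n)\<close>. Terms with \<open>real n \<ge> s\<close> vanish, so
    the sum is locally finite, and the \<open>n\<close>-th term is at least \<open>b n\<close> once
    \<open>s \<ge> real n + 1\<close>.\<close>
  define S where "S m s = (\<Sum>n<m. b n * sq_pos (s - real n))" for m s
  define D where "D m s = (\<Sum>n<m. b n * (2 * max 0 (s - real n)))" for m s
  define k where "k s = nat \<lceil>\<bar>s\<bar>\<rceil>" for s :: real
  have k: "s \<le> real (k s)" for s unfolding k_def by linarith
  have st: "S m' s = S m s" "D m' s = D m s" if "s \<le> real m" "m \<le> m'" for m m' s
  proof -
    have z: "max 0 (s - real n) = 0" if "n \<in> {..<m'} - {..<m}" for n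
      using that \<open>s \<le> real m\<close> by auto
    show "S m' s = S m s" unfolding S_def
      by (rule sum.mono_neutral_left[symmetric]) (use \<open>m \<le> m'\<close> z in \<open>auto simp: sq_pos_def\<close>)
    show "D m' s = D m s" unfolding D_def
      by (rule sum.mono_neutral_left[symmetric]) (use \<open>m \<le> m'\<close> z in auto)
  qed
  have HS: "S (k s) s = S m s" "D (k s) s = D m s" if "s \<le> real m" for m s
    using st[OF that, of "max m (k s)"] st[OF k, of s "max m (k s)"] by simp_all
  have SD: "(S m has_real_derivative D m s) (at s)" for m s
    unfolding S_def D_def
  proof (rule DERIV_sum)
    fix n
    have "((\<lambda>s. s - real n) has_real_derivative 1) (at s)" by (auto intro!: derivative_eq_intros)
    from DERIV_cmult[OF DERIV_chain2[OF sq_pos_has_derivative[of "s - real n"] this], of "b n"]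
    show "((\<lambda>s. b n * sq_pos (s - real n)) has_real_derivative b n * (2 * max 0 (s - real n))) (at s)" by simp
  qed
  have near: "\<forall>\<^sub>F x in nhds s. x \<le> real (Suc (k s))" for s
  proof -
    have "s \<in> {..<real (Suc (k s))}" using k[of s] by simp
    then have "\<forall>\<^sub>F x in nhds s. x \<in> {..<real (Suc (k s))}" by (intro eventually_nhds_in_open) auto
    then show ?thesis by eventually_elim simp
  qed
  show ?thesis
  proof (rule exI[of _ "\<lambda>s. S (k s) s"], rule exI[of _ "\<lambda>s. D (k s) s"], intro conjI allI impI)
    show "((\<lambda>s. S (k s) s) has_real_derivative D (k s) s) (at s)" for s
    proof -
      have "\<forall>\<^sub>F x in nhds s. S (k x) x = S (Suc (k s)) x" using near[of s] by eventually_elim (rule HS(1))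
      moreover have "D (k s) s = D (Suc (k s)) s" using k[of s] by (intro HS(2)) simp
      ultimately show ?thesis using SD[of "Suc (k s)" s] by (subst DERIV_cong_ev[OF refl]) auto
    qed
    show "continuous_on UNIV (\<lambda>s. D (k s) s)"
    proof (rule continuous_at_imp_continuous_on, rule ballI)
      fix s
      have "\<forall>\<^sub>F x in nhds s. D (k x) x = D (Suc (k s)) x" using near[of s] by eventually_elim (rule HS(2))
      moreover have "isCont (D (Suc (k s))) s" unfolding D_def by (intro continuous_intros)
      ultimately show "isCont (\<lambda>s. D (k s) s) s" by (subst isCont_cong) auto
    qed
    show "0 \<le> S (k s) s" for s unfolding S_def by (intro sum_nonneg mult_nonneg_nonneg b) (simp add: sq_pos_def)
    show "0 \<le> D (k s) s" for s unfolding D_def by (intro sum_nonneg mult_nonneg_nonneg b) simp_all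
    show "b n \<le> S (k s) s" if "real n + 1 \<le> s" for n s
    proof -
      have n: "n \<in> {..<k s}" using that k[of s] by simp
      have "1 \<le> sq_pos (s - real n)" using that unfolding sq_pos_def by (intro one_le_power) simp
      then have "b n * 1 \<le> b n * sq_pos (s - real n)" by (intro mult_left_mono b)
      also have "\<dots> \<le> S (k s) s" unfolding S_def
        by (rule member_le_sum[OF n, of "\<lambda>n. b n * sq_pos (s - real n)"]) (auto intro!: mult_nonneg_nonneg b simp: sq_pos_def)
      finally show ?thesis by simp
    qed
  qed
qed

text \<open>The mixed term is \<open>2 * c * d * (y \<bullet> k)\<^sup>2\<close>, so a nonnegative
  radial correction can only lengthen the vector.\<close>

lemma norm_sq_radial_ge:
  fixes k y :: "'h::real_inner"
  assumes "0 \<le> c" "0 \<le> d"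
  shows "c\<^sup>2 * (norm k)\<^sup>2 \<le> (norm (c *\<^sub>R k + (d * (y \<bullet> k)) *\<^sub>R y))\<^sup>2"
proof -
  have "(norm (c *\<^sub>R k + (d * (y \<bullet> k)) *\<^sub>R y))\<^sup>2 = c\<^sup>2 * (norm k)\<^sup>2 + (2 * c * d * (y \<bullet> k)\<^sup>2 + (d * (y \<bullet> k))\<^sup>2 * (y \<bullet> y))"
    unfolding power2_norm_eq_inner by (simp add: inner_add_left inner_add_right inner_commute[of k y] power2_eq_square algebra_simps)
  moreover have "0 \<le> 2 * c * d * (y \<bullet> k)\<^sup>2 + (d * (y \<bullet> k))\<^sup>2 * (y \<bullet> y)" using assms by simp
  ultimately show ?thesis by linarith
qed

text \<open>A positive factor that is nondecreasing in the norm keeps directions and makes the norm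
  of the image strictly increasing. Injectivity is what the chain rule for squashed tuples asks
  for.\<close>

lemma radial_inj:
  fixes t :: real
  assumes t: "0 < t" and H: "\<And>s. 0 \<le> H s" "\<And>s s'. s \<le> s' \<Longrightarrow> H s \<le> H s'"
  shows "inj (\<lambda>y :: 'h::real_inner. (1 + t * H (y \<bullet> y)) *\<^sub>R y)"
proof (rule injI)
  fix y z :: 'h
  assume eq: "(1 + t * H (y \<bullet> y)) *\<^sub>R y = (1 + t * H (z \<bullet> z)) *\<^sub>R z"
  have pos: "0 < 1 + t * H s" for s using t H(1)[of s] by (simp add: add_pos_nonneg)
  have lt: "(1 + t * H (p \<bullet> p)) * norm p < (1 + t * H (q \<bullet> q)) * norm q" if "norm p < norm q" for p q :: 'h
  proof -
    have "(norm p)\<^sup>2 \<le> (norm q)\<^sup>2" using that by (intro power_mono) auto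
    then have "H (p \<bullet> p) \<le> H (q \<bullet> q)" by (intro H(2)) (simp add: power2_norm_eq_inner)
    then have "(1 + t * H (p \<bullet> p)) * norm p \<le> (1 + t * H (q \<bullet> q)) * norm p" using t by (intro mult_right_mono) auto
    also have "\<dots> < (1 + t * H (q \<bullet> q)) * norm q" using that pos by (intro mult_strict_left_mono) auto
    finally show ?thesis .
  qed
  have "(1 + t * H (y \<bullet> y)) * norm y = (1 + t * H (z \<bullet> z)) * norm z"
    using arg_cong[OF eq, of norm] pos[of "y \<bullet> y"] pos[of "z \<bullet> z"] by simp
  then have "norm y = norm z" using lt[of y z] lt[of z y] by linarith
  then have "y \<bullet> y = z \<bullet> z" by (simp add: norm_eq)
  then show "y = z" using eq pos[of "z \<bullet> z"] by simp
qed

context stationary_map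
begin

text \<open>Criticality provides some \<open>t > 0\<close> with finite squashed energy. Inside the
  ball \<open>cutoff\<close> is \<open>1\<close> with zero gradient, and since \<open>H'\<close> is
  nonnegative, the squashed energy dominates that of each single branch with the factor
  \<open>t * H\<close>.\<close>

lemma radial_squash_energy:
  assumes H: "\<And>s. (H has_real_derivative H' s) (at s)" "continuous_on UNIV H'" "\<And>s. 0 \<le> H s" "\<And>s. 0 \<le> H' s"
  shows "\<exists>t g. 0 < t \<and> integrable M2 g \<and> (\<forall>x. 0 \<le> g x) \<and>
    (\<forall>x p. x \<in> ball 0 2 \<longrightarrow> approx_differentiable f x \<longrightarrow> p \<in># some_differential f x \<longrightarrow>
      (t * H (fst p \<bullet> fst p) * hs_norm (snd p))\<^sup>2 \<le> g x)"
proof -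
  let ?Y = "\<lambda>(x :: real^'m, y::'h). (cutoff x * H (y \<bullet> y)) *\<^sub>R y"
  let ?h = "\<lambda>t x. {# y + t *\<^sub>R ?Y (x, y). y \<in># f x #}"
  have "C1_map_on (U \<times> UNIV) ?Y"
    by (rule radial_product_C1[OF cutoff_has_derivative continuous_cutoff_grad H(1,2)])
  moreover have "compactly_inside {x\<in>U. \<exists>y. ?Y (x, y) \<noteq> 0} U"
  proof -
    have sub: "{x\<in>U. \<exists>y. ?Y (x, y) \<noteq> 0} \<subseteq> {x. cutoff x \<noteq> 0}" by auto
    have "bounded {x :: real^'m. cutoff x \<noteq> 0}" "closure {x :: real^'m. cutoff x \<noteq> 0} \<subseteq> U"
      using cutoff_compactly_inside[OF ball_U] by (simp_all add: compactly_inside_def)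
    then show ?thesis
      unfolding compactly_inside_def compact_closure using bounded_subset[OF _ sub] closure_mono[OF sub] by blast
  qed
  ultimately have "energy_critical U ?h" using squash unfolding squash_stationary_def by blast
  then have "\<forall>\<^sub>F t in nhds 0. set_integrable lebesgue U (\<lambda>x. (Df_norm (?h t) x)\<^sup>2)" by (simp only: energy_critical_def)
  then obtain d where d: "0 < d" "\<And>t. dist t 0 < d \<Longrightarrow> set_integrable lebesgue U (\<lambda>x. (Df_norm (?h t) x)\<^sup>2)"
    unfolding eventually_nhds_metric by blast
  define t where "t = d / 2"
  have t: "0 < t" using d(1) by (simp add: t_def)
  have "set_integrable lebesgue U (\<lambda>x. (Df_norm (?h t) x)\<^sup>2)" using d by (intro d(2)) (simp add: t_def)
  then have int: "integrable M2 (\<lambda>x. (Df_norm (?h t) x)\<^sup>2)"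
    by (intro restrict_M2) (simp only: set_integrable_lebesgue_on[OF U_lebesgue])
  have Hmono: "H s \<le> H s'" if "s \<le> s'" for s s'
    by (rule DERIV_nonneg_imp_nondecreasing[OF that]) (use H(1,4) in blast)
  show ?thesis
  proof (intro exI[of _ t] exI[of _ "\<lambda>x. (Df_norm (?h t) x)\<^sup>2"] conjI allI impI t int)
    fix x p assume x: "x \<in> ball (0 :: real^'m) 2" and ad: "approx_differentiable f x" and p: "p \<in># some_differential f x"
    have xU: "x \<in> U" using x ball2_U by blast
    let ?w = "some_differential f x"
    define F where "F q = snd q + t *\<^sub>R ?Y q" for q :: "(real^'m) \<times> 'h"
    define F' where "F' y q = snd q + t *\<^sub>R (case q of (v, k) \<Rightarrow> (cutoff x * H (y \<bullet> y)) *\<^sub>R k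
      + (cutoff x * H' (y \<bullet> y) * (2 * (y \<bullet> k)) + H (y \<bullet> y) * (cutoff_grad x \<bullet> v)) *\<^sub>R y)" for y and q :: "(real^'m) \<times> 'h"
    have D: "(F has_derivative F' y) (at (x, y))" for y
      unfolding F_def[abs_def] F'_def[abs_def]
      by (intro has_derivative_add has_derivative_snd has_derivative_ident has_derivative_scaleR_right
          radial_product_has_derivative cutoff_has_derivative H(1))
    have Fx: "(\<lambda>y. F (x, y)) = (\<lambda>y. (1 + t * H (y \<bullet> y)) *\<^sub>R y)"
      using cutoff_inside(1)[OF x] by (simp add: F_def fun_eq_iff scaleR_add_left)
    have inj: "inj_on (\<lambda>y. F (x, y)) (set_mset (f x))"
      unfolding Fx by (rule inj_on_subset[OF radial_inj[OF t H(3) Hmono]]) auto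
    have heq: "(\<lambda>x. image_mset (\<lambda>y. F (x, y)) (f x)) = ?h t" by (simp add: F_def)
    let ?L = "\<lambda>p. Blinfun (\<lambda>v. F' (fst p) (v, blinfun_apply (snd p) v))"
    have "has_approx_differential (?h t) x (image_mset (\<lambda>p. (F (x, fst p), ?L p)) ?w)"
      using has_approx_differential_squash[OF open_U xU size_f some_differential[OF ad] D inj] unfolding heq .
    from Df_norm_sq_eq[OF open_U xU _ this] have "(Df_norm (?h t) x)\<^sup>2 = tuple_energy (image_mset (\<lambda>p. (F (x, fst p), ?L p)) ?w)"
      by (simp add: size_f)
    then have E: "(Df_norm (?h t) x)\<^sup>2 = (\<Sum>p\<in>#?w. (hs_norm (?L p))\<^sup>2)"
      by (simp add: tuple_energy_def image_mset.compositionality o_def)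
    obtain w0 where w0: "?w = add_mset p w0" using multi_member_split[OF p] by blast
    have "(hs_norm (?L p))\<^sup>2 \<le> (Df_norm (?h t) x)\<^sup>2"
      unfolding E w0 using sum_mset_nonneg'[of w0 "\<lambda>p. (hs_norm (?L p))\<^sup>2"] by simp
    moreover have "(t * H (fst p \<bullet> fst p) * hs_norm (snd p))\<^sup>2 \<le> (hs_norm (?L p))\<^sup>2"
    proof -
      let ?y = "fst p"
      define c where "c = 1 + t * H (?y \<bullet> ?y)"
      define e where "e = 2 * t * H' (?y \<bullet> ?y)"
      have c: "0 \<le> c" "0 \<le> t * H (?y \<bullet> ?y)" "t * H (?y \<bullet> ?y) \<le> c" "0 \<le> e" using t H(3,4) by (simp_all add: c_def e_def)
      have bl: "bounded_linear (\<lambda>v. F' ?y (v, blinfun_apply (snd p) v))"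
        by (rule bounded_linear_compose[OF has_derivative_bounded_linear[OF D]])
          (intro bounded_linear_Pair bounded_linear_ident blinfun.bounded_linear_right)
      have ap: "blinfun_apply (?L p) v = c *\<^sub>R blinfun_apply (snd p) v + (e * (?y \<bullet> blinfun_apply (snd p) v)) *\<^sub>R ?y" for v
        unfolding bounded_linear_Blinfun_apply[OF bl]
        using cutoff_inside[OF x] by (simp add: F'_def c_def e_def scaleR_add_left scaleR_add_right mult_ac)
      have "(t * H (?y \<bullet> ?y))\<^sup>2 * (hs_norm (snd p))\<^sup>2 \<le> c\<^sup>2 * (hs_norm (snd p))\<^sup>2"
        using c by (intro mult_right_mono power_mono) auto
      also have "\<dots> = (\<Sum>b\<in>Basis. c\<^sup>2 * (norm (blinfun_apply (snd p) b))\<^sup>2)" by (simp add: hs_norm_sq sum_distrib_left)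
      also have "\<dots> \<le> (hs_norm (?L p))\<^sup>2"
        unfolding hs_norm_sq ap by (intro sum_mono norm_sq_radial_ge c)
      finally show ?thesis by (simp only: power_mult_distrib)
    qed
    ultimately show "(t * H (fst p \<bullet> fst p) * hs_norm (snd p))\<^sup>2 \<le> (Df_norm (?h t) x)\<^sup>2" by linarith
  qed simp
qed

text \<open>Were it false, squashing along \<open>Y(x, y) = H(\<bar>y\<bar>\<^sup>2) y\<close> with \<open>H\<close> growing fast enough would
  produce infinite energy for every \<open>t > 0\<close>.\<close>

lemma differential_vanishes_at_large_values:
  "\<exists>n::nat. AE x in lebesgue. x \<in> ball 0 2 \<longrightarrow> approx_differentiable f x \<longrightarrow>
     (\<forall>p\<in>#some_differential f x. real n < fst p \<bullet> fst p \<longrightarrow> snd p = 0)"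
proof (rule ccontr)
  assume neg: "\<nexists>n::nat. AE x in lebesgue. x \<in> ball 0 2 \<longrightarrow> approx_differentiable f x \<longrightarrow>
     (\<forall>p\<in>#some_differential f x. real n < fst p \<bullet> fst p \<longrightarrow> snd p = 0)"
  define A where "A n k = {x \<in> ball 0 2. approx_differentiable f x \<and>
    (\<exists>p\<in>#some_differential f x. real n + 1 < fst p \<bullet> fst p \<and> inverse (real (Suc k)) \<le> (hs_norm (snd p))\<^sup>2)}" for n k
  have "\<exists>k. outer_measure_of lebesgue (A n k) \<noteq> 0" for n
  proof (rule ccontr)
    assume "\<nexists>k. outer_measure_of lebesgue (A n k) \<noteq> 0"
    then have z: "outer_measure_of lebesgue (A n k) = 0" for k by blast
    have "AE x in lebesgue. x \<notin> A n k" for k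
    proof -
      obtain A' where "A' \<in> sets lebesgue" "A n k \<subseteq> A'" "outer_measure_of lebesgue (A n k) = emeasure lebesgue A'"
        using outer_measure_of_attain[of "A n k" lebesgue] by auto
      then have A': "A' \<in> null_sets lebesgue" "A n k \<subseteq> A'" using z[of k] by (simp_all add: null_sets_def)
      from AE_not_in[OF A'(1)] show ?thesis using A'(2) by (auto elim!: eventually_mono)
    qed
    then have "AE x in lebesgue. \<forall>k. x \<notin> A n k" by (simp add: AE_all_countable)
    then have "AE x in lebesgue. x \<in> ball 0 2 \<longrightarrow> approx_differentiable f x \<longrightarrow>
      (\<forall>p\<in>#some_differential f x. real (Suc n) < fst p \<bullet> fst p \<longrightarrow> snd p = 0)"
    proof eventually_elim
      case (elim x)
      show ?case
      proof (intro impI ballI)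
        fix p assume p: "x \<in> ball 0 2" "approx_differentiable f x" "p \<in># some_differential f x" "real (Suc n) < fst p \<bullet> fst p"
        show "snd p = 0"
        proof (rule ccontr)
          assume "snd p \<noteq> 0"
          have "hs_norm (snd p) \<noteq> 0"
          proof
            assume 0: "hs_norm (snd p) = 0"
            have "snd p = 0"
            proof (rule blinfun_eqI)
              fix v show "blinfun_apply (snd p) v = blinfun_apply 0 v" using norm_le_hs_norm[of "snd p" v] 0 by simp
            qed
            then show False using \<open>snd p \<noteq> 0\<close> by simp
          qed
          then have "0 < (hs_norm (snd p))\<^sup>2" by simp
          from reals_Archimedean[OF this] obtain k where "inverse (real (Suc k)) < (hs_norm (snd p))\<^sup>2" by blast
          then have "x \<in> A n k" using p unfolding A_def by (auto intro!: bexI[of _ p])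
          then show False using elim by blast
        qed
      qed
    qed
    then show False using neg by blast
  qed
  then obtain K where K: "\<And>n. outer_measure_of lebesgue (A n (K n)) \<noteq> 0" by metis
  have "\<exists>\<epsilon>>0. ennreal \<epsilon> \<le> outer_measure_of lebesgue (A n (K n))" for n
  proof (cases "outer_measure_of lebesgue (A n (K n))")
    case (real r)
    then show ?thesis using K[of n] by (intro exI[of _ r]) (auto simp: less_le)
  qed (auto intro: exI[of _ 1])
  then obtain \<epsilon> where \<epsilon>: "\<And>n. 0 < \<epsilon> n" "\<And>n. ennreal (\<epsilon> n) \<le> outer_measure_of lebesgue (A n (K n))" by metis
  \<comment> \<open>Chosen so that the energy forced on \<open>A n (K n)\<close> is
    \<open>t\<^sup>2 * real n\<close>, which is unbounded in \<open>n\<close>.\<close>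
  define b where "b n = sqrt (real n * real (Suc (K n)) / \<epsilon> n)" for n
  have b0: "0 \<le> b n" for n using \<epsilon>(1)[of n] by (simp add: b_def)
  have bsq: "(b n)\<^sup>2 * inverse (real (Suc (K n))) * \<epsilon> n = real n" for n
    using \<epsilon>(1)[of n] by (simp add: b_def field_simps del: of_nat_Suc)
  obtain H H' where "(\<forall>s. (H has_real_derivative H' s) (at s)) \<and> continuous_on UNIV H' \<and>
    (\<forall>s. 0 \<le> H s) \<and> (\<forall>s. 0 \<le> H' s) \<and> (\<forall>n s. real n + 1 \<le> s \<longrightarrow> b n \<le> H s)"
    using fast_growing_C1[of b, OF b0] by (elim exE) (rule that)
  then have H: "\<And>s. (H has_real_derivative H' s) (at s)" "continuous_on UNIV H'"
    "\<And>s. 0 \<le> H s" "\<And>s. 0 \<le> H' s" "\<And>n s. real n + 1 \<le> s \<Longrightarrow> b n \<le> H s"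
    by blast+
  obtain t g where "0 < t \<and> integrable M2 g \<and> (\<forall>x. 0 \<le> g x) \<and>
    (\<forall>x p. x \<in> ball 0 2 \<longrightarrow> approx_differentiable f x \<longrightarrow> p \<in># some_differential f x \<longrightarrow>
      (t * H (fst p \<bullet> fst p) * hs_norm (snd p))\<^sup>2 \<le> g x)"
    using radial_squash_energy[OF H(1-4)] by (elim exE) (rule that)
  then have t: "0 < t" and g: "integrable M2 g" "\<And>x. 0 \<le> g x"
    "\<And>x p. x \<in> ball 0 2 \<Longrightarrow> approx_differentiable f x \<Longrightarrow> p \<in># some_differential f x \<Longrightarrow>
      (t * H (fst p \<bullet> fst p) * hs_norm (snd p))\<^sup>2 \<le> g x"
    by blast+
  define I where "I = (LINT x|M2. g x)"
  \<comment> \<open>An index beyond which the forced energy exceeds the finite integral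
    \<open>I\<close>; Markov's inequality for \<open>g\<close> then gives the contradiction.\<close>
  obtain n0 :: nat where n0: "I / t\<^sup>2 < real n0" using reals_Archimedean2 by blast
  define n where "n = Suc n0"
  have "I < real n0 * t\<^sup>2" using n0 t by (simp add: pos_divide_less_eq)
  also have "\<dots> \<le> real n * t\<^sup>2" by (intro mult_right_mono) (simp_all add: n_def)
  finally have n: "I < t\<^sup>2 * real n" by (simp only: mult.commute)
  define c where "c = t\<^sup>2 * ((b n)\<^sup>2 * inverse (real (Suc (K n))))"
  have ce: "c * \<epsilon> n = t\<^sup>2 * real n" unfolding c_def using bsq[of n] by (simp only: mult.assoc)
  have "0 < c * \<epsilon> n" unfolding ce using t by (simp add: n_def)
  then have c: "0 < c" using \<epsilon>(1)[of n] by (simp add: zero_less_mult_iff)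
  define G where "G = {x \<in> space M2. c \<le> g x}"
  have sub: "A n (K n) \<subseteq> G"
  proof
    fix x assume x: "x \<in> A n (K n)"
    then obtain p where p: "p \<in># some_differential f x" "real n + 1 < fst p \<bullet> fst p" "inverse (real (Suc (K n))) \<le> (hs_norm (snd p))\<^sup>2"
      unfolding A_def by blast
    have x2: "x \<in> ball 0 2" "approx_differentiable f x" using x by (auto simp: A_def)
    have "(b n)\<^sup>2 * inverse (real (Suc (K n))) \<le> (H (fst p \<bullet> fst p))\<^sup>2 * (hs_norm (snd p))\<^sup>2"
      using p(2,3) b0[of n] H(5)[of n "fst p \<bullet> fst p"] by (intro mult_mono power_mono) auto
    then have "c \<le> t\<^sup>2 * ((H (fst p \<bullet> fst p))\<^sup>2 * (hs_norm (snd p))\<^sup>2)" unfolding c_def by (intro mult_left_mono) auto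
    also have "\<dots> \<le> g x" using g(3)[OF x2 p(1)] by (simp add: power_mult_distrib mult.assoc)
    finally show "x \<in> G" using x2(1) by (simp add: G_def space_restrict_space)
  qed
  have GM: "G \<in> sets M2" unfolding G_def using borel_measurable_integrable[OF g(1)] by measurable
  then have Gl: "G \<in> sets lebesgue" "G \<subseteq> ball 0 2" by (auto simp: sets_restrict_space_iff)
  have "ennreal (\<epsilon> n) \<le> outer_measure_of lebesgue G"
    using \<epsilon>(2)[of n] outer_measure_of_mono[OF sub, of lebesgue] by (rule order_trans)
  also have "\<dots> = emeasure M2 G" using Gl by (simp add: outer_measure_of_eq emeasure_restrict_space)
  also have "\<dots> \<le> ennreal (1 / c * I)"
    unfolding G_def I_def using integral_Markov_inequality[OF g(1) _ c] g(2) by simp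
  finally have "\<epsilon> n \<le> 1 / c * I" using \<epsilon>(1)[of n] by (simp add: ennreal_le_iff2)
  then have "c * \<epsilon> n \<le> I" using c by (simp add: pos_le_divide_eq mult.commute)
  then show False using n ce by simp
qed

end

section \<open>Measurability on the tuple space and multiples of Sobolev maps\<close>

lemma QQ_borel_openI:
  assumes "W \<subseteq> QQ Q" "\<And>u. u \<in> W \<Longrightarrow> \<exists>r>0. \<forall>v\<in>QQ Q. Gdist u v < r \<longrightarrow> v \<in> W"
  shows "W \<in> sets (QQ_borel Q)"
proof -
  have "openin (Metric_space.mtopology (QQ Q) Gdist) W"
    unfolding Metric_space.openin_mtopology[OF Metric_space_QQ]
  proof (intro conjI allI impI assms(1))
    fix u assume "u \<in> W"
    with assms(2) obtain r where "0 < r" "\<forall>v\<in>QQ Q. Gdist u v < r \<longrightarrow> v \<in> W" by blast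
    then show "\<exists>r>0. Metric_space.mball (QQ Q) Gdist u r \<subseteq> W"
      by (intro exI[of _ r]) (auto simp: Metric_space.in_mball[OF Metric_space_QQ])
  qed
  then show ?thesis unfolding QQ_borel_def
    by (intro in_measure_of) (auto simp: Metric_space.openin_mtopology[OF Metric_space_QQ])
qed

lemma QQ_lipschitz_measurable:
  fixes \<theta> :: "'h::real_normed_vector multiset \<Rightarrow> real"
  assumes lip: "\<And>u v. u \<in> QQ Q \<Longrightarrow> v \<in> QQ Q \<Longrightarrow> \<bar>\<theta> u - \<theta> v\<bar> \<le> B * Gdist u v"
  shows "\<theta> \<in> borel_measurable (QQ_borel Q)"
proof (rule borel_measurableI)
  fix S :: "real set" assume S: "open S"
  show "\<theta> -` S \<inter> space (QQ_borel Q) \<in> sets (QQ_borel Q)"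
  proof (rule QQ_borel_openI)
    show "\<theta> -` S \<inter> space (QQ_borel Q) \<subseteq> QQ Q" by (simp add: space_QQ_borel)
    fix u assume u: "u \<in> \<theta> -` S \<inter> space (QQ_borel Q)"
    then obtain e where e: "0 < e" "ball (\<theta> u) e \<subseteq> S" using S by (auto simp: open_contains_ball)
    show "\<exists>r>0. \<forall>v\<in>QQ Q. Gdist u v < r \<longrightarrow> v \<in> \<theta> -` S \<inter> space (QQ_borel Q)"
    proof (intro exI[of _ "e / (\<bar>B\<bar> + 1)"] conjI ballI impI)
      show "0 < e / (\<bar>B\<bar> + 1)" using e by (simp add: add_nonneg_pos)
      fix v assume v: "v \<in> QQ Q" "Gdist u v < e / (\<bar>B\<bar> + 1)"
      have uQ: "u \<in> QQ Q" using u by (simp add: space_QQ_borel)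
      have "B * Gdist u v \<le> (\<bar>B\<bar> + 1) * Gdist u v" by (intro mult_right_mono Gdist_nonneg) simp
      also have "\<dots> < e" using v(2) by (simp add: pos_less_divide_eq mult.commute add_nonneg_pos)
      finally have "\<bar>\<theta> u - \<theta> v\<bar> < e" using lip[OF uQ v(1)] by linarith
      then have "\<theta> v \<in> ball (\<theta> u) e" by (simp add: dist_real_def)
      then show "v \<in> \<theta> -` S \<inter> space (QQ_borel Q)" using e(2) v(1) by (auto simp: space_QQ_borel)
    qed
  qed
qed

lemma scale_QQ_measurable:
  assumes N: "0 < (N::real)"
  shows "image_mset ((*\<^sub>R) N :: 'h::real_normed_vector \<Rightarrow> 'h) \<in> QQ_borel Q \<rightarrow>\<^sub>M QQ_borel Q"
proof -
  let ?s = "image_mset ((*\<^sub>R) N :: 'h \<Rightarrow> 'h)"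
  have "?s \<in> QQ_borel Q \<rightarrow>\<^sub>M sigma (QQ Q) {W. openin (Metric_space.mtopology (QQ Q) Gdist) W}"
  proof (rule measurable_measure_of)
    show "{W. openin (Metric_space.mtopology (QQ Q) Gdist) W} \<subseteq> Pow (QQ Q :: 'h multiset set)"
      by (auto simp: Metric_space.openin_mtopology[OF Metric_space_QQ])
    show "?s \<in> space (QQ_borel Q) \<rightarrow> QQ Q" by (auto simp: space_QQ_borel QQ_def)
    fix W :: "'h multiset set" assume "W \<in> {W. openin (Metric_space.mtopology (QQ Q) Gdist) W}"
    then have W: "W \<subseteq> QQ Q" "\<And>u. u \<in> W \<Longrightarrow> \<exists>r>0. Metric_space.mball (QQ Q) Gdist u r \<subseteq> W"
      by (auto simp: Metric_space.openin_mtopology[OF Metric_space_QQ])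
    show "?s -` W \<inter> space (QQ_borel Q) \<in> sets (QQ_borel Q)"
    proof (rule QQ_borel_openI)
      show "?s -` W \<inter> space (QQ_borel Q) \<subseteq> QQ Q" by (simp add: space_QQ_borel)
      fix u assume u: "u \<in> ?s -` W \<inter> space (QQ_borel Q)"
      then obtain r where r: "0 < r" "Metric_space.mball (QQ Q) Gdist (?s u) r \<subseteq> W" using W(2) by blast
      show "\<exists>r>0. \<forall>v\<in>QQ Q. Gdist u v < r \<longrightarrow> v \<in> ?s -` W \<inter> space (QQ_borel Q)"
      proof (intro exI[of _ "r / N"] conjI ballI impI)
        show "0 < r / N" using r N by simp
        fix v assume v: "v \<in> QQ Q" "Gdist u v < r / N"
        have "size u = size v" "u \<in> QQ Q" using u v by (simp_all add: space_QQ_borel QQ_def)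
        then have "Gdist (?s u) (?s v) < r" using Gdist_scale[of u v N] v(2) N by (simp add: pos_less_divide_eq mult.commute)
        then have "?s v \<in> Metric_space.mball (QQ Q) Gdist (?s u) r"
          using u v(1) unfolding Metric_space.in_mball[OF Metric_space_QQ] space_QQ_borel by (auto simp: QQ_def)
        then show "v \<in> ?s -` W \<inter> space (QQ_borel Q)" using r(2) v(1) by (auto simp: space_QQ_borel)
      qed
    qed
  qed
  then show ?thesis by (simp only: QQ_borel_def)
qed

lemma QQ_norm_scale_sq: "(QQ_norm (image_mset ((*\<^sub>R) N) u))\<^sup>2 = N\<^sup>2 * (QQ_norm u)\<^sup>2"
  unfolding QQ_norm_sq by (simp add: image_mset.compositionality o_def power_mult_distrib sum_mset_distrib_left)

lemma frechet_derivative_off_support: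
  assumes "x \<notin> closure {x. \<phi> x \<noteq> 0}"
  shows "frechet_derivative \<phi> (at x) v = 0"
proof -
  have "((\<lambda>_. 0) has_derivative (\<lambda>_. 0)) (at x)" by simp
  then have "(\<phi> has_derivative (\<lambda>_. 0)) (at x)"
  proof (rule has_derivative_transform_within_open)
    show "open (- closure {x. \<phi> x \<noteq> 0})" by auto
    show "x \<in> - closure {x. \<phi> x \<noteq> 0}" using assms by simp
    show "0 = \<phi> y" if "y \<in> - closure {x. \<phi> x \<noteq> 0}" for y using that closure_subset[of "{x. \<phi> x \<noteq> 0}"] by auto
  qed
  from frechet_derivative_at[OF this] show ?thesis by metis
qed

text \<open>Test functions supported in \<open>V\<close> are test functions on \<open>U\<close>, so
  integration by parts restricts; outside \<open>V\<close> both integrands vanish with the test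
  function and its derivative.\<close>

lemma weak_gradient_scale:
  fixes h h' :: "real^'m \<Rightarrow> real"
  assumes wg: "weak_gradient_on U h v" and V: "V \<subseteq> U" and eq: "\<And>x. x \<in> V \<Longrightarrow> h' x = N * h x"
  shows "weak_gradient_on V h' (\<lambda>x. N *\<^sub>R v x)"
  unfolding weak_gradient_on_def
proof (intro conjI allI impI ballI)
  fix K assume K: "compact K \<and> K \<subseteq> V"
  then have a: "h absolutely_integrable_on K" "v absolutely_integrable_on K"
    using wg V unfolding weak_gradient_on_def by auto
  have "(\<lambda>x. indicator K x *\<^sub>R h' x) = (\<lambda>x. N * (indicator K x *\<^sub>R h x))"
    using K eq by (auto simp: fun_eq_iff indicator_def)
  then show "h' absolutely_integrable_on K"
    using integrable_mult_right[OF a(1)[unfolded set_integrable_def], of N] unfolding set_integrable_def by (simp only:)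
  have "(\<lambda>x. indicator K x *\<^sub>R N *\<^sub>R v x) = (\<lambda>x. N *\<^sub>R (indicator K x *\<^sub>R v x))" by (simp add: fun_eq_iff)
  then show "(\<lambda>x. N *\<^sub>R v x) absolutely_integrable_on K"
    using integrable_scaleR_right[OF a(2)[unfolded set_integrable_def], of N] unfolding set_integrable_def by (simp only:)
next
  fix \<phi> :: "real^'m \<Rightarrow> real" and j assume \<phi>: "\<phi> \<in> Cc_infinity V"
  then have sup: "closure {x. \<phi> x \<noteq> 0} \<subseteq> V" by (simp add: Cc_infinity_def compactly_inside_def)
  have "\<phi> \<in> Cc_infinity U" using \<phi> V by (auto simp: Cc_infinity_def compactly_inside_def)
  then have I: "(LINT x:U|lebesgue. h x * frechet_derivative \<phi> (at x) (axis j 1)) = - (LINT x:U|lebesgue. v x $ j * \<phi> x)"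
    using wg unfolding weak_gradient_on_def by blast
  have z: "frechet_derivative \<phi> (at x) (axis j 1) = 0" "\<phi> x = 0" if "x \<notin> V" for x
    using that sup closure_subset[of "{x. \<phi> x \<noteq> 0}"] by (auto intro: frechet_derivative_off_support)
  have e1: "(\<lambda>x. indicator V x *\<^sub>R (h' x * frechet_derivative \<phi> (at x) (axis j 1)))
     = (\<lambda>x. N * (indicator U x *\<^sub>R (h x * frechet_derivative \<phi> (at x) (axis j 1))))"
  proof
    fix x show "indicator V x *\<^sub>R (h' x * frechet_derivative \<phi> (at x) (axis j 1))
     = N * (indicator U x *\<^sub>R (h x * frechet_derivative \<phi> (at x) (axis j 1)))"
      using V eq[of x] z[of x] by (cases "x \<in> V") (auto simp: indicator_def)
  qed
  have e2: "(\<lambda>x. indicator V x *\<^sub>R ((N *\<^sub>R v x) $ j * \<phi> x)) = (\<lambda>x. N * (indicator U x *\<^sub>R (v x $ j * \<phi> x)))"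
  proof
    fix x show "indicator V x *\<^sub>R ((N *\<^sub>R v x) $ j * \<phi> x) = N * (indicator U x *\<^sub>R (v x $ j * \<phi> x))"
      using V z[of x] by (cases "x \<in> V") (auto simp: indicator_def)
  qed
  show "(LINT x:V|lebesgue. h' x * frechet_derivative \<phi> (at x) (axis j 1)) = - (LINT x:V|lebesgue. (N *\<^sub>R v x) $ j * \<phi> x)"
    using I unfolding set_lebesgue_integral_def e1 e2 integral_mult_right_zero by simp
qed

lemma scale_inverse:
  assumes "0 < (N::real)"
  shows "image_mset ((*\<^sub>R) N) (image_mset ((*\<^sub>R) (inverse N)) u) = (u :: 'h::real_normed_vector multiset)"
  using assms by (simp add: image_mset.compositionality o_def)

text \<open>The distance of \<open>N f\<close> from \<open>T\<close> is \<open>N\<close> times the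
  distance of \<open>f\<close> from \<open>T / N\<close>, so the weak gradients for \<open>f\<close>
  serve after multiplication by \<open>N\<close>.\<close>

lemma W12_scale:
  fixes f :: "real^'m \<Rightarrow> 'h::real_normed_vector multiset"
  assumes f: "f \<in> W12 U Q" and V: "V \<subseteq> U" "V \<in> sets lebesgue" and U: "U \<in> sets lebesgue" and N: "0 < N"
  shows "(\<lambda>x. image_mset ((*\<^sub>R) N) (f x)) \<in> W12 V Q"
proof -
  have fm: "f \<in> lebesgue_on U \<rightarrow>\<^sub>M QQ_borel Q" and fi: "set_integrable lebesgue U (\<lambda>x. (QQ_norm (f x))\<^sup>2)"
    using f by (auto simp: W12_def)
  obtain g where g: "g \<in> borel_measurable (lebesgue_on U)" "set_integrable lebesgue U (\<lambda>x. (g x)\<^sup>2)"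
    "\<And>T. T \<in> QQ Q \<Longrightarrow> \<exists>v. weak_gradient_on U (\<lambda>x. Gdist (f x) T) v \<and> (AE x in lebesgue_on U. norm (v x) \<le> g x)"
    using f by (auto simp: W12_def)
  have sz: "size (f x) = Q" if "x \<in> V" for x
    using measurable_space[OF fm, of x] that V(1) by (auto simp: space_QQ_borel QQ_def space_restrict_space)
  have fmV: "f \<in> lebesgue_on V \<rightarrow>\<^sub>M QQ_borel Q" by (rule measurable_restrict_mono[OF fm V(1)])
  have "(\<lambda>x. image_mset ((*\<^sub>R) N) (f x)) \<in> lebesgue_on V \<rightarrow>\<^sub>M QQ_borel Q"
    by (rule measurable_compose[OF fmV scale_QQ_measurable[OF N]])
  moreover have "set_integrable lebesgue V (\<lambda>x. (QQ_norm (image_mset ((*\<^sub>R) N) (f x)))\<^sup>2)"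
    unfolding QQ_norm_scale_sq using set_integrable_subset[OF fi V(2,1)] by simp
  moreover have "\<exists>g. g \<in> borel_measurable (lebesgue_on V) \<and> set_integrable lebesgue V (\<lambda>x. (g x)\<^sup>2) \<and>
      (\<forall>T\<in>QQ Q. \<exists>v. weak_gradient_on V (\<lambda>x. Gdist (image_mset ((*\<^sub>R) N) (f x)) T) v \<and> (AE x in lebesgue_on V. norm (v x) \<le> g x))"
  proof (intro exI[of _ "\<lambda>x. N * g x"] conjI ballI)
    show "(\<lambda>x. N * g x) \<in> borel_measurable (lebesgue_on V)"
      using measurable_restrict_mono[OF g(1) V(1)] by simp
    show "set_integrable lebesgue V (\<lambda>x. (N * g x)\<^sup>2)"
      unfolding power_mult_distrib using set_integrable_subset[OF g(2) V(2,1)] by simp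
    fix T :: "'h multiset" assume T: "T \<in> QQ Q"
    let ?T = "image_mset ((*\<^sub>R) (inverse N)) T"
    have T': "?T \<in> QQ Q" using T by (simp add: QQ_def)
    from g(3)[OF T'] obtain v where v: "weak_gradient_on U (\<lambda>x. Gdist (f x) ?T) v" "AE x in lebesgue_on U. norm (v x) \<le> g x" by blast
    have "Gdist (image_mset ((*\<^sub>R) N) (f x)) T = N * Gdist (f x) ?T" if "x \<in> V" for x
      using Gdist_scale[OF _ N, of "f x" ?T] sz[OF that] T by (simp only: scale_inverse[OF N]) (simp add: QQ_def)
    from weak_gradient_scale[OF v(1) V(1) this]
    have "weak_gradient_on V (\<lambda>x. Gdist (image_mset ((*\<^sub>R) N) (f x)) T) (\<lambda>x. N *\<^sub>R v x)" .
    moreover have "AE x in lebesgue_on V. norm (N *\<^sub>R v x) \<le> N * g x"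
    proof -
      have "AE x in lebesgue. x \<in> U \<longrightarrow> norm (v x) \<le> g x" using v(2) U by (simp add: AE_restrict_space_iff)
      then have "AE x in lebesgue. x \<in> V \<longrightarrow> norm (N *\<^sub>R v x) \<le> N * g x"
        by eventually_elim (use V(1) N in auto)
      then show ?thesis using V(2) by (simp add: AE_restrict_space_iff)
    qed
    ultimately show "\<exists>v. weak_gradient_on V (\<lambda>x. Gdist (image_mset ((*\<^sub>R) N) (f x)) T) v \<and> (AE x in lebesgue_on V. norm (v x) \<le> N * g x)" by blast
  qed
  ultimately show ?thesis unfolding W12_def by blast
qed

context stationary_map
begin

text \<open>Only \<open>good_energy\<close> acquires the factor \<open>N\<^sup>2\<close>; this
  mismatch is what makes the two parts separable.\<close>

lemma Df_norm_constant_scale: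
  assumes x: "x \<in> U" and N: "0 < N"
  shows "(Df_norm (\<lambda>x. image_mset ((*\<^sub>R) N) (f x)) x)\<^sup>2 = N\<^sup>2 * good_energy f x + bad_energy f x"
  using scaled_energy[OF x, of "\<lambda>_. 1" "\<lambda>_. 0" "N - 1"] N cross_term_scale[of f x 0, simplified] by simp

lemma borel_measurable_lipschitz_comp:
  assumes "\<And>u v. u \<in> QQ Q \<Longrightarrow> v \<in> QQ Q \<Longrightarrow> \<bar>\<theta> u - \<theta> v\<bar> \<le> B * Gdist u v"
  shows "(\<lambda>x. \<theta> (f x)) \<in> borel_measurable (lebesgue_on U)"
proof -
  have "f \<in> lebesgue_on U \<rightarrow>\<^sub>M QQ_borel Q" using f_W12 by (simp add: W12_def)
  from measurable_compose[OF this QQ_lipschitz_measurable[OF assms]] show ?thesis .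
qed

lemma Gdist_square_integrable:
  assumes P: "P \<in> QQ Q" and A: "A \<subseteq> ball 0 2" "A \<in> sets lebesgue"
  shows "set_integrable lebesgue A (\<lambda>x. (Gdist (f x) P)\<^sup>2)"
proof -
  have lip: "\<bar>Gdist u P - Gdist v P\<bar> \<le> 1 * Gdist u v" if "u \<in> QQ Q" "v \<in> QQ Q" for u v :: "'h multiset"
    using Gdist_triangle[of u Q v P] Gdist_triangle[of v Q u P] that P Gdist_commute[of u v] by (simp add: QQ_def)
  have m: "(\<lambda>x. Gdist (f x) P) \<in> borel_measurable (lebesgue_on U)" by (rule borel_measurable_lipschitz_comp[OF lip])
  have m2: "(\<lambda>x. Gdist (f x) P) \<in> borel_measurable M2" by (rule measurable_restrict_mono[OF m ball2_U])
  have i: "integrable M2 (\<lambda>x. 2 * (QQ_norm (f x))\<^sup>2 + 2 * (QQ_norm P)\<^sup>2)"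
    by (intro Bochner_Integration.integrable_add integrable_mult_right restrict_M2[OF integrable_QQ_norm]
        finite_measure.integrable_const[OF finite_measure_lebesgue_on[OF lmeasurable_ball]])
  have "integrable M2 (\<lambda>x. (Gdist (f x) P)\<^sup>2)"
  proof (rule Bochner_Integration.integrable_bound[OF i])
    show "(\<lambda>x. (Gdist (f x) P)\<^sup>2) \<in> borel_measurable M2" using m2 by simp
    show "AE x in M2. norm ((Gdist (f x) P)\<^sup>2) \<le> norm (2 * (QQ_norm (f x))\<^sup>2 + 2 * (QQ_norm P)\<^sup>2)"
    proof (rule AE_I2)
      fix x :: "real^'m" assume "x \<in> space M2"
      then have sz: "size (f x) = Q" using ball2_U by (intro size_f) (auto simp: space_restrict_space)
      have "Gdist (f x) P \<le> Gdist (f x) (replicate_mset Q 0) + Gdist (replicate_mset Q 0) P"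
        using sz P by (intro Gdist_triangle[of _ Q]) (auto simp: QQ_def)
      then have "Gdist (f x) P \<le> QQ_norm (f x) + QQ_norm P"
        using sz P Gdist_commute[of P] by (simp add: QQ_norm_def QQ_def)
      then have "(Gdist (f x) P)\<^sup>2 \<le> (QQ_norm (f x) + QQ_norm P)\<^sup>2" by (intro power_mono Gdist_nonneg)
      also have "\<dots> \<le> 2 * (QQ_norm (f x))\<^sup>2 + 2 * (QQ_norm P)\<^sup>2"
        using zero_le_power2[of "QQ_norm (f x) - QQ_norm P"] by (simp add: power2_sum power2_diff)
      finally show "norm ((Gdist (f x) P)\<^sup>2) \<le> norm (2 * (QQ_norm (f x))\<^sup>2 + 2 * (QQ_norm P)\<^sup>2)" by simp
    qed
  qed
  then have "set_integrable lebesgue (ball 0 2) (\<lambda>x. (Gdist (f x) P)\<^sup>2)" by (simp add: set_integrable_lebesgue_on)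
  from set_integrable_subset[OF this A(2,1)] show ?thesis .
qed

text \<open>Where \<open>f\<close> has no approximate differential, the energy density has the same arbitrary value for
  \<open>f\<close> and for its multiples \<open>N f\<close>; the Poincare inequality for \<open>N f\<close> with \<open>N\<close> large therefore
  removes this contribution.\<close>

lemma scaled_poincare:
  assumes poincare: "\<And>(h :: real^'m \<Rightarrow> 'h multiset) a r. r > 0 \<Longrightarrow> h \<in> W12 (ball a r) Q \<Longrightarrow> \<exists>P. is_mean CP Q h a r P"
    and r: "0 < r" and B: "ball a r \<subseteq> ball 0 2" and \<delta>: "0 < \<delta>"
  shows "\<exists>P\<in>QQ Q. (LINT x:ball a r|lebesgue. (Gdist (f x) P)\<^sup>2)
    \<le> \<bar>CP\<bar> * r\<^sup>2 * ((LINT x:ball a r|lebesgue. good_energy f x) + \<delta>)"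
proof -
  have BU: "ball a r \<subseteq> U" using B ball2_U by blast
  have si: "set_integrable lebesgue (ball a r) (good_energy f)" "set_integrable lebesgue (ball a r) (bad_energy f)"
    using integrable_good_energy integrable_bad_energy B
    by (auto simp: set_integrable_lebesgue_on(1)[symmetric] intro: set_integrable_subset)
  define b where "b = (LINT x:ball a r|lebesgue. bad_energy f x)"
  have b: "0 \<le> b" unfolding b_def set_lebesgue_integral_def
    by (rule Bochner_Integration.integral_nonneg) (simp add: bad_energy_nonneg)
  \<comment> \<open>Large enough for the bad part to contribute at most \<open>\<delta>\<close>
    after division by \<open>N\<^sup>2\<close>.\<close>
  define N where "N = sqrt (b / \<delta>) + 1"
  have N: "0 < N" unfolding N_def using b \<delta> by (simp add: add_nonneg_pos)
  have "b / \<delta> \<le> N\<^sup>2"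
  proof -
    have "(sqrt (b / \<delta>))\<^sup>2 \<le> N\<^sup>2" using b \<delta> unfolding N_def by (intro power_mono) auto
    then show ?thesis using b \<delta> by simp
  qed
  then have bN: "b \<le> N\<^sup>2 * \<delta>" using \<delta> by (simp add: pos_divide_le_eq)
  let ?h = "\<lambda>x. image_mset ((*\<^sub>R) N) (f x)"
  have "?h \<in> W12 (ball a r) Q" using W12_scale[OF f_W12 BU _ U_lebesgue N] by simp
  from poincare[OF r this] obtain P where P: "P \<in> QQ Q"
    "(LINT x:ball a r|lebesgue. (Gdist (?h x) P)\<^sup>2) \<le> CP * r\<^sup>2 * dirichlet (ball a r) ?h"
    by (auto simp: is_mean_def)
  let ?P = "image_mset ((*\<^sub>R) (inverse N)) P"
  let ?G = "LINT x:ball a r|lebesgue. good_energy f x"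
  have P': "?P \<in> QQ Q" using P(1) by (simp add: QQ_def)
  have eq: "(Gdist (?h x) P)\<^sup>2 = N\<^sup>2 * (Gdist (f x) ?P)\<^sup>2" if "x \<in> ball a r" for x
  proof -
    have "size (f x) = Q" using that BU by (intro size_f) auto
    then have "Gdist (?h x) P = N * Gdist (f x) ?P"
      using Gdist_scale[OF _ N, of "f x" ?P] P(1) by (simp only: scale_inverse[OF N]) (simp add: QQ_def)
    then show ?thesis by (simp add: power_mult_distrib)
  qed
  have "dirichlet (ball a r) ?h = (LINT x:ball a r|lebesgue. N\<^sup>2 * good_energy f x + bad_energy f x)"
    unfolding dirichlet_def using BU by (intro set_lebesgue_integral_cong) (auto simp: Df_norm_constant_scale[OF _ N])
  also have "\<dots> = N\<^sup>2 * ?G + b" using si by (simp add: set_integral_add b_def)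
  finally have D: "dirichlet (ball a r) ?h = N\<^sup>2 * ?G + b" .
  have G0: "0 \<le> ?G" unfolding set_lebesgue_integral_def
    by (rule Bochner_Integration.integral_nonneg) (simp add: good_energy_nonneg)
  have "N\<^sup>2 * (LINT x:ball a r|lebesgue. (Gdist (f x) ?P)\<^sup>2) = (LINT x:ball a r|lebesgue. N\<^sup>2 * (Gdist (f x) ?P)\<^sup>2)"
    by simp
  also have "\<dots> = (LINT x:ball a r|lebesgue. (Gdist (?h x) P)\<^sup>2)"
    by (intro set_lebesgue_integral_cong) (auto simp: eq)
  also have "\<dots> \<le> CP * r\<^sup>2 * (N\<^sup>2 * ?G + b)" using P(2) by (simp only: D)
  also have "\<dots> \<le> \<bar>CP\<bar> * r\<^sup>2 * (N\<^sup>2 * ?G + N\<^sup>2 * \<delta>)"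
  proof (rule mult_mono)
    show "CP * r\<^sup>2 \<le> \<bar>CP\<bar> * r\<^sup>2" by (rule mult_right_mono) auto
    show "N\<^sup>2 * ?G + b \<le> N\<^sup>2 * ?G + N\<^sup>2 * \<delta>" using bN by (rule add_left_mono)
    show "0 \<le> N\<^sup>2 * ?G + b" using G0 b by (intro add_nonneg_nonneg mult_nonneg_nonneg zero_le_power2)
  qed (rule mult_nonneg_nonneg, simp_all)
  also have "\<dots> = N\<^sup>2 * (\<bar>CP\<bar> * r\<^sup>2 * (?G + \<delta>))" by (simp add: algebra_simps)
  finally have "(LINT x:ball a r|lebesgue. (Gdist (f x) ?P)\<^sup>2) \<le> \<bar>CP\<bar> * r\<^sup>2 * (?G + \<delta>)"
    by (rule mult_left_le_imp_le) (use N in simp)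
  then show ?thesis using P' by blast
qed

end

section \<open>The truncated sum of norms\<close>

lemma density_zero_null:
  fixes a :: "'a::euclidean_space"
  assumes "N \<in> null_sets lebesgue"
  shows "density_zero N a"
  unfolding density_zero_iff
proof (intro allI impI)
  fix \<theta> :: real assume "0 < \<theta>"
  have "outer_measure_of lebesgue (N \<inter> ball a r) \<le> outer_measure_of lebesgue N" for r
    by (rule outer_measure_of_mono) auto
  moreover have "outer_measure_of lebesgue N = 0" using assms by (simp add: outer_measure_of_eq null_sets_def)
  ultimately show "\<exists>\<delta>>0. \<forall>r. 0 < r \<and> r < \<delta> \<longrightarrow> outer_measure_of lebesgue (N \<inter> ball a r) \<le> ennreal \<theta> * emeasure lebesgue (ball a r)"
    by (intro exI[of _ 1]) simp
qed

definition excess :: "real \<Rightarrow> 'h::real_normed_vector multiset \<Rightarrow> real"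
  where "excess R w = (\<Sum>y\<in>#w. max 0 (norm y - R))"

lemma excess_lipschitz:
  assumes "size u = size v"
  shows "\<bar>excess R u - excess R v\<bar> \<le> size u * Gdist u v"
  unfolding excess_def
proof (rule sum_mset_lipschitz[OF assms])
  fix y z :: 'a
  show "\<bar>max 0 (norm y - R) - max 0 (norm z - R)\<bar> \<le> norm (y - z)"
    using norm_triangle_ineq3[of y z] by (simp add: abs_if max_def split: if_splits)
qed

text \<open>All summands of the excess are nonnegative, so a bound on the sum bounds every single
  entry.\<close>

lemma QQ_norm_le_excess:
  assumes "excess R w \<le> c" "0 \<le> R"
  shows "QQ_norm w \<le> sqrt (size w) * (R + c)"
proof -
  have "norm y \<le> R + c" if y: "y \<in># w" for y
  proof -
    obtain w0 where w0: "w = add_mset y w0" using multi_member_split[OF y] by blast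
    have "max 0 (norm y - R) + excess R w0 \<le> c" using assms(1) unfolding w0 by (simp add: excess_def)
    moreover have "0 \<le> excess R w0" unfolding excess_def by (rule sum_mset_nonneg') simp
    moreover have "norm y - R \<le> max 0 (norm y - R)" by simp
    ultimately show ?thesis by linarith
  qed
  then have ny: "\<bar>(norm y)\<^sup>2\<bar> \<le> (R + c)\<^sup>2" if "y \<in># w" for y
    using power_mono[of "norm y" "R + c" 2] that by simp
  have "(QQ_norm w)\<^sup>2 \<le> size w * (R + c)\<^sup>2"
    using abs_sum_mset_le[of w "\<lambda>y. (norm y)\<^sup>2", OF ny] unfolding QQ_norm_sq by linarith
  also have "\<dots> = (sqrt (size w) * (R + c))\<^sup>2" by (simp add: power_mult_distrib)
  finally have sq: "(QQ_norm w)\<^sup>2 \<le> (sqrt (size w) * (R + c))\<^sup>2" .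
  have "0 \<le> excess R w" unfolding excess_def by (rule sum_mset_nonneg') simp
  then have "0 \<le> sqrt (size w) * (R + c)" using assms by (intro mult_nonneg_nonneg) auto
  with sq show ?thesis by (rule power2_le_imp_le)
qed

context stationary_map
begin

text \<open>Near \<open>a\<close> each branch of the first-order tuple is either constant, its
  differential being \<open>0\<close> above \<open>R1\<close>, or moves by less than
  \<open>1\<close> and stays below \<open>R\<close>. So that tuple has the same excess as
  \<open>f a\<close>, and the Lipschitz bound transfers the approximation error of
  \<open>f\<close>.\<close>

lemma excess_approx_constant:
  assumes R: "0 \<le> R1" "R = R1 + 1" and a: "a \<in> U" and w: "has_approx_differential f a w"
    and L: "\<And>p. p \<in># w \<Longrightarrow> R1 < norm (fst p) \<Longrightarrow> snd p = 0" and \<eta>: "0 < \<eta>"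
  shows "density_zero {x. x \<noteq> a \<and> \<eta> * norm (x - a) \<le> \<bar>excess R (f x) - excess R (f a)\<bar>} a"
proof -
  have "\<exists>d>0. \<forall>k. norm k < d \<longrightarrow> max 0 (norm (fst p + blinfun_apply (snd p) k) - R) = max 0 (norm (fst p) - R)"
    if p: "p \<in> set_mset w" for p
  proof (cases "R1 < norm (fst p)")
    case True
    then show ?thesis using L[of p] p by (intro exI[of _ 1]) simp
  next
    case False
    have K: "0 < norm (snd p) + 1" by (simp add: add_nonneg_pos)
    show ?thesis
    proof (intro exI[of _ "1 / (norm (snd p) + 1)"] conjI allI impI)
      show "0 < 1 / (norm (snd p) + 1)" using K by simp
      fix k :: "real^'m" assume k: "norm k < 1 / (norm (snd p) + 1)"
      have "norm (blinfun_apply (snd p) k) \<le> (norm (snd p) + 1) * norm k" by (rule blinfun_norm_le) simp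
      also have "\<dots> < 1" using k K by (simp add: pos_less_divide_eq mult.commute)
      finally have "norm (fst p + blinfun_apply (snd p) k) < R"
        using False R norm_triangle_ineq[of "fst p" "blinfun_apply (snd p) k"] by linarith
      then show "max 0 (norm (fst p + blinfun_apply (snd p) k) - R) = max 0 (norm (fst p) - R)" using False R by simp
    qed
  qed
  then obtain d1 where d1: "0 < d1" "\<And>p k. p \<in> set_mset w \<Longrightarrow> norm k < d1 \<Longrightarrow>
    max 0 (norm (fst p + blinfun_apply (snd p) k) - R) = max 0 (norm (fst p) - R)"
    using finite_uniform_radius[of "set_mset w" "\<lambda>p k. max 0 (norm (fst p + blinfun_apply (snd p) k) - R) = max 0 (norm (fst p) - R)"] finite_set_mset by metis
  obtain d2 where d2: "0 < d2" "ball a d2 \<subseteq> U" using open_U a by (auto simp: open_contains_ball)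
  note D = has_approx_differentialD[OF w]
  have same: "excess R (affine_tuple w a x) = excess R (f a)" if "norm (x - a) < d1" for x
    unfolding excess_def affine_tuple_def D(1)[symmetric] image_mset.compositionality o_def
    by (intro arg_cong[of _ _ sum_mset] image_mset_cong d1(2) that) simp
  define e where "e = \<eta> / (real Q + 1)"
  have e: "0 < e" using \<eta> by (simp add: e_def)
  show ?thesis
  proof (rule density_zero_mono_local[OF D(3)[OF e], of "min d1 d2"])
    show "0 < min d1 d2" using d1 d2 by simp
    show "{x. x \<noteq> a \<and> \<eta> * norm (x - a) \<le> \<bar>excess R (f x) - excess R (f a)\<bar>} \<inter> ball a (min d1 d2)
      \<subseteq> {x. x \<noteq> a \<and> e * norm (x - a) \<le> Gdist (f x) (affine_tuple w a x)}"
    proof (intro subsetI, elim IntE CollectE conjE, intro CollectI conjI)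
      fix x assume x: "x \<noteq> a" "\<eta> * norm (x - a) \<le> \<bar>excess R (f x) - excess R (f a)\<bar>" "x \<in> ball a (min d1 d2)"
      have xd: "norm (x - a) < d1" "x \<in> U" using x(3) d2(2) by (auto simp: dist_norm norm_minus_commute)
      have sz: "size (f x) = Q" "size (affine_tuple w a x) = Q"
        using size_f[OF xd(2)] size_f[OF a] D(4) by (simp_all add: affine_tuple_def)
      have "\<bar>excess R (f x) - excess R (f a)\<bar> \<le> real Q * Gdist (f x) (affine_tuple w a x)"
        using excess_lipschitz[of "f x" "affine_tuple w a x" R] sz unfolding same[OF xd(1)] by simp
      also have "\<dots> \<le> (real Q + 1) * Gdist (f x) (affine_tuple w a x)" by (intro mult_right_mono Gdist_nonneg) simp
      finally have "\<eta> * norm (x - a) \<le> (real Q + 1) * Gdist (f x) (affine_tuple w a x)" using x(2) by simp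
      then show "e * norm (x - a) \<le> Gdist (f x) (affine_tuple w a x)"
        by (simp add: e_def pos_divide_le_eq mult.commute)
    qed
  qed
qed

theorem essentially_bounded:
  assumes poincare: "\<And>(h :: real^'m \<Rightarrow> 'h multiset) a r. r > 0 \<Longrightarrow> h \<in> W12 (ball a r) Q \<Longrightarrow> \<exists>P. is_mean CP Q h a r P"
  shows "\<exists>M. AE x in lebesgue. x \<in> ball 0 1 \<longrightarrow> QQ_norm (f x) \<le> M"
proof -
  obtain n :: nat where n: "AE x in lebesgue. x \<in> ball 0 2 \<longrightarrow> approx_differentiable f x \<longrightarrow>
     (\<forall>p\<in>#some_differential f x. real n < fst p \<bullet> fst p \<longrightarrow> snd p = 0)"
    using differential_vanishes_at_large_values by blast
  define R where "R = sqrt (real n) + 1"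
  have R: "0 \<le> sqrt (real n)" "0 \<le> R" by (simp_all add: R_def)
  have lip: "\<bar>excess R u - excess R v\<bar> \<le> real Q * Gdist u v" if "u \<in> QQ Q" "v \<in> QQ Q" for u v :: "'h multiset"
    using excess_lipschitz[of u v R] that by (simp add: QQ_def)
  have uf: "(\<lambda>x. if x \<in> U then excess R (f x) else 0) \<in> borel_measurable lebesgue"
    by (rule borel_measurable_if_I[OF borel_measurable_lipschitz_comp[OF lip] U_lebesgue])
  \<comment> \<open>Borel representatives serve Fubini and translations; approximate limits are
    insensitive to the null set where they differ from the original functions.\<close>
  obtain u where u: "u \<in> borel_measurable lborel" "AE x in lborel. (if x \<in> U then excess R (f x) else 0) = u x"
    using completion_ex_borel_measurable_real[OF uf] by blast
  have b2: "ball (0::real^'m) 2 \<in> sets lebesgue" by simp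
  define e0 where "e0 x = indicator (ball 0 2) x * good_energy f x" for x
  have e0i: "integrable lebesgue e0"
    using integrable_good_energy unfolding set_integrable_lebesgue_on(1)[OF b2, symmetric] set_integrable_def e0_def by simp
  have e0m: "e0 \<in> borel_measurable lebesgue" by (rule borel_measurable_integrable[OF e0i])
  obtain e1 where e1: "e1 \<in> borel_measurable lborel" "AE x in lborel. e0 x = e1 x"
    using completion_ex_borel_measurable_real[OF e0m] by blast
  \<comment> \<open>The absolute value makes the representative nonnegative everywhere, not merely
    almost everywhere.\<close>
  define e where "e x = \<bar>e1 x\<bar>" for x
  have em: "e \<in> borel_measurable lborel" using e1(1) unfolding e_def[abs_def] by simp
  have ee: "AE x in lborel. e x = e0 x"
    using e1(2)
  proof eventually_elim
    case (elim x)
    have "0 \<le> e0 x" unfolding e0_def by (intro mult_nonneg_nonneg good_energy_nonneg) simp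
    then show ?case using elim by (simp add: e_def)
  qed
  have ei: "integrable lborel e"
  proof -
    have "integrable lebesgue e"
      using e0i integrable_cong_AE[OF measurable_completion[OF em] e0m] AE_completion[OF ee] by blast
    then show ?thesis using integrable_completion[OF em] by simp
  qed
  have LI: "(LINT x:ball a r|lborel. e x) = (LINT x:ball a r|lebesgue. good_energy f x)" if B: "ball a r \<subseteq> ball 0 2" for a r
  proof -
    have m1: "(\<lambda>x. indicator (ball a r) x *\<^sub>R e x) \<in> borel_measurable lborel"
      by (intro borel_measurable_scaleR borel_measurable_indicator em) simp
    have m2: "(\<lambda>x. indicator (ball a r) x *\<^sub>R e0 x) \<in> borel_measurable lebesgue"
      by (intro borel_measurable_scaleR borel_measurable_indicator e0m) simp
    have "(LINT x:ball a r|lborel. e x) = (LINT x|lebesgue. indicator (ball a r) x *\<^sub>R e x)"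
      unfolding set_lebesgue_integral_def by (rule integral_completion[OF m1, symmetric])
    also have "\<dots> = (LINT x|lebesgue. indicator (ball a r) x *\<^sub>R e0 x)"
      by (rule integral_cong_AE[OF measurable_completion[OF m1] m2])
        (use AE_completion[OF ee] in \<open>auto elim!: eventually_mono\<close>)
    also have "\<dots> = (LINT x|lebesgue. indicator (ball a r) x *\<^sub>R good_energy f x)"
      using B by (intro Bochner_Integration.integral_cong refl) (auto simp: e0_def indicator_def)
    finally show ?thesis unfolding set_lebesgue_integral_def .
  qed
  \<comment> \<open>The excess is Lipschitz for \<open>Gdist\<close> with constant \<open>Q\<close>,
    hence the squared factor in the Poincare constant.\<close>
  interpret vanishing_derivative u e "(real Q)\<^sup>2 * \<bar>CP\<bar>"
  proof
    show "u \<in> borel_measurable borel" using u(1) by simp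
    show "integrable lborel e" by (rule ei)
    show "0 \<le> e x" for x by (simp add: e_def)
    show "0 \<le> (real Q)\<^sup>2 * \<bar>CP\<bar>" by simp
    fix a :: "real^'m" and r \<delta> :: real assume r: "0 < r" and B: "ball a r \<subseteq> ball 0 2" and \<delta>: "0 < \<delta>"
    from scaled_poincare[OF poincare r B \<delta>] obtain P where P: "P \<in> QQ Q"
      "(LINT x:ball a r|lebesgue. (Gdist (f x) P)\<^sup>2) \<le> \<bar>CP\<bar> * r\<^sup>2 * ((LINT x:ball a r|lebesgue. good_energy f x) + \<delta>)" by blast
    have i: "integrable lebesgue (\<lambda>x. indicator (ball a r) x *\<^sub>R (Gdist (f x) P)\<^sup>2)"
      using Gdist_square_integrable[OF P(1) B] by (simp add: set_integrable_def)
    have le: "AE x in lebesgue. ennreal ((u x - excess R P)\<^sup>2) * indicator (ball a r) x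
      \<le> ennreal ((real Q)\<^sup>2 * (indicator (ball a r) x *\<^sub>R (Gdist (f x) P)\<^sup>2))"
      using AE_completion[OF u(2)]
    proof eventually_elim
      case (elim x)
      show ?case
      proof (cases "x \<in> ball a r")
        case True
        then have xU: "x \<in> U" using B ball2_U by blast
        then have "\<bar>u x - excess R P\<bar> \<le> real Q * Gdist (f x) P"
          using elim lip[OF _ P(1), of "f x"] size_f[OF xU] by (simp add: QQ_def)
        then have "\<bar>u x - excess R P\<bar>\<^sup>2 \<le> (real Q * Gdist (f x) P)\<^sup>2" by (intro power_mono) auto
        then show ?thesis using True by (simp add: power_mult_distrib ennreal_leI)
      qed simp
    qed
    have "(\<integral>\<^sup>+x. ennreal ((u x - excess R P)\<^sup>2) * indicator (ball a r) x \<partial>lborel)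
      = (\<integral>\<^sup>+x. ennreal ((u x - excess R P)\<^sup>2) * indicator (ball a r) x \<partial>lebesgue)" by (rule nn_integral_completion[symmetric])
    also have "\<dots> \<le> (\<integral>\<^sup>+x. ennreal ((real Q)\<^sup>2 * (indicator (ball a r) x *\<^sub>R (Gdist (f x) P)\<^sup>2)) \<partial>lebesgue)"
      by (rule nn_integral_mono_AE[OF le])
    also have "\<dots> = ennreal (LINT x|lebesgue. (real Q)\<^sup>2 * (indicator (ball a r) x *\<^sub>R (Gdist (f x) P)\<^sup>2))"
      by (rule nn_integral_eq_integral[OF integrable_mult_right[OF i]]) simp
    also have "(LINT x|lebesgue. (real Q)\<^sup>2 * (indicator (ball a r) x *\<^sub>R (Gdist (f x) P)\<^sup>2))
      = (real Q)\<^sup>2 * (LINT x:ball a r|lebesgue. (Gdist (f x) P)\<^sup>2)"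
      unfolding set_lebesgue_integral_def by (rule integral_mult_right_zero)
    also have "ennreal \<dots> \<le> ennreal ((real Q)\<^sup>2 * \<bar>CP\<bar> * r\<^sup>2 * ((LINT x:ball a r|lborel. e x) + \<delta>))"
      unfolding LI[OF B] mult.assoc by (rule ennreal_leI, rule mult_left_mono) (use P(2) in \<open>simp_all add: mult.assoc\<close>)
    finally show "\<exists>c. (\<integral>\<^sup>+x. ennreal ((u x - c)\<^sup>2) * indicator (ball a r) x \<partial>lborel)
      \<le> ennreal ((real Q)\<^sup>2 * \<bar>CP\<bar> * r\<^sup>2 * ((LINT x:ball a r|lborel. e x) + \<delta>))" by blast
  next
    obtain N where N: "N \<in> null_sets lborel" "{x. \<not> (if x \<in> U then excess R (f x) else 0) = u x} \<subseteq> N"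
      using u(2) unfolding eventually_ae_filter by auto
    have uN: "u x = excess R (f x)" if "x \<notin> N" "x \<in> U" for x
    proof -
      have "x \<notin> {x. \<not> (if x \<in> U then excess R (f x) else 0) = u x}" using N(2) that(1) by blast
      then show ?thesis using that(2) by simp
    qed
    have Nl: "N \<in> null_sets lebesgue" by (rule null_sets_completionI[OF N(1)])
    show "AE a in lborel. a \<in> ball 0 2 \<longrightarrow> e a = 0 \<or> (\<forall>\<eta>>0. density_zero {x. x \<noteq> a \<and> \<eta> * norm (x - a) \<le> \<bar>u x - u a\<bar>} a)"
      using n[unfolded AE_completion_iff] ee AE_not_in[OF N(1)]
    proof eventually_elim
      case (elim a)
      show ?case
      proof (intro impI)
        assume a: "a \<in> ball 0 2"
        then have aU: "a \<in> U" using ball2_U by blast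
        show "e a = 0 \<or> (\<forall>\<eta>>0. density_zero {x. x \<noteq> a \<and> \<eta> * norm (x - a) \<le> \<bar>u x - u a\<bar>} a)"
        proof (cases "approx_differentiable f a")
          case False
          then show ?thesis using elim(2) by (simp add: e0_def good_energy_def)
        next
          case True
          have L: "snd p = 0" if "p \<in># some_differential f a" "sqrt (real n) < norm (fst p)" for p
          proof -
            have "(sqrt (real n))\<^sup>2 < (norm (fst p))\<^sup>2" using that(2) by (intro power_strict_mono) auto
            then have "real n < fst p \<bullet> fst p" by (simp add: power2_norm_eq_inner)
            then show ?thesis using elim(1) a True that(1) by blast
          qed
          have "density_zero {x. x \<noteq> a \<and> \<eta> * norm (x - a) \<le> \<bar>u x - u a\<bar>} a" if \<eta>: "0 < \<eta>" for \<eta>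
          proof -
            obtain d where d: "0 < d" "ball a d \<subseteq> U" using open_U aU by (auto simp: open_contains_ball)
            have ua: "u a = excess R (f a)" by (rule uN[OF elim(3) aU])
            \<comment> \<open>Adding the null set \<open>N\<close> costs nothing in density and
              allows \<open>u\<close> to replace the excess of \<open>f\<close>.\<close>
            have "density_zero ({x. x \<noteq> a \<and> \<eta> * norm (x - a) \<le> \<bar>excess R (f x) - excess R (f a)\<bar>} \<union> N) a"
              using excess_approx_constant[OF R(1) R_def aU some_differential[OF True] L \<eta>] density_zero_null[OF Nl]
              by (rule density_zero_Un)
            then show ?thesis
            proof (rule density_zero_mono_local[OF _ d(1)])
              show "{x. x \<noteq> a \<and> \<eta> * norm (x - a) \<le> \<bar>u x - u a\<bar>} \<inter> ball a d
                \<subseteq> {x. x \<noteq> a \<and> \<eta> * norm (x - a) \<le> \<bar>excess R (f x) - excess R (f a)\<bar>} \<union> N"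
              proof
                fix x assume x: "x \<in> {x. x \<noteq> a \<and> \<eta> * norm (x - a) \<le> \<bar>u x - u a\<bar>} \<inter> ball a d"
                then have xU: "x \<in> U" using d(2) by blast
                show "x \<in> {x. x \<noteq> a \<and> \<eta> * norm (x - a) \<le> \<bar>excess R (f x) - excess R (f a)\<bar>} \<union> N"
                proof (cases "x \<in> N")
                  case False
                  then have "u x = excess R (f x)" using xU by (intro uN)
                  then show ?thesis using x ua by simp
                qed simp
              qed
            qed
          qed
          then show ?thesis by blast
        qed
      qed
    qed
  qed
  obtain c where c: "AE x in lborel. x \<in> ball 0 1 \<longrightarrow> u x = c" using AE_constant by blast
  have "AE x in lborel. x \<in> ball 0 1 \<longrightarrow> QQ_norm (f x) \<le> sqrt (real Q) * (R + c)"
    using c u(2)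
  proof eventually_elim
    case (elim x)
    show ?case
    proof
      assume x: "x \<in> ball 0 1"
      then have xU: "x \<in> U" using ball2_U by auto
      have "excess R (f x) \<le> c" using elim x xU by simp
      from QQ_norm_le_excess[OF this R(2)] show "QQ_norm (f x) \<le> sqrt (real Q) * (R + c)" using size_f[OF xU] by simp
    qed
  qed
  then show ?thesis by (intro exI[of _ "sqrt (real Q) * (R + c)"] AE_completion)
qed

end

text \<open>The summand \<open>1\<close> serves the energy estimate;
  \<open>\<bar>CP\<bar> / unit_ball_vol\<close> converts it into the estimate for means, since the
  ball has volume \<open>unit_ball_vol * r ^ m\<close>. Reading the extended real \<open>M\<close>
  as a number is faithful once it is known to be finite.\<close>

definition rate_const :: "('h::real_normed_vector \<times> ((real^'m) \<Rightarrow>\<^sub>L 'h)) itself \<Rightarrow> real \<Rightarrow> ereal \<Rightarrow> real \<Rightarrow> real"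
  where "rate_const T CP M E = (1 + \<bar>CP\<bar> / unit_ball_vol (real CARD('m))) * decay_const T (real_of_ereal M) E"

lemma rate_const_pos: "0 < rate_const T CP M E"
  unfolding rate_const_def
  by (intro mult_pos_pos decay_const_pos add_pos_nonneg divide_nonneg_nonneg) (simp_all add: less_imp_le)

section \<open>Both estimates with a common constant\<close>

context stationary_map
begin

text \<open>Finiteness comes from \<open>essentially_bounded\<close>. Nonnegativity holds because
  the unit ball has positive measure, on which a negative essential supremum would contradict
  \<open>QQ_norm_nonneg\<close>.\<close>

lemma esssup_bound:
  assumes poincare: "\<And>(h :: real^'m \<Rightarrow> 'h multiset) a r. r > 0 \<Longrightarrow> h \<in> W12 (ball a r) Q \<Longrightarrow> \<exists>P. is_mean CP Q h a r P"
  defines "M \<equiv> esssup (lebesgue_on (ball 0 1)) (\<lambda>x. ereal (QQ_norm (f x)))"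
  shows "AE x in lebesgue. x \<in> ball 0 1 \<longrightarrow> QQ_norm (f x) \<le> real_of_ereal M" "0 \<le> real_of_ereal M"
proof -
  have b1: "ball (0::real^'m) 1 \<in> sets lebesgue" by simp
  obtain M0 where "AE x in lebesgue. x \<in> ball 0 1 \<longrightarrow> QQ_norm (f x) \<le> M0" using essentially_bounded[OF poincare] by blast
  then have M0: "AE x in lebesgue_on (ball 0 1). ereal (QQ_norm (f x)) \<le> ereal M0" by (simp add: AE_restrict_space_iff)
  have lip: "\<bar>QQ_norm u - QQ_norm v\<bar> \<le> 1 * Gdist u v" if "u \<in> QQ Q" "v \<in> QQ Q" for u v :: "'h multiset"
    using Gdist_triangle[of u Q v "replicate_mset Q 0"] Gdist_triangle[of v Q u "replicate_mset Q 0"] that Gdist_commute[of u v]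
    by (simp add: QQ_def QQ_norm_def)
  have "(\<lambda>x. QQ_norm (f x)) \<in> borel_measurable (lebesgue_on (ball 0 1))"
    by (rule measurable_restrict_mono[OF borel_measurable_lipschitz_comp[OF lip]]) (use ball2_U in auto)
  then have m: "(\<lambda>x. ereal (QQ_norm (f x))) \<in> borel_measurable (lebesgue_on (ball 0 1))" by simp
  have le: "M \<le> ereal M0" unfolding M_def by (rule esssup_I[OF m M0])
  have AE1: "AE x in lebesgue_on (ball 0 1). ereal (QQ_norm (f x)) \<le> M" unfolding M_def by (rule esssup_AE)
  have ge: "0 \<le> M"
  proof (rule ccontr)
    assume "\<not> 0 \<le> M"
    have "AE x in lebesgue_on (ball (0::real^'m) 1). False"
      using AE1
    proof eventually_elim
      case (elim x)
      have "(0::ereal) \<le> ereal (QQ_norm (f x))" by (simp add: QQ_norm_nonneg)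
      then show False using elim \<open>\<not> 0 \<le> M\<close> by (meson order_trans)
    qed
    then have "emeasure (lebesgue_on (ball (0::real^'m) 1)) (space (lebesgue_on (ball (0::real^'m) 1))) = 0"
      by (simp add: ae_filter_eq_bot_iff eventually_False)
    then show False
      using emeasure_lebesgue_ball[of 1 "0::real^'m"] unit_ball_vol_pos[of "real CARD('m)"]
      by (simp add: emeasure_restrict_space space_restrict_space)
  qed
  obtain m0 where M: "M = ereal m0" using le ge by (cases M) auto
  show "0 \<le> real_of_ereal M" using ge M by simp
  show "AE x in lebesgue. x \<in> ball 0 1 \<longrightarrow> QQ_norm (f x) \<le> real_of_ereal M"
    using AE1 by (simp add: AE_restrict_space_iff M)
qed

lemma dirichlet_nonneg: "0 \<le> dirichlet A f"
  unfolding dirichlet_def set_lebesgue_integral_def by (rule Bochner_Integration.integral_nonneg) simp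

text \<open>The energy estimate is the primary one; inserting it into the defining inequality of a
  mean gives the other.\<close>

lemma energy_and_mean_decay:
  assumes poincare: "\<And>(h :: real^'m \<Rightarrow> 'h multiset) a r. r > 0 \<Longrightarrow> h \<in> W12 (ball a r) Q \<Longrightarrow> \<exists>P. is_mean CP Q h a r P"
    and a: "a \<in> ball 0 (1 / 2)" and r: "0 < r" "r \<le> 1 / 2"
  defines "Cf \<equiv> rate_const TYPE('h \<times> ((real^'m) \<Rightarrow>\<^sub>L 'h)) CP (esssup (lebesgue_on (ball 0 1)) (\<lambda>x. ereal (QQ_norm (f x)))) (dirichlet (ball 0 1) f)"
  shows "1 / r powi (int CARD('m) - 2) * (LINT x:ball a r|lebesgue. (Df_norm f x)\<^sup>2) \<le> Cf * (1 / \<bar>ln r\<bar>) powr (1 / 2)"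
    "is_mean CP Q f a r P \<Longrightarrow> 1 / measure lebesgue (ball a r) * (LINT x:ball a r|lebesgue. (Gdist (f x) P)\<^sup>2) \<le> Cf * (1 / \<bar>ln r\<bar>) powr (1 / 2)"
proof -
  let ?M = "real_of_ereal (esssup (lebesgue_on (ball 0 1)) (\<lambda>x. ereal (QQ_norm (f x))))"
  let ?T = "TYPE('h \<times> ((real^'m) \<Rightarrow>\<^sub>L 'h))"
  let ?V = "unit_ball_vol (real CARD('m))"
  let ?D = "decay_const ?T ?M (dirichlet (ball 0 1) f)"
  define X where "X = ?D * (1 / \<bar>ln r\<bar>) powr (1 / 2)"
  define d where "d = r powr (2 - real CARD('m)) * dirichlet (ball a r) f"
  have V: "0 < ?V" by simp
  have dX: "d \<le> X" unfolding d_def X_def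
    by (rule dirichlet_decay[OF a esssup_bound[OF poincare] r])
  have d0: "0 \<le> d" unfolding d_def by (intro mult_nonneg_nonneg dirichlet_nonneg) simp
  have CfX: "Cf * (1 / \<bar>ln r\<bar>) powr (1 / 2) = (1 + \<bar>CP\<bar> / ?V) * X"
    by (simp add: Cf_def rate_const_def X_def mult.assoc)
  have cX: "(1 + \<bar>CP\<bar> / ?V) * d \<le> (1 + \<bar>CP\<bar> / ?V) * X"
    using dX V by (intro mult_left_mono add_nonneg_nonneg divide_nonneg_nonneg) auto
  have split: "(1 + \<bar>CP\<bar> / ?V) * d = d + \<bar>CP\<bar> / ?V * d" by (simp add: distrib_right)
  have cd: "0 \<le> \<bar>CP\<bar> / ?V * d" using V d0 by (intro mult_nonneg_nonneg divide_nonneg_nonneg) auto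
  have "1 / r powi (int CARD('m) - 2) = r powr (2 - real CARD('m))"
    using r(1) by (simp add: powr_real_of_int'[symmetric] powr_minus_divide[symmetric])
  then show "1 / r powi (int CARD('m) - 2) * (LINT x:ball a r|lebesgue. (Df_norm f x)\<^sup>2) \<le> Cf * (1 / \<bar>ln r\<bar>) powr (1 / 2)"
    using cX cd split unfolding CfX by (simp add: d_def dirichlet_def)
  assume "is_mean CP Q f a r P"
  then have "(LINT x:ball a r|lebesgue. (Gdist (f x) P)\<^sup>2) \<le> CP * r\<^sup>2 * dirichlet (ball a r) f" by (simp add: is_mean_def)
  also have "\<dots> \<le> \<bar>CP\<bar> * r\<^sup>2 * dirichlet (ball a r) f" by (intro mult_right_mono dirichlet_nonneg) auto
  finally have "1 / measure lebesgue (ball a r) * (LINT x:ball a r|lebesgue. (Gdist (f x) P)\<^sup>2)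
    \<le> 1 / measure lebesgue (ball a r) * (\<bar>CP\<bar> * r\<^sup>2 * dirichlet (ball a r) f)" by (intro mult_left_mono) auto
  also have "1 / measure lebesgue (ball a r) * (\<bar>CP\<bar> * r\<^sup>2 * dirichlet (ball a r) f) = \<bar>CP\<bar> / ?V * d"
    using r(1) measure_lborel_ball(2)[of r a] by (simp add: d_def powr_eq_quotient[OF r(1)])
  also have "\<dots> \<le> Cf * (1 / \<bar>ln r\<bar>) powr (1 / 2)" unfolding CfX using cX d0 split by linarith
  finally show "1 / measure lebesgue (ball a r) * (LINT x:ball a r|lebesgue. (Gdist (f x) P)\<^sup>2) \<le> Cf * (1 / \<bar>ln r\<bar>) powr (1 / 2)" .
qed

end

text \<open>The constant is a fixed function of the essential supremum and of the energy in the unit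
  ball, so it can be named before \<open>U\<close> and \<open>f\<close>. The energy is needed as an
  argument for radii bounded away from \<open>0\<close>, where the logarithm gives no decay.\<close>

theorem proposition8p4:
  fixes Q :: nat and CP :: real
  assumes "Q \<ge> 1"
    and "\<not> (\<exists>B :: 'h::{real_inner, banach, second_countable_topology} set.
               finite B \<and> span B = UNIV)"
    and "\<And>(f :: real^'m \<Rightarrow> 'h multiset) a r.
           r > 0 \<Longrightarrow> f \<in> W12 (ball a r) Q \<Longrightarrow> \<exists>P. is_mean CP Q f a r P"
  shows "\<exists>\<alpha> (C :: ereal \<Rightarrow> real \<Rightarrow> real). 0 < \<alpha> \<and> \<alpha> < 1 \<and> (\<forall>M E. 0 < C M E) \<and>
    (\<forall>U (f :: real^'m \<Rightarrow> 'h multiset).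
       open U \<and> ball 0 3 \<subseteq> U \<and> f \<in> W12 U Q \<and>
       squeeze_stationary U f \<and> squash_stationary U f \<longrightarrow>
       (let Cf = C (esssup (lebesgue_on (ball 0 1)) (\<lambda>x. ereal (QQ_norm (f x))))
                   (dirichlet (ball 0 1) f)
        in \<forall>a \<in> ball 0 (1/2). \<forall>r. 0 < r \<and> r \<le> 1/2 \<longrightarrow>
             (\<forall>P. is_mean CP Q f a r P \<longrightarrow>
                1 / measure lebesgue (ball a r) *
                  (LINT x:ball a r|lebesgue. (Gdist (f x) P)\<^sup>2) \<le> Cf * (1 / \<bar>ln r\<bar>) powr \<alpha>) \<and>
             1 / r powi (int CARD('m) - 2) * (LINT x:ball a r|lebesgue. (Df_norm f x)\<^sup>2)
                \<le> Cf * (1 / \<bar>ln r\<bar>) powr \<alpha>))"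
proof (rule exI[of _ "1 / 2"], rule exI[of _ "rate_const TYPE('h \<times> ((real^'m) \<Rightarrow>\<^sub>L 'h)) CP"], unfold Let_def,
    intro conjI allI impI ballI rate_const_pos; (elim conjE)?)
  fix U and f :: "real^'m \<Rightarrow> 'h multiset" and a :: "real^'m" and r :: real
  assume U: "open U" "ball 0 3 \<subseteq> U" "f \<in> W12 U Q" "squeeze_stationary U f" "squash_stationary U f"
    and a: "a \<in> ball 0 (1/2)" and r: "0 < r" "r \<le> 1/2"
  interpret stationary_map U Q f by unfold_locales (rule U)+
  note decay = energy_and_mean_decay[OF assms(3) a r]
  show "1 / r powi (int CARD('m) - 2) * (LINT x:ball a r|lebesgue. (Df_norm f x)\<^sup>2)
      \<le> rate_const TYPE('h \<times> ((real^'m) \<Rightarrow>\<^sub>L 'h)) CP (esssup (lebesgue_on (ball 0 1)) (\<lambda>x. ereal (QQ_norm (f x))))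
        (dirichlet (ball 0 1) f) * (1 / \<bar>ln r\<bar>) powr (1 / 2)"
    by (rule decay(1))
  fix P assume "is_mean CP Q f a r P"
  then show "1 / measure lebesgue (ball a r) * (LINT x:ball a r|lebesgue. (Gdist (f x) P)\<^sup>2)
      \<le> rate_const TYPE('h \<times> ((real^'m) \<Rightarrow>\<^sub>L 'h)) CP (esssup (lebesgue_on (ball 0 1)) (\<lambda>x. ereal (QQ_norm (f x))))
        (dirichlet (ball 0 1) f) * (1 / \<bar>ln r\<bar>) powr (1 / 2)"
    by - (rule decay(2))
qed simp_all

end
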